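(* Fix $p\in(0,1)$ and a (possibly random) permuton $\mu_0$. Let $F$ be the permuton-valued Feller diffusion with parameter $p$ and initial condition $\mu_0$ (the scaling limit of up-down chains on permutations defined in the context), and for $\varepsilon\in(0,1)$ let $F_\varepsilon$ be the pure-jump Feller process on the space $\mathcal P$ of permutons with initial condition $\mu_0$ which jumps at rate $2\varepsilon^{-2}$ from $\mu$ to $\mathrm{Inf}^\varepsilon(\mu)$, i.e. with domain $C(\mathcal P)$ and generator $$\mathcal A_\varepsilon f(\mu)=2\varepsilon^{-2}\big(\mathbb E[f(\mathrm{Inf}^\varepsilon(\mu))]-f(\mu)\big).$$ Then $F_\varepsilon$ converges in distribution to $F$ in the Skorokhod space $D([0,\infty),\mathcal P)$ as $\varepsilon\to0$.
   Context: A permuton is a probability measure on $[0,1]^2$ with uniform marginals; $\mathcal P$ is the space of permutons with the weak topology (compact, metrizable by the Wasserstein metric). Random inflation. For $s\in[0,1]$, $\varphi^{s,\varepsilon}(x)=(1-\varepsilon)x$ if $x\le s$ and $(1-\varepsilon)x+\varepsilon$ if $x>s$. For $(x_0,y_0)\in[0,1]^2$, $(\varphi^{x_0,\varepsilon},\varphi^{y_0,\varepsilon})$ acts componentwise on $[0,1]^2$; $\delta^{(\varepsilon),\nearrow}_{(x_0,y_0)}$ (resp. $\delta^{(\varepsilon),\searrow}_{(x_0,y_0)}$) is the uniform probability measure on the increasing (resp. decreasing) diagonal of the square $[(1-\varepsilon)x_0,(1-\varepsilon)x_0+\varepsilon]\times[(1-\varepsilon)y_0,(1-\varepsilon)y_0+\varepsilon]$.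 For $\bullet\in\{\nearrow,\searrow\}$, $$\mathrm{inf}^{\varepsilon,\bullet}_{(x_0,y_0)}(\mu)=(1-\varepsilon)\,(\varphi^{x_0,\varepsilon},\varphi^{y_0,\varepsilon})_\#\mu+\varepsilon\,\delta^{(\varepsilon),\bullet}_{(x_0,y_0)},$$ where $g_\#\mu$ is the push-forward. $\mathrm{Inf}^\varepsilon(\mu)=\mathrm{inf}^{\varepsilon,B}_{(X_0,Y_0)}(\mu)$ where $(X_0,Y_0)$ has law $\mu$ and $B$ is independent of it, equal to $\nearrow$ with probability $p$ and $\searrow$ with probability $1-p$. The process $F$. Let $\mathbb S_n$ be the set of permutations of $\{1,\dots,n\}$. $X_n$ is the Markov chain on $\mathbb S_n$ whose step consists of: replacing a uniformly random point of the diagram $\{(i,\sigma(i))\}$ by two points consecutive in position and value (shifting the others), in increasing position with probability $p$ and decreasing position with probability $1-p$; then deleting a uniformly random point of the resulting diagram of size $n+1$ and relabelling order-preservingly. Let $\iota(\pi)$ be the permuton with density $n\,\mathbf 1[\pi(\lceil nx\rceil)=\lceil ny\rceil]$. If $\iota(X_n(0))$ converges in distribution to $\mu_0$, then $(\iota(X_n(\lfloor n^2t\rfloor)))_{t\ge0}$ converges in distribution in $D([0,\infty),\mathcal P)$ to a Feller process with continuous paths and initial condition $\mu_0$; this is $F$. Its generator $\mathcal A$ has as a core the span of the functions $d^o_\pi$ ($\pi$ a permutation), $d^o_\pi(\mu)$ being the probability that $|\pi|$ i.i.d. points of law $\mu$ form the diagram of $\pi$, and for $\pi$ of size $k$, $\mathcal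 Ad^o_\pi=-k(k-1)\big(d^o_\pi-\sum_{\tau\in\mathbb S_{k-1}}p^\uparrow(\tau,\pi)d^o_\tau\big)$, where $p^\uparrow(\tau,\pi)$ is the probability that the first (duplication) half-step transforms $\tau$ into $\pi$. *)

theory Defs
  imports
    "HOL-Probability.Probability"
    "HOL-Combinatorics.Combinatorics"
begin

section \<open>Permutons\<close>

abbreviation unif01 :: "real measure" where
  "unif01 \<equiv> uniform_measure lborel {0..1}"

lemma prob_space_unif01: "prob_space unif01"
  by (rule prob_space_uniform_measure) auto

lemma emeasure_unif01: "A \<in> sets borel \<Longrightarrow> emeasure unif01 A = emeasure lborel ({0..1} \<inter> A)"
  by (subst emeasure_uniform_measure) (auto simp: divide_ennreal_def)

text \<open>Permutons are represented as Borel measures on the plane. The uniform marginals force them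
  to be carried by the unit square.\<close>

definition is_permuton :: "(real \<times> real) measure \<Rightarrow> bool" where
  "is_permuton \<mu> \<longleftrightarrow> prob_space \<mu> \<and> sets \<mu> = sets borel \<and>
     distr \<mu> borel fst = unif01 \<and> distr \<mu> borel snd = unif01"

lemma is_permuton_diagonal: "is_permuton (distr unif01 borel (\<lambda>u. (u, u)))"
proof -
  have m: "(\<lambda>u. (u, u)) \<in> unif01 \<rightarrow>\<^sub>M (borel :: (real \<times> real) measure)"
    by (auto intro!: borel_measurable_Pair)
  have id: "distr unif01 borel (\<lambda>u. u) = unif01"
    by (rule measure_eqI) (auto simp: emeasure_distr)
  have "fst \<in> borel_measurable (borel :: (real \<times> real) measure)"
    "snd \<in> borel_measurable (borel :: (real \<times> real) measure)"
    by (auto simp: borel_prod[symmetric])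
  then show ?thesis
    unfolding is_permuton_def using m
    by (auto simp: distr_distr comp_def id
        intro!: prob_space.prob_space_distr[OF prob_space_unif01])
qed

typedef permuton = "{\<mu>. is_permuton \<mu>}"
  morphisms meas Abs_permuton
  using is_permuton_diagonal by blast

text \<open>The weak topology.\<close>

instantiation permuton :: topological_space
begin

definition open_permuton :: "permuton set \<Rightarrow> bool" where
  "open_permuton = generate_topology
     {{\<mu>. (\<integral>z. f z \<partial>(meas \<mu>)) \<in> U} | (f :: real \<times> real \<Rightarrow> real) U.
        continuous_on UNIV f \<and> bounded (range f) \<and> open U}"

instance
  by standard (auto simp: open_permuton_def intro: generate_topology.intros)

end

definition couplings :: "'a::topological_space measure \<Rightarrow> 'a measure \<Rightarrow> ('a \<times> 'a) measure set" where
  "couplings \<mu> \<nu> = {\<gamma>. sets \<gamma> = sets borel \<and> distr \<gamma> borel fst = \<mu> \<and> distr \<gamma> borel snd = \<nu>}"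

definition wasserstein :: "permuton \<Rightarrow> permuton \<Rightarrow> real" where
  "wasserstein \<mu> \<nu> = (INF \<gamma>\<in>couplings (meas \<mu>) (meas \<nu>). \<integral>(z, w). dist z w \<partial>\<gamma>)"


section \<open>Random inflation\<close>

definition push_away :: "real \<Rightarrow> real \<Rightarrow> real \<Rightarrow> real" where
  "push_away s \<epsilon> x = (if x \<le> s then (1 - \<epsilon>) * x else (1 - \<epsilon>) * x + \<epsilon>)"

text \<open>The Boolean parameter chooses between the increasing (\<^const>\<open>True\<close>) and the decreasing
  (\<^const>\<open>False\<close>) variant, here and in the duplication step of the chain below.\<close>

definition small_diagonal :: "real \<Rightarrow> bool \<Rightarrow> real \<times> real \<Rightarrow> (real \<times> real) measure" where
  "small_diagonal \<epsilon> b z = distr unif01 borel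
     (\<lambda>u. ((1 - \<epsilon>) * fst z + \<epsilon> * u, (1 - \<epsilon>) * snd z + \<epsilon> * (if b then u else 1 - u)))"

definition inflate_meas ::
    "real \<Rightarrow> bool \<Rightarrow> real \<times> real \<Rightarrow> (real \<times> real) measure \<Rightarrow> (real \<times> real) measure" where
  "inflate_meas \<epsilon> b z \<mu> = measure_of UNIV (sets borel) (\<lambda>A.
     ennreal (1 - \<epsilon>) * emeasure (distr \<mu> borel (map_prod (push_away (fst z) \<epsilon>) (push_away (snd z) \<epsilon>))) A
     + ennreal \<epsilon> * emeasure (small_diagonal \<epsilon> b z) A)"

lemma gap_marginal:
  assumes e: "0 < \<epsilon>" "\<epsilon> < 1" and s: "0 \<le> s" "s \<le> 1" and A: "A \<in> sets borel"
  shows "ennreal (1 - \<epsilon>) * emeasure (distr unif01 borel (push_away s \<epsilon>)) A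
     + ennreal \<epsilon> * emeasure (distr unif01 borel (\<lambda>u. (1 - \<epsilon>) * s + \<epsilon> * (if b then u else 1 - u))) A
     = emeasure unif01 A"
proof -
  let ?d = "1 - \<epsilon>"
  have [measurable]: "A \<in> sets borel" "push_away s \<epsilon> \<in> borel_measurable borel"
    using A unfolding push_away_def[abs_def] by auto
  have aff: "ennreal \<bar>c\<bar> * emeasure lborel {x. t + c * x \<in> B} = emeasure lborel B"
    if c: "c \<noteq> 0" and [measurable]: "B \<in> sets borel" for c t :: real and B
  proof -
    have "emeasure lborel B = ennreal \<bar>c\<bar> * (\<integral>\<^sup>+ x. indicator B (t + c * x) \<partial>lborel)"
      by (subst nn_integral_indicator[symmetric], simp, rule nn_integral_real_affine[OF _ c]) simp
    also have "(\<integral>\<^sup>+ x. indicator B (t + c * x) \<partial>lborel)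
       = (\<integral>\<^sup>+ x. indicator {x. t + c * x \<in> B} x \<partial>lborel)"
      by (intro nn_integral_cong) (auto split: split_indicator)
    finally show ?thesis by simp
  qed
  let ?C1 = "{0..?d * s} \<inter> A" and ?C2 = "{?d * s + \<epsilon><..1} \<inter> A" and ?C3 = "{?d * s..?d * s + \<epsilon>} \<inter> A"
  have split: "{0..1} \<inter> push_away s \<epsilon> -` A = {x. 0 + ?d * x \<in> ?C1} \<union> {x. \<epsilon> + ?d * x \<in> ?C2}"
  proof (rule set_eqI)
    fix x
    have l: "?d * x \<le> ?d * s \<longleftrightarrow> x \<le> s" "0 \<le> ?d * x \<longleftrightarrow> 0 \<le> x"
      using e by (simp_all add: zero_le_mult_iff)
    have l1: "\<epsilon> + ?d * x \<le> 1 \<longleftrightarrow> x \<le> 1"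
    proof -
      have "\<epsilon> + ?d * x \<le> 1 \<longleftrightarrow> ?d * x \<le> ?d * 1" by auto
      also have "\<dots> \<longleftrightarrow> x \<le> 1" using e by (intro mult_le_cancel_left_pos) simp
      finally show ?thesis .
    qed
    have "?d * s + \<epsilon> < \<epsilon> + ?d * x \<longleftrightarrow> \<not> ?d * x \<le> ?d * s" by linarith
    then show "x \<in> {0..1} \<inter> push_away s \<epsilon> -` A \<longleftrightarrow> x \<in> {x. 0 + ?d * x \<in> ?C1} \<union> {x. \<epsilon> + ?d * x \<in> ?C2}"
      using l l1 s by (auto simp: push_away_def add.commute)
  qed
  have disj: "{x. 0 + ?d * x \<in> ?C1} \<inter> {x. \<epsilon> + ?d * x \<in> ?C2} = {}"
    by auto
  have 1: "ennreal ?d * emeasure (distr unif01 borel (push_away s \<epsilon>)) A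
     = emeasure lborel ?C1 + emeasure lborel ?C2"
  proof -
    have "emeasure (distr unif01 borel (push_away s \<epsilon>)) A
      = emeasure lborel {x. 0 + ?d * x \<in> ?C1} + emeasure lborel {x. \<epsilon> + ?d * x \<in> ?C2}"
      using emeasure_unif01[of "push_away s \<epsilon> -` A"] measurable_sets_borel[of "push_away s \<epsilon>" borel A]
      by (simp add: emeasure_distr split plus_emeasure[symmetric] disj flip: plus_emeasure)
         (subst plus_emeasure, auto simp: disj[simplified])
    then show ?thesis
      using aff[of ?d ?C1 0] aff[of ?d ?C2 \<epsilon>] e by (simp add: distrib_left)
  qed
  have 2: "ennreal \<epsilon> * emeasure (distr unif01 borel (\<lambda>u. ?d * s + \<epsilon> * (if b then u else 1 - u))) A
     = emeasure lborel ?C3"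
  proof -
    define c t where "c = (if b then \<epsilon> else - \<epsilon>)" and "t = (if b then ?d * s else ?d * s + \<epsilon>)"
    have f: "(\<lambda>u. ?d * s + \<epsilon> * (if b then u else 1 - u)) = (\<lambda>u. t + c * u)"
      by (auto simp: c_def t_def fun_eq_iff algebra_simps)
    have g: "{0..1} \<inter> (\<lambda>u. t + c * u) -` A = {u. t + c * u \<in> ?C3}"
    proof -
      have "(0 \<le> u \<and> u \<le> 1) = (?d * s \<le> t + c * u \<and> t + c * u \<le> ?d * s + \<epsilon>)" for u
        using e mult_le_cancel_left_pos[of \<epsilon> u 1] by (auto simp: c_def t_def zero_le_mult_iff)
      then show ?thesis
        by (intro set_eqI) (simp only: Int_iff vimage_eq atLeastAtMost_iff mem_Collect_eq)
    qed
    have "emeasure (distr unif01 borel (\<lambda>u. t + c * u)) A = emeasure lborel {u. t + c * u \<in> ?C3}"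
      using emeasure_unif01[of "(\<lambda>u. t + c * u) -` A"] measurable_sets_borel[of "\<lambda>u. t + c * u" borel A]
      by (simp add: emeasure_distr g)
    moreover have "\<bar>c\<bar> = \<epsilon>" "c \<noteq> 0"
      using e by (auto simp: c_def)
    ultimately show ?thesis
      using aff[of c ?C3 t] unfolding f by simp
  qed
  have ds: "0 \<le> ?d * s" "?d * s + \<epsilon> \<le> 1"
    using e s mult_left_le[of s ?d] by (simp, linarith)
  have null: "emeasure lborel ?C3 = emeasure lborel ({?d * s<..?d * s + \<epsilon>} \<inter> A)"
    by (rule emeasure_eq_AE) (use AE_lborel_singleton[of "?d * s"] in auto)
  have "emeasure lborel ({0..1} \<inter> A) = emeasure lborel (?C1 \<union> ({?d * s<..?d * s + \<epsilon>} \<inter> A) \<union> ?C2)"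
    using ds e by (intro arg_cong[of _ _ "emeasure lborel"]) auto
  also have "\<dots> = emeasure lborel ?C1 + emeasure lborel ({?d * s<..?d * s + \<epsilon>} \<inter> A) + emeasure lborel ?C2"
    using ds e by (simp add: plus_emeasure Int_Un_distrib2 disjoint_iff)
  finally show ?thesis
    unfolding 1 2 emeasure_unif01[OF A] null by (simp add: ac_simps)
qed

lemma is_permuton_inflate_meas:
  assumes e: "0 < \<epsilon>" "\<epsilon> < 1" and z: "z \<in> {0..1} \<times> {0..1}" and mu: "is_permuton \<mu>"
  shows "is_permuton (inflate_meas \<epsilon> b z \<mu>)"
proof -
  let ?P = "map_prod (push_away (fst z) \<epsilon>) (push_away (snd z) \<epsilon>)"
  let ?I = "inflate_meas \<epsilon> b z \<mu>"
  have [measurable]: "push_away s \<epsilon> \<in> borel_measurable borel" for s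
    unfolding push_away_def[abs_def] by auto
  have [measurable]: "fst \<in> borel_measurable (borel :: (real \<times> real) measure)"
    "snd \<in> borel_measurable (borel :: (real \<times> real) measure)"
    by (auto simp: borel_prod[symmetric])
  have [measurable]: "?P \<in> borel_measurable borel"
    unfolding map_prod_def case_prod_beta' by (intro borel_measurable_Pair) measurable
  have mu_sets[measurable_cong]: "sets \<mu> = sets borel" using mu by (simp add: is_permuton_def)
  have q[measurable]: "(\<lambda>u. ((1 - \<epsilon>) * fst z + \<epsilon> * u, (1 - \<epsilon>) * snd z + \<epsilon> * (if b then u else 1 - u)))
      \<in> borel_measurable borel"
    by (intro borel_measurable_Pair) (cases b; measurable)+
  have sets: "sets ?I = sets borel" and sp: "space ?I = UNIV"
    by (simp_all add: inflate_meas_def sets.sigma_sets_eq[of borel, simplified])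
  have em: "emeasure ?I A = ennreal (1 - \<epsilon>) * emeasure (distr \<mu> borel ?P) A
     + ennreal \<epsilon> * emeasure (small_diagonal \<epsilon> b z) A" if "A \<in> sets borel" for A
    using that
  proof (subst emeasure_measure_of[OF inflate_meas_def])
    show "countably_additive (sets ?I) (\<lambda>A. ennreal (1 - \<epsilon>) * emeasure (distr \<mu> borel ?P) A
     + ennreal \<epsilon> * emeasure (small_diagonal \<epsilon> b z) A)"
      unfolding countably_additive_def sets
      by (auto simp: suminf_add[symmetric] suminf_emeasure ennreal_suminf_cmult small_diagonal_def)
  qed (auto simp: positive_def sets)
  have marg: "distr ?I borel fst = unif01"
  proof (rule measure_eqI)
    fix A assume "A \<in> sets (distr ?I borel fst)"
    then have [measurable]: "A \<in> sets borel" by simp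
    have v: "fst -` A \<in> sets (borel :: (real \<times> real) measure)"
      using measurable_sets[of fst "borel :: (real \<times> real) measure" borel A] by simp
    have m: "fst \<in> borel_measurable ?I" using sets by (simp cong: measurable_cong_sets)
    have a: "emeasure (distr \<mu> borel ?P) (fst -` A) = emeasure (distr unif01 borel (push_away (fst z) \<epsilon>)) A"
    proof -
      have "unif01 = distr \<mu> borel fst" using mu by (simp add: is_permuton_def)
      then show ?thesis
        by (simp only:) (simp add: distr_distr emeasure_distr v comp_def vimage_def)
    qed
    have b: "emeasure (small_diagonal \<epsilon> b z) (fst -` A) = 
        emeasure (distr unif01 borel (\<lambda>u. (1 - \<epsilon>) * fst z + \<epsilon> * u)) A"
      unfolding small_diagonal_def by (simp add: emeasure_distr v vimage_def)
    have "emeasure (distr ?I borel fst) A = emeasure ?I (fst -` A)"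
      using m by (simp add: emeasure_distr sp)
    then show "emeasure (distr ?I borel fst) A = emeasure unif01 A"
      using gap_marginal[of \<epsilon> "fst z" A True] e z unfolding em[OF v] a b by auto
  qed simp
  have marg2: "distr ?I borel snd = unif01"
  proof (rule measure_eqI)
    fix A assume "A \<in> sets (distr ?I borel snd)"
    then have [measurable]: "A \<in> sets borel" by simp
    have v: "snd -` A \<in> sets (borel :: (real \<times> real) measure)"
      using measurable_sets[of snd "borel :: (real \<times> real) measure" borel A] by simp
    have m: "snd \<in> borel_measurable ?I" using sets by (simp cong: measurable_cong_sets)
    have a: "emeasure (distr \<mu> borel ?P) (snd -` A) = emeasure (distr unif01 borel (push_away (snd z) \<epsilon>)) A"
    proof -
      have "unif01 = distr \<mu> borel snd" using mu by (simp add: is_permuton_def)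
      then show ?thesis
        by (simp only:) (simp add: distr_distr emeasure_distr v comp_def vimage_def)
    qed
    have b: "emeasure (small_diagonal \<epsilon> b z) (snd -` A) = 
        emeasure (distr unif01 borel (\<lambda>u. (1 - \<epsilon>) * snd z + \<epsilon> * (if b then u else 1 - u))) A"
      unfolding small_diagonal_def by (simp add: emeasure_distr v vimage_def)
    have "emeasure (distr ?I borel snd) A = emeasure ?I (snd -` A)"
      using m by (simp add: emeasure_distr sp)
    then show "emeasure (distr ?I borel snd) A = emeasure unif01 A"
      using gap_marginal[of \<epsilon> "snd z" A b] e z unfolding em[OF v] a b by auto
  qed simp
  have "prob_space ?I"
  proof (rule prob_space_distrD)
    show "fst \<in> ?I \<rightarrow>\<^sub>M borel" using sets by (simp cong: measurable_cong_sets)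
    show "prob_space (distr ?I borel fst)" unfolding marg by (rule prob_space_unif01)
  qed
  then show ?thesis
    unfolding is_permuton_def using sets marg marg2 by blast
qed

text \<open>Points \<open>z\<close> outside the unit square form a null set for every permuton; the value there only
  keeps \<open>inflate\<close> measurable in \<open>z\<close>.\<close>

definition inflate :: "real \<Rightarrow> bool \<Rightarrow> real \<times> real \<Rightarrow> permuton \<Rightarrow> permuton" where
  "inflate \<epsilon> b z \<mu> =
     (if z \<in> {0..1} \<times> {0..1} then Abs_permuton (inflate_meas \<epsilon> b z (meas \<mu>)) else \<mu>)"

definition expect_Inf :: "real \<Rightarrow> real \<Rightarrow> (permuton \<Rightarrow> real) \<Rightarrow> permuton \<Rightarrow> real" where
  "expect_Inf p \<epsilon> f \<mu> =
     (\<integral>(z, b). f (inflate \<epsilon> b z \<mu>) \<partial>(meas \<mu> \<Otimes>\<^sub>M measure_pmf (bernoulli_pmf p)))"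


section \<open>Up-down chains on permutations\<close>

text \<open>Permutations of size \<open>n\<close> are functions \<open>\<pi>\<close> with \<open>\<pi> permutes {1..n}\<close>.\<close>

definition duplicate :: "nat \<Rightarrow> bool \<Rightarrow> (nat \<Rightarrow> nat) \<Rightarrow> nat \<Rightarrow> nat" where
  "duplicate i b \<tau> = (\<lambda>j.
     let shift = (\<lambda>v. if v > \<tau> i then v + 1 else v) in
     if j < i then shift (\<tau> j)
     else if j = i then (if b then \<tau> i else \<tau> i + 1)
     else if j = i + 1 then (if b then \<tau> i + 1 else \<tau> i)
     else shift (\<tau> (j - 1)))"

definition delete_point :: "nat \<Rightarrow> (nat \<Rightarrow> nat) \<Rightarrow> nat \<Rightarrow> nat" where
  "delete_point j \<pi> = (\<lambda>i.
     let v = \<pi> (if i < j then i else i + 1) in if v > \<pi> j then v - 1 else v)"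

definition up_step :: "real \<Rightarrow> nat \<Rightarrow> (nat \<Rightarrow> nat) \<Rightarrow> (nat \<Rightarrow> nat) pmf" where
  "up_step p n \<tau> = map_pmf (\<lambda>(i, b). duplicate i b \<tau>) (pair_pmf (pmf_of_set {1..n}) (bernoulli_pmf p))"

definition down_step :: "nat \<Rightarrow> (nat \<Rightarrow> nat) \<Rightarrow> (nat \<Rightarrow> nat) pmf" where
  "down_step n \<pi> = map_pmf (\<lambda>j. delete_point j \<pi>) (pmf_of_set {1..n + 1})"

definition up_down_step :: "real \<Rightarrow> nat \<Rightarrow> (nat \<Rightarrow> nat) \<Rightarrow> (nat \<Rightarrow> nat) pmf" where
  "up_down_step p n \<tau> = bind_pmf (up_step p n \<tau>) (down_step n)"

definition up_down_chain ::
    "real \<Rightarrow> nat \<Rightarrow> 'a measure \<Rightarrow> (nat \<Rightarrow> 'a \<Rightarrow> nat \<Rightarrow> nat) \<Rightarrow> bool" where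
  "up_down_chain p n M X \<longleftrightarrow> prob_space M \<and>
     (\<forall>m. X m \<in> M \<rightarrow>\<^sub>M count_space UNIV) \<and>
     (\<forall>m. \<forall>\<omega>\<in>space M. X m \<omega> permutes {1..n}) \<and>
     (\<forall>m x. measure M {\<omega> \<in> space M. \<forall>i\<le>Suc m. X i \<omega> = x i} =
        measure M {\<omega> \<in> space M. \<forall>i\<le>m. X i \<omega> = x i} * pmf (up_down_step p n (x m)) (x (Suc m)))"

lemma nn_integral_cell:
  assumes k: "k \<in> {1..n}"
  shows "(\<integral>\<^sup>+ y. ennreal (if 0 \<le> y \<and> y \<le> 1 \<and> nat \<lceil>real n * y\<rceil> = k then real n else 0) \<partial>lborel) = 1"
proof -
  have n: "0 < real n" using k by auto
  have eq: "(0 \<le> y \<and> y \<le> 1 \<and> nat \<lceil>real n * y\<rceil> = k) \<longleftrightarrow> y \<in> {(real k - 1) / n <.. real k / n}" for y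
  proof -
    have "nat \<lceil>real n * y\<rceil> = k \<longleftrightarrow> \<lceil>real n * y\<rceil> = int k" using k by auto
    also have "\<dots> \<longleftrightarrow> real k - 1 < real n * y \<and> real n * y \<le> real k"
      by (simp add: ceiling_eq_iff)
    also have "\<dots> \<longleftrightarrow> y \<in> {(real k - 1) / n <.. real k / n}"
      using n by (simp add: field_simps)
    finally have *: "nat \<lceil>real n * y\<rceil> = k \<longleftrightarrow> y \<in> {(real k - 1) / n <.. real k / n}" .
    have "0 \<le> (real k - 1) / n" "real k / n \<le> 1" using k by auto
    then have "0 \<le> y \<and> y \<le> 1" if "y \<in> {(real k - 1) / n <.. real k / n}"
      using that by (simp only: greaterThanAtMost_iff) linarith
    then show ?thesis using * by blast
  qed
  have "(\<integral>\<^sup>+ y. ennreal (if 0 \<le> y \<and> y \<le> 1 \<and> nat \<lceil>real n * y\<rceil> = k then real n else 0) \<partial>lborel)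
    = (\<integral>\<^sup>+ y. ennreal n * indicator {(real k - 1) / n <.. real k / n} y \<partial>lborel)"
    unfolding eq by (intro nn_integral_cong) (auto split: split_indicator)
  also have "\<dots> = ennreal n * ennreal (real k / n - (real k - 1) / n)"
    using n by (subst nn_integral_cmult_indicator) (auto simp: divide_right_mono)
  also have "\<dots> = 1"
    using n by (simp add: ennreal_mult[symmetric] diff_divide_distrib[symmetric])
  finally show ?thesis .
qed

lemma is_permuton_density:
  fixes g :: "real \<Rightarrow> real \<Rightarrow> ennreal"
  assumes gm: "(\<lambda>(x, y). g x y) \<in> borel_measurable borel"
    and row: "\<And>x. x \<noteq> 0 \<Longrightarrow> (\<integral>\<^sup>+ y. g x y \<partial>lborel) = indicator {0..1} x"
    and col: "\<And>y. y \<noteq> 0 \<Longrightarrow> (\<integral>\<^sup>+ x. g x y \<partial>lborel) = indicator {0..1} y"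
  shows "is_permuton (density lborel (\<lambda>(x, y). g x y))"
proof -
  let ?D = "density lborel (\<lambda>(x, y). g x y)"
  have [measurable]: "fst \<in> borel_measurable (borel :: (real \<times> real) measure)"
    "snd \<in> borel_measurable (borel :: (real \<times> real) measure)"
    by (auto simp: borel_prod[symmetric])
  have gm2[measurable]: "(\<lambda>z. g (fst z) (snd z)) \<in> borel_measurable (lborel \<Otimes>\<^sub>M lborel)"
    using gm by (simp add: lborel_prod case_prod_beta')
  have ind: "emeasure unif01 A = (\<integral>\<^sup>+ x. indicator A x * indicator {0..1} x \<partial>lborel)"
    if "A \<in> sets borel" for A
    unfolding emeasure_unif01[OF that] using that
    by (simp add: indicator_inter_arith[symmetric] Int_commute)
  have eD: "emeasure ?D S = (\<integral>\<^sup>+ z. g (fst z) (snd z) * indicator S z \<partial>(lborel \<Otimes>\<^sub>M lborel))"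
    if "S \<in> sets borel" for S
    using that gm unfolding lborel_prod
    by (subst emeasure_density) (simp_all add: case_prod_beta')
  have m1: "distr ?D borel fst = unif01"
  proof (rule measure_eqI)
    fix A assume "A \<in> sets (distr ?D borel fst)"
    then have A[measurable]: "A \<in> sets borel" by simp
    have v: "fst -` A \<in> sets (borel :: (real \<times> real) measure)"
      using measurable_sets[of fst "borel :: (real \<times> real) measure" borel A] by simp
    have "emeasure (distr ?D borel fst) A = emeasure ?D (fst -` A)"
      by (simp add: emeasure_distr)
    also have "\<dots> = (\<integral>\<^sup>+ z. g (fst z) (snd z) * indicator A (fst z) \<partial>(lborel \<Otimes>\<^sub>M lborel))"
      unfolding eD[OF v] by (intro nn_integral_cong) (auto split: split_indicator)
    also have "\<dots> = (\<integral>\<^sup>+ x. \<integral>\<^sup>+ y. g x y * indicator A x \<partial>lborel \<partial>lborel)"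
      by (subst lborel.nn_integral_fst[symmetric]) simp_all
    also have "\<dots> = (\<integral>\<^sup>+ x. indicator A x * indicator {0..1} x \<partial>lborel)"
    proof (rule nn_integral_cong_AE)
      show "AE x in lborel. (\<integral>\<^sup>+ y. g x y * indicator A x \<partial>lborel) = indicator A x * indicator {0..1} x"
        using AE_lborel_singleton[of 0]
      proof eventually_elim
        case (elim x)
        then show ?case using row[of x] by (cases "x \<in> A") simp_all
      qed
    qed
    finally show "emeasure (distr ?D borel fst) A = emeasure unif01 A" using ind[OF A] by simp
  qed simp
  have m2: "distr ?D borel snd = unif01"
  proof (rule measure_eqI)
    fix A assume "A \<in> sets (distr ?D borel snd)"
    then have A[measurable]: "A \<in> sets borel" by simp
    have v: "snd -` A \<in> sets (borel :: (real \<times> real) measure)"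
      using measurable_sets[of snd "borel :: (real \<times> real) measure" borel A] by simp
    have "emeasure (distr ?D borel snd) A = emeasure ?D (snd -` A)"
      by (simp add: emeasure_distr)
    also have "\<dots> = (\<integral>\<^sup>+ z. g (fst z) (snd z) * indicator A (snd z) \<partial>(lborel \<Otimes>\<^sub>M lborel))"
      unfolding eD[OF v] by (intro nn_integral_cong) (auto split: split_indicator)
    also have "\<dots> = (\<integral>\<^sup>+ y. \<integral>\<^sup>+ x. g x y * indicator A y \<partial>lborel \<partial>lborel)"
      by (subst lborel_pair.nn_integral_snd[symmetric]) simp_all
    also have "\<dots> = (\<integral>\<^sup>+ y. indicator A y * indicator {0..1} y \<partial>lborel)"
    proof (rule nn_integral_cong_AE)
      show "AE y in lborel. (\<integral>\<^sup>+ x. g x y * indicator A y \<partial>lborel) = indicator A y * indicator {0..1} y"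
        using AE_lborel_singleton[of 0]
      proof eventually_elim
        case (elim y)
        then show ?case using col[of y] by (cases "y \<in> A") simp_all
      qed
    qed
    finally show "emeasure (distr ?D borel snd) A = emeasure unif01 A" using ind[OF A] by simp
  qed simp
  have "prob_space ?D"
  proof (rule prob_space_distrD)
    show "fst \<in> ?D \<rightarrow>\<^sub>M borel" by simp
    show "prob_space (distr ?D borel fst)" unfolding m1 by (rule prob_space_unif01)
  qed
  then show ?thesis
    unfolding is_permuton_def using m1 m2 by simp
qed

lemma is_permuton_perm_density:
  assumes n: "1 \<le> n" and pi: "\<pi> permutes {1..n}"
  shows "is_permuton (density lborel (\<lambda>(x, y).
     ennreal (if 0 \<le> x \<and> x \<le> 1 \<and> 0 \<le> y \<and> y \<le> 1 \<and> \<pi> (nat \<lceil>real n * x\<rceil>) = nat \<lceil>real n * y\<rceil>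
       then real n else 0)))"
proof -
  let ?g = "\<lambda>x y. ennreal (if 0 \<le> x \<and> x \<le> 1 \<and> 0 \<le> y \<and> y \<le> 1 \<and> 
     \<pi> (nat \<lceil>real n * x\<rceil>) = nat \<lceil>real n * y\<rceil> then real n else 0)"
  have gm: "(\<lambda>(x, y). ?g x y) \<in> borel_measurable (borel :: (real \<times> real) measure)"
  proof -
    define a where "a x = nat \<lceil>real n * x\<rceil>" for x
    have a[measurable]: "a \<in> borel \<rightarrow>\<^sub>M count_space UNIV"
      unfolding a_def[abs_def]
      by (rule measurable_compose[where N = "count_space UNIV :: int measure"]) measurable
    have "(\<lambda>z. \<pi> (a (fst z))) \<in> borel \<Otimes>\<^sub>M borel \<rightarrow>\<^sub>M count_space UNIV"
      by (rule measurable_compose[where N = "count_space UNIV :: nat measure"]) measurable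
    then have [measurable]: "Measurable.pred (borel \<Otimes>\<^sub>M borel) (\<lambda>z. \<pi> (a (fst z)) = k)" for k
      by (rule measurable_compose) simp
    have [measurable]: "Measurable.pred (borel \<Otimes>\<^sub>M borel) (\<lambda>z. a (snd z) = k)" for k
      by (rule measurable_compose[where N = "count_space UNIV :: nat measure"]) measurable
    have "Measurable.pred (borel \<Otimes>\<^sub>M borel) (\<lambda>z. \<exists>k. \<pi> (a (fst z)) = k \<and> a (snd z) = k)"
      by measurable
    then have [measurable]: "Measurable.pred (borel \<Otimes>\<^sub>M borel) (\<lambda>z. \<pi> (a (fst z)) = a (snd z))"
      by (simp add: eq_commute)
    show ?thesis
      unfolding borel_prod[symmetric] a_def[symmetric] case_prod_beta' by measurable
  qed
  have cell: "nat \<lceil>real n * x\<rceil> \<in> {1..n}" if "0 < x" "x \<le> 1" for x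
  proof -
    have "0 < real n * x" "real n * x \<le> real n * 1" using that n by (auto intro: mult_left_mono)
    then show ?thesis by (auto simp: ceiling_le_iff le_nat_iff nat_le_iff one_le_ceiling)
  qed
  have row: "(\<integral>\<^sup>+ y. ?g x y \<partial>lborel) = indicator {0..1} x" if "x \<noteq> 0" for x
  proof (cases "0 < x \<and> x \<le> 1")
    case True
    have "\<pi> (nat \<lceil>real n * x\<rceil>) \<in> {1..n}"
      using permutes_in_image[OF pi] cell True by blast
    from nn_integral_cell[OF this] True show ?thesis by (simp add: eq_commute[of "\<pi> _"])
  qed (use that in auto)
  have col: "(\<integral>\<^sup>+ x. ?g x y \<partial>lborel) = indicator {0..1} y" if "y \<noteq> 0" for y
  proof (cases "0 < y \<and> y \<le> 1")
    case True
    have "inv \<pi> (nat \<lceil>real n * y\<rceil>) \<in> {1..n}"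
      using permutes_in_image[OF permutes_inv[OF pi]] cell True by blast
    moreover have "\<pi> i = j \<longleftrightarrow> i = inv \<pi> j" for i j
      using permutes_inverses[OF pi] by metis
    ultimately show ?thesis
      using nn_integral_cell[of "inv \<pi> (nat \<lceil>real n * y\<rceil>)" n] True by simp
  qed (use that in auto)
  show ?thesis
    by (rule is_permuton_density[OF gm row col])
qed

definition perm_permuton :: "nat \<Rightarrow> (nat \<Rightarrow> nat) \<Rightarrow> permuton" where
  "perm_permuton n \<pi> = Abs_permuton (density lborel (\<lambda>(x, y).
     ennreal (if 0 \<le> x \<and> x \<le> 1 \<and> 0 \<le> y \<and> y \<le> 1 \<and> \<pi> (nat \<lceil>real n * x\<rceil>) = nat \<lceil>real n * y\<rceil>
       then real n else 0)))"

text \<open>\<open>z 1, \<dots>, z k\<close>, relabelled by increasing abscissa through \<open>s\<close>, form the diagram of \<open>\<pi>\<close>.\<close>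

definition forms_diagram :: "nat \<Rightarrow> (nat \<Rightarrow> nat) \<Rightarrow> (nat \<Rightarrow> real \<times> real) \<Rightarrow> bool" where
  "forms_diagram k \<pi> z \<longleftrightarrow> (\<exists>s. s permutes {1..k} \<and>
     (\<forall>i\<in>{1..k}. \<forall>j\<in>{1..k}.
        (i < j \<longrightarrow> fst (z (s i)) < fst (z (s j))) \<and>
        (\<pi> i < \<pi> j \<longrightarrow> snd (z (s i)) < snd (z (s j)))))"

definition perm_density :: "nat \<Rightarrow> (nat \<Rightarrow> nat) \<Rightarrow> permuton \<Rightarrow> real" where
  "perm_density k \<pi> \<mu> = measure (\<Pi>\<^sub>M i\<in>{1..k}. meas \<mu>)
     {z \<in> space (\<Pi>\<^sub>M i\<in>{1..k}. meas \<mu>). forms_diagram k \<pi> z}"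


section \<open>The Skorokhod space\<close>

text \<open>Paths on the half-line are extensional, that is, undefined at negative times.\<close>

definition cadlag_paths :: "(real \<Rightarrow> 'a::topological_space) set" where
  "cadlag_paths = {x \<in> extensional {0..}.
     (\<forall>t\<ge>0. (x \<longlongrightarrow> x t) (at_right t)) \<and> (\<forall>t>0. \<exists>l. (x \<longlongrightarrow> l) (at_left t))}"

text \<open>The metric of Ethier and Kurtz, Markov Processes, Section 3.5: \<open>time_changes\<close> is their
  \<open>\<Lambda>\<close> and \<open>log_slope\<close> their \<open>\<gamma>\<close>; \<open>d\<close> is a metric for the topology of the state space.\<close>

definition log_slopes :: "(real \<Rightarrow> real) \<Rightarrow> real set" where
  "log_slopes \<theta> = {\<bar>ln ((\<theta> t - \<theta> s) / (t - s))\<bar> | s t. 0 \<le> s \<and> s < t}"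

definition time_changes :: "(real \<Rightarrow> real) set" where
  "time_changes = {\<theta>. strict_mono_on {0..} \<theta> \<and> \<theta> ` {0..} = {0..} \<and> bdd_above (log_slopes \<theta>)}"

definition log_slope :: "(real \<Rightarrow> real) \<Rightarrow> real" where
  "log_slope \<theta> = Sup (log_slopes \<theta>)"

definition skorokhod_dist ::
    "('a \<Rightarrow> 'a \<Rightarrow> real) \<Rightarrow> (real \<Rightarrow> 'a) \<Rightarrow> (real \<Rightarrow> 'a) \<Rightarrow> real" where
  "skorokhod_dist d x y = (INF \<theta>\<in>time_changes. max (log_slope \<theta>)
     (LBINT u:{0..}. exp (- u) * (SUP t\<in>{0..}. min 1 (d (x (min t u)) (y (min (\<theta> t) u))))))"

definition skorokhod :: "('a::topological_space \<Rightarrow> 'a \<Rightarrow> real) \<Rightarrow> (real \<Rightarrow> 'a) topology" where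
  "skorokhod d = topology (\<lambda>U. U \<subseteq> cadlag_paths \<and>
     (\<forall>x\<in>U. \<exists>e>0. \<forall>y\<in>cadlag_paths. skorokhod_dist d x y < e \<longrightarrow> y \<in> U))"

lemma openin_skorokhod:
  "openin (skorokhod d) U \<longleftrightarrow> U \<subseteq> cadlag_paths \<and>
     (\<forall>x\<in>U. \<exists>e>0. \<forall>y\<in>cadlag_paths. skorokhod_dist d x y < e \<longrightarrow> y \<in> U)"
proof -
  let ?P = "\<lambda>U. U \<subseteq> cadlag_paths \<and>
     (\<forall>x\<in>U. \<exists>e>0. \<forall>y\<in>cadlag_paths. skorokhod_dist d x y < e \<longrightarrow> y \<in> U)"
  have "?P (U \<inter> V)" if U: "?P U" and V: "?P V" for U V
  proof (intro conjI ballI)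
    show "U \<inter> V \<subseteq> cadlag_paths" using U by blast
    fix x assume x: "x \<in> U \<inter> V"
    obtain a where a: "a > 0" "\<forall>y\<in>cadlag_paths. skorokhod_dist d x y < a \<longrightarrow> y \<in> U"
      using U x by blast
    obtain b where b: "b > 0" "\<forall>y\<in>cadlag_paths. skorokhod_dist d x y < b \<longrightarrow> y \<in> V"
      using V x by blast
    show "\<exists>e>0. \<forall>y\<in>cadlag_paths. skorokhod_dist d x y < e \<longrightarrow> y \<in> U \<inter> V"
      using a b by (intro exI[of _ "min a b"]) auto
  qed
  moreover have "?P (\<Union>K)" if "\<forall>U\<in>K. ?P U" for K
    using that by (intro conjI ballI) (blast, metis Union_iff)
  ultimately have "istopology ?P"
    unfolding istopology_def by blast
  then show ?thesis
    unfolding skorokhod_def by simp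
qed

lemma topspace_skorokhod: "topspace (skorokhod d) = cadlag_paths"
proof -
  have "openin (skorokhod d) cadlag_paths"
    unfolding openin_skorokhod by (auto intro!: exI[of _ 1])
  then show ?thesis
    by (metis openin_skorokhod openin_subset openin_topspace subset_antisym)
qed

abbreviation skorokhod_permuton :: "(real \<Rightarrow> permuton) topology" where
  "skorokhod_permuton \<equiv> skorokhod wasserstein"

definition random_element :: "'b topology \<Rightarrow> 'a measure \<Rightarrow> ('a \<Rightarrow> 'b) \<Rightarrow> bool" where
  "random_element X M Y \<longleftrightarrow>
     prob_space M \<and> Y \<in> M \<rightarrow>\<^sub>M sigma (topspace X) {U. openin X U}"

definition converges_in_distribution ::
    "'b topology \<Rightarrow> ('i \<Rightarrow> 'a measure) \<Rightarrow> ('i \<Rightarrow> 'a \<Rightarrow> 'b) \<Rightarrow> 'c measure \<Rightarrow> ('c \<Rightarrow> 'b) \<Rightarrow> 'i filter \<Rightarrow> bool"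
  where
  "converges_in_distribution X N Y M Z G \<longleftrightarrow>
     (\<forall>\<^sub>F i in G. random_element X (N i) (Y i)) \<and> random_element X M Z \<and>
     (\<forall>h :: 'b \<Rightarrow> real. continuous_map X euclideanreal h \<and> bounded (h ` topspace X) \<longrightarrow>
        ((\<lambda>i. \<integral>\<omega>. h (Y i \<omega>) \<partial>(N i)) \<longlongrightarrow> (\<integral>\<omega>. h (Z \<omega>) \<partial>M)) G)"


section \<open>Feller processes on a compact state space\<close>

text \<open>For a compact state space \<open>'a\<close>, the type \<open>'a \<Rightarrow>\<^sub>C real\<close> with its supremum norm is \<open>C('a)\<close>.
  Semigroups are only considered at nonnegative times.\<close>

definition feller_semigroup ::
    "(real \<Rightarrow> ('a::topological_space \<Rightarrow>\<^sub>C real) \<Rightarrow> ('a \<Rightarrow>\<^sub>C real)) \<Rightarrow> bool" where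
  "feller_semigroup T \<longleftrightarrow>
     (\<forall>t\<ge>0. linear (T t) \<and> T t (const_bcontfun 1) = const_bcontfun 1 \<and>
        (\<forall>f. (\<forall>x. 0 \<le> apply_bcontfun f x) \<longrightarrow> (\<forall>x. 0 \<le> apply_bcontfun (T t f) x))) \<and>
     T 0 = id \<and> (\<forall>s\<ge>0. \<forall>t\<ge>0. T (s + t) = T s \<circ> T t) \<and>
     (\<forall>f. ((\<lambda>t. T t f) \<longlongrightarrow> f) (at_right 0))"

text \<open>The generator, as the graph of a partially defined operator.\<close>

definition generator ::
    "(real \<Rightarrow> 'b \<Rightarrow> 'b) \<Rightarrow> ('b::real_normed_vector \<times> 'b) set" where
  "generator T = {(f, g). ((\<lambda>t. (T t f - f) /\<^sub>R t) \<longlongrightarrow> g) (at_right 0)}"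

definition is_core :: "('b::real_normed_vector \<times> 'b) set \<Rightarrow> 'b set \<Rightarrow> bool" where
  "is_core A D \<longleftrightarrow> subspace D \<and> D \<subseteq> Domain A \<and> closure {(f, g) \<in> A. f \<in> D} = A"

definition past :: "'a measure \<Rightarrow> ('a \<Rightarrow> real \<Rightarrow> 's::topological_space) \<Rightarrow> real \<Rightarrow> 'a measure" where
  "past M Y s = sigma (space M)
     {(\<lambda>\<omega>. Y \<omega> u) -` A \<inter> space M | u A. 0 \<le> u \<and> u \<le> s \<and> A \<in> sets borel}"

text \<open>Cadlag process \<open>Y\<close> that is Markov for the semigroup \<open>T\<close> with initial law \<open>m\<close>; it is also
  a random element of the Skorokhod space, given a metric \<open>d\<close> for the topology of the state space.\<close>

definition feller_process ::
    "('s::topological_space \<Rightarrow> 's \<Rightarrow> real) \<Rightarrow> (real \<Rightarrow> ('s \<Rightarrow>\<^sub>C real) \<Rightarrow> ('s \<Rightarrow>\<^sub>C real)) \<Rightarrow>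
     's measure \<Rightarrow> 'a measure \<Rightarrow> ('a \<Rightarrow> real \<Rightarrow> 's) \<Rightarrow> bool" where
  "feller_process d T m M Y \<longleftrightarrow>
     feller_semigroup T \<and> random_element (skorokhod d) M Y \<and>
     (\<forall>t\<ge>0. (\<lambda>\<omega>. Y \<omega> t) \<in> M \<rightarrow>\<^sub>M borel) \<and>
     distr M borel (\<lambda>\<omega>. Y \<omega> 0) = m \<and>
     (\<forall>s\<ge>0. \<forall>t\<ge>0. \<forall>f. AE \<omega> in M.
        real_cond_exp M (past M Y s) (\<lambda>\<omega>. apply_bcontfun f (Y \<omega> (s + t))) \<omega> =
          apply_bcontfun (T t f) (Y \<omega> s))"


section \<open>The limiting diffusion and its approximations\<close>

definition density_functions :: "(permuton \<Rightarrow>\<^sub>C real) set" where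
  "density_functions = {f. \<exists>k \<pi>. 1 \<le> k \<and> \<pi> permutes {1..k} \<and> apply_bcontfun f = perm_density k \<pi>}"

text \<open>For \<open>k = 1\<close> the sum involves the meaningless \<open>up_step p 0\<close>, but has the factor \<open>k * (k - 1) = 0\<close>.\<close>

definition diffusion_generator :: "real \<Rightarrow> ((permuton \<Rightarrow>\<^sub>C real) \<times> (permuton \<Rightarrow>\<^sub>C real)) set \<Rightarrow> bool" where
  "diffusion_generator p A \<longleftrightarrow> is_core A (span density_functions) \<and>
     (\<forall>k \<pi> f g. 1 \<le> k \<longrightarrow> \<pi> permutes {1..k} \<longrightarrow> apply_bcontfun f = perm_density k \<pi> \<longrightarrow> (f, g) \<in> A \<longrightarrow>
        (\<forall>\<mu>. apply_bcontfun g \<mu> = - real (k * (k - 1)) * (perm_density k \<pi> \<mu>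
           - (\<Sum>\<tau> | \<tau> permutes {1..k - 1}. pmf (up_step p (k - 1) \<tau>) \<pi> * perm_density (k - 1) \<tau> \<mu>))))"

text \<open>\<open>F\<close>, defined on \<open>M\<close>, is the scaling limit of up-down chains \<open>X n\<close> on the probability spaces
  \<open>L n\<close>; the remaining clauses are the known description of this limit.\<close>

definition permuton_diffusion ::
    "real \<Rightarrow> permuton measure \<Rightarrow> (nat \<Rightarrow> 'c measure) \<Rightarrow> (nat \<Rightarrow> nat \<Rightarrow> 'c \<Rightarrow> nat \<Rightarrow> nat) \<Rightarrow>
     'a measure \<Rightarrow> ('a \<Rightarrow> real \<Rightarrow> permuton) \<Rightarrow> bool" where
  "permuton_diffusion p m L X M F \<longleftrightarrow>
     (\<forall>n\<ge>1. up_down_chain p n (L n) (X n)) \<and>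
     converges_in_distribution euclidean L (\<lambda>n \<omega>. perm_permuton n (X n 0 \<omega>)) m (\<lambda>\<mu>. \<mu>) sequentially \<and>
     converges_in_distribution skorokhod_permuton
       L (\<lambda>n \<omega>. \<lambda>t\<in>{0..}. perm_permuton n (X n (nat \<lfloor>(real n)\<^sup>2 * t\<rfloor>) \<omega>)) M F sequentially \<and>
     (AE \<omega> in M. continuous_on {0..} (F \<omega>)) \<and>
     (\<exists>T. feller_process wasserstein T m M F \<and> diffusion_generator p (generator T))"

definition inflation_process ::
    "real \<Rightarrow> real \<Rightarrow> permuton measure \<Rightarrow> 'b measure \<Rightarrow> ('b \<Rightarrow> real \<Rightarrow> permuton) \<Rightarrow> bool" where
  "inflation_process p \<epsilon> m N Y \<longleftrightarrow>
     (\<exists>T. feller_process wasserstein T m N Y \<and> Domain (generator T) = UNIV \<and>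
        (\<forall>(f, g)\<in>generator T. \<forall>\<mu>.
           apply_bcontfun g \<mu> = 2 / \<epsilon>\<^sup>2 * (expect_Inf p \<epsilon> (apply_bcontfun f) \<mu> - apply_bcontfun f \<mu>)))"

end

theory Submission
  imports Defs
begin

text \<open>Applied to a pattern density of size \<open>k\<close>, the generators of the inflation processes and of the
  diffusion differ by \<open>O(\<epsilon>)\<close>: of \<open>k\<close> sampled points at least two fall on the inserted diagonal with
  probability of order \<open>\<epsilon>\<^sup>2\<close>; exactly two such points amount to a duplication in the pattern of the other
  points and the root of the inflation, and a single one is exchangeable with the others. As duplication
  lowers the size of the pattern, a linear differential inequality and induction on \<open>k\<close> give convergence
  of the semigroups on pattern densities, and these span a dense space.

  The Markov property then yields convergence of the expectations of continuous functions of finitely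
  many observations. Tightness is replaced by an inequality of Ottaviani type, which bounds the oscillation
  of an observable between the points of a time grid by its maximal increment along the grid; the
  expectation of the latter converges as well, and is small for the limit because its paths are
  continuous. Hence, outside events of small probability, a continuous functional on the Skorokhod
  space is bounded below by a Lipschitz function of the observations, and this bound is asymptotically
  sharp at the limit by the Borel--Cantelli lemma.\<close>

subsection \<open>Permutons\<close>

text \<open>The jump rate is matched to the quadratic term: a given pair of sample points falls on
  the inserted diagonal with probability \<epsilon>^2, there are k(k-1)/2 pairs, and the rate
  \<open>2 / \<epsilon>\<^sup>2\<close> turns this into the factor k(k-1) of the limiting generator.
  A term of order \<epsilon> would be fatal at this rate; it vanishes because the root of the
  inflation is itself a sample from the permuton, so that a single point on the diagonal leaves the
  law of the pattern unchanged.

  For the paths, pure-jump processes have to be compared with a continuous one in the Wasserstein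
  metric through finitely many real observations. Values of the copula on an n by n grid serve for
  this: they are continuous in the permuton, and an error \<eta> in them costs 1/n + n^2 \<eta> in
  the Wasserstein distance, up to constants. Hence the scale \<eta> = 1/n^3. As the limiting paths
  are continuous, the identity is a sufficient time change. A lower bound for the limit inferior of
  the means of each bounded continuous functional is enough, because it applies to the negative
  functional as well.\<close>

lemma is_permuton_meas [simp]: "is_permuton (meas \<mu>)"
  using meas by auto

lemma prob_space_meas [simp]: "prob_space (meas \<mu>)"
  using is_permuton_meas[of \<mu>] by (simp add: is_permuton_def)

lemma sets_meas [simp, measurable_cong]: "sets (meas \<mu>) = sets borel"
  using is_permuton_meas[of \<mu>] by (simp add: is_permuton_def)

lemma space_meas [simp]: "space (meas \<mu>) = UNIV"
  by (metis sets_eq_imp_space_eq sets_meas space_borel)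

lemma measurable_fst_borel [measurable]:
  "fst \<in> borel_measurable (borel :: ('a::second_countable_topology \<times> 'b::second_countable_topology) measure)"
  by (simp add: borel_prod[symmetric])

lemma measurable_snd_borel [measurable]:
  "snd \<in> borel_measurable (borel :: ('a::second_countable_topology \<times> 'b::second_countable_topology) measure)"
  by (simp add: borel_prod[symmetric])

lemma measure_meas_fst:
  assumes [measurable]: "A \<in> sets borel"
  shows "measure (meas \<mu>) {z. fst z \<in> A} = measure lborel ({0..1} \<inter> A)"
proof -
  have "distr (meas \<mu>) borel fst = unif01"
    using is_permuton_meas[of \<mu>] by (simp add: is_permuton_def)
  then have "emeasure (meas \<mu>) (fst -` A) = emeasure unif01 A"
    using emeasure_distr[of fst "meas \<mu>" borel A] by simp
  then show ?thesis
    by (simp add: emeasure_unif01[OF assms] measure_def vimage_def del: emeasure_uniform_measure)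
qed

lemma measure_meas_snd:
  assumes [measurable]: "A \<in> sets borel"
  shows "measure (meas \<mu>) {z. snd z \<in> A} = measure lborel ({0..1} \<inter> A)"
proof -
  have "distr (meas \<mu>) borel snd = unif01"
    using is_permuton_meas[of \<mu>] by (simp add: is_permuton_def)
  then have "emeasure (meas \<mu>) (snd -` A) = emeasure unif01 A"
    using emeasure_distr[of snd "meas \<mu>" borel A] by simp
  then show ?thesis
    by (simp add: emeasure_unif01[OF assms] measure_def vimage_def del: emeasure_uniform_measure)
qed

lemma measure_meas_fst_Ioc_le: "a \<le> b \<Longrightarrow> measure (meas \<mu>) {z. fst z \<in> {a<..b}} \<le> b - a"
proof -
  assume "a \<le> b"
  then have "measure lborel ({0..1} \<inter> {a<..b}) \<le> measure lborel {a<..b}"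
    by (intro measure_mono_fmeasurable) (auto intro!: fmeasurableI)
  with \<open>a \<le> b\<close> show ?thesis using measure_meas_fst[of "{a<..b}" \<mu>] by simp
qed

lemma measure_meas_snd_Ioc_le: "a \<le> b \<Longrightarrow> measure (meas \<mu>) {z. snd z \<in> {a<..b}} \<le> b - a"
proof -
  assume "a \<le> b"
  then have "measure lborel ({0..1} \<inter> {a<..b}) \<le> measure lborel {a<..b}"
    by (intro measure_mono_fmeasurable) (auto intro!: fmeasurableI)
  with \<open>a \<le> b\<close> show ?thesis using measure_meas_snd[of "{a<..b}" \<mu>] by simp
qed

text \<open>The square is open at its left and lower sides to match the cells of
  \<open>grid_cell\<close>, which partition it; by the uniform marginals the lines through 0 carry
  no mass.\<close>

lemma AE_meas_square: "AE z in meas \<mu>. fst z \<in> {0<..1} \<and> snd z \<in> {0<..1}"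
proof -
  interpret prob_space "meas \<mu>" by simp
  have "measure lborel ({0..1} \<inter> {0<..1::real}) = 1"
  proof -
    have "{0..1} \<inter> {0<..1::real} = {0<..1}" by auto
    then show ?thesis by simp
  qed
  then have "prob {z \<in> space (meas \<mu>). fst z \<in> {0<..1}} = 1" "prob {z \<in> space (meas \<mu>). snd z \<in> {0<..1}} = 1"
    using measure_meas_fst[of "{0<..1}" \<mu>] measure_meas_snd[of "{0<..1}" \<mu>] by auto
  moreover have "{z \<in> space (meas \<mu>). fst z \<in> {0<..1}} \<in> events" "{z \<in> space (meas \<mu>). snd z \<in> {0<..1}} \<in> events"
    by measurable
  ultimately have "AE z in meas \<mu>. fst z \<in> {0<..1}" "AE z in meas \<mu>. snd z \<in> {0<..1}"
    by (simp_all only: prob_Collect_eq_1)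
  then show ?thesis by eventually_elim auto
qed

lemma continuous_integral_meas:
  fixes f :: "real \<times> real \<Rightarrow> real"
  assumes f: "continuous_on UNIV f" "bounded (range f)"
  shows "continuous_on UNIV (\<lambda>\<mu>. \<integral>z. f z \<partial>(meas \<mu>))"
proof (subst continuous_on_open_vimage, simp, intro allI impI)
  fix U :: "real set" assume "open U"
  then have "open {\<mu>. (\<integral>z. f z \<partial>(meas \<mu>)) \<in> U}"
    unfolding open_permuton_def using f by (intro generate_topology.Basis) auto
  then show "open ((\<lambda>\<mu>. \<integral>z. f z \<partial>(meas \<mu>)) -` U \<inter> UNIV)"
    by (simp add: vimage_def)
qed

text \<open>Uniform limits, in the form that serves copulas, pattern densities and integrals of
  curves: each of these is approximated uniformly by functions already known to be
  continuous.\<close>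

lemma continuous_on_uniformly_approximable:
  fixes f :: "'a::topological_space \<Rightarrow> 'b::metric_space"
  assumes "\<And>e. 0 < e \<Longrightarrow> \<exists>g. continuous_on S g \<and> (\<forall>x\<in>S. dist (g x) (f x) \<le> e)"
  shows "continuous_on S f"
proof -
  have "\<forall>n. \<exists>g. continuous_on S g \<and> (\<forall>x\<in>S. dist (g x) (f x) \<le> inverse (real (Suc n)))"
    using assms by auto
  then obtain g where g: "\<And>n. continuous_on S (g n)"
    "\<And>n x. x \<in> S \<Longrightarrow> dist (g n x) (f x) \<le> inverse (real (Suc n))" by metis
  have "uniform_limit S g f sequentially"
  proof (rule uniform_limitI)
    fix e :: real assume "0 < e"
    from LIMSEQ_inverse_real_of_nat this have "\<forall>\<^sub>F n in sequentially. inverse (real (Suc n)) < e"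
      by (rule order_tendstoD)
    then show "\<forall>\<^sub>F n in sequentially. \<forall>x\<in>S. dist (g n x) (f x) < e"
      by eventually_elim (meson g(2) order_le_less_trans)
  qed
  then show ?thesis
    by (rule uniform_limit_theorem[rotated]) (use g in auto)
qed

text \<open>The distribution function. Its values on a grid are the observations of a path: numbers
  in [0,1] that depend continuously on the permuton and control the Wasserstein distance.\<close>

definition copula :: "permuton \<Rightarrow> real \<Rightarrow> real \<Rightarrow> real" where
  "copula \<mu> a b = measure (meas \<mu>) {z. fst z \<le> a \<and> snd z \<le> b}"

lemma copula_nonneg: "0 \<le> copula \<mu> a b" and copula_le_1: "copula \<mu> a b \<le> 1"
  unfolding copula_def using prob_space.prob_le_1[OF prob_space_meas] by auto

text \<open>The indicator of a quadrant is discontinuous, but a ramp of width \<open>d\<close>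
  differs from it only on two strips of that width. Uniform marginals bound the mass of each strip
  by \<open>d\<close>, the same bound for all permutons, so the approximation is uniform.\<close>

lemma continuous_copula: "continuous_on UNIV (\<lambda>\<mu>. copula \<mu> a b)"
proof (rule continuous_on_uniformly_approximable)
  fix e :: real assume e: "0 < e"
  define d where "d = e / 2"
  have d: "0 < d" using e by (simp add: d_def)
  define \<phi> where "\<phi> z = max 0 (min 1 ((a + d - fst z) / d)) * max 0 (min 1 ((b + d - snd z) / d))" for z :: "real \<times> real"
  have c: "continuous_on UNIV \<phi>"
    unfolding \<phi>_def[abs_def] using d by (intro continuous_intros) auto
  have b01: "0 \<le> \<phi> z \<and> \<phi> z \<le> 1" for z
    unfolding \<phi>_def by (auto intro!: mult_le_one)
  have bd: "bounded (range \<phi>)"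
    by (rule boundedI[of _ 1]) (use b01 in auto)
  have "dist (\<integral>z. \<phi> z \<partial>(meas \<mu>)) (copula \<mu> a b) \<le> e" for \<mu>
  proof -
    interpret prob_space "meas \<mu>" by simp
    have [measurable]: "\<phi> \<in> borel_measurable borel"
      using c by (rule borel_measurable_continuous_onI)
    have i1: "integrable (meas \<mu>) \<phi>"
      by (rule integrable_const_bound[of _ 1]) (use b01 in auto)
    let ?A = "{z::real\<times>real. fst z \<le> a \<and> snd z \<le> b}"
    let ?B = "{z::real\<times>real. fst z \<in> {a<..a+d}}" and ?C = "{z::real\<times>real. snd z \<in> {b<..b+d}}"
    have A: "?A \<in> sets borel" by measurable
    have B: "?B \<in> sets borel" by measurable
    have C: "?C \<in> sets borel" by measurable
    have i2: "integrable (meas \<mu>) (indicat_real ?A)" "integrable (meas \<mu>) (indicat_real ?B)" "integrable (meas \<mu>) (indicat_real ?C)"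
      using A B C by (auto simp: emeasure_eq_measure intro!: integrable_real_indicator)
    have "\<bar>\<phi> z - indicat_real ?A z\<bar> \<le> indicat_real ?B z + indicat_real ?C z" for z
    proof (cases "fst z > a + d \<or> snd z > b + d")
      case True
      then have "\<phi> z = 0" using d by (auto simp: \<phi>_def divide_le_0_iff max_def min_def field_simps)
      then show ?thesis using True d by (auto split: split_indicator)
    next
      case False
      show ?thesis
      proof (cases "z \<in> ?A")
        case True
        then have "\<phi> z = 1" using d by (auto simp: \<phi>_def le_divide_eq max_def min_def)
        then show ?thesis using True by simp
      next
        case F: False
        with False have "z \<in> ?B \<or> z \<in> ?C" by auto
        then show ?thesis using b01[of z] F by (auto split: split_indicator)
      qed
    qed
    then have "\<bar>\<integral>z. \<phi> z - indicat_real ?A z \<partial>(meas \<mu>)\<bar> \<le> (\<integral>z. indicat_real ?B z + indicat_real ?C z \<partial>(meas \<mu>))"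
      using i1 i2 by (intro integral_abs_bound[THEN order_trans] integral_mono) auto
    also have "\<dots> = measure (meas \<mu>) ?B + measure (meas \<mu>) ?C"
      using i2 by (subst Bochner_Integration.integral_add) auto
    also have "\<dots> \<le> d + d"
      using measure_meas_fst_Ioc_le[of a "a + d" \<mu>] measure_meas_snd_Ioc_le[of b "b + d" \<mu>] d by auto
    finally show ?thesis
      using i1 i2 by (simp add: copula_def dist_real_def d_def)
  qed
  then show "\<exists>g. continuous_on UNIV g \<and> (\<forall>\<mu>\<in>UNIV. dist (g \<mu>) (copula \<mu> a b) \<le> e)"
    using continuous_integral_meas[OF c bd] by blast
qed

subsection \<open>The Wasserstein distance and copulas\<close>

lemma nn_integral_step:
  assumes "finite I" "\<And>i. i \<in> I \<Longrightarrow> 0 \<le> e i" "\<And>i. i \<in> I \<Longrightarrow> c i \<in> sets M" "finite_measure M"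
  shows "(\<integral>\<^sup>+ w. ennreal (\<Sum>i\<in>I. e i * indicator (c i) w) \<partial>M) = ennreal (\<Sum>i\<in>I. e i * measure M (c i))"
proof -
  interpret finite_measure M by fact
  have "(\<integral>\<^sup>+ w. ennreal (\<Sum>i\<in>I. e i * indicator (c i) w) \<partial>M) = (\<integral>\<^sup>+ w. (\<Sum>i\<in>I. ennreal (e i) * indicator (c i) w) \<partial>M)"
    using assms by (intro nn_integral_cong) (subst sum_ennreal[symmetric], auto simp: ennreal_mult' ennreal_indicator)
  also have "\<dots> = (\<Sum>i\<in>I. ennreal (e i) * emeasure M (c i))"
    using assms by (subst nn_integral_sum) (auto simp: nn_integral_cmult_indicator)
  also have "\<dots> = ennreal (\<Sum>i\<in>I. e i * measure M (c i))"
    using assms by (simp add: emeasure_eq_measure ennreal_mult'[symmetric] sum_ennreal)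
  finally show ?thesis .
qed

text \<open>The marginals are computed by Tonelli. The conditions on rows and columns are required
  almost everywhere only, which lets cells of mass zero be ignored later.\<close>

lemma density_in_couplings:
  fixes P Q :: "'a::second_countable_topology measure"
  assumes "prob_space P" "prob_space Q" and sP [measurable_cong]: "sets P = sets borel" and sQ [measurable_cong]: "sets Q = sets borel"
    and [measurable]: "k \<in> borel_measurable (P \<Otimes>\<^sub>M Q)"
    and row: "AE z in P. (\<integral>\<^sup>+ w. k (z, w) \<partial>Q) = 1"
    and col: "AE w in Q. (\<integral>\<^sup>+ z. k (z, w) \<partial>P) = 1"
  shows "density (P \<Otimes>\<^sub>M Q) k \<in> couplings P Q"
proof -
  interpret P: prob_space P by fact
  interpret Q: prob_space Q by fact
  interpret PQ: pair_sigma_finite P Q ..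
  have sets: "sets (P \<Otimes>\<^sub>M Q) = sets borel"
    using sets_pair_measure_cong[OF sP sQ] by (simp only: borel_prod)
  have "distr (density (P \<Otimes>\<^sub>M Q) k) borel fst = P"
  proof (rule measure_eqI)
    fix A assume "A \<in> sets (distr (density (P \<Otimes>\<^sub>M Q) k) borel fst)"
    then have A [measurable]: "A \<in> sets borel" by simp
    have "emeasure (distr (density (P \<Otimes>\<^sub>M Q) k) borel fst) A = (\<integral>\<^sup>+ x. indicator A x \<partial>(distr (density (P \<Otimes>\<^sub>M Q) k) borel fst))"
      by simp
    also have "\<dots> = (\<integral>\<^sup>+ x. k x * indicator A (fst x) \<partial>(P \<Otimes>\<^sub>M Q))"
      by (subst nn_integral_distr) (auto simp: nn_integral_density)
    also have "\<dots> = (\<integral>\<^sup>+ z. (\<integral>\<^sup>+ w. k (z, w) * indicator A z \<partial>Q) \<partial>P)"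
      by (subst Q.nn_integral_fst[symmetric]) auto
    also have "\<dots> = (\<integral>\<^sup>+ z. indicator A z \<partial>P)"
    proof (rule nn_integral_cong_AE)
      show "AE z in P. (\<integral>\<^sup>+ w. k (z, w) * indicator A z \<partial>Q) = indicator A z"
        using row by eventually_elim (auto split: split_indicator)
    qed
    finally show "emeasure (distr (density (P \<Otimes>\<^sub>M Q) k) borel fst) A = emeasure P A"
      using A by (simp add: sP)
  qed (simp add: sP)
  moreover have "distr (density (P \<Otimes>\<^sub>M Q) k) borel snd = Q"
  proof (rule measure_eqI)
    fix A assume "A \<in> sets (distr (density (P \<Otimes>\<^sub>M Q) k) borel snd)"
    then have A [measurable]: "A \<in> sets borel" by simp
    have "emeasure (distr (density (P \<Otimes>\<^sub>M Q) k) borel snd) A = (\<integral>\<^sup>+ x. indicator A x \<partial>(distr (density (P \<Otimes>\<^sub>M Q) k) borel snd))"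
      by simp
    also have "\<dots> = (\<integral>\<^sup>+ x. k x * indicator A (snd x) \<partial>(P \<Otimes>\<^sub>M Q))"
      by (subst nn_integral_distr) (auto simp: nn_integral_density)
    also have "\<dots> = (\<integral>\<^sup>+ w. (\<integral>\<^sup>+ z. k (z, w) * indicator A w \<partial>P) \<partial>Q)"
      by (subst PQ.nn_integral_snd[symmetric]) auto
    also have "\<dots> = (\<integral>\<^sup>+ w. indicator A w \<partial>Q)"
    proof (rule nn_integral_cong_AE)
      show "AE w in Q. (\<integral>\<^sup>+ z. k (z, w) * indicator A w \<partial>P) = indicator A w"
        using col by eventually_elim (auto split: split_indicator)
    qed
    finally show "emeasure (distr (density (P \<Otimes>\<^sub>M Q) k) borel snd) A = emeasure Q A"
      using A by (simp add: sQ)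
  qed (simp add: sQ)
  ultimately show ?thesis
    unfolding couplings_def using sets by simp
qed

text \<open>A discrete coupling \<open>L\<close> of the masses of the cells is spread over each pair of cells as a product.\<close>

lemma couplings_of_cells:
  fixes P Q :: "'a::{second_countable_topology, metric_space} measure"
  assumes "prob_space P" "prob_space Q" and sP [measurable_cong]: "sets P = sets borel" and sQ [measurable_cong]: "sets Q = sets borel"
    and I: "finite I" and c [measurable]: "\<And>i. i \<in> I \<Longrightarrow> c i \<in> sets borel" and dj: "disjoint_family_on c I"
    and cP: "AE z in P. z \<in> (\<Union>i\<in>I. c i)" and cQ: "AE z in Q. z \<in> (\<Union>i\<in>I. c i)"
    and L: "\<And>i j. i \<in> I \<Longrightarrow> j \<in> I \<Longrightarrow> 0 \<le> L i j"
    and row: "\<And>i. i \<in> I \<Longrightarrow> (\<Sum>j\<in>I. L i j) = measure P (c i)"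
    and col: "\<And>j. j \<in> I \<Longrightarrow> (\<Sum>i\<in>I. L i j) = measure Q (c j)"
    and D: "\<And>i j z w. i \<in> I \<Longrightarrow> j \<in> I \<Longrightarrow> z \<in> c i \<Longrightarrow> w \<in> c j \<Longrightarrow> dist z w \<le> D i j"
    and D0: "\<And>i j. i \<in> I \<Longrightarrow> j \<in> I \<Longrightarrow> 0 \<le> D i j"
  shows "\<exists>\<gamma>\<in>couplings P Q. (\<integral>(z, w). dist z w \<partial>\<gamma>) \<le> (\<Sum>i\<in>I. \<Sum>j\<in>I. L i j * D i j)"
proof -
  interpret P: prob_space P by fact
  interpret Q: prob_space Q by fact
  have spP: "space P = UNIV" and spQ: "space Q = UNIV"
    using sP sQ by (metis sets_eq_imp_space_eq space_borel)+
  \<comment> \<open>Density of the coupling on the pair of cells \<open>c i\<close> and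
    \<open>c j\<close>. On cells of mass zero the quotient is 0 by convention; there
    \<open>L\<close> vanishes too, by its row and column sums.\<close>
  define K where "K i j = L i j / (measure P (c i) * measure Q (c j))" for i j
  define k where "k zw = (\<Sum>i\<in>I. \<Sum>j\<in>I. K i j * indicator (c i) (fst zw) * indicator (c j) (snd zw))" for zw :: "'a \<times> 'a"
  have K0: "0 \<le> K i j" if "i \<in> I" "j \<in> I" for i j
    using L that by (simp add: K_def)
  have Lp: "L i j = 0" if "i \<in> I" "j \<in> I" "measure P (c i) = 0" for i j
  proof -
    have "L i j \<le> (\<Sum>j\<in>I. L i j)" using that L I by (intro member_le_sum) auto
    then show ?thesis using row that L[of i j] by simp
  qed
  have Lq: "L i j = 0" if "i \<in> I" "j \<in> I" "measure Q (c j) = 0" for i j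
  proof -
    have "L i j \<le> (\<Sum>i\<in>I. L i j)" using that L I by (intro member_le_sum[of _ _ "\<lambda>i. L i j"]) auto
    then show ?thesis using col that L[of i j] by simp
  qed
  have [measurable]: "k \<in> borel_measurable (P \<Otimes>\<^sub>M Q)"
    unfolding k_def[abs_def] using c by measurable
  have only: "(\<Sum>i\<in>I. f i * indicat_real (c i) z) = f i" if "i \<in> I" "z \<in> c i" for f z i
  proof -
    have "(\<Sum>j\<in>I. f j * indicat_real (c j) z) = (\<Sum>j\<in>{i}. f j * indicat_real (c j) z)"
      using that I dj by (intro sum.mono_neutral_right) (auto simp: disjoint_family_on_def split: split_indicator)
    then show ?thesis using that by simp
  qed
  have kz: "k (z, w) = (\<Sum>j\<in>I. K i j * indicator (c j) w)" if "i \<in> I" "z \<in> c i" for z w i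
    unfolding k_def using only[OF that, of "\<lambda>i. (\<Sum>j\<in>I. K i j * indicator (c j) w)"]
    by (simp add: sum_distrib_right sum_distrib_left ac_simps)
  have kw: "k (z, w) = (\<Sum>i\<in>I. K i j * indicator (c i) z)" if "j \<in> I" "w \<in> c j" for z w j
    unfolding k_def using only[OF that, of "\<lambda>j. (\<Sum>i\<in>I. K i j * indicator (c i) z)"]
    by (subst sum.swap) (simp add: sum_distrib_right sum_distrib_left ac_simps)
  have nullP: "AE z in P. \<forall>i\<in>I. z \<in> c i \<longrightarrow> measure P (c i) \<noteq> 0"
  proof (rule AE_finite_allI[OF I])
    fix i assume i: "i \<in> I"
    show "AE z in P. z \<in> c i \<longrightarrow> measure P (c i) \<noteq> 0"
    proof (cases "measure P (c i) = 0")
      case True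
      then have "c i \<in> null_sets P" using c[OF i] by (auto simp: null_sets_def sP P.emeasure_eq_measure)
      then have "AE z in P. z \<notin> c i" by (rule AE_not_in)
      then show ?thesis by eventually_elim simp
    qed simp
  qed
  have nullQ: "AE z in Q. \<forall>i\<in>I. z \<in> c i \<longrightarrow> measure Q (c i) \<noteq> 0"
  proof (rule AE_finite_allI[OF I])
    fix i assume i: "i \<in> I"
    show "AE z in Q. z \<in> c i \<longrightarrow> measure Q (c i) \<noteq> 0"
    proof (cases "measure Q (c i) = 0")
      case True
      then have "c i \<in> null_sets Q" using c[OF i] by (auto simp: null_sets_def sQ Q.emeasure_eq_measure)
      then have "AE z in Q. z \<notin> c i" by (rule AE_not_in)
      then show ?thesis by eventually_elim simp
    qed simp
  qed
  have 1: "AE z in P. (\<integral>\<^sup>+ w. ennreal (k (z, w)) \<partial>Q) = 1"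
    using cP nullP
  proof eventually_elim
    case (elim z)
    then obtain i where i: "i \<in> I" "z \<in> c i" "measure P (c i) \<noteq> 0" by auto
    have "(\<integral>\<^sup>+ w. ennreal (k (z, w)) \<partial>Q) = ennreal (\<Sum>j\<in>I. K i j * measure Q (c j))"
      unfolding kz[OF i(1,2)] using i K0 c by (intro nn_integral_step[OF I]) (auto simp: sQ Q.finite_measure_axioms)
    also have "(\<Sum>j\<in>I. K i j * measure Q (c j)) = (\<Sum>j\<in>I. L i j) / measure P (c i)"
      unfolding sum_divide_distrib using i Lq by (intro sum.cong refl) (force simp: K_def)
    finally show ?case using i row by simp
  qed
  have 2: "AE w in Q. (\<integral>\<^sup>+ z. ennreal (k (z, w)) \<partial>P) = 1"
    using cQ nullQ
  proof eventually_elim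
    case (elim w)
    then obtain j where i: "j \<in> I" "w \<in> c j" "measure Q (c j) \<noteq> 0" by auto
    have "(\<integral>\<^sup>+ z. ennreal (k (z, w)) \<partial>P) = ennreal (\<Sum>i\<in>I. K i j * measure P (c i))"
      unfolding kw[OF i(1,2)] using i K0 c by (intro nn_integral_step[OF I]) (auto simp: sP P.finite_measure_axioms)
    also have "(\<Sum>i\<in>I. K i j * measure P (c i)) = (\<Sum>i\<in>I. L i j) / measure Q (c j)"
      unfolding sum_divide_distrib using i Lp by (intro sum.cong refl) (force simp: K_def)
    finally show ?case using i col by simp
  qed
  define \<gamma> where "\<gamma> = density (P \<Otimes>\<^sub>M Q) (\<lambda>zw. ennreal (k zw))"
  have \<gamma>: "\<gamma> \<in> couplings P Q"
    unfolding \<gamma>_def using 1 2 by (intro density_in_couplings) (auto simp: assms)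
  have sets\<gamma> [measurable_cong]: "sets \<gamma> = sets borel" using \<gamma> by (simp add: couplings_def)
  have [measurable]: "(\<lambda>zw. dist (fst zw) (snd zw)) \<in> borel_measurable (P \<Otimes>\<^sub>M Q)"
    by measurable
  have m\<gamma>: "(\<lambda>zw. dist (fst zw) (snd zw)) \<in> borel_measurable \<gamma>"
    by (simp add: \<gamma>_def)
  have "(\<integral>\<^sup>+ zw. ennreal (dist (fst zw) (snd zw)) \<partial>\<gamma>) = (\<integral>\<^sup>+ zw. ennreal (k zw) * ennreal (dist (fst zw) (snd zw)) \<partial>(P \<Otimes>\<^sub>M Q))"
    unfolding \<gamma>_def by (rule nn_integral_density) auto
  also have "\<dots> = (\<integral>\<^sup>+ z. (\<integral>\<^sup>+ w. ennreal (k (z, w)) * ennreal (dist z w) \<partial>Q) \<partial>P)"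
    by (subst Q.nn_integral_fst[symmetric]) auto
  also have "\<dots> \<le> (\<integral>\<^sup>+ z. ennreal (\<Sum>i\<in>I. (\<Sum>j\<in>I. K i j * D i j * measure Q (c j)) * indicator (c i) z) \<partial>P)"
  proof (rule nn_integral_mono_AE)
    show "AE z in P. (\<integral>\<^sup>+ w. ennreal (k (z, w)) * ennreal (dist z w) \<partial>Q) \<le> ennreal (\<Sum>i\<in>I. (\<Sum>j\<in>I. K i j * D i j * measure Q (c j)) * indicator (c i) z)"
      using cP
    proof eventually_elim
      case (elim z)
      then obtain i where i: "i \<in> I" "z \<in> c i" by auto
      have "(\<integral>\<^sup>+ w. ennreal (k (z, w)) * ennreal (dist z w) \<partial>Q) \<le> (\<integral>\<^sup>+ w. ennreal (\<Sum>j\<in>I. K i j * D i j * indicator (c j) w) \<partial>Q)"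
      proof (rule nn_integral_mono)
        fix w
        have "k (z, w) * dist z w \<le> (\<Sum>j\<in>I. K i j * D i j * indicator (c j) w)"
          unfolding kz[OF i] sum_distrib_right using i K0 D
          by (intro sum_mono) (auto simp: mult_left_mono split: split_indicator)
        then show "ennreal (k (z, w)) * ennreal (dist z w) \<le> ennreal (\<Sum>j\<in>I. K i j * D i j * indicator (c j) w)"
          by (simp add: ennreal_mult''[symmetric] ennreal_leI)
      qed
      also have "\<dots> = ennreal (\<Sum>j\<in>I. K i j * D i j * measure Q (c j))"
        using i K0 D0 c by (intro nn_integral_step[OF I]) (auto simp: sQ Q.finite_measure_axioms)
      finally show ?case using only[OF i, of "\<lambda>i. (\<Sum>j\<in>I. K i j * D i j * measure Q (c j))"] by simp
    qed
  qed
  also have "\<dots> = ennreal (\<Sum>i\<in>I. (\<Sum>j\<in>I. K i j * D i j * measure Q (c j)) * measure P (c i))"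
    using K0 D0 c by (intro nn_integral_step[OF I]) (auto simp: sP P.finite_measure_axioms intro!: sum_nonneg)
  also have "(\<Sum>i\<in>I. (\<Sum>j\<in>I. K i j * D i j * measure Q (c j)) * measure P (c i)) = (\<Sum>i\<in>I. \<Sum>j\<in>I. L i j * D i j)"
    unfolding sum_distrib_right
  proof (intro sum.cong refl)
    fix i j assume ij: "i \<in> I" "j \<in> I"
    show "K i j * D i j * measure Q (c j) * measure P (c i) = L i j * D i j"
      using Lp[OF ij] Lq[OF ij] by (auto simp: K_def)
  qed
  finally have *: "(\<integral>\<^sup>+ zw. ennreal (dist (fst zw) (snd zw)) \<partial>\<gamma>) \<le> ennreal (\<Sum>i\<in>I. \<Sum>j\<in>I. L i j * D i j)" .
  have "(\<integral>(z, w). dist z w \<partial>\<gamma>) = enn2real (\<integral>\<^sup>+ zw. ennreal (dist (fst zw) (snd zw)) \<partial>\<gamma>)"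
    using m\<gamma> by (subst integral_eq_nn_integral[symmetric]) (auto simp: case_prod_beta')
  also have "\<dots> \<le> (\<Sum>i\<in>I. \<Sum>j\<in>I. L i j * D i j)"
    using enn2real_mono[OF *] L D0 by (simp add: sum_nonneg)
  finally show ?thesis using \<gamma> by blast
qed

text \<open>The maximal coupling: the common part \<open>m\<close> of both vectors stays on the
  diagonal, and the excess masses are coupled as a product. Only the excess \<open>r\<close>, which
  is at most the l1 distance, pays \<open>D\<close>. If \<open>r = 0\<close>, the division by
  \<open>r\<close> yields 0, which is right because no excess is left.\<close>

lemma coupling_of_masses:
  fixes p q :: "'i \<Rightarrow> real"
  assumes I: "finite I" and p0: "\<And>i. i \<in> I \<Longrightarrow> 0 \<le> p i" and q0: "\<And>i. i \<in> I \<Longrightarrow> 0 \<le> q i"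
    and p1: "sum p I = 1" and q1: "sum q I = 1" and d: "0 \<le> d" "d \<le> D"
  shows "\<exists>L. (\<forall>i\<in>I. \<forall>j\<in>I. 0 \<le> L i j) \<and> (\<forall>i\<in>I. (\<Sum>j\<in>I. L i j) = p i) \<and> (\<forall>j\<in>I. (\<Sum>i\<in>I. L i j) = q j) \<and>
     (\<Sum>i\<in>I. \<Sum>j\<in>I. L i j * (if i = j then d else D)) \<le> d + D * (\<Sum>i\<in>I. \<bar>p i - q i\<bar>)"
proof -
  define m where "m i = min (p i) (q i)" for i
  define r where "r = 1 - sum m I"
  define L where "L i j = (if i = j then m i else 0) + (p i - m i) * (q j - m j) / r" for i j
  have rp: "(\<Sum>i\<in>I. p i - m i) = r" and rq: "(\<Sum>i\<in>I. q i - m i) = r"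
    using p1 q1 by (simp_all add: sum_subtractf r_def)
  have pm: "0 \<le> p i - m i" "0 \<le> q i - m i" for i by (auto simp: m_def)
  have r0: "0 \<le> r" using pm by (auto simp: rp[symmetric] intro!: sum_nonneg)
  have m0: "0 \<le> m i" if "i \<in> I" for i using p0 q0 that by (auto simp: m_def)
  have L0: "0 \<le> L i j" if "i \<in> I" "j \<in> I" for i j
    unfolding L_def using pm m0[OF that(1)] r0 by (auto intro!: add_nonneg_nonneg divide_nonneg_nonneg mult_nonneg_nonneg)
  have row: "(\<Sum>j\<in>I. L i j) = p i" if i: "i \<in> I" for i
  proof -
    have "(\<Sum>j\<in>I. L i j) = m i + (p i - m i) * r / r"
      unfolding L_def sum.distrib rq[symmetric] sum_distrib_left sum_divide_distrib using i I by simp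
    moreover have "p i - m i = 0" if "r = 0"
      using rp that pm i I by (simp add: sum_nonneg_eq_0_iff)
    ultimately show ?thesis by (cases "r = 0") auto
  qed
  have col: "(\<Sum>i\<in>I. L i j) = q j" if j: "j \<in> I" for j
  proof -
    have "(\<Sum>i\<in>I. L i j) = m j + r * (q j - m j) / r"
      unfolding L_def sum.distrib rp[symmetric] sum_distrib_right sum_divide_distrib using j I by simp
    moreover have "q j - m j = 0" if "r = 0"
      using rq that pm j I by (simp add: sum_nonneg_eq_0_iff)
    ultimately show ?thesis by (cases "r = 0") auto
  qed
  have "(\<Sum>i\<in>I. \<Sum>j\<in>I. L i j * (if i = j then d else D))
     \<le> (\<Sum>i\<in>I. \<Sum>j\<in>I. (if i = j then d * m i else 0) + D * ((p i - m i) * (q j - m j) / r))"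
  proof (intro sum_mono)
    fix i j assume "i \<in> I" "j \<in> I"
    have "0 \<le> (p i - m i) * (q j - m j) / r" using pm r0 by simp
    then have "d * ((p i - m i) * (q j - m j) / r) \<le> D * ((p i - m i) * (q j - m j) / r)"
      using d by (intro mult_right_mono)
    then show "L i j * (if i = j then d else D) \<le> (if i = j then d * m i else 0) + D * ((p i - m i) * (q j - m j) / r)"
      by (auto simp: L_def algebra_simps)
  qed
  also have "\<dots> = d * sum m I + D * (r * r / r)"
  proof -
    have "(\<Sum>i\<in>I. \<Sum>j\<in>I. (p i - m i) * (q j - m j) / r) = r * r / r"
      by (simp only: sum_divide_distrib[symmetric] sum_distrib_left[symmetric] sum_distrib_right[symmetric] rp rq)
    then show ?thesis
      using I by (simp add: sum.distrib sum_distrib_left[symmetric] del: times_divide_eq_right)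
  qed
  also have "\<dots> = d * sum m I + D * r"
    by simp
  also have "\<dots> \<le> d * 1 + D * (\<Sum>i\<in>I. \<bar>p i - q i\<bar>)"
  proof (intro add_mono mult_left_mono)
    show "sum m I \<le> 1" using r0 by (simp add: r_def)
    show "r \<le> (\<Sum>i\<in>I. \<bar>p i - q i\<bar>)"
      unfolding rp[symmetric] by (intro sum_mono) (auto simp: m_def)
  qed (use d in auto)
  finally show ?thesis using L0 row col by (intro exI[of _ L]) auto
qed

lemma bdd_below_transport_costs:
  "bdd_below ((\<lambda>\<gamma>. \<integral>(z, w). dist z w \<partial>\<gamma>) ` couplings P (Q :: 'a::metric_space measure))"
  by (rule bdd_belowI[of _ 0]) (auto intro!: Bochner_Integration.integral_nonneg simp: case_prod_beta')

section \<open>Grids of the unit square and the Wasserstein distance\<close>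

definition grid_cell :: "nat \<Rightarrow> nat \<times> nat \<Rightarrow> (real \<times> real) set" where
  "grid_cell N ij = {real (fst ij) / N<..real (Suc (fst ij)) / N} \<times> {real (snd ij) / N<..real (Suc (snd ij)) / N}"

lemma grid_cell_borel [measurable]: "grid_cell N ij \<in> sets borel"
  unfolding grid_cell_def by (intro borel_Times) auto

lemma Ioc_grid_iff:
  assumes "0 < N"
  shows "x \<in> {real i / real N<..real (Suc i) / real N} \<longleftrightarrow> \<lceil>real N * x\<rceil> = int (Suc i)"
proof -
  have "x \<in> {real i / real N<..real (Suc i) / real N} \<longleftrightarrow> real i < real N * x \<and> real N * x \<le> real (Suc i)"
    using assms by (simp add: field_simps)
  also have "\<dots> \<longleftrightarrow> \<lceil>real N * x\<rceil> = int (Suc i)"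
    by (simp add: ceiling_eq_iff)
  finally show ?thesis .
qed

lemma in_grid_cell_iff:
  assumes "0 < N"
  shows "z \<in> grid_cell N ij \<longleftrightarrow> \<lceil>real N * fst z\<rceil> = int (Suc (fst ij)) \<and> \<lceil>real N * snd z\<rceil> = int (Suc (snd ij))"
  unfolding grid_cell_def mem_Times_iff Ioc_grid_iff[OF assms] ..

lemma disjoint_grid_cells:
  assumes "0 < N" shows "disjoint_family_on (grid_cell N) I"
  unfolding disjoint_family_on_def using in_grid_cell_iff[OF assms] by (auto simp: prod_eq_iff)

lemma unit_square_grid_cells:
  assumes N: "0 < N" and z: "fst z \<in> {0<..1}" "snd z \<in> {0<..1}"
  shows "z \<in> (\<Union>ij\<in>{..<N} \<times> {..<N}. grid_cell N ij)"
proof -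
  have *: "\<exists>i<N. \<lceil>real N * x\<rceil> = int (Suc i)" if "x \<in> {0<..1}" for x
  proof -
    have "0 < real N * x" "real N * x \<le> real N * 1" using that N by (auto intro: mult_left_mono)
    then have "0 < \<lceil>real N * x\<rceil>" "\<lceil>real N * x\<rceil> \<le> int N" by (auto simp: ceiling_le_iff)
    then show ?thesis by (intro exI[of _ "nat (\<lceil>real N * x\<rceil> - 1)"] conjI) linarith+
  qed
  from *[OF z(1)] *[OF z(2)] show ?thesis
    by (auto simp: in_grid_cell_iff[OF N])
qed

lemma measure_grid_cell:
  assumes N: "0 < N"
  shows "measure (meas \<mu>) (grid_cell N (i, j)) =
    copula \<mu> (real (Suc i) / N) (real (Suc j) / N) - copula \<mu> (real i / N) (real (Suc j) / N)
    - copula \<mu> (real (Suc i) / N) (real j / N) + copula \<mu> (real i / N) (real j / N)"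
proof -
  interpret prob_space "meas \<mu>" by simp
  define Q where "Q a b = {z::real\<times>real. fst z \<le> a \<and> snd z \<le> b}" for a b
  have [measurable]: "Q a b \<in> sets (meas \<mu>)" for a b unfolding Q_def by measurable
  have le: "real i / N \<le> real (Suc i) / N" for i by (intro divide_right_mono) auto
  let ?a = "real i / N" and ?a' = "real (Suc i) / N" and ?b = "real j / N" and ?b' = "real (Suc j) / N"
  have "prob (Q ?a' ?b' - Q ?a ?b') = prob (Q ?a' ?b') - prob (Q ?a ?b')"
    using le[of i] by (intro finite_measure_Diff) (auto simp: Q_def)
  moreover have "prob (Q ?a' ?b - Q ?a ?b) = prob (Q ?a' ?b) - prob (Q ?a ?b)"
    using le[of i] by (intro finite_measure_Diff) (auto simp: Q_def)
  moreover have "prob ((Q ?a' ?b' - Q ?a ?b') - (Q ?a' ?b - Q ?a ?b)) = prob (Q ?a' ?b' - Q ?a ?b') - prob (Q ?a' ?b - Q ?a ?b)"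
    using le[of j] by (intro finite_measure_Diff) (auto simp: Q_def)
  moreover have "(Q ?a' ?b' - Q ?a ?b') - (Q ?a' ?b - Q ?a ?b) = grid_cell N (i, j)"
    by (auto simp: Q_def grid_cell_def)
  ultimately show ?thesis
    by (simp add: copula_def Q_def)
qed

text \<open>The masses of a cell differ by at most \<open>4 * \<eta>\<close>, one \<eta> for each
  corner. Two points of one cell are at distance at most \<open>2 / N\<close>, any two points of the
  square at most 2, and the \<open>N\<^sup>2\<close> cells together contribute
  \<open>2 * N\<^sup>2 * 4 * \<eta>\<close>.\<close>

lemma wasserstein_le_grid:
  assumes N: "0 < N" and \<eta>: "\<And>i j. i \<le> N \<Longrightarrow> j \<le> N \<Longrightarrow> \<bar>copula \<mu> (real i / N) (real j / N) - copula \<nu> (real i / N) (real j / N)\<bar> \<le> \<eta>"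
  shows "wasserstein \<mu> \<nu> \<le> 2 / N + 8 * (real N)\<^sup>2 * \<eta>"
proof -
  let ?I = "{..<N} \<times> {..<N}"
  define p where "p ij = measure (meas \<mu>) (grid_cell N ij)" for ij
  define q where "q ij = measure (meas \<nu>) (grid_cell N ij)" for ij
  have cells: "AE z in meas \<mu>. z \<in> (\<Union>ij\<in>?I. grid_cell N ij)" for \<mu>
    using AE_meas_square[of \<mu>] by eventually_elim (use unit_square_grid_cells[OF N] in auto)
  have sum1: "(\<Sum>ij\<in>?I. measure (meas \<mu>) (grid_cell N ij)) = 1" for \<mu>
  proof -
    interpret prob_space "meas \<mu>" by simp
    have "(\<Sum>ij\<in>?I. prob (grid_cell N ij)) = prob (\<Union>ij\<in>?I. grid_cell N ij)"
      by (intro finite_measure_finite_Union[symmetric] disjoint_grid_cells[OF N]) auto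
    also have "\<dots> = 1" using cells[of \<mu>] by (intro prob_eq_1[THEN iffD2]) auto
    finally show ?thesis .
  qed
  have pq: "\<bar>p ij - q ij\<bar> \<le> 4 * \<eta>" if "ij \<in> ?I" for ij
  proof -
    obtain i j where ij: "ij = (i, j)" "i < N" "j < N" using \<open>ij \<in> ?I\<close> by (cases ij) auto
    show ?thesis
      using \<eta>[of i j] \<eta>[of "Suc i" j] \<eta>[of i "Suc j"] \<eta>[of "Suc i" "Suc j"] ij
      unfolding p_def q_def ij measure_grid_cell[OF N] by linarith
  qed
  define D :: "nat \<times> nat \<Rightarrow> nat \<times> nat \<Rightarrow> real" where "D i j = (if i = j then 2 / N else 2)" for i j
  have d1: "dist z w \<le> \<bar>fst z - fst w\<bar> + \<bar>snd z - snd w\<bar>" for z w :: "real \<times> real"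
    using sqrt_sum_squares_le_sum_abs[of "fst z - fst w" "snd z - snd w"]
    by (simp add: dist_prod_def dist_real_def)
  have bd: "0 \<le> fst z \<and> fst z \<le> 1 \<and> 0 \<le> snd z \<and> snd z \<le> 1" if "ij \<in> ?I" "z \<in> grid_cell N ij" for ij z
  proof -
    have "0 \<le> real k / N" "real (Suc k) / N \<le> 1" if "k < N" for k
      using that N by auto
    from this[of "fst ij"] this[of "snd ij"] that show ?thesis
      unfolding grid_cell_def mem_Times_iff greaterThanAtMost_iff lessThan_iff by linarith
  qed
  obtain L where L: "\<forall>i\<in>?I. \<forall>j\<in>?I. 0 \<le> L i j" "\<forall>i\<in>?I. (\<Sum>j\<in>?I. L i j) = p i" "\<forall>j\<in>?I. (\<Sum>i\<in>?I. L i j) = q j"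
     "(\<Sum>i\<in>?I. \<Sum>j\<in>?I. L i j * (if i = j then 2 / real N else 2)) \<le> 2 / real N + 2 * (\<Sum>i\<in>?I. \<bar>p i - q i\<bar>)"
  proof -
    have "2 / real N \<le> 2" using N by (simp add: field_simps)
    then have "\<exists>L. (\<forall>i\<in>?I. \<forall>j\<in>?I. 0 \<le> L i j) \<and> (\<forall>i\<in>?I. (\<Sum>j\<in>?I. L i j) = p i) \<and> (\<forall>j\<in>?I. (\<Sum>i\<in>?I. L i j) = q j) \<and>
      (\<Sum>i\<in>?I. \<Sum>j\<in>?I. L i j * (if i = j then 2 / real N else 2)) \<le> 2 / real N + 2 * (\<Sum>i\<in>?I. \<bar>p i - q i\<bar>)"
      using sum1 by (intro coupling_of_masses) (simp_all add: p_def q_def)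
    then show thesis using that by blast
  qed
  have "\<exists>\<gamma>\<in>couplings (meas \<mu>) (meas \<nu>). (\<integral>(z, w). dist z w \<partial>\<gamma>) \<le> (\<Sum>i\<in>?I. \<Sum>j\<in>?I. L i j * D i j)"
  proof (rule couplings_of_cells[where c = "grid_cell N"])
    fix i j z w assume h: "i \<in> ?I" "j \<in> ?I" "z \<in> grid_cell N i" "w \<in> grid_cell N j"
    show "dist z w \<le> D i j"
    proof (cases "i = j")
      case True
      have *: "real (Suc k) / N = real k / N + 1 / N" for k by (simp add: add_divide_distrib)
      have "\<bar>fst z - fst w\<bar> \<le> 1 / N" "\<bar>snd z - snd w\<bar> \<le> 1 / N"
        using h True unfolding grid_cell_def * by auto
      then show ?thesis using d1[of z w] True by (simp add: D_def)
    next
      case False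
      show ?thesis using bd[OF h(1,3)] bd[OF h(2,4)] d1[of z w] False
        by (simp only: D_def if_False) arith
    qed
  qed (use L cells disjoint_grid_cells[OF N] in \<open>auto simp: p_def q_def D_def\<close>)
  then obtain \<gamma> where \<gamma>: "\<gamma> \<in> couplings (meas \<mu>) (meas \<nu>)" "(\<integral>(z, w). dist z w \<partial>\<gamma>) \<le> (\<Sum>i\<in>?I. \<Sum>j\<in>?I. L i j * D i j)"
    by blast
  have "wasserstein \<mu> \<nu> \<le> (\<integral>(z, w). dist z w \<partial>\<gamma>)"
    unfolding wasserstein_def using \<gamma>(1) by (intro cINF_lower bdd_below_transport_costs)
  also have "\<dots> \<le> 2 / N + 2 * (\<Sum>i\<in>?I. \<bar>p i - q i\<bar>)"
    using \<gamma>(2) L(4) by (simp add: D_def)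
  also have "(\<Sum>i\<in>?I. \<bar>p i - q i\<bar>) \<le> (\<Sum>i\<in>?I. 4 * \<eta>)"
    using pq by (intro sum_mono) auto
  finally show ?thesis by (simp add: power2_eq_square)
qed

subsection \<open>Diagrams and duplication\<close>

text \<open>\<open>forms_diagram\<close> with its labelling \<open>s\<close> made explicit. Among
  permutations, a configuration admits at most one pair of \<open>s\<close> and
  \<open>\<pi>\<close>, so that the events for different pairs are disjoint.\<close>

definition sorts_diagram :: "nat \<Rightarrow> (nat \<Rightarrow> nat) \<Rightarrow> (nat \<Rightarrow> nat) \<Rightarrow> (nat \<Rightarrow> real \<times> real) \<Rightarrow> bool" where
  "sorts_diagram k \<pi> s z \<longleftrightarrow> (\<forall>i\<in>{1..k}. \<forall>j\<in>{1..k}.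
        (i < j \<longrightarrow> fst (z (s i)) < fst (z (s j))) \<and>
        (\<pi> i < \<pi> j \<longrightarrow> snd (z (s i)) < snd (z (s j))))"

lemma forms_diagram_iff: "forms_diagram k \<pi> z \<longleftrightarrow> (\<exists>s. s permutes {1..k} \<and> sorts_diagram k \<pi> s z)"
  by (simp add: forms_diagram_def sorts_diagram_def)

text \<open>Only comparisons matter, and implications between strict ones suffice, because
  \<open>forms_diagram\<close> asserts nothing but strict inequalities.\<close>

lemma forms_diagram_mono:
  assumes "forms_diagram k \<pi> z"
    and "\<And>i j. i \<in> {1..k} \<Longrightarrow> j \<in> {1..k} \<Longrightarrow> fst (z i) < fst (z j) \<Longrightarrow> fst (w i) < fst (w j)"
    and "\<And>i j. i \<in> {1..k} \<Longrightarrow> j \<in> {1..k} \<Longrightarrow> snd (z i) < snd (z j) \<Longrightarrow> snd (w i) < snd (w j)"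
  shows "forms_diagram k \<pi> w"
proof -
  obtain s where s: "s permutes {1..k}" "sorts_diagram k \<pi> s z"
    using assms(1) by (auto simp: forms_diagram_iff)
  have in_s: "s i \<in> {1..k}" if "i \<in> {1..k}" for i using s(1) that by (simp only: permutes_in_image)
  have "sorts_diagram k \<pi> s w"
    unfolding sorts_diagram_def
  proof (intro ballI conjI impI)
    fix i j assume ij: "i \<in> {1..k}" "j \<in> {1..k}"
    show "fst (w (s i)) < fst (w (s j))" if "i < j"
      using s(2) ij that unfolding sorts_diagram_def by (intro assms(2) in_s) auto
    show "snd (w (s i)) < snd (w (s j))" if "\<pi> i < \<pi> j"
      using s(2) ij that unfolding sorts_diagram_def by (intro assms(3) in_s) auto
  qed
  then show ?thesis using s(1) by (auto simp: forms_diagram_iff)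
qed

lemma forms_diagram_cong:
  assumes "\<And>i. i \<in> {1..k} \<Longrightarrow> z i = w i"
  shows "forms_diagram k \<pi> z \<longleftrightarrow> forms_diagram k \<pi> w"
  by (rule iffI; erule forms_diagram_mono) (simp_all add: assms del: atLeastAtMost_iff)

text \<open>Relabelling the points is absorbed by the existentially quantified labelling; with a
  product measure this gives exchangeability of the sample.\<close>

lemma forms_diagram_permute:
  assumes \<sigma>: "\<sigma> permutes {1..k}"
  shows "forms_diagram k \<pi> (\<lambda>i. z (\<sigma> i)) \<longleftrightarrow> forms_diagram k \<pi> z"
proof
  assume "forms_diagram k \<pi> (\<lambda>i. z (\<sigma> i))"
  then obtain s where "s permutes {1..k}" "sorts_diagram k \<pi> s (\<lambda>i. z (\<sigma> i))"
    by (auto simp: forms_diagram_iff)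
  then have "\<sigma> \<circ> s permutes {1..k}" "sorts_diagram k \<pi> (\<sigma> \<circ> s) z"
    using permutes_compose[OF _ \<sigma>] by (simp_all add: sorts_diagram_def)
  then show "forms_diagram k \<pi> z" unfolding forms_diagram_iff by blast
next
  assume "forms_diagram k \<pi> z"
  then obtain s where "s permutes {1..k}" "sorts_diagram k \<pi> s z"
    by (auto simp: forms_diagram_iff)
  then have "inv \<sigma> \<circ> s permutes {1..k}" "sorts_diagram k \<pi> (inv \<sigma> \<circ> s) (\<lambda>i. z (\<sigma> i))"
    using permutes_compose[OF _ permutes_inv[OF \<sigma>]] by (simp_all add: sorts_diagram_def permutes_inverses(1)[OF \<sigma>])
  then show "forms_diagram k \<pi> (\<lambda>i. z (\<sigma> i))" unfolding forms_diagram_iff by blast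
qed

section \<open>Ranks, and uniqueness of the diagram of a configuration\<close>

lemma permutes_eq_rank:
  fixes f :: "nat \<Rightarrow> nat"
  assumes f: "f permutes {1..k}" and i: "i \<in> {1..k}"
  shows "f i = card {j\<in>{1..k}. f j \<le> f i}"
proof -
  have "f ` {j\<in>{1..k}. f j \<le> f i} = {1..f i}"
  proof (intro equalityI subsetI)
    fix v assume v: "v \<in> {1..f i}"
    have "f i \<in> {1..k}" using f i by (simp only: permutes_in_image)
    then have "inv f v \<in> {1..k}" using v permutes_in_image[OF permutes_inv[OF f]] by auto
    moreover have "f (inv f v) = v" by (rule permutes_inverses(1)[OF f])
    ultimately show "v \<in> f ` {j\<in>{1..k}. f j \<le> f i}" using v by (intro image_eqI[of _ _ "inv f v"]) auto
  next
    fix v assume "v \<in> f ` {j\<in>{1..k}. f j \<le> f i}"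
    then obtain j where "j \<in> {1..k}" "f j \<le> f i" "v = f j" by blast
    then show "v \<in> {1..f i}" using permutes_in_image[OF f, of j] by auto
  qed
  then have "f i = card (f ` {j\<in>{1..k}. f j \<le> f i})" by (simp only: card_atLeastAtMost diff_Suc_1 One_nat_def)
  also have "\<dots> = card {j\<in>{1..k}. f j \<le> f i}"
    by (rule card_image) (rule inj_on_subset[OF permutes_inj[OF f] subset_UNIV])
  finally show ?thesis .
qed

text \<open>A permutation of \<open>{1..k}\<close> is determined by the order of its values, since
  every value is its own rank. The one-sided hypothesis yields an equivalence by injectivity of
  \<open>f\<close> and trichotomy.\<close>

lemma permutes_eqI_less:
  fixes f g :: "nat \<Rightarrow> nat"
  assumes f: "f permutes {1..k}" and g: "g permutes {1..k}"
    and less: "\<And>i j. i \<in> {1..k} \<Longrightarrow> j \<in> {1..k} \<Longrightarrow> f i < f j \<Longrightarrow> g i < g j"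
  shows "f = g"
proof
  fix i
  have le: "f j \<le> f i \<longleftrightarrow> g j \<le> g i" if "i \<in> {1..k}" "j \<in> {1..k}" for i j
  proof (cases "i = j")
    case False
    then have "f i \<noteq> f j" using permutes_inj[OF f] by (auto dest: injD)
    then show ?thesis using less[OF that] less[OF that(2,1)] by linarith
  qed simp
  show "f i = g i"
  proof (cases "i \<in> {1..k}")
    case True
    have "{j\<in>{1..k}. f j \<le> f i} = {j\<in>{1..k}. g j \<le> g i}" using le[OF True] by auto
    then show ?thesis using permutes_eq_rank[OF f True] permutes_eq_rank[OF g True] by simp
  next
    case False
    then show ?thesis using f g by (simp add: permutes_not_in)
  qed
qed

lemma ex_permutes_order:
  fixes x :: "nat \<Rightarrow> real"
  assumes "inj_on x {1..k}"
  shows "\<exists>r. r permutes {1..k} \<and> (\<forall>i\<in>{1..k}. \<forall>j\<in>{1..k}. r i < r j \<longrightarrow> x i < x j)"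
proof -
  define r where "r i = (if i \<in> {1..k} then card {j\<in>{1..k}. x j \<le> x i} else i)" for i
  have lt: "r i < r j" if "i \<in> {1..k}" "j \<in> {1..k}" "x i < x j" for i j
  proof -
    have "j \<in> {l\<in>{1..k}. x l \<le> x j}" "j \<notin> {l\<in>{1..k}. x l \<le> x i}" using that by auto
    moreover have "{l\<in>{1..k}. x l \<le> x i} \<subseteq> {l\<in>{1..k}. x l \<le> x j}" using that by auto
    ultimately have "{l\<in>{1..k}. x l \<le> x i} \<subset> {l\<in>{1..k}. x l \<le> x j}" by blast
    then have "card {l\<in>{1..k}. x l \<le> x i} < card {l\<in>{1..k}. x l \<le> x j}" by (intro psubset_card_mono) auto
    then show ?thesis using that by (simp add: r_def)
  qed
  have rng: "r i \<in> {1..k}" if "i \<in> {1..k}" for i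
  proof -
    have "card {j\<in>{1..k}. x j \<le> x i} \<le> card {1..k}" by (intro card_mono) auto
    moreover have "0 < card {j\<in>{1..k}. x j \<le> x i}" using that by (auto simp: card_gt_0_iff)
    moreover have "r i = card {j\<in>{1..k}. x j \<le> x i}" using that by (simp add: r_def)
    ultimately show ?thesis unfolding atLeastAtMost_iff card_atLeastAtMost by linarith
  qed
  have inj: "inj_on r {1..k}"
  proof (rule inj_onI, rule ccontr)
    fix i j assume ij: "i \<in> {1..k}" "j \<in> {1..k}" "r i = r j" "i \<noteq> j"
    then have "x i \<noteq> x j" using assms by (auto dest: inj_onD)
    then show False using lt[of i j] lt[of j i] ij by (metis less_irrefl linorder_neqE_linordered_idom)
  qed
  have "r ` {1..k} = {1..k}" using inj rng by (intro endo_inj_surj) auto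
  then have "bij_betw r {1..k} {1..k}" using inj by (simp add: bij_betw_def)
  then have "r permutes {1..k}" by (rule bij_imp_permutes) (auto simp: r_def)
  moreover have "x i < x j" if "i \<in> {1..k}" "j \<in> {1..k}" "r i < r j" for i j
  proof (rule ccontr)
    assume n: "\<not> x i < x j"
    have "i \<noteq> j" using that(3) by blast
    then have "x i \<noteq> x j" using assms that by (auto dest: inj_onD)
    then have "r j < r i" using n that lt[of j i] by linarith
    then show False using that(3) by simp
  qed
  ultimately show ?thesis by blast
qed

text \<open>The inverse of the labelling ranks the abscissae, and then the permutation ranks the
  ordinates; both are determined by the order they reproduce.\<close>

lemma sorts_diagram_unique:
  assumes s: "s permutes {1..k}" and t: "t permutes {1..k}" and \<pi>: "\<pi> permutes {1..k}" and \<tau>: "\<tau> permutes {1..k}"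
    and sz: "sorts_diagram k \<pi> s z" and tz: "sorts_diagram k \<tau> t z"
  shows "s = t" "\<pi> = \<tau>"
proof -
  have im: "f i \<in> {1..k} \<longleftrightarrow> i \<in> {1..k}" if "f permutes {1..k}" for f i using that by (rule permutes_in_image)
  have "inv s = inv t"
  proof (rule permutes_eqI_less[OF permutes_inv[OF s] permutes_inv[OF t]], rule ccontr)
    fix i j assume ij: "i \<in> {1..k}" "j \<in> {1..k}" "inv s i < inv s j" "\<not> inv t i < inv t j"
    have I: "inv s i \<in> {1..k}" "inv s j \<in> {1..k}" "inv t i \<in> {1..k}" "inv t j \<in> {1..k}"
      using ij(1,2) im[OF permutes_inv[OF s]] im[OF permutes_inv[OF t]] by simp_all
    have "fst (z i) < fst (z j)"
      using sz I ij(3) permutes_inverses(1)[OF s] unfolding sorts_diagram_def by metis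
    moreover have "inv t i \<noteq> inv t j" using ij(3) permutes_inverses(1)[OF t] by (metis less_irrefl)
    then have "inv t j < inv t i" using ij(4) by simp
    then have "fst (z j) < fst (z i)"
      using tz I permutes_inverses(1)[OF t] unfolding sorts_diagram_def by metis
    ultimately show False by simp
  qed
  then show st: "s = t"
    using permutes_inv_inv[OF s] permutes_inv_inv[OF t] by metis
  show "\<pi> = \<tau>"
  proof (rule permutes_eqI_less[OF \<pi> \<tau>], rule ccontr)
    fix i j assume ij: "i \<in> {1..k}" "j \<in> {1..k}" "\<pi> i < \<pi> j" "\<not> \<tau> i < \<tau> j"
    then have "\<tau> i \<noteq> \<tau> j" using permutes_inj[OF \<tau>] by (metis injD less_irrefl)
    then have "snd (z (s j)) < snd (z (s i))" "snd (z (s i)) < snd (z (s j))"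
      using ij sz tz st unfolding sorts_diagram_def by (metis linorder_neqE_nat)+
    then show False by simp
  qed
qed

text \<open>If \<open>r\<close> ranks the abscissae and \<open>t\<close> the ordinates, then
  \<open>inv r\<close> lists the points from left to right, and \<open>t \<circ> inv r\<close> gives
  the ranks of their ordinates in that order.\<close>

lemma ex_sorts_diagram:
  assumes "inj_on (\<lambda>i. fst (z i)) {1..k}" "inj_on (\<lambda>i. snd (z i)) {1..k}"
  shows "\<exists>\<pi> s. \<pi> permutes {1..k} \<and> s permutes {1..k} \<and> sorts_diagram k \<pi> s z"
proof -
  obtain r where r: "r permutes {1..k}" "\<And>i j. i\<in>{1..k} \<Longrightarrow> j\<in>{1..k} \<Longrightarrow> r i < r j \<Longrightarrow> fst (z i) < fst (z j)"
    using ex_permutes_order[OF assms(1)] by blast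
  obtain t where t: "t permutes {1..k}" "\<And>i j. i\<in>{1..k} \<Longrightarrow> j\<in>{1..k} \<Longrightarrow> t i < t j \<Longrightarrow> snd (z i) < snd (z j)"
    using ex_permutes_order[OF assms(2)] by blast
  have im: "inv r i \<in> {1..k} \<longleftrightarrow> i \<in> {1..k}" for i by (rule permutes_in_image[OF permutes_inv[OF r(1)]])
  have "sorts_diagram k (t \<circ> inv r) (inv r) z"
    unfolding sorts_diagram_def comp_def using r t im permutes_inverses(1)[OF r(1)] by metis
  then show ?thesis
    using permutes_inv[OF r(1)] permutes_compose[OF permutes_inv[OF r(1)] t(1)] by blast
qed

lemma permutesI_inj:
  assumes "finite A" "\<And>i. i \<in> A \<Longrightarrow> f i \<in> A" "inj_on f A" "\<And>i. i \<notin> A \<Longrightarrow> f i = i"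
  shows "f permutes A"
proof (rule bij_imp_permutes)
  have "f ` A = A" using assms by (intro endo_inj_surj) auto
  then show "bij_betw f A A" using assms by (simp add: bij_betw_def)
qed (use assms in auto)

text \<open>The point of \<open>\<tau>\<close> of which the \<open>j\<close>-th point of \<open>duplicate i b \<tau>\<close> is a descendant.\<close>

definition ancestor :: "nat \<Rightarrow> nat \<Rightarrow> nat" where
  "ancestor i j = (if j \<le> i then j else j - 1)"

lemma duplicate_permutes:
  assumes \<tau>: "\<tau> permutes {1..n}" and i: "i \<in> {1..n}"
  shows "duplicate i b \<tau> permutes {1..Suc n}"
proof (rule permutesI_inj)
  have im: "\<tau> j \<in> {1..n} \<longleftrightarrow> j \<in> {1..n}" for j by (rule permutes_in_image[OF \<tau>])
  have out: "\<tau> j = j" if "j \<notin> {1..n}" for j using \<tau> that by (rule permutes_not_in)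
  have inj: "\<tau> j = \<tau> l \<longleftrightarrow> j = l" for j l using permutes_inj[OF \<tau>] by (auto dest: injD)
  show "duplicate i b \<tau> j \<in> {1..Suc n}" if "j \<in> {1..Suc n}" for j
    using im[of j] im[of i] im[of "j - 1"] i that unfolding duplicate_def Let_def by (cases "j < i"; cases "j = i"; cases "j = i + 1") auto
  show "duplicate i b \<tau> j = j" if "j \<notin> {1..Suc n}" for j
  proof (cases "j = 0")
    case True
    then show ?thesis using out[of 0] i by (simp add: duplicate_def Let_def)
  next
    case False
    then have "j - 1 \<notin> {1..n}" "j - 1 > n" using that i by auto
    then show ?thesis using out[of "j - 1"] im[of i] i False by (auto simp: duplicate_def Let_def)
  qed
  show "inj_on (duplicate i b \<tau>) {1..Suc n}"
  proof (rule inj_onI)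
    fix j l assume jl: "j \<in> {1..Suc n}" "l \<in> {1..Suc n}" "duplicate i b \<tau> j = duplicate i b \<tau> l"
    \<comment> \<open>All cases of the definition expressed through the ancestor; the twins
      \<open>i\<close> and \<open>i + 1\<close> are the only two indices with a common
      ancestor.\<close>
    have dup: "duplicate i b \<tau> j = (if j = i then (if b then \<tau> i else \<tau> i + 1) else if j = i + 1 then (if b then \<tau> i + 1 else \<tau> i)
       else if \<tau> (ancestor i j) > \<tau> i then \<tau> (ancestor i j) + 1 else \<tau> (ancestor i j))" for j
      by (auto simp: duplicate_def Let_def ancestor_def)
    have anc: "ancestor i j = i \<longleftrightarrow> j = i \<or> j = i + 1" if "j \<in> {1..Suc n}" for j
      using that i by (auto simp: ancestor_def)
    have "\<tau> (ancestor i j) = \<tau> i \<longleftrightarrow> j = i \<or> j = i + 1" "\<tau> (ancestor i l) = \<tau> i \<longleftrightarrow> l = i \<or> l = i + 1"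
      using anc jl inj by simp_all
    then have "(j = i \<or> j = i + 1) \<and> (l = i \<or> l = i + 1) \<and> j = l \<or>
       \<not> (j = i \<or> j = i + 1) \<and> \<not> (l = i \<or> l = i + 1) \<and> \<tau> (ancestor i j) = \<tau> (ancestor i l)"
      using jl(3) unfolding dup by (auto split: if_splits)
    then show "j = l"
      unfolding inj by (auto simp: ancestor_def split: if_splits)
  qed
qed auto

text \<open>The configuration \<open>w\<close> arises from \<open>z\<close> by doubling the point
  \<open>s i\<close>; the new point has label \<open>Suc n\<close>, and \<open>c\<close> maps a
  label to the point of \<open>z\<close> it descends from. Points with different ancestors inherit
  the order of the ancestors. Only the two twins need a separate rule, which leaves open which of
  them lies to the left.\<close>

lemma forms_diagram_duplicate:
  assumes \<tau>: "\<tau> permutes {1..n}" and s: "s permutes {1..n}" and sorts: "sorts_diagram n \<tau> s z"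
    and i: "i \<in> {1..n}"
  defines "c \<equiv> (\<lambda>j. if j = Suc n then s i else j)"
  assumes fst: "\<And>j l. j \<in> {1..Suc n} \<Longrightarrow> l \<in> {1..Suc n} \<Longrightarrow> fst (z (c j)) < fst (z (c l)) \<Longrightarrow> fst (w j) < fst (w l)"
    and snd: "\<And>j l. j \<in> {1..Suc n} \<Longrightarrow> l \<in> {1..Suc n} \<Longrightarrow> snd (z (c j)) < snd (z (c l)) \<Longrightarrow> snd (w j) < snd (w l)"
    and twins: "fst (w (s i)) < fst (w (Suc n)) \<and> (if b then snd (w (s i)) < snd (w (Suc n)) else snd (w (Suc n)) < snd (w (s i)))
      \<or> fst (w (Suc n)) < fst (w (s i)) \<and> (if b then snd (w (Suc n)) < snd (w (s i)) else snd (w (s i)) < snd (w (Suc n)))"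
  shows "forms_diagram (Suc n) (duplicate i b \<tau>) w"
proof -
  have im: "s j \<in> {1..n} \<longleftrightarrow> j \<in> {1..n}" for j by (rule permutes_in_image[OF s])
  have inj: "s j = s l \<longleftrightarrow> j = l" for j l using permutes_inj[OF s] by (auto dest: injD)
  have injt: "\<tau> j = \<tau> l \<longleftrightarrow> j = l" for j l using permutes_inj[OF \<tau>] by (auto dest: injD)
  \<comment> \<open>Tells whether the old twin is the left one; \<open>s'\<close> gives the places
    \<open>i\<close> and \<open>Suc i\<close> to the twins accordingly and shifts the later points
    by one.\<close>
  define e where "e \<longleftrightarrow> fst (w (s i)) < fst (w (Suc n))"
  define s' where "s' j = (if j = i then (if e then s i else Suc n) else if j = Suc i then (if e then Suc n else s i)
     else if j \<le> Suc n then s (ancestor i j) else j)" for j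
  have anc: "ancestor i j = i \<longleftrightarrow> j = i \<or> j = Suc i" if "j \<in> {1..Suc n}" for j
    using that i by (auto simp: ancestor_def)
  have anc_in: "ancestor i j \<in> {1..n}" if "j \<in> {1..Suc n}" for j
    using that i by (auto simp: ancestor_def)
  have cs: "c (s' j) = s (ancestor i j)" if "j \<in> {1..Suc n}" for j
    using im[of "ancestor i j"] anc_in[OF that] im[of i] i that by (auto simp: c_def s'_def ancestor_def)
  have s'_in: "s' j \<in> {1..Suc n}" if "j \<in> {1..Suc n}" for j
    using im[of "ancestor i j"] anc_in[OF that] im[of i] i that by (auto simp: s'_def)
  have "s' permutes {1..Suc n}"
  proof (rule permutesI_inj)
    show "inj_on s' {1..Suc n}"
    proof (rule inj_onI)
      fix j l assume jl: "j \<in> {1..Suc n}" "l \<in> {1..Suc n}" "s' j = s' l"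
      then have "ancestor i j = ancestor i l" using cs by (metis inj)
      then consider "j = l" | "j = i" "l = Suc i" | "l = i" "j = Suc i"
        using i by (auto simp: ancestor_def split: if_splits)
      then show "j = l"
        by cases (use jl(3) im[of i] i in \<open>auto simp: s'_def split: if_splits\<close>)
    qed
    show "s' j = j" if "j \<notin> {1..Suc n}" for j
    proof (cases "j = 0")
      case True
      have "s 0 = 0" using s by (rule permutes_not_in) simp
      then show ?thesis using True i by (auto simp: s'_def ancestor_def)
    next
      case False
      then show ?thesis using that i by (auto simp: s'_def)
    qed
  qed (use s'_in in auto)
  moreover have "sorts_diagram (Suc n) (duplicate i b \<tau>) s' w"
    unfolding sorts_diagram_def
  proof (intro ballI conjI impI)
    fix j l assume jl: "j \<in> {1..Suc n}" "l \<in> {1..Suc n}"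
    show "fst (w (s' j)) < fst (w (s' l))" if "j < l"
    proof (cases "j = i \<and> l = Suc i")
      case True
      then show ?thesis using twins by (auto simp: s'_def e_def)
    next
      case False
      then have "ancestor i j < ancestor i l" using that by (auto simp: ancestor_def)
      then have "fst (z (c (s' j))) < fst (z (c (s' l)))"
        using sorts anc_in jl cs unfolding sorts_diagram_def by metis
      then show ?thesis using fst s'_in jl by blast
    qed
    have dup: "duplicate i b \<tau> j = (if j = i then (if b then \<tau> i else \<tau> i + 1) else if j = i + 1 then (if b then \<tau> i + 1 else \<tau> i)
       else if \<tau> (ancestor i j) > \<tau> i then \<tau> (ancestor i j) + 1 else \<tau> (ancestor i j))" for j
      by (auto simp: duplicate_def Let_def ancestor_def)
    show "snd (w (s' j)) < snd (w (s' l))" if lt: "duplicate i b \<tau> j < duplicate i b \<tau> l"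
    proof (cases "ancestor i j = i \<and> ancestor i l = i")
      case True
      then have "j = i \<and> l = Suc i \<and> b \<or> j = Suc i \<and> l = i \<and> \<not> b"
        using anc jl lt unfolding dup by (auto split: if_splits)
      then show ?thesis using twins by (auto simp: s'_def e_def)
    next
      case False
      have "\<tau> (ancestor i j) = \<tau> i \<longleftrightarrow> j = i \<or> j = i + 1" "\<tau> (ancestor i l) = \<tau> i \<longleftrightarrow> l = i \<or> l = i + 1"
        using anc jl injt by simp_all
      then have "\<tau> (ancestor i j) < \<tau> (ancestor i l)"
        using lt False anc[OF jl(1)] anc[OF jl(2)] unfolding dup by (auto split: if_splits)
      then have "snd (z (c (s' j))) < snd (z (c (s' l)))"
        using sorts anc_in jl cs unfolding sorts_diagram_def by metis
      then show ?thesis using snd s'_in jl by blast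
    qed
  qed
  ultimately show ?thesis by (auto simp: forms_diagram_iff)
qed

text \<open>A configuration forms at most one permutation, so knowing that it forms the duplicate
  decides the question for every \<open>\<pi>\<close>.\<close>

lemma forms_diagram_duplicate_iff:
  assumes \<tau>: "\<tau> permutes {1..n}" and s: "s permutes {1..n}" and sorts: "sorts_diagram n \<tau> s z"
    and i: "i \<in> {1..n}" and \<pi>: "\<pi> permutes {1..Suc n}"
  defines "c \<equiv> (\<lambda>j. if j = Suc n then s i else j)"
  assumes fst: "\<And>j l. j \<in> {1..Suc n} \<Longrightarrow> l \<in> {1..Suc n} \<Longrightarrow> fst (z (c j)) < fst (z (c l)) \<Longrightarrow> fst (w j) < fst (w l)"
    and snd: "\<And>j l. j \<in> {1..Suc n} \<Longrightarrow> l \<in> {1..Suc n} \<Longrightarrow> snd (z (c j)) < snd (z (c l)) \<Longrightarrow> snd (w j) < snd (w l)"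
    and twins: "fst (w (s i)) < fst (w (Suc n)) \<and> (if b then snd (w (s i)) < snd (w (Suc n)) else snd (w (Suc n)) < snd (w (s i)))
      \<or> fst (w (Suc n)) < fst (w (s i)) \<and> (if b then snd (w (Suc n)) < snd (w (s i)) else snd (w (s i)) < snd (w (Suc n)))"
  shows "forms_diagram (Suc n) \<pi> w \<longleftrightarrow> duplicate i b \<tau> = \<pi>"
proof -
  have "forms_diagram (Suc n) (duplicate i b \<tau>) w"
    using fst snd unfolding c_def by (intro forms_diagram_duplicate[OF \<tau> s sorts i _ _ twins])
  then show ?thesis
    using sorts_diagram_unique(2) duplicate_permutes[OF \<tau> i] \<pi> unfolding forms_diagram_iff by metis
qed

subsection \<open>Random inflation as a mixture\<close>

lemma nn_integral_mixture:
  assumes sets: "sets N1 = sets M" "sets N2 = sets M"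
    and em: "\<And>A. A \<in> sets M \<Longrightarrow> emeasure M A = a * emeasure N1 A + b * emeasure N2 A"
    and f: "f \<in> borel_measurable M"
  shows "(\<integral>\<^sup>+ x. f x \<partial>M) = a * (\<integral>\<^sup>+ x. f x \<partial>N1) + b * (\<integral>\<^sup>+ x. f x \<partial>N2)"
  using f
proof (induction rule: borel_measurable_induct)
  case (cong f g)
  have "integral\<^sup>N K f = integral\<^sup>N K g" if "sets K = sets M" for K
    using cong(3) sets_eq_imp_space_eq[OF that] by (intro nn_integral_cong) simp
  then show ?case using cong sets by simp
next
  case (set A)
  then show ?case using sets em by simp
next
  case (mult u c)
  have [measurable]: "u \<in> borel_measurable M" "u \<in> borel_measurable N1" "u \<in> borel_measurable N2"
    using mult(2) sets by (simp_all cong: measurable_cong_sets)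
  show ?case using mult by (simp add: nn_integral_cmult distrib_left ac_simps)
next
  case (add u v)
  have [measurable]: "u \<in> borel_measurable M" "u \<in> borel_measurable N1" "u \<in> borel_measurable N2"
    "v \<in> borel_measurable M" "v \<in> borel_measurable N1" "v \<in> borel_measurable N2"
    using add sets by (simp_all cong: measurable_cong_sets)
  show ?case using add by (simp add: nn_integral_add distrib_left ac_simps)
next
  case (seq U)
  have [measurable]: "U i \<in> borel_measurable M" "U i \<in> borel_measurable N1" "U i \<in> borel_measurable N2" for i
    using seq sets by (simp_all cong: measurable_cong_sets)
  have mono: "incseq (\<lambda>i. integral\<^sup>N K (U i))" for K
    using seq(3) by (auto simp: incseq_def le_fun_def intro!: nn_integral_mono)
  have lim: "(\<integral>\<^sup>+ x. (SUP i. U i) x \<partial>K) = (SUP i. integral\<^sup>N K (U i))" if "\<And>i. U i \<in> borel_measurable K" for K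
    unfolding SUP_apply using seq(3) that by (rule nn_integral_monotone_convergence_SUP)
  have "(\<integral>\<^sup>+ x. (SUP i. U i) x \<partial>M) = (SUP i. a * integral\<^sup>N N1 (U i) + b * integral\<^sup>N N2 (U i))"
    by (subst lim) (simp_all add: seq.IH)
  also have "\<dots> = (SUP i. a * integral\<^sup>N N1 (U i)) + (SUP i. b * integral\<^sup>N N2 (U i))"
    using mono by (intro ennreal_SUP_add) (auto simp: incseq_def intro!: mult_left_mono)
  also have "\<dots> = a * (SUP i. integral\<^sup>N N1 (U i)) + b * (SUP i. integral\<^sup>N N2 (U i))"
    by (simp add: SUP_mult_left_ennreal)
  also have "(SUP i. integral\<^sup>N N1 (U i)) = (\<integral>\<^sup>+ x. (SUP i. U i) x \<partial>N1)"
    by (rule lim[symmetric]) simp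
  also have "(SUP i. integral\<^sup>N N2 (U i)) = (\<integral>\<^sup>+ x. (SUP i. U i) x \<partial>N2)"
    by (rule lim[symmetric]) simp
  finally show ?case .
qed

text \<open>A point of the inflated permuton is either a displaced point \<open>x\<close> of the original one or, on the
  event \<open>c\<close>, a point of the small diagonal, of relative position \<open>u\<close>.\<close>

definition inflated_point :: "real \<Rightarrow> bool \<Rightarrow> real \<times> real \<Rightarrow> bool \<Rightarrow> (real \<times> real) \<times> real \<Rightarrow> real \<times> real" where
  "inflated_point \<epsilon> b z c q = (if c
     then ((1 - \<epsilon>) * fst z + \<epsilon> * snd q, (1 - \<epsilon>) * snd z + \<epsilon> * (if b then snd q else 1 - snd q))
     else (push_away (fst z) \<epsilon> (fst (fst q)), push_away (snd z) \<epsilon> (snd (fst q))))"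

abbreviation marked_point :: "permuton \<Rightarrow> ((real \<times> real) \<times> real) measure" where
  "marked_point \<mu> \<equiv> meas \<mu> \<Otimes>\<^sub>M unif01"

lemma prob_space_marked_point: "prob_space (marked_point \<mu>)"
  by (intro prob_space_pair prob_space_meas prob_space_unif01)

lemma measurable_push_away [measurable]:
  assumes [measurable]: "f \<in> borel_measurable M" "g \<in> borel_measurable M"
  shows "(\<lambda>x. push_away (f x) \<epsilon> (g x)) \<in> borel_measurable M"
  unfolding push_away_def[abs_def] by measurable

lemma measurable_inflated_point:
  assumes [measurable]: "f \<in> borel_measurable M" "g \<in> M \<rightarrow>\<^sub>M marked_point \<mu>"
  shows "(\<lambda>x. fst (inflated_point \<epsilon> b (f x) c (g x))) \<in> borel_measurable M"
    "(\<lambda>x. snd (inflated_point \<epsilon> b (f x) c (g x))) \<in> borel_measurable M"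
proof -
  have [measurable]: "(\<lambda>x. fst (g x)) \<in> M \<rightarrow>\<^sub>M borel" "(\<lambda>x. snd (g x)) \<in> M \<rightarrow>\<^sub>M borel"
    using measurable_compose[OF assms(2) measurable_fst] measurable_compose[OF assms(2) measurable_snd]
    by (simp_all cong: measurable_cong_sets)
  show "(\<lambda>x. fst (inflated_point \<epsilon> b (f x) c (g x))) \<in> borel_measurable M"
    "(\<lambda>x. snd (inflated_point \<epsilon> b (f x) c (g x))) \<in> borel_measurable M"
    unfolding inflated_point_def by (cases c; cases b; simp; measurable)+
qed

text \<open>Displaced and diagonal points are realised as functions of one and the same marked
  point, each ignoring one of its components. A sample of the inflated permuton can then be written
  on a single product space, whatever the set of points on the diagonal.\<close>

lemma nn_integral_inflate:
  assumes e: "0 < \<epsilon>" "\<epsilon> < 1" and z: "z \<in> {0..1} \<times> {0..1}" and f [measurable]: "f \<in> borel_measurable borel"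
  shows "(\<integral>\<^sup>+ x. f x \<partial>(meas (inflate \<epsilon> b z \<mu>))) =
     ennreal (1 - \<epsilon>) * (\<integral>\<^sup>+ q. f (inflated_point \<epsilon> b z False q) \<partial>(marked_point \<mu>))
     + ennreal \<epsilon> * (\<integral>\<^sup>+ q. f (inflated_point \<epsilon> b z True q) \<partial>(marked_point \<mu>))"
proof -
  interpret M: prob_space "meas \<mu>" by simp
  interpret U: prob_space unif01 by (rule prob_space_unif01)
  interpret MU: pair_prob_space "meas \<mu>" unif01 ..
  let ?P = "map_prod (push_away (fst z) \<epsilon>) (push_away (snd z) \<epsilon>)"
  let ?I = "inflate_meas \<epsilon> b z (meas \<mu>)"
  let ?d = "\<lambda>u. ((1 - \<epsilon>) * fst z + \<epsilon> * u, (1 - \<epsilon>) * snd z + \<epsilon> * (if b then u else 1 - u))"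
  have eq: "meas (inflate \<epsilon> b z \<mu>) = ?I"
    unfolding inflate_def using z is_permuton_inflate_meas[OF e z is_permuton_meas]
    by (simp add: Abs_permuton_inverse)
  have P [measurable]: "?P \<in> borel_measurable borel"
    unfolding map_prod_def case_prod_beta' by (intro borel_measurable_Pair) measurable
  have d [measurable]: "?d \<in> borel_measurable borel"
    by (intro borel_measurable_Pair) (cases b; measurable)+
  have sets: "sets ?I = sets borel"
    by (simp add: inflate_meas_def sets.sigma_sets_eq[of borel, simplified])
  have em: "emeasure ?I A = ennreal (1 - \<epsilon>) * emeasure (distr (meas \<mu>) borel ?P) A
     + ennreal \<epsilon> * emeasure (small_diagonal \<epsilon> b z) A" if "A \<in> sets ?I" for A
    using that
  proof (subst emeasure_measure_of[OF inflate_meas_def])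
    show "countably_additive (sets ?I) (\<lambda>A. ennreal (1 - \<epsilon>) * emeasure (distr (meas \<mu>) borel ?P) A
     + ennreal \<epsilon> * emeasure (small_diagonal \<epsilon> b z) A)"
      unfolding countably_additive_def sets
      by (auto simp: suminf_add[symmetric] suminf_emeasure ennreal_suminf_cmult small_diagonal_def)
  qed (auto simp: positive_def sets)
  have "(\<integral>\<^sup>+ x. f x \<partial>?I) = ennreal (1 - \<epsilon>) * (\<integral>\<^sup>+ x. f x \<partial>(distr (meas \<mu>) borel ?P)) + ennreal \<epsilon> * (\<integral>\<^sup>+ x. f x \<partial>(small_diagonal \<epsilon> b z))"
    by (rule nn_integral_mixture) (use em sets in \<open>simp_all add: small_diagonal_def cong: measurable_cong_sets\<close>)
  also have "(\<integral>\<^sup>+ x. f x \<partial>(distr (meas \<mu>) borel ?P)) = (\<integral>\<^sup>+ x. f (?P x) \<partial>(meas \<mu>))"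
    by (rule nn_integral_distr) auto
  also have "\<dots> = (\<integral>\<^sup>+ q. f (inflated_point \<epsilon> b z False q) \<partial>(marked_point \<mu>))"
    by (subst U.nn_integral_fst[symmetric]) (auto simp: inflated_point_def map_prod_def case_prod_beta' U.emeasure_space_1[simplified])
  also have "(\<integral>\<^sup>+ x. f x \<partial>(small_diagonal \<epsilon> b z)) = (\<integral>\<^sup>+ u. f (?d u) \<partial>unif01)"
    unfolding small_diagonal_def by (rule nn_integral_distr) auto
  also have "\<dots> = (\<integral>\<^sup>+ q. f (inflated_point \<epsilon> b z True q) \<partial>(marked_point \<mu>))"
    by (subst U.nn_integral_fst[symmetric]) (cases b; simp add: inflated_point_def M.emeasure_space_1[simplified])+
  finally show ?thesis unfolding eq .
qed

text \<open>The expansion of a product of sums: every coordinate chooses independently between the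
  two components, and \<open>S\<close> is the set of those that chose the second. Adding a
  coordinate \<open>i\<close> splits each \<open>S\<close> into \<open>S\<close> and
  \<open>insert i S\<close>.\<close>

lemma nn_integral_PiM_mixture:
  assumes P: "prob_space P" and Q: "prob_space Q"
    and G: "\<And>c. G c \<in> Q \<rightarrow>\<^sub>M P"
    and mix: "\<And>f. f \<in> borel_measurable P \<Longrightarrow> (\<integral>\<^sup>+ x. f x \<partial>P) =
       ennreal (1 - \<epsilon>) * (\<integral>\<^sup>+ q. f (G False q) \<partial>Q) + ennreal \<epsilon> * (\<integral>\<^sup>+ q. f (G True q) \<partial>Q)"
    and e: "0 \<le> \<epsilon>" "\<epsilon> \<le> 1" and I: "finite I"
    and f: "f \<in> borel_measurable (\<Pi>\<^sub>M i\<in>I. P)"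
  shows "(\<integral>\<^sup>+ x. f x \<partial>(\<Pi>\<^sub>M i\<in>I. P)) = (\<Sum>S\<in>Pow I. ennreal (\<epsilon> ^ card S * (1 - \<epsilon>) ^ card (I - S)) *
     (\<integral>\<^sup>+ q. f (\<lambda>i\<in>I. G (i \<in> S) (q i)) \<partial>(\<Pi>\<^sub>M i\<in>I. Q)))"
  using I f
proof (induction I arbitrary: f)
  case empty
  then show ?case by (simp add: PiM_empty nn_integral_count_space_finite restrict_def)
next
  case (insert i I)
  interpret P: prob_space P by fact
  interpret Q: prob_space Q by fact
  interpret PP: product_sigma_finite "\<lambda>_. P" by standard
  interpret QQ: product_sigma_finite "\<lambda>_. Q" by standard
  note [measurable] = insert.prems G
  have upd [measurable]: "(\<lambda>(x, y). x(i := y)) \<in> (\<Pi>\<^sub>M i\<in>I. P) \<Otimes>\<^sub>M P \<rightarrow>\<^sub>M (\<Pi>\<^sub>M i\<in>insert i I. P)"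
    by (simp add: measurable_add_dim)
  have conf [measurable]: "(\<lambda>q. \<lambda>j\<in>J. G (j \<in> S) (q j)) \<in> (\<Pi>\<^sub>M i\<in>J. Q) \<rightarrow>\<^sub>M (\<Pi>\<^sub>M i\<in>J. P)" for J S
    by (intro measurable_restrict) measurable
  let ?w = "\<lambda>J S. ennreal (\<epsilon> ^ card S * (1 - \<epsilon>) ^ card (J - S))"
  let ?C = "\<lambda>J S q. \<lambda>j\<in>J. G (j \<in> S) (q j)"
  let ?A = "\<lambda>J S. (\<integral>\<^sup>+ q. f (?C J S q) \<partial>(\<Pi>\<^sub>M i\<in>J. Q))"
  have "(\<integral>\<^sup>+ x. f x \<partial>(\<Pi>\<^sub>M i\<in>insert i I. P)) = (\<integral>\<^sup>+ x. (\<integral>\<^sup>+ y. f (x(i := y)) \<partial>P) \<partial>(\<Pi>\<^sub>M i\<in>I. P))"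
    using insert by (intro PP.product_nn_integral_insert) auto
  also have "\<dots> = (\<Sum>S\<in>Pow I. ?w I S * (\<integral>\<^sup>+ q. (\<integral>\<^sup>+ y. f ((?C I S q)(i := y)) \<partial>P) \<partial>(\<Pi>\<^sub>M i\<in>I. Q)))"
    by (rule insert.IH) measurable
  also have "\<dots> = (\<Sum>S\<in>Pow I. ?w (insert i I) S * ?A (insert i I) S + ?w (insert i I) (insert i S) * ?A (insert i I) (insert i S))"
  proof (rule sum.cong[OF refl])
    fix S assume S: "S \<in> Pow I"
    then have iS: "i \<notin> S" "finite S" using insert by (auto intro: finite_subset)
    have A: "?A (insert i I) S' = (\<integral>\<^sup>+ q. (\<integral>\<^sup>+ y. f ((?C I S q)(i := G (i \<in> S') y)) \<partial>Q) \<partial>(\<Pi>\<^sub>M i\<in>I. Q))"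
      if "S' = S \<or> S' = insert i S" for S'
    proof -
      have "?A (insert i I) S' = (\<integral>\<^sup>+ q. (\<integral>\<^sup>+ y. f (?C (insert i I) S' (q(i := y))) \<partial>Q) \<partial>(\<Pi>\<^sub>M i\<in>I. Q))"
        using insert by (intro QQ.product_nn_integral_insert) auto
      also have "\<dots> = (\<integral>\<^sup>+ q. (\<integral>\<^sup>+ y. f ((?C I S q)(i := G (i \<in> S') y)) \<partial>Q) \<partial>(\<Pi>\<^sub>M i\<in>I. Q))"
        using that insert by (intro nn_integral_cong arg_cong[of _ _ f]) (auto simp: fun_eq_iff)
      finally show ?thesis .
    qed
    have m [measurable]: "(\<lambda>q. \<integral>\<^sup>+ y. f ((?C I S q)(i := G c y)) \<partial>Q) \<in> borel_measurable (\<Pi>\<^sub>M i\<in>I. Q)" for c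
      by measurable
    have "(\<integral>\<^sup>+ q. (\<integral>\<^sup>+ y. f ((?C I S q)(i := y)) \<partial>P) \<partial>(\<Pi>\<^sub>M i\<in>I. Q))
      = (\<integral>\<^sup>+ q. ennreal (1 - \<epsilon>) * (\<integral>\<^sup>+ y. f ((?C I S q)(i := G False y)) \<partial>Q) + ennreal \<epsilon> * (\<integral>\<^sup>+ y. f ((?C I S q)(i := G True y)) \<partial>Q) \<partial>(\<Pi>\<^sub>M i\<in>I. Q))"
    proof (intro nn_integral_cong mix)
      fix q assume "q \<in> space (\<Pi>\<^sub>M i\<in>I. Q)"
      then have "?C I S q \<in> space (\<Pi>\<^sub>M i\<in>I. P)" using measurable_space[OF conf] by blast
      then show "(\<lambda>y. f ((?C I S q)(i := y))) \<in> borel_measurable P" by measurable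
    qed
    also have "\<dots> = ennreal (1 - \<epsilon>) * ?A (insert i I) S + ennreal \<epsilon> * ?A (insert i I) (insert i S)"
    proof -
      have "?A (insert i I) S = (\<integral>\<^sup>+ q. (\<integral>\<^sup>+ y. f ((?C I S q)(i := G False y)) \<partial>Q) \<partial>(\<Pi>\<^sub>M i\<in>I. Q))"
        using A[of S] iS(1) by simp
      moreover have "?A (insert i I) (insert i S) = (\<integral>\<^sup>+ q. (\<integral>\<^sup>+ y. f ((?C I S q)(i := G True y)) \<partial>Q) \<partial>(\<Pi>\<^sub>M i\<in>I. Q))"
        using A[of "insert i S"] by (simp only: insertI1 simp_thms)
      ultimately show ?thesis by (simp only:) (simp add: nn_integral_add nn_integral_cmult)
    qed
    finally have "(\<integral>\<^sup>+ q. (\<integral>\<^sup>+ y. f ((?C I S q)(i := y)) \<partial>P) \<partial>(\<Pi>\<^sub>M i\<in>I. Q))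
      = ennreal (1 - \<epsilon>) * ?A (insert i I) S + ennreal \<epsilon> * ?A (insert i I) (insert i S)" .
    moreover have "?w (insert i I) S = ?w I S * ennreal (1 - \<epsilon>)"
    proof -
      have "insert i I - S = insert i (I - S)" using iS by auto
      then show ?thesis using insert e by (simp add: ennreal_mult'[symmetric] ac_simps)
    qed
    moreover have "?w (insert i I) (insert i S) = ?w I S * ennreal \<epsilon>"
    proof -
      have "insert i I - insert i S = I - S" using insert by auto
      then show ?thesis using iS e by (simp add: ennreal_mult''[symmetric] ac_simps)
    qed
    ultimately show "?w I S * (\<integral>\<^sup>+ q. (\<integral>\<^sup>+ y. f ((?C I S q)(i := y)) \<partial>P) \<partial>(\<Pi>\<^sub>M i\<in>I. Q))
       = ?w (insert i I) S * ?A (insert i I) S + ?w (insert i I) (insert i S) * ?A (insert i I) (insert i S)"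
      by (simp add: distrib_left ac_simps)
  qed
  also have "\<dots> = (\<Sum>S\<in>Pow (insert i I). ?w (insert i I) S * ?A (insert i I) S)"
  proof -
    have "inj_on (insert i) (Pow I)" using insert(2) by (auto simp: inj_on_def)
    moreover have "Pow I \<inter> insert i ` Pow I = {}" using insert(2) by auto
    ultimately show ?thesis using insert(1)
      by (simp add: Pow_insert sum.union_disjoint sum.reindex sum.distrib)
  qed
  finally show ?case .
qed

subsection \<open>Pattern densities\<close>

text \<open>All coordinates but \<open>j\<close> are fixed first, so that a bound for a single
  point, uniform in the other one, is enough. It is applied to ties and near ties between sample
  points.\<close>

lemma PiM_pair_emeasure_le:
  assumes M: "prob_space M" and I: "finite I" "i \<in> I" "j \<in> I" "i \<noteq> j"
    and R [measurable]: "Measurable.pred (M \<Otimes>\<^sub>M M) (\<lambda>(x, y). R x y)"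
    and c: "\<And>x. x \<in> space M \<Longrightarrow> emeasure M {y \<in> space M. R x y} \<le> c"
  shows "emeasure (\<Pi>\<^sub>M i\<in>I. M) {z \<in> space (\<Pi>\<^sub>M i\<in>I. M). R (z i) (z j)} \<le> c"
proof -
  interpret prob_space M by fact
  interpret product_sigma_finite "\<lambda>_. M" by standard
  interpret PP: prob_space "\<Pi>\<^sub>M i\<in>I - {j}. M" by (intro prob_space_PiM M)
  have ins: "insert j (I - {j}) = I" using I by auto
  have [measurable]: "Measurable.pred (\<Pi>\<^sub>M i\<in>I. M) (\<lambda>z. R (z i) (z j))"
    using measurable_compose[OF _ R, of "\<lambda>z. (z i, z j)" "\<Pi>\<^sub>M i\<in>I. M"] I by simp
  have "emeasure (\<Pi>\<^sub>M i\<in>I. M) {z \<in> space (\<Pi>\<^sub>M i\<in>I. M). R (z i) (z j)}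
    = (\<integral>\<^sup>+ z. indicator {z \<in> space (\<Pi>\<^sub>M i\<in>I. M). R (z i) (z j)} z \<partial>(\<Pi>\<^sub>M i\<in>I. M))"
    by simp
  also have "\<dots> = (\<integral>\<^sup>+ x. (\<integral>\<^sup>+ y. indicator {z \<in> space (\<Pi>\<^sub>M i\<in>I. M). R (z i) (z j)} (x(j := y)) \<partial>M) \<partial>(\<Pi>\<^sub>M i\<in>I - {j}. M))"
    using product_nn_integral_insert[of "I - {j}" j "indicator {z \<in> space (\<Pi>\<^sub>M i\<in>I. M). R (z i) (z j)}"] I
    unfolding ins by simp
  also have "\<dots> \<le> (\<integral>\<^sup>+ x. c \<partial>(\<Pi>\<^sub>M i\<in>I - {j}. M))"
  proof (rule nn_integral_mono)
    fix x assume x: "x \<in> space (\<Pi>\<^sub>M i\<in>I - {j}. M)"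
    then have xi: "x i \<in> space M" using I by (auto simp: space_PiM)
    have [measurable]: "Measurable.pred M (\<lambda>y. R (x i) y)"
      using measurable_compose[OF _ R, of "\<lambda>y. (x i, y)" M] xi by simp
    have "(\<integral>\<^sup>+ y. indicator {z \<in> space (\<Pi>\<^sub>M i\<in>I. M). R (z i) (z j)} (x(j := y)) \<partial>M)
       \<le> (\<integral>\<^sup>+ y. indicator {y \<in> space M. R (x i) y} y \<partial>M)"
      using I by (intro nn_integral_mono) (auto split: split_indicator)
    also have "\<dots> = emeasure M {y \<in> space M. R (x i) y}" by simp
    also have "\<dots> \<le> c" using c[OF xi] .
    finally show "(\<integral>\<^sup>+ y. indicator {z \<in> space (\<Pi>\<^sub>M i\<in>I. M). R (z i) (z j)} (x(j := y)) \<partial>M) \<le> c" .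
  qed
  also have "\<dots> = c" by (simp add: PP.emeasure_space_1)
  finally show ?thesis .
qed

lemma forms_diagram_measurable [measurable]:
  assumes "\<And>i. i \<in> {1..k} \<Longrightarrow> (\<lambda>x. fst (f x i)) \<in> borel_measurable M"
    and "\<And>i. i \<in> {1..k} \<Longrightarrow> (\<lambda>x. snd (f x i)) \<in> borel_measurable M"
  shows "Measurable.pred M (\<lambda>x. forms_diagram k \<pi> (f x))"
proof -
  have *: "Measurable.pred M (\<lambda>x. fst (f x i) < fst (f x j))" "Measurable.pred M (\<lambda>x. snd (f x i) < snd (f x j))"
    if "i \<in> {1..k}" "j \<in> {1..k}" for i j
    using assms that by simp_all
  have "forms_diagram k \<pi> (f x) \<longleftrightarrow> (\<exists>s\<in>{s. s permutes {1..k}}.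
     (\<forall>i\<in>{1..k}. \<forall>j\<in>{1..k}.
        (i < j \<longrightarrow> fst (f x (s i)) < fst (f x (s j))) \<and>
        (\<pi> i < \<pi> j \<longrightarrow> snd (f x (s i)) < snd (f x (s j)))))" for x
    unfolding forms_diagram_def by blast
  moreover have "Measurable.pred M (\<lambda>x. \<exists>s\<in>{s. s permutes {1..k}}.
     (\<forall>i\<in>{1..k}. \<forall>j\<in>{1..k}.
        (i < j \<longrightarrow> fst (f x (s i)) < fst (f x (s j))) \<and>
        (\<pi> i < \<pi> j \<longrightarrow> snd (f x (s i)) < snd (f x (s j)))))"
  proof (intro pred_intros_finite pred_intros_logic)
    show "finite {s. s permutes {1..k}}" by (rule finite_permutations) simp
  qed (use permutes_in_image in \<open>fastforce intro!: *\<close>)+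
  ultimately show ?thesis by simp
qed

lemma measurable_component_meas [measurable]:
  "i \<in> I \<Longrightarrow> (\<lambda>z. z i) \<in> (\<Pi>\<^sub>M i\<in>I. meas \<mu>) \<rightarrow>\<^sub>M borel"
  using measurable_component_singleton[of i I "\<lambda>_. meas \<mu>"] by simp

section \<open>Discretisation of pattern densities\<close>

lemma emeasure_meas_fst_column_le:
  assumes N: "0 < N"
  shows "emeasure (meas \<mu>) {y. \<lceil>real N * fst x\<rceil> = \<lceil>real N * fst y\<rceil>} \<le> ennreal (1 / N)"
proof -
  interpret prob_space "meas \<mu>" by simp
  define m where "m = \<lceil>real N * fst x\<rceil>"
  have "{y. m = \<lceil>real N * fst y\<rceil>} = {y::real\<times>real. fst y \<in> {(m - 1) / N<..m / N}}"
    using N by (auto simp: field_simps ceiling_eq_iff eq_commute[of m])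
  moreover have "measure (meas \<mu>) {y. fst y \<in> {(m - 1) / N<..m / N}} \<le> m / N - (m - 1) / N"
    by (rule measure_meas_fst_Ioc_le) (simp add: divide_right_mono)
  ultimately show ?thesis
    by (simp add: emeasure_eq_measure m_def[symmetric] diff_divide_distrib ennreal_leI)
qed

lemma emeasure_meas_snd_column_le:
  assumes N: "0 < N"
  shows "emeasure (meas \<mu>) {y. \<lceil>real N * snd x\<rceil> = \<lceil>real N * snd y\<rceil>} \<le> ennreal (1 / N)"
proof -
  interpret prob_space "meas \<mu>" by simp
  define m where "m = \<lceil>real N * snd x\<rceil>"
  have "{y. m = \<lceil>real N * snd y\<rceil>} = {y::real\<times>real. snd y \<in> {(m - 1) / N<..m / N}}"
    using N by (auto simp: field_simps ceiling_eq_iff eq_commute[of m])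
  moreover have "measure (meas \<mu>) {y. snd y \<in> {(m - 1) / N<..m / N}} \<le> m / N - (m - 1) / N"
    by (rule measure_meas_snd_Ioc_le) (simp add: divide_right_mono)
  ultimately show ?thesis
    by (simp add: emeasure_eq_measure m_def[symmetric] diff_divide_distrib ennreal_leI)
qed

text \<open>The bad event of the discretisation: when two points share a column or a row of the
  grid, their cells do not reveal their order.\<close>

definition same_column :: "nat \<Rightarrow> nat \<Rightarrow> (nat \<Rightarrow> real \<times> real) \<Rightarrow> bool" where
  "same_column k N z \<longleftrightarrow> (\<exists>i\<in>{1..k}. \<exists>j\<in>{1..k}. i \<noteq> j \<and>
     (\<lceil>real N * fst (z i)\<rceil> = \<lceil>real N * fst (z j)\<rceil> \<or> \<lceil>real N * snd (z i)\<rceil> = \<lceil>real N * snd (z j)\<rceil>))"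

lemma same_column_measurable [measurable]: "Measurable.pred (\<Pi>\<^sub>M i\<in>{1..k}. meas \<mu>) (same_column k N)"
proof -
  have [measurable]: "(\<lambda>z. \<lceil>real N * fst (z i)\<rceil>) \<in> (\<Pi>\<^sub>M i\<in>{1..k}. meas \<mu>) \<rightarrow>\<^sub>M count_space UNIV"
    "(\<lambda>z. \<lceil>real N * snd (z i)\<rceil>) \<in> (\<Pi>\<^sub>M i\<in>{1..k}. meas \<mu>) \<rightarrow>\<^sub>M count_space UNIV" if "i \<in> {1..k}" for i
    using that by measurable
  show ?thesis
    unfolding same_column_def[abs_def] by (intro pred_intros_finite pred_intros_logic) auto
qed

text \<open>A union bound over the \<open>k\<^sup>2\<close> ordered pairs, where columns and rows
  contribute at most \<open>1 / N\<close> each by the uniform marginals.\<close>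

lemma measure_same_column_le:
  assumes N: "0 < N"
  shows "measure (\<Pi>\<^sub>M i\<in>{1..k}. meas \<mu>) {z \<in> space (\<Pi>\<^sub>M i\<in>{1..k}. meas \<mu>). same_column k N z} \<le> 2 * (real k)\<^sup>2 / N"
proof -
  let ?P = "\<Pi>\<^sub>M i\<in>{1..k}. meas \<mu>"
  interpret prob_space ?P by (intro prob_space_PiM) simp
  define A where "A i j = {z \<in> space ?P. i \<noteq> j \<and> \<lceil>real N * fst (z i)\<rceil> = \<lceil>real N * fst (z j)\<rceil>}" for i j
  define B where "B i j = {z \<in> space ?P. i \<noteq> j \<and> \<lceil>real N * snd (z i)\<rceil> = \<lceil>real N * snd (z j)\<rceil>}" for i j
  have m [measurable]: "(\<lambda>z. \<lceil>real N * fst (z i)\<rceil>) \<in> ?P \<rightarrow>\<^sub>M count_space UNIV"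
    "(\<lambda>z. \<lceil>real N * snd (z i)\<rceil>) \<in> ?P \<rightarrow>\<^sub>M count_space UNIV" if "i \<in> {1..k}" for i
    using that by measurable
  have AB [measurable]: "A i j \<in> events" "B i j \<in> events" if "i \<in> {1..k}" "j \<in> {1..k}" for i j
    using that unfolding A_def B_def by measurable
  have A: "prob (A i j) \<le> 1 / N" if "i \<in> {1..k}" "j \<in> {1..k}" for i j
  proof (cases "i = j")
    case False
    have "emeasure ?P {z \<in> space ?P. \<lceil>real N * fst (z i)\<rceil> = \<lceil>real N * fst (z j)\<rceil>} \<le> ennreal (1 / N)"
      using that False emeasure_meas_fst_column_le[OF N] by (intro PiM_pair_emeasure_le) auto
    then show ?thesis using False unfolding emeasure_eq_measure by (simp add: A_def)
  qed (simp add: A_def)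
  have B: "prob (B i j) \<le> 1 / N" if "i \<in> {1..k}" "j \<in> {1..k}" for i j
  proof (cases "i = j")
    case False
    have "emeasure ?P {z \<in> space ?P. \<lceil>real N * snd (z i)\<rceil> = \<lceil>real N * snd (z j)\<rceil>} \<le> ennreal (1 / N)"
      using that False emeasure_meas_snd_column_le[OF N] by (intro PiM_pair_emeasure_le) auto
    then show ?thesis using False unfolding emeasure_eq_measure by (simp add: B_def)
  qed (simp add: B_def)
  let ?K = "{1..k} \<times> {1..k}"
  have ABm: "A (fst ij) (snd ij) \<union> B (fst ij) (snd ij) \<in> events" if "ij \<in> ?K" for ij
    using that AB[of "fst ij" "snd ij"] by (simp add: mem_Times_iff)
  have "{z \<in> space ?P. same_column k N z} \<subseteq> (\<Union>ij\<in>?K. A (fst ij) (snd ij) \<union> B (fst ij) (snd ij))"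
    unfolding same_column_def A_def B_def by fastforce
  then have "prob {z \<in> space ?P. same_column k N z} \<le> prob (\<Union>ij\<in>?K. A (fst ij) (snd ij) \<union> B (fst ij) (snd ij))"
    by (rule finite_measure_mono) (intro sets.finite_UN ABm, simp)
  also have "\<dots> \<le> (\<Sum>ij\<in>?K. prob (A (fst ij) (snd ij) \<union> B (fst ij) (snd ij)))"
    by (rule finite_measure_subadditive_finite) (use ABm in blast)+
  also have "\<dots> \<le> (\<Sum>ij\<in>?K. 2 / real N)"
  proof (rule sum_mono)
    fix ij assume ij: "ij \<in> ?K"
    then have ij': "fst ij \<in> {1..k}" "snd ij \<in> {1..k}" by (simp_all only: mem_Times_iff)
    have "prob (A (fst ij) (snd ij) \<union> B (fst ij) (snd ij)) \<le> prob (A (fst ij) (snd ij)) + prob (B (fst ij) (snd ij))"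
      by (rule measure_Un_le) (use AB[OF ij'] in blast)+
    also have "\<dots> \<le> 1 / N + 1 / N" by (intro add_mono A B ij')
    finally show "prob (A (fst ij) (snd ij) \<union> B (fst ij) (snd ij)) \<le> 2 / real N" by simp
  qed
  also have "\<dots> = 2 * (real k)\<^sup>2 / N" by (simp add: power2_eq_square)
  finally show ?thesis .
qed

lemma AE_PiM_square:
  fixes k :: nat
  shows "AE z in (\<Pi>\<^sub>M i\<in>{1..k}. meas \<mu>). \<forall>i\<in>{1..k}. fst (z i) \<in> {0<..1} \<and> snd (z i) \<in> {0<..1}"
proof (rule AE_finite_allI)
  fix i assume "i \<in> {1..k}"
  then show "AE z in (\<Pi>\<^sub>M i\<in>{1..k}. meas \<mu>). fst (z i) \<in> {0<..1} \<and> snd (z i) \<in> {0<..1}"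
    using AE_PiM_component[of "{1..k}" "\<lambda>_. meas \<mu>" i "\<lambda>z. fst z \<in> {0<..1} \<and> snd z \<in> {0<..1}"] AE_meas_square[of \<mu>]
    by auto
qed simp

text \<open>The cells of the sample points determine the diagram as soon as no two points share a
  column or a row. Thus the union of the boxes indexed by \<open>good\<close> lies inside the event
  of forming \<open>\<pi>\<close>, and the difference is contained, up to a null set, in the bad
  event.\<close>

lemma perm_density_approx:
  fixes k N :: nat and \<pi> :: "nat \<Rightarrow> nat"
  assumes N: "0 < N"
  defines "good \<equiv> {c \<in> (\<Pi>\<^sub>E i\<in>{1..k}. {..<N} \<times> {..<N}). forms_diagram k \<pi> (\<lambda>i. (real (fst (c i)), real (snd (c i))))}"
  shows "\<bar>(\<Sum>c\<in>good. \<Prod>i\<in>{1..k}. measure (meas \<mu>) (grid_cell N (c i))) - perm_density k \<pi> \<mu>\<bar> \<le> 2 * (real k)\<^sup>2 / N"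
proof -
  let ?P = "\<Pi>\<^sub>M i\<in>{1..k}. meas \<mu>"
  interpret M: prob_space "meas \<mu>" by simp
  interpret P: prob_space ?P by (intro prob_space_PiM) simp
  interpret F: finite_product_prob_space "\<lambda>_. meas \<mu>" "{1..k}" by standard simp
  have fin: "finite good"
    unfolding good_def by (rule finite_subset[of _ "\<Pi>\<^sub>E i\<in>{1..k}. {..<N} \<times> {..<N}"]) (auto intro!: finite_PiE)
  define E where "E c = (\<Pi>\<^sub>E i\<in>{1..k}. grid_cell N (c i))" for c
  have Em [measurable]: "E c \<in> P.events" for c
    unfolding E_def by (intro sets_PiM_I_finite) auto
  have dj: "disjoint_family_on E good"
    unfolding disjoint_family_on_def
  proof (intro ballI impI)
    fix c c' assume c: "c \<in> good" "c' \<in> good" "c \<noteq> c'"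
    then obtain i where i: "i \<in> {1..k}" "c i \<noteq> c' i"
      unfolding good_def mem_Collect_eq by (meson PiE_ext)
    then have "grid_cell N (c i) \<inter> grid_cell N (c' i) = {}"
      by (intro disjoint_family_onD[OF disjoint_grid_cells[OF N, of UNIV]]) auto
    then show "E c \<inter> E c' = {}" using i unfolding E_def PiE_iff disjoint_iff by blast
  qed
  have "(\<Sum>c\<in>good. \<Prod>i\<in>{1..k}. measure (meas \<mu>) (grid_cell N (c i))) = (\<Sum>c\<in>good. P.prob (E c))"
  proof (rule sum.cong[OF refl])
    fix c
    show "(\<Prod>i\<in>{1..k}. measure (meas \<mu>) (grid_cell N (c i))) = P.prob (E c)"
      using F.prob_times[of "\<lambda>i. grid_cell N (c i)"] by (simp add: E_def)
  qed
  also have "\<dots> = P.prob (\<Union>c\<in>good. E c)"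
    using fin dj Em by (intro P.finite_measure_finite_Union[symmetric]) (auto simp only: image_subset_iff)
  finally have eq: "(\<Sum>c\<in>good. \<Prod>i\<in>{1..k}. measure (meas \<mu>) (grid_cell N (c i))) = P.prob (\<Union>c\<in>good. E c)" .
  let ?F = "{z \<in> space ?P. forms_diagram k \<pi> z}" and ?B = "{z \<in> space ?P. same_column k N z}"
  have [measurable]: "Measurable.pred ?P (\<lambda>z. forms_diagram k \<pi> z)"
    by (rule forms_diagram_measurable)
      (rule measurable_compose[OF measurable_component_meas], assumption, simp)+
  have GE: "(\<Union>c\<in>good. E c) \<in> P.events" by (intro sets.finite_UN fin Em)
  have Fm: "?F \<in> P.events" by measurable
  have Bm: "?B \<in> P.events" by measurable
  have cell: "fst (z i) \<in> {real (fst (c i)) / N<..real (Suc (fst (c i))) / N} \<and> snd (z i) \<in> {real (snd (c i)) / N<..real (Suc (snd (c i))) / N}"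
    if "z \<in> E c" "i \<in> {1..k}" for z c i
    using that by (auto simp: E_def PiE_iff grid_cell_def mem_Times_iff)
  have step: "x < y" if "x \<in> {real m / N<..real (Suc m) / N}" "y \<in> {real n / N<..real (Suc n) / N}" "real m < real n" for x y :: real and m n
  proof -
    have "real (Suc m) / N \<le> real n / N" using that by (intro divide_right_mono) auto
    then show ?thesis using that by auto
  qed
  have "(\<Union>c\<in>good. E c) \<subseteq> ?F"
  proof
    fix z assume "z \<in> (\<Union>c\<in>good. E c)"
    then obtain c where c: "c \<in> good" "z \<in> E c" by blast
    then have "z \<in> space ?P" by (auto simp: E_def space_PiM)
    moreover obtain s where s: "s permutes {1..k}"
     "\<And>i j. i\<in>{1..k} \<Longrightarrow> j\<in>{1..k} \<Longrightarrow>
        (i < j \<longrightarrow> real (fst (c (s i))) < real (fst (c (s j)))) \<and>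
        (\<pi> i < \<pi> j \<longrightarrow> real (snd (c (s i))) < real (snd (c (s j))))"
      using c unfolding good_def forms_diagram_def fst_conv snd_conv by blast
    have "forms_diagram k \<pi> z"
      unfolding forms_diagram_def
    proof (intro exI[of _ s] conjI ballI impI s(1))
      fix i j assume ij: "i \<in> {1..k}" "j \<in> {1..k}"
      then have sij: "s i \<in> {1..k}" "s j \<in> {1..k}" using permutes_in_image[OF s(1)] by auto
      show "fst (z (s i)) < fst (z (s j))" if "i < j"
        by (rule step[of _ "fst (c (s i))" _ "fst (c (s j))"]) (use cell[OF c(2) sij(1)] cell[OF c(2) sij(2)] s(2)[OF ij] that in blast)+
      show "snd (z (s i)) < snd (z (s j))" if "\<pi> i < \<pi> j"
        by (rule step[of _ "snd (c (s i))" _ "snd (c (s j))"]) (use cell[OF c(2) sij(1)] cell[OF c(2) sij(2)] s(2)[OF ij] that in blast)+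
    qed
    ultimately show "z \<in> ?F" by simp
  qed
  then have le: "P.prob (\<Union>c\<in>good. E c) \<le> P.prob ?F"
    by (rule P.finite_measure_mono[OF _ Fm])
  have "P.prob ?F \<le> P.prob ((\<Union>c\<in>good. E c) \<union> ?B)"
  proof (rule P.finite_measure_mono_AE)
    show "AE z in ?P. z \<in> ?F \<longrightarrow> z \<in> (\<Union>c\<in>good. E c) \<union> ?B"
      using AE_PiM_square[of k \<mu>] AE_space
    proof eventually_elim
      case (elim z)
      show ?case
      proof (rule impI, rule UnCI)
        assume z: "z \<in> ?F" "z \<notin> ?B"
        have "\<forall>i\<in>{1..k}. \<exists>ij\<in>{..<N} \<times> {..<N}. z i \<in> grid_cell N ij"
          using unit_square_grid_cells[OF N] elim by blast
        then obtain c0 where c0: "\<And>i. i \<in> {1..k} \<Longrightarrow> c0 i \<in> {..<N} \<times> {..<N} \<and> z i \<in> grid_cell N (c0 i)" by metis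
        define c where "c = restrict c0 {1..k}"
        have c: "c i \<in> {..<N} \<times> {..<N}" "z i \<in> grid_cell N (c i)" if "i \<in> {1..k}" for i
          using c0 that by (auto simp: c_def)
        have zE: "z \<in> E c" using elim c unfolding E_def by (auto simp: space_PiM PiE_iff)
        obtain s where s: "s permutes {1..k}"
         "\<And>i j. i\<in>{1..k} \<Longrightarrow> j\<in>{1..k} \<Longrightarrow>
            (i < j \<longrightarrow> fst (z (s i)) < fst (z (s j))) \<and>
            (\<pi> i < \<pi> j \<longrightarrow> snd (z (s i)) < snd (z (s j)))"
          using z unfolding forms_diagram_def by blast
        \<comment> \<open>Off the bad event, strict order of points gives strict order of cells:
          equal cell indices are excluded, and the opposite order of cells would be inherited by the
          points.\<close>
        have rev: "fst (c i) < fst (c j)" if "fst (z i) < fst (z j)" "i \<in> {1..k}" "j \<in> {1..k}" for i j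
        proof -
          have "fst (c i) \<noteq> fst (c j)"
          proof
            assume "fst (c i) = fst (c j)"
            then have "\<lceil>real N * fst (z i)\<rceil> = \<lceil>real N * fst (z j)\<rceil>"
              using c(2)[OF that(2)] c(2)[OF that(3)] unfolding in_grid_cell_iff[OF N] by simp
            moreover have "i \<noteq> j" using that(1) by blast
            ultimately have "same_column k N z" unfolding same_column_def using that by blast
            then show False using z(2) elim by blast
          qed
          moreover have "\<not> fst (c j) < fst (c i)"
          proof
            assume "fst (c j) < fst (c i)"
            then have "fst (z j) < fst (z i)"
              using cell[OF zE that(2)] cell[OF zE that(3)] step[of "fst (z j)" "fst (c j)" "fst (z i)" "fst (c i)"]
              by (metis of_nat_less_iff)
            then show False using that(1) by simp
          qed
          ultimately show ?thesis by linarith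
        qed
        have rev2: "snd (c i) < snd (c j)" if "snd (z i) < snd (z j)" "i \<in> {1..k}" "j \<in> {1..k}" for i j
        proof -
          have "snd (c i) \<noteq> snd (c j)"
          proof
            assume "snd (c i) = snd (c j)"
            then have "\<lceil>real N * snd (z i)\<rceil> = \<lceil>real N * snd (z j)\<rceil>"
              using c(2)[OF that(2)] c(2)[OF that(3)] unfolding in_grid_cell_iff[OF N] by simp
            moreover have "i \<noteq> j" using that(1) by blast
            ultimately have "same_column k N z" unfolding same_column_def using that by blast
            then show False using z(2) elim by blast
          qed
          moreover have "\<not> snd (c j) < snd (c i)"
          proof
            assume "snd (c j) < snd (c i)"
            then have "snd (z j) < snd (z i)"
              using cell[OF zE that(2)] cell[OF zE that(3)] step[of "snd (z j)" "snd (c j)" "snd (z i)" "snd (c i)"]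
              by (metis of_nat_less_iff)
            then show False using that(1) by simp
          qed
          ultimately show ?thesis by linarith
        qed
        have "forms_diagram k \<pi> (\<lambda>i. (real (fst (c i)), real (snd (c i))))"
          unfolding forms_diagram_def using s permutes_in_image[OF s(1)] rev rev2
          by (intro exI[of _ s]) auto
        then have "c \<in> good" using c by (auto simp: good_def c_def)
        then show "z \<in> (\<Union>c\<in>good. E c)" using zE by blast
      qed
    qed
  qed (rule sets.Un[OF GE Bm])
  also have "\<dots> \<le> P.prob (\<Union>c\<in>good. E c) + P.prob ?B"
    by (rule measure_Un_le[OF GE Bm])
  also have "P.prob ?B \<le> 2 * (real k)\<^sup>2 / N" by (rule measure_same_column_le[OF N])
  finally show ?thesis using le unfolding eq perm_density_def by simp
qed

text \<open>A uniform limit of polynomials in the masses of cells, which are combinations of copula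
  values.\<close>

lemma continuous_perm_density: "continuous_on UNIV (perm_density k \<pi>)"
proof (rule continuous_on_uniformly_approximable)
  fix e :: real assume e: "0 < e"
  obtain N :: nat where N: "2 * (real k)\<^sup>2 / e < real N" using reals_Archimedean2 by blast
  then have N0: "0 < N" using e by (cases "N = 0") (auto simp: divide_less_0_iff not_less)
  define good where "good = {c \<in> (\<Pi>\<^sub>E i\<in>{1..k}. {..<N} \<times> {..<N}). forms_diagram k \<pi> (\<lambda>i. (real (fst (c i)), real (snd (c i))))}"
  have "continuous_on UNIV (\<lambda>\<mu>. measure (meas \<mu>) (grid_cell N ij))" for ij
    by (cases ij) (simp only: measure_grid_cell[OF N0], intro continuous_intros continuous_copula)
  then have "continuous_on UNIV (\<lambda>\<mu>. \<Sum>c\<in>good. \<Prod>i\<in>{1..k}. measure (meas \<mu>) (grid_cell N (c i)))"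
    by (intro continuous_intros) auto
  moreover have "dist (\<Sum>c\<in>good. \<Prod>i\<in>{1..k}. measure (meas \<mu>) (grid_cell N (c i))) (perm_density k \<pi> \<mu>) \<le> e" for \<mu>
  proof -
    have "2 * (real k)\<^sup>2 / N \<le> e" using N N0 e by (simp add: field_simps)
    then show ?thesis
      using perm_density_approx[OF N0, where k = k and \<pi> = \<pi> and \<mu> = \<mu>] unfolding dist_real_def good_def by simp
  qed
  ultimately show "\<exists>g. continuous_on UNIV g \<and> (\<forall>\<mu>\<in>UNIV. dist (g \<mu>) (perm_density k \<pi> \<mu>) \<le> e)"
    by (intro exI conjI ballI)
qed

lemma perm_density_nonneg: "0 \<le> perm_density k \<pi> \<mu>"
  by (simp add: perm_density_def)

lemma perm_density_le_1: "perm_density k \<pi> \<mu> \<le> 1"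
  unfolding perm_density_def by (intro prob_space.prob_le_1 prob_space_PiM) simp

subsection \<open>The generator of the inflation process on pattern densities\<close>

lemma space_marked_point [simp]: "space (marked_point \<mu>) = UNIV"
  by (simp add: space_pair_measure)

lemma ex_permutes_image:
  assumes I: "finite I" and S: "S \<subseteq> I" "T \<subseteq> I" "card S = card T"
  shows "\<exists>\<sigma>. \<sigma> permutes I \<and> (\<forall>i\<in>I. \<sigma> i \<in> T \<longleftrightarrow> i \<in> S)"
proof -
  have fin: "finite S" "finite T" using I S by (auto intro: finite_subset)
  obtain f where f: "bij_betw f S T" using finite_same_card_bij[OF fin S(3)] by blast
  have "card (I - S) = card (I - T)" using fin S by (simp add: card_Diff_subset)
  then obtain g where g: "bij_betw g (I - S) (I - T)" using finite_same_card_bij[of "I - S" "I - T"] I by blast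
  define \<sigma> where "\<sigma> i = (if i \<in> S then f i else if i \<in> I then g i else i)" for i
  have "bij_betw \<sigma> S T" using f by (rule bij_betw_cong[THEN iffD1, rotated]) (simp add: \<sigma>_def)
  moreover have "bij_betw \<sigma> (I - S) (I - T)" using g by (rule bij_betw_cong[THEN iffD1, rotated]) (simp add: \<sigma>_def)
  ultimately have "bij_betw \<sigma> (S \<union> (I - S)) (T \<union> (I - T))" by (rule bij_betw_combine) auto
  moreover have "S \<union> (I - S) = I" "T \<union> (I - T) = I" using S by auto
  ultimately have "\<sigma> permutes I" using S by (intro bij_imp_permutes) (auto simp: \<sigma>_def)
  moreover have "\<sigma> i \<in> T \<longleftrightarrow> i \<in> S" if "i \<in> I" for i
    using bij_betwE[OF f] bij_betwE[OF g] that by (auto simp: \<sigma>_def)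
  ultimately show ?thesis by blast
qed

definition inflated_forms :: "nat \<Rightarrow> (nat \<Rightarrow> nat) \<Rightarrow> real \<Rightarrow> bool \<Rightarrow> nat set \<Rightarrow> real \<times> real \<Rightarrow> (nat \<Rightarrow> (real \<times> real) \<times> real) \<Rightarrow> bool" where
  "inflated_forms k \<pi> \<epsilon> b S z q \<longleftrightarrow> forms_diagram k \<pi> (\<lambda>i. inflated_point \<epsilon> b z (i \<in> S) (q i))"

lemma measurable_inflated_forms [measurable]:
  assumes [measurable]: "f \<in> borel_measurable M" "\<And>i. i \<in> {1..k} \<Longrightarrow> (\<lambda>x. g x i) \<in> M \<rightarrow>\<^sub>M marked_point \<mu>"
  shows "Measurable.pred M (\<lambda>x. inflated_forms k \<pi> \<epsilon> b S (f x) (g x))"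
  unfolding inflated_forms_def
  by (rule forms_diagram_measurable) (rule measurable_inflated_point[OF assms(1)], rule assms(2), assumption)+

text \<open>The probability of forming \<open>\<pi>\<close> conditionally on the root
  \<open>z\<close>, the direction \<open>b\<close> and the set \<open>S\<close> of sample points
  that fall on the diagonal.\<close>

definition inflated_prob :: "nat \<Rightarrow> (nat \<Rightarrow> nat) \<Rightarrow> real \<Rightarrow> bool \<Rightarrow> permuton \<Rightarrow> nat set \<Rightarrow> real \<times> real \<Rightarrow> real" where
  "inflated_prob k \<pi> \<epsilon> b \<mu> S z = measure (\<Pi>\<^sub>M i\<in>{1..k}. marked_point \<mu>)
     {q \<in> space (\<Pi>\<^sub>M i\<in>{1..k}. marked_point \<mu>). inflated_forms k \<pi> \<epsilon> b S z q}"

lemma prob_space_marked_points: "prob_space (\<Pi>\<^sub>M i\<in>I. marked_point \<mu>)"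
  by (intro prob_space_PiM prob_space_marked_point)

lemma inflated_forms_sets:
  "{q \<in> space (\<Pi>\<^sub>M i\<in>{1..k}. marked_point \<mu>). inflated_forms k \<pi> \<epsilon> b S z q} \<in> sets (\<Pi>\<^sub>M i\<in>{1..k}. marked_point \<mu>)"
proof -
  have "Measurable.pred (\<Pi>\<^sub>M i\<in>{1..k}. marked_point \<mu>) (\<lambda>q. inflated_forms k \<pi> \<epsilon> b S ((\<lambda>_. z) q) q)"
    by (rule measurable_inflated_forms) (simp, rule measurable_component_singleton)
  then show ?thesis by (simp add: pred_def)
qed

lemma inflated_prob_le_1: "inflated_prob k \<pi> \<epsilon> b \<mu> S z \<le> 1"
  and inflated_prob_nonneg: "0 \<le> inflated_prob k \<pi> \<epsilon> b \<mu> S z"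
  unfolding inflated_prob_def using prob_space.prob_le_1[OF prob_space_marked_points] by auto

lemma perm_density_inflate:
  assumes e: "0 < \<epsilon>" "\<epsilon> < 1" and z: "z \<in> {0..1} \<times> {0..1}"
  shows "perm_density k \<pi> (inflate \<epsilon> b z \<mu>) =
     (\<Sum>S\<in>Pow {1..k}. \<epsilon> ^ card S * (1 - \<epsilon>) ^ card ({1..k} - S) * inflated_prob k \<pi> \<epsilon> b \<mu> S z)"
proof -
  let ?\<nu> = "meas (inflate \<epsilon> b z \<mu>)" and ?I = "{1..k}"
  let ?P = "\<Pi>\<^sub>M i\<in>?I. ?\<nu>" and ?QI = "\<Pi>\<^sub>M i\<in>?I. marked_point \<mu>"
  interpret P: prob_space ?P by (intro prob_space_PiM) simp
  interpret Q: prob_space ?QI by (rule prob_space_marked_points)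
  let ?F = "{x \<in> space ?P. forms_diagram k \<pi> x}"
  have "Measurable.pred ?P (\<lambda>z. forms_diagram k \<pi> z)"
    by (rule forms_diagram_measurable)
      (rule measurable_compose[OF measurable_component_meas], assumption, simp)+
  then have F: "?F \<in> sets ?P" by (simp add: pred_def)
  have G: "inflated_point \<epsilon> b z c \<in> marked_point \<mu> \<rightarrow>\<^sub>M ?\<nu>" for c
  proof -
    have "(\<lambda>q. (fst (inflated_point \<epsilon> b z c q), snd (inflated_point \<epsilon> b z c q))) \<in> borel_measurable (marked_point \<mu>)"
      by (intro borel_measurable_Pair measurable_inflated_point[where f = "\<lambda>_. z" and \<mu> = \<mu>]) simp_all
    then have "inflated_point \<epsilon> b z c \<in> borel_measurable (marked_point \<mu>)" by (simp only: prod.collapse)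
    then show ?thesis by (subst measurable_cong_sets[OF refl sets_meas])
  qed
  have "emeasure ?P ?F = (\<integral>\<^sup>+ x. indicator ?F x \<partial>?P)" using F by simp
  also have "\<dots> = (\<Sum>S\<in>Pow ?I. ennreal (\<epsilon> ^ card S * (1 - \<epsilon>) ^ card (?I - S)) *
     (\<integral>\<^sup>+ q. indicator ?F (\<lambda>i\<in>?I. inflated_point \<epsilon> b z (i \<in> S) (q i)) \<partial>?QI))"
  proof (rule nn_integral_PiM_mixture)
    fix f :: "real \<times> real \<Rightarrow> ennreal" assume "f \<in> borel_measurable ?\<nu>"
    then show "integral\<^sup>N ?\<nu> f = ennreal (1 - \<epsilon>) * (\<integral>\<^sup>+ q. f (inflated_point \<epsilon> b z False q) \<partial>(marked_point \<mu>))
     + ennreal \<epsilon> * (\<integral>\<^sup>+ q. f (inflated_point \<epsilon> b z True q) \<partial>(marked_point \<mu>))"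
      by (intro nn_integral_inflate[OF e z]) (subst (asm) measurable_cong_sets[OF sets_meas refl])
  next
    show "indicator ?F \<in> borel_measurable ?P" using F by (rule borel_measurable_indicator)
    show "prob_space ?\<nu>" "prob_space (marked_point \<mu>)" by (rule prob_space_meas prob_space_marked_point)+
    show "inflated_point \<epsilon> b z c \<in> marked_point \<mu> \<rightarrow>\<^sub>M ?\<nu>" for c by (rule G)
  qed (use e in simp_all)
  also have "\<dots> = (\<Sum>S\<in>Pow ?I. ennreal (\<epsilon> ^ card S * (1 - \<epsilon>) ^ card (?I - S)) * ennreal (inflated_prob k \<pi> \<epsilon> b \<mu> S z))"
  proof (rule sum.cong[OF refl])
    fix S
    have "(\<integral>\<^sup>+ q. indicator ?F (\<lambda>i\<in>?I. inflated_point \<epsilon> b z (i \<in> S) (q i)) \<partial>?QI)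
      = (\<integral>\<^sup>+ q. indicator {q \<in> space ?QI. inflated_forms k \<pi> \<epsilon> b S z q} q \<partial>?QI)"
    proof (rule nn_integral_cong)
      fix q assume q: "q \<in> space ?QI"
      have "forms_diagram k \<pi> (\<lambda>i\<in>?I. inflated_point \<epsilon> b z (i \<in> S) (q i)) \<longleftrightarrow> inflated_forms k \<pi> \<epsilon> b S z q"
        unfolding inflated_forms_def by (rule forms_diagram_cong) (simp only: restrict_apply if_True)
      then show "indicator ?F (\<lambda>i\<in>?I. inflated_point \<epsilon> b z (i \<in> S) (q i)) = (indicator {q \<in> space ?QI. inflated_forms k \<pi> \<epsilon> b S z q} q :: ennreal)"
        using q by (simp add: indicator_def space_PiM)
    qed
    also have "\<dots> = emeasure ?QI {q \<in> space ?QI. inflated_forms k \<pi> \<epsilon> b S z q}"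
      by (rule nn_integral_indicator[OF inflated_forms_sets])
    also have "\<dots> = ennreal (inflated_prob k \<pi> \<epsilon> b \<mu> S z)"
      by (simp only: inflated_prob_def Q.emeasure_eq_measure)
    finally show "ennreal (\<epsilon> ^ card S * (1 - \<epsilon>) ^ card (?I - S)) * (\<integral>\<^sup>+ q. indicator ?F (\<lambda>i\<in>?I. inflated_point \<epsilon> b z (i \<in> S) (q i)) \<partial>?QI)
      = ennreal (\<epsilon> ^ card S * (1 - \<epsilon>) ^ card (?I - S)) * ennreal (inflated_prob k \<pi> \<epsilon> b \<mu> S z)"
      by (simp only:)
  qed
  also have "\<dots> = ennreal (\<Sum>S\<in>Pow ?I. \<epsilon> ^ card S * (1 - \<epsilon>) ^ card (?I - S) * inflated_prob k \<pi> \<epsilon> b \<mu> S z)"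
    using e by (subst sum_ennreal[symmetric]) (auto simp: inflated_prob_nonneg ennreal_mult' intro!: mult_nonneg_nonneg)
  finally show ?thesis
    using e unfolding perm_density_def P.emeasure_eq_measure
    by (subst (asm) ennreal_inj) (auto simp: inflated_prob_nonneg intro!: sum_nonneg mult_nonneg_nonneg)
qed

text \<open>Exchangeability: a permutation of the indices that carries \<open>S\<close> to
  \<open>T\<close> preserves the product measure, and the pattern does not see the labels. The size
  of \<open>S\<close> alone matters, so it is enough to compute one convenient set of each
  size.\<close>

lemma inflated_prob_cong_card:
  assumes S: "S \<subseteq> {1..k}" "T \<subseteq> {1..k}" "card S = card T"
  shows "inflated_prob k \<pi> \<epsilon> b \<mu> S z = inflated_prob k \<pi> \<epsilon> b \<mu> T z"
proof -
  let ?I = "{1..k}"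
  let ?QI = "\<Pi>\<^sub>M i\<in>?I. marked_point \<mu>"
  obtain \<sigma> where \<sigma>: "\<sigma> permutes ?I" "\<And>i. i \<in> ?I \<Longrightarrow> \<sigma> i \<in> T \<longleftrightarrow> i \<in> S"
    using ex_permutes_image[of ?I S T] S by auto
  have im: "\<sigma> i \<in> ?I \<longleftrightarrow> i \<in> ?I" for i using \<sigma>(1) by (rule permutes_in_image)
  let ?t = "\<lambda>q. \<lambda>i\<in>?I. q (\<sigma> i)"
  have d: "distr ?QI ?QI ?t = ?QI"
    using \<sigma>(1) im by (intro distr_PiM_reindex) (auto simp: prob_space_marked_point permutes_inj_on)
  have m: "?t \<in> ?QI \<rightarrow>\<^sub>M ?QI"
    using im by (intro measurable_restrict measurable_component_singleton) auto
  have "inflated_prob k \<pi> \<epsilon> b \<mu> S z = measure (distr ?QI ?QI ?t) {q \<in> space ?QI. inflated_forms k \<pi> \<epsilon> b S z q}"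
    unfolding d inflated_prob_def ..
  also have "\<dots> = measure ?QI (?t -` {q \<in> space ?QI. inflated_forms k \<pi> \<epsilon> b S z q} \<inter> space ?QI)"
    using m inflated_forms_sets by (rule measure_distr)
  also have "?t -` {q \<in> space ?QI. inflated_forms k \<pi> \<epsilon> b S z q} \<inter> space ?QI = {q \<in> space ?QI. inflated_forms k \<pi> \<epsilon> b T z q}"
  proof -
    have "inflated_forms k \<pi> \<epsilon> b S z (?t q) \<longleftrightarrow> inflated_forms k \<pi> \<epsilon> b T z q" for q
    proof -
      have "inflated_forms k \<pi> \<epsilon> b S z (?t q) \<longleftrightarrow> forms_diagram k \<pi> (\<lambda>i. (\<lambda>j. inflated_point \<epsilon> b z (j \<in> T) (q j)) (\<sigma> i))"
        unfolding inflated_forms_def by (rule forms_diagram_cong) (simp add: \<sigma>(2) del: atLeastAtMost_iff)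
      also have "\<dots> \<longleftrightarrow> inflated_forms k \<pi> \<epsilon> b T z q"
        unfolding inflated_forms_def by (rule forms_diagram_permute[OF \<sigma>(1)])
      finally show ?thesis .
    qed
    then show ?thesis using measurable_space[OF m] by auto
  qed
  finally show ?thesis by (simp add: inflated_prob_def)
qed

section \<open>Order relations between points of the inflated permuton\<close>

lemma push_away_strict_mono: "\<epsilon> < 1 \<Longrightarrow> 0 \<le> \<epsilon> \<Longrightarrow> x < y \<Longrightarrow> push_away s \<epsilon> x < push_away s \<epsilon> y"
proof -
  assume e: "\<epsilon> < 1" "0 \<le> \<epsilon>" and xy: "x < y"
  have "(1 - \<epsilon>) * x < (1 - \<epsilon>) * y" using e xy by (intro mult_strict_left_mono) auto
  moreover define X Y where "X = (1 - \<epsilon>) * x" and "Y = (1 - \<epsilon>) * y"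
  ultimately show "push_away s \<epsilon> x < push_away s \<epsilon> y"
    unfolding push_away_def X_def[symmetric] Y_def[symmetric] using e xy by auto
qed

lemma push_away_less:
  assumes "0 < \<epsilon>" "\<epsilon> < 1" "0 \<le> u" "x < s" shows "push_away s \<epsilon> x < (1 - \<epsilon>) * s + \<epsilon> * u"
proof -
  have "(1 - \<epsilon>) * x < (1 - \<epsilon>) * s" "0 \<le> \<epsilon> * u" using assms by auto
  then show ?thesis using assms(4) by (simp add: push_away_def)
qed

lemma less_push_away:
  assumes "0 < \<epsilon>" "\<epsilon> < 1" "u \<le> 1" "s < x" shows "(1 - \<epsilon>) * s + \<epsilon> * u < push_away s \<epsilon> x"
proof -
  have "(1 - \<epsilon>) * s < (1 - \<epsilon>) * x" "\<epsilon> * u \<le> \<epsilon> * 1" using assms by (auto simp del: mult_1_right)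
  then show ?thesis using assms(4) by (simp add: push_away_def)
qed

text \<open>Relative to all other points, a point on the small diagonal behaves like the root
  \<open>z\<close>: the gap opened by \<open>push_away\<close> is exactly the range of the diagonal.
  Two points on the diagonal are excluded, since both are represented by the same root.\<close>

lemma inflated_point_less:
  assumes e: "0 < \<epsilon>" "\<epsilon> < 1" and u: "0 \<le> snd q" "snd q \<le> 1" "0 \<le> snd q'" "snd q' \<le> 1"
    and cc: "\<not> (c \<and> c')"
  shows "fst (if c then z else fst q) < fst (if c' then z else fst q') \<Longrightarrow> fst (inflated_point \<epsilon> b z c q) < fst (inflated_point \<epsilon> b z c' q')"
    and "snd (if c then z else fst q) < snd (if c' then z else fst q') \<Longrightarrow> snd (inflated_point \<epsilon> b z c q) < snd (inflated_point \<epsilon> b z c' q')"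
proof -
  assume "fst (if c then z else fst q) < fst (if c' then z else fst q')"
  then show "fst (inflated_point \<epsilon> b z c q) < fst (inflated_point \<epsilon> b z c' q')"
    using push_away_less[OF e, of "snd q'" "fst (fst q)" "fst z"] less_push_away[OF e, of "snd q" "fst z" "fst (fst q')"]
      push_away_strict_mono[of \<epsilon> "fst (fst q)" "fst (fst q')" "fst z"] u e cc
    by (cases c; cases c') (simp_all add: inflated_point_def)
next
  assume *: "snd (if c then z else fst q) < snd (if c' then z else fst q')"
  define v v' where "v = (if b then snd q else 1 - snd q)" and "v' = (if b then snd q' else 1 - snd q')"
  have "0 \<le> v" "v \<le> 1" "0 \<le> v'" "v' \<le> 1" using u by (auto simp: v_def v'_def)
  with * show "snd (inflated_point \<epsilon> b z c q) < snd (inflated_point \<epsilon> b z c' q')"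
    using push_away_less[OF e, of v' "snd (fst q)" "snd z"] less_push_away[OF e, of v "snd z" "snd (fst q')"]
      push_away_strict_mono[of \<epsilon> "snd (fst q)" "snd (fst q')" "snd z"] e cc
    unfolding inflated_point_def v_def[symmetric] v'_def[symmetric]
    by (cases c; cases c') simp_all
qed

text \<open>The root has law \<mu> and is independent of the sample, so it may replace the sample
  point \<open>a\<close>: when that point is put on the diagonal, its own position has no influence.
  The resulting family is again i.i.d.\<close>

lemma distr_resample:
  assumes J: "J \<subseteq> I" "a \<in> J" and I: "finite I"
  shows "distr (meas \<mu> \<Otimes>\<^sub>M (\<Pi>\<^sub>M i\<in>I. marked_point \<mu>)) (\<Pi>\<^sub>M i\<in>J. meas \<mu>)
     (\<lambda>zq. \<lambda>i\<in>J. if i = a then fst zq else fst (snd zq i)) = (\<Pi>\<^sub>M i\<in>J. meas \<mu>)" (is "distr ?\<Omega> _ ?f = _")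
    and "(\<lambda>zq. \<lambda>i\<in>J. if i = a then fst zq else fst (snd zq i)) \<in>
      (meas \<mu> \<Otimes>\<^sub>M (\<Pi>\<^sub>M i\<in>I. marked_point \<mu>)) \<rightarrow>\<^sub>M (\<Pi>\<^sub>M i\<in>J. meas \<mu>)"
proof -
  interpret M: prob_space "meas \<mu>" by simp
  interpret U: prob_space unif01 by (rule prob_space_unif01)
  interpret Q: prob_space "marked_point \<mu>" by (rule prob_space_marked_point)
  interpret QI: prob_space "\<Pi>\<^sub>M i\<in>I. marked_point \<mu>" by (rule prob_space_marked_points)
  interpret MM: product_sigma_finite "\<lambda>_. meas \<mu>" by standard
  interpret QQ: finite_product_sigma_finite "\<lambda>_. marked_point \<mu>" I by standard (rule I)
  show m: "?f \<in> ?\<Omega> \<rightarrow>\<^sub>M (\<Pi>\<^sub>M i\<in>J. meas \<mu>)"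
  proof (rule measurable_restrict)
    fix i assume "i \<in> J"
    then have "i \<in> I" using J by auto
    then have "(\<lambda>zq. fst (snd zq i)) \<in> ?\<Omega> \<rightarrow>\<^sub>M meas \<mu>"
      by measurable
    then show "(\<lambda>zq. if i = a then fst zq else fst (snd zq i)) \<in> ?\<Omega> \<rightarrow>\<^sub>M meas \<mu>"
      by (cases "i = a") auto
  qed
  show "distr ?\<Omega> (\<Pi>\<^sub>M i\<in>J. meas \<mu>) ?f = (\<Pi>\<^sub>M i\<in>J. meas \<mu>)"
  proof (rule MM.PiM_eqI)
    show "finite J" using J I by (auto intro: finite_subset)
    fix A assume A: "\<And>i. i \<in> J \<Longrightarrow> A i \<in> sets (meas \<mu>)"
    \<comment> \<open>The discarded position of \<open>a\<close> and the points outside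
      \<open>J\<close> are left unconstrained.\<close>
    define B where "B i = (if i \<in> J - {a} then A i else UNIV)" for i
    have B: "B i \<in> sets (meas \<mu>)" for i using A by (auto simp: B_def)
    have "emeasure (distr ?\<Omega> (\<Pi>\<^sub>M i\<in>J. meas \<mu>) ?f) (Pi\<^sub>E J A) = emeasure ?\<Omega> (?f -` Pi\<^sub>E J A \<inter> space ?\<Omega>)"
      using A \<open>finite J\<close> by (intro emeasure_distr[OF m] sets_PiM_I_finite) auto
    also have "?f -` Pi\<^sub>E J A \<inter> space ?\<Omega> = A a \<times> (\<Pi>\<^sub>E i\<in>I. B i \<times> (UNIV :: real set))"
    proof (intro equalityI subsetI)
      fix zq assume zq: "zq \<in> ?f -` Pi\<^sub>E J A \<inter> space ?\<Omega>"
      then have f: "?f zq \<in> Pi\<^sub>E J A" and ext: "snd zq \<in> extensional I"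
        by (auto simp: space_pair_measure space_PiM PiE_iff)
      have f': "(if i = a then fst zq else fst (snd zq i)) \<in> A i" if "i \<in> J" for i
        using PiE_mem[OF f that] that by simp
      have "snd zq i \<in> B i \<times> UNIV" for i
        using f'[of i] by (auto simp: B_def mem_Times_iff)
      then show "zq \<in> A a \<times> (\<Pi>\<^sub>E i\<in>I. B i \<times> (UNIV :: real set))"
        using f'[OF J(2)] ext by (simp add: mem_Times_iff[of zq] PiE_iff)
    next
      fix zq assume "zq \<in> A a \<times> (\<Pi>\<^sub>E i\<in>I. B i \<times> (UNIV :: real set))"
      then have zq: "fst zq \<in> A a" "snd zq \<in> extensional I" "\<And>i. i \<in> I \<Longrightarrow> fst (snd zq i) \<in> B i"
        by (auto simp: PiE_iff mem_Times_iff)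
      have "(if i = a then fst zq else fst (snd zq i)) \<in> A i" if "i \<in> J" for i
        using zq(1) zq(3)[OF subsetD[OF J(1) that]] that by (auto simp: B_def)
      then show "zq \<in> ?f -` Pi\<^sub>E J A \<inter> space ?\<Omega>"
        using zq(2) by (simp add: space_pair_measure space_PiM PiE_iff mem_Times_iff[of zq])
    qed
    also have "emeasure ?\<Omega> \<dots> = emeasure (meas \<mu>) (A a) * emeasure (\<Pi>\<^sub>M i\<in>I. marked_point \<mu>) (\<Pi>\<^sub>E i\<in>I. B i \<times> (UNIV :: real set))"
      using A J B I by (intro QI.emeasure_pair_measure_Times sets_PiM_I_finite) auto
    also have "emeasure (\<Pi>\<^sub>M i\<in>I. marked_point \<mu>) (\<Pi>\<^sub>E i\<in>I. B i \<times> (UNIV :: real set)) = (\<Prod>i\<in>I. emeasure (marked_point \<mu>) (B i \<times> UNIV))"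
      using B by (intro QQ.measure_times) auto
    also have "\<dots> = (\<Prod>i\<in>I. emeasure (meas \<mu>) (B i))"
    proof (rule prod.cong[OF refl])
      fix i
      show "emeasure (marked_point \<mu>) (B i \<times> UNIV) = emeasure (meas \<mu>) (B i)"
        using B[of i] U.emeasure_space_1 by (subst U.emeasure_pair_measure_Times) simp_all
    qed
    also have "\<dots> = (\<Prod>i\<in>J - {a}. emeasure (meas \<mu>) (A i))"
      using J I M.emeasure_space_1 by (intro prod.mono_neutral_cong_right) (auto simp: B_def)
    finally show "emeasure (distr ?\<Omega> (\<Pi>\<^sub>M i\<in>J. meas \<mu>) ?f) (Pi\<^sub>E J A) = (\<Prod>i\<in>J. emeasure (meas \<mu>) (A i))"
      by (simp only: prod.remove[OF \<open>finite J\<close> J(2)])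
  qed simp
qed

section \<open>Absence of ties\<close>

lemma AE_PiM_pair_neq:
  fixes g :: "'a \<Rightarrow> real"
  assumes M: "prob_space M" and I: "finite I" and g [measurable]: "g \<in> borel_measurable M"
    and null: "\<And>x. emeasure M {y \<in> space M. g y = x} = 0"
  shows "AE V in (\<Pi>\<^sub>M i\<in>I. M). inj_on (\<lambda>i. g (V i)) I"
proof -
  let ?P = "\<Pi>\<^sub>M i\<in>I. M"
  have 1: "AE V in ?P. g (V i) \<noteq> g (V j)" if ij: "i \<in> I" "j \<in> I" "i \<noteq> j" for i j
  proof (rule AE_I')
    have "emeasure ?P {V \<in> space ?P. g (V i) = g (V j)} \<le> 0"
    proof (rule PiM_pair_emeasure_le[OF M I ij])
      show "Measurable.pred (M \<Otimes>\<^sub>M M) (\<lambda>(x, y). g x = g y)" by measurable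
      show "emeasure M {y \<in> space M. g x = g y} \<le> 0" for x
        using null[of "g x"] by (simp add: eq_commute[of "g x"])
    qed
    moreover have "(\<lambda>V. g (V i)) \<in> borel_measurable ?P" "(\<lambda>V. g (V j)) \<in> borel_measurable ?P"
      using ij by (auto intro: measurable_compose[OF measurable_component_singleton[of _ I "\<lambda>_. M"] g])
    then have "{V \<in> space ?P. g (V i) = g (V j)} \<in> sets ?P" by (rule borel_measurable_eq)
    ultimately show "{V \<in> space ?P. g (V i) = g (V j)} \<in> null_sets ?P" by (simp add: null_sets_def)
  qed auto
  have "AE V in ?P. \<forall>i\<in>I. \<forall>j\<in>I. i \<noteq> j \<longrightarrow> g (V i) \<noteq> g (V j)"
  proof (intro AE_finite_allI I)
    fix i j assume "i \<in> I" "j \<in> I"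
    then show "AE V in ?P. i \<noteq> j \<longrightarrow> g (V i) \<noteq> g (V j)"
      using 1[of i j] by (cases "i = j") auto
  qed
  then show ?thesis by eventually_elim (unfold inj_on_def, blast)
qed

lemma AE_points_generic:
  fixes n :: nat
  shows "AE V in (\<Pi>\<^sub>M i\<in>{1..n}. meas \<mu>). inj_on (\<lambda>i. fst (V i)) {1..n} \<and> inj_on (\<lambda>i. snd (V i)) {1..n}"
proof -
  interpret M: prob_space "meas \<mu>" by simp
  have 0: "measure lborel ({0..1} \<inter> {x::real}) = 0" for x
    by (rule measure_eq_0_null_sets) (rule null_sets_subset[of "{x}"], auto)
  have 1: "emeasure (meas \<mu>) {y \<in> space (meas \<mu>). fst y = x} = 0" for x
    using measure_meas_fst[of "{x}" \<mu>] 0[of x] by (simp add: M.emeasure_eq_measure)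
  have 2: "emeasure (meas \<mu>) {y \<in> space (meas \<mu>). snd y = x} = 0" for x
    using measure_meas_snd[of "{x}" \<mu>] 0[of x] by (simp add: M.emeasure_eq_measure)
  have m: "fst \<in> borel_measurable (meas \<mu>)" "snd \<in> borel_measurable (meas \<mu>)"
    by (simp_all only: measurable_cong_sets[OF sets_meas refl] measurable_fst_borel measurable_snd_borel)
  show ?thesis
    by (rule AE_conjI) (rule AE_PiM_pair_neq, simp, simp, rule m, rule 1 2)+
qed

lemma AE_marks_generic:
  fixes k :: nat
  shows "AE q in (\<Pi>\<^sub>M i\<in>{1..k}. marked_point \<mu>).
     (\<forall>i\<in>{1..k}. 0 \<le> snd (q i) \<and> snd (q i) \<le> 1) \<and> inj_on (\<lambda>i. snd (q i)) {1..k}"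
proof (rule AE_conjI)
  interpret M: prob_space "meas \<mu>" by simp
  interpret U: prob_space unif01 by (rule prob_space_unif01)
  have em: "emeasure (marked_point \<mu>) (UNIV \<times> A) = emeasure lborel ({0..1} \<inter> A)" if A: "A \<in> sets borel" for A
    using U.emeasure_pair_measure_Times[of UNIV "meas \<mu>" A] M.emeasure_space_1 emeasure_unif01[OF A] A
    by simp
  have snd: "snd \<in> borel_measurable (marked_point \<mu>)"
    using measurable_snd[of "meas \<mu>" unif01] by simp
  have "AE q in marked_point \<mu>. 0 \<le> snd q \<and> snd q \<le> 1"
  proof (rule AE_I')
    have "UNIV \<times> - {0..1::real} \<in> sets (marked_point \<mu>)" by (intro pair_measureI) auto
    then show "UNIV \<times> - {0..1} \<in> null_sets (marked_point \<mu>)"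
      using em[of "- {0..1}"] by (simp add: null_sets_def)
  qed auto
  then show "AE q in (\<Pi>\<^sub>M i\<in>{1..k}. marked_point \<mu>). \<forall>i\<in>{1..k}. 0 \<le> snd (q i) \<and> snd (q i) \<le> 1"
    by (intro AE_finite_allI AE_PiM_component) (auto simp: prob_space_marked_point)
  show "AE q in (\<Pi>\<^sub>M i\<in>{1..k}. marked_point \<mu>). inj_on (\<lambda>i. snd (q i)) {1..k}"
  proof (intro AE_PiM_pair_neq prob_space_marked_point snd)
    fix x :: real
    have "{y \<in> space (marked_point \<mu>). snd y = x} = UNIV \<times> {x}" by auto
    moreover have "emeasure lborel ({0..1} \<inter> {x}) \<le> emeasure lborel {x}" by (intro emeasure_mono) auto
    ultimately show "emeasure (marked_point \<mu>) {y \<in> space (marked_point \<mu>). snd y = x} = 0"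
      using em[of "{x}"] by simp
  qed simp
qed

lemma inflated_forms_pair_sets:
  "{zq \<in> space (meas \<mu> \<Otimes>\<^sub>M (\<Pi>\<^sub>M i\<in>{1..k}. marked_point \<mu>)). inflated_forms k \<pi> \<epsilon> b S (fst zq) (snd zq)}
     \<in> sets (meas \<mu> \<Otimes>\<^sub>M (\<Pi>\<^sub>M i\<in>{1..k}. marked_point \<mu>))"
proof -
  let ?\<Omega> = "meas \<mu> \<Otimes>\<^sub>M (\<Pi>\<^sub>M i\<in>{1..k}. marked_point \<mu>)"
  have "Measurable.pred ?\<Omega> (\<lambda>zq. inflated_forms k \<pi> \<epsilon> b S (fst zq) (snd zq))"
  proof (rule measurable_inflated_forms)
    show "fst \<in> borel_measurable ?\<Omega>"
      using measurable_fst[of "meas \<mu>" "\<Pi>\<^sub>M i\<in>{1..k}. marked_point \<mu>"]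
      by (simp only: measurable_cong_sets[OF refl sets_meas])
    show "(\<lambda>zq. snd zq i) \<in> ?\<Omega> \<rightarrow>\<^sub>M marked_point \<mu>" if "i \<in> {1..k}" for i
      by (rule measurable_compose[OF measurable_snd measurable_component_singleton[OF that]])
  qed
  then show ?thesis by (simp only: pred_def)
qed

section \<open>Averages over the root for zero, one and two points on the diagonal\<close>

lemma inflated_prob_integral:
  shows "(\<lambda>z. inflated_prob k \<pi> \<epsilon> b \<mu> S z) \<in> borel_measurable borel" (is ?m)
    and "(\<integral>z. inflated_prob k \<pi> \<epsilon> b \<mu> S z \<partial>(meas \<mu>)) = measure (meas \<mu> \<Otimes>\<^sub>M (\<Pi>\<^sub>M i\<in>{1..k}. marked_point \<mu>))
     {zq \<in> space (meas \<mu> \<Otimes>\<^sub>M (\<Pi>\<^sub>M i\<in>{1..k}. marked_point \<mu>)). inflated_forms k \<pi> \<epsilon> b S (fst zq) (snd zq)}" (is ?i)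
proof -
  let ?QI = "\<Pi>\<^sub>M i\<in>{1..k}. marked_point \<mu>"
  let ?\<Omega> = "meas \<mu> \<Otimes>\<^sub>M ?QI"
  let ?E = "{zq \<in> space ?\<Omega>. inflated_forms k \<pi> \<epsilon> b S (fst zq) (snd zq)}"
  interpret M: prob_space "meas \<mu>" by simp
  interpret QI: prob_space ?QI by (rule prob_space_marked_points)
  have P: "emeasure ?QI (Pair z -` ?E) = ennreal (inflated_prob k \<pi> \<epsilon> b \<mu> S z)" for z
  proof -
    have "Pair z -` ?E = {q \<in> space ?QI. inflated_forms k \<pi> \<epsilon> b S z q}"
      by (rule set_eqI) (simp only: vimage_eq mem_Collect_eq space_pair_measure mem_Times_iff fst_conv snd_conv space_meas UNIV_I simp_thms)
    then show ?thesis by (simp only: inflated_prob_def QI.emeasure_eq_measure)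
  qed
  have m1: "(\<lambda>z. ennreal (inflated_prob k \<pi> \<epsilon> b \<mu> S z)) \<in> borel_measurable (meas \<mu>)"
    using QI.measurable_emeasure_Pair[OF inflated_forms_pair_sets[where k = k and \<pi> = \<pi> and \<epsilon> = \<epsilon> and b = b and S = S and \<mu> = \<mu>]] by (simp only: P)
  then have m2: "(\<lambda>z. inflated_prob k \<pi> \<epsilon> b \<mu> S z) \<in> borel_measurable (meas \<mu>)"
    using borel_measurable_enn2real[OF m1] by (simp only: enn2real_ennreal[OF inflated_prob_nonneg])
  then show ?m by (subst (asm) measurable_cong_sets[OF sets_meas refl])
  have "emeasure ?\<Omega> ?E = (\<integral>\<^sup>+ z. ennreal (inflated_prob k \<pi> \<epsilon> b \<mu> S z) \<partial>(meas \<mu>))"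
    using QI.emeasure_pair_measure_alt[OF inflated_forms_pair_sets[where k = k and \<pi> = \<pi> and \<epsilon> = \<epsilon> and b = b and S = S and \<mu> = \<mu>]] by (simp only: P)
  then show ?i
    unfolding measure_def integral_eq_nn_integral[OF m2 AE_I2[OF inflated_prob_nonneg]] by (rule arg_cong[OF sym])
qed

text \<open>With no point on the diagonal all points are displaced by the same strictly increasing
  maps, which leave every pattern intact for every root.\<close>

lemma inflated_prob_empty:
  assumes e: "0 < \<epsilon>" "\<epsilon> < 1"
  shows "inflated_prob k \<pi> \<epsilon> b \<mu> {} z = perm_density k \<pi> \<mu>"
proof -
  let ?I = "{1..k}"
  let ?QI = "\<Pi>\<^sub>M i\<in>?I. marked_point \<mu>" and ?P = "\<Pi>\<^sub>M i\<in>?I. meas \<mu>"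
  interpret M: prob_space "meas \<mu>" by simp
  interpret U: prob_space unif01 by (rule prob_space_unif01)
  have "distr ?QI ?P (compose ?I fst) = (\<Pi>\<^sub>M i\<in>?I. distr (marked_point \<mu>) (meas \<mu>) fst)"
    by (rule distr_PiM_finite_prob_space')
      (rule finite_atLeastAtMost prob_space_marked_point prob_space_meas measurable_fst)+
  also have "distr (marked_point \<mu>) (meas \<mu>) fst = meas \<mu>" by (rule U.distr_pair_fst)
  finally have d: "distr ?QI ?P (compose ?I fst) = ?P" .
  have m: "compose ?I fst \<in> ?QI \<rightarrow>\<^sub>M ?P"
    unfolding compose_def
  proof (rule measurable_restrict)
    fix i assume i: "i \<in> ?I"
    show "(\<lambda>x. fst (x i)) \<in> ?QI \<rightarrow>\<^sub>M meas \<mu>"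
      by (rule measurable_compose[OF measurable_component_singleton[OF i] measurable_fst])
  qed
  have pd: "Measurable.pred ?P (\<lambda>z. forms_diagram k \<pi> z)"
    by (rule forms_diagram_measurable)
      (rule measurable_compose[OF measurable_component_meas], assumption, simp)+
  have "perm_density k \<pi> \<mu> = measure (distr ?QI ?P (compose ?I fst)) {V \<in> space ?P. forms_diagram k \<pi> V}"
    unfolding perm_density_def d ..
  also have "\<dots> = measure ?QI (compose ?I fst -` {V \<in> space ?P. forms_diagram k \<pi> V} \<inter> space ?QI)"
    by (rule measure_distr[OF m]) (use pd in \<open>simp only: pred_def\<close>)
  also have "compose ?I fst -` {V \<in> space ?P. forms_diagram k \<pi> V} \<inter> space ?QI = {q \<in> space ?QI. inflated_forms k \<pi> \<epsilon> b {} z q}"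
  proof -
    have lt: "push_away s \<epsilon> x < push_away s \<epsilon> y \<longleftrightarrow> x < y" for s x y
      using push_away_strict_mono[of \<epsilon> x y s] push_away_strict_mono[of \<epsilon> y x s] e
      by (cases x y rule: linorder_cases) auto
    have "forms_diagram k \<pi> (compose ?I fst q) \<longleftrightarrow> inflated_forms k \<pi> \<epsilon> b {} z q" for q
      unfolding inflated_forms_def
      by (rule iffI; erule forms_diagram_mono) (simp_all only: inflated_point_def lt compose_def restrict_apply if_True if_False fst_conv snd_conv empty_iff)
    moreover have "compose ?I fst q \<in> space ?P" if "q \<in> space ?QI" for q
      using that by (rule measurable_space[OF m])
    ultimately show ?thesis by blast
  qed
  finally show ?thesis by (simp only: inflated_prob_def)
qed

lemma AE_marks_generic_pair:
  fixes k :: nat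
  shows "AE zq in meas \<mu> \<Otimes>\<^sub>M (\<Pi>\<^sub>M i\<in>{1..k}. marked_point \<mu>).
     (\<forall>i\<in>{1..k}. 0 \<le> snd (snd zq i) \<and> snd (snd zq i) \<le> 1) \<and> inj_on (\<lambda>i. snd (snd zq i)) {1..k}"
proof -
  let ?QI = "\<Pi>\<^sub>M i\<in>{1..k}. marked_point \<mu>"
  interpret M: prob_space "meas \<mu>" by simp
  interpret QI: prob_space ?QI by (rule prob_space_marked_points)
  interpret MQ: pair_prob_space "meas \<mu>" ?QI ..
  define G where "G q \<longleftrightarrow> (\<forall>i\<in>{1..k}. 0 \<le> snd (q i) \<and> snd (q i) \<le> 1) \<and> inj_on (\<lambda>i. snd (q i)) {1..k}"
    for q :: "nat \<Rightarrow> (real \<times> real) \<times> real"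
  have "AE q in ?QI. G q" unfolding G_def by (rule AE_marks_generic)
  then obtain N where N: "{q \<in> space ?QI. \<not> G q} \<subseteq> N" "emeasure ?QI N = 0" "N \<in> sets ?QI" by (rule AE_E)
  have "UNIV \<times> N \<in> null_sets (meas \<mu> \<Otimes>\<^sub>M ?QI)"
    using N(2,3) QI.emeasure_pair_measure_Times[of UNIV "meas \<mu>" N] by (simp add: null_sets_def)
  moreover have "{zq \<in> space (meas \<mu> \<Otimes>\<^sub>M ?QI). \<not> G (snd zq)} \<subseteq> UNIV \<times> N"
  proof
    fix zq assume "zq \<in> {zq \<in> space (meas \<mu> \<Otimes>\<^sub>M ?QI). \<not> G (snd zq)}"
    then have "snd zq \<in> {q \<in> space ?QI. \<not> G q}" unfolding space_pair_measure by (simp add: mem_Times_iff)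
    then show "zq \<in> UNIV \<times> N" using N(1) by (cases zq) (simp only: snd_conv mem_Times_iff, blast)
  qed
  ultimately have "AE zq in meas \<mu> \<Otimes>\<^sub>M ?QI. G (snd zq)" by (rule AE_I')
  then show ?thesis unfolding G_def .
qed

lemma AE_resampled_generic:
  fixes n k :: nat
  assumes "n \<le> k" and a: "a \<in> {1..n}"
  shows "AE zq in meas \<mu> \<Otimes>\<^sub>M (\<Pi>\<^sub>M i\<in>{1..k}. marked_point \<mu>).
    inj_on (\<lambda>i. fst (if i = a then fst zq else fst (snd zq i))) {1..n} \<and>
    inj_on (\<lambda>i. snd (if i = a then fst zq else fst (snd zq i))) {1..n}"
proof -
  have sub: "{1..n} \<subseteq> {1..k}" using assms by auto
  define G where "G V \<longleftrightarrow> inj_on (\<lambda>i. fst (V i)) {1..n} \<and> inj_on (\<lambda>i. snd (V i)) {1..n}" for V :: "nat \<Rightarrow> real \<times> real"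
  have "AE V in (\<Pi>\<^sub>M i\<in>{1..n}. meas \<mu>). G V" unfolding G_def by (rule AE_points_generic)
  then have "AE V in distr (meas \<mu> \<Otimes>\<^sub>M (\<Pi>\<^sub>M i\<in>{1..k}. marked_point \<mu>)) (\<Pi>\<^sub>M i\<in>{1..n}. meas \<mu>)
     (\<lambda>zq. \<lambda>i\<in>{1..n}. if i = a then fst zq else fst (snd zq i)). G V"
    by (simp only: distr_resample(1)[OF sub a finite_atLeastAtMost])
  then have "AE zq in meas \<mu> \<Otimes>\<^sub>M (\<Pi>\<^sub>M i\<in>{1..k}. marked_point \<mu>). G (\<lambda>i\<in>{1..n}. if i = a then fst zq else fst (snd zq i))"
    by (rule AE_distrD[OF distr_resample(2)[OF sub a finite_atLeastAtMost]])
  then show ?thesis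
    unfolding G_def inj_on_def by (simp only: restrict_apply if_True cong: ball_cong)
qed

text \<open>This is the cancellation of the term of order \<epsilon>. A single point on the diagonal
  compares with the others as the root does, and averaging over the root makes it one more
  independent sample. Choosing the last point is no restriction, by exchangeability.\<close>

lemma integral_inflated_prob_singleton:
  assumes e: "0 < \<epsilon>" "\<epsilon> < 1" and k: "1 \<le> k"
  shows "(\<integral>z. inflated_prob k \<pi> \<epsilon> b \<mu> {k} z \<partial>(meas \<mu>)) = perm_density k \<pi> \<mu>"
proof -
  let ?I = "{1..k}"
  let ?QI = "\<Pi>\<^sub>M i\<in>?I. marked_point \<mu>" and ?P = "\<Pi>\<^sub>M i\<in>?I. meas \<mu>"
  let ?\<Omega> = "meas \<mu> \<Otimes>\<^sub>M ?QI"
  let ?f = "\<lambda>zq. \<lambda>i\<in>?I. if i = k then fst zq else fst (snd zq i)"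
  have k': "k \<in> ?I" using k by simp
  interpret M: prob_space "meas \<mu>" by simp
  interpret QI: prob_space ?QI by (rule prob_space_marked_points)
  interpret MQ: pair_prob_space "meas \<mu>" ?QI ..
  note f = distr_resample[OF subset_refl k' finite_atLeastAtMost, of \<mu>]
  have pd: "Measurable.pred ?P (\<lambda>z. forms_diagram k \<pi> z)"
    by (rule forms_diagram_measurable)
      (rule measurable_compose[OF measurable_component_meas], assumption, simp)+
  then have F: "{V \<in> space ?P. forms_diagram k \<pi> V} \<in> sets ?P" by (simp only: pred_def)
  have "perm_density k \<pi> \<mu> = measure (distr ?\<Omega> ?P ?f) {V \<in> space ?P. forms_diagram k \<pi> V}"
    unfolding perm_density_def f(1) ..
  also have "\<dots> = measure ?\<Omega> (?f -` {V \<in> space ?P. forms_diagram k \<pi> V} \<inter> space ?\<Omega>)"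
    by (rule measure_distr[OF f(2) F])
  also have "\<dots> = measure ?\<Omega> {zq \<in> space ?\<Omega>. inflated_forms k \<pi> \<epsilon> b {k} (fst zq) (snd zq)}"
  proof (rule MQ.finite_measure_eq_AE)
    show "?f -` {V \<in> space ?P. forms_diagram k \<pi> V} \<inter> space ?\<Omega> \<in> sets ?\<Omega>"
      by (rule measurable_sets[OF f(2) F])
    show "{zq \<in> space ?\<Omega>. inflated_forms k \<pi> \<epsilon> b {k} (fst zq) (snd zq)} \<in> sets ?\<Omega>"
      by (rule inflated_forms_pair_sets)
    show "AE zq in ?\<Omega>. zq \<in> ?f -` {V \<in> space ?P. forms_diagram k \<pi> V} \<inter> space ?\<Omega> \<longleftrightarrow>
       zq \<in> {zq \<in> space ?\<Omega>. inflated_forms k \<pi> \<epsilon> b {k} (fst zq) (snd zq)}"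
      using AE_marks_generic_pair[of k \<mu>] AE_resampled_generic[OF order_refl k', of \<mu>] AE_space
    proof eventually_elim
      case (elim zq)
      define z q where "z = fst zq" and "q = snd zq"
      define V where "V i = (if i \<in> {k} then z else fst (q i))" for i
      define w where "w i = inflated_point \<epsilon> b z (i \<in> {k}) (q i)" for i
      have lt: "fst (V i) < fst (V j) \<Longrightarrow> fst (w i) < fst (w j)" "snd (V i) < snd (V j) \<Longrightarrow> snd (w i) < snd (w j)"
        if ij: "i \<in> ?I" "j \<in> ?I" for i j
      proof -
        have u: "0 \<le> snd (q i)" "snd (q i) \<le> 1" "0 \<le> snd (q j)" "snd (q j) \<le> 1" using elim ij by (auto simp: q_def)
        show "fst (w i) < fst (w j)" if "fst (V i) < fst (V j)"
          using that unfolding V_def w_def by (intro inflated_point_less(1)[OF e u]) auto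
        show "snd (w i) < snd (w j)" if "snd (V i) < snd (V j)"
          using that unfolding V_def w_def by (intro inflated_point_less(2)[OF e u]) auto
      qed
      \<comment> \<open>Strict order is transported from \<open>V\<close> to \<open>w\<close> only.
        Since \<open>V\<close> has no ties almost surely, the implication can be reversed by
        trichotomy.\<close>
      have inj: "inj_on (\<lambda>i. fst (V i)) ?I" "inj_on (\<lambda>i. snd (V i)) ?I"
        using elim unfolding V_def z_def q_def singleton_iff by blast+
      have "forms_diagram k \<pi> V \<longleftrightarrow> forms_diagram k \<pi> w"
      proof
        assume "forms_diagram k \<pi> w"
        then show "forms_diagram k \<pi> V"
        proof (rule forms_diagram_mono)
          fix i j assume ij: "i \<in> ?I" "j \<in> ?I"
          show "fst (V i) < fst (V j)" if "fst (w i) < fst (w j)"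
          proof -
            have "i \<noteq> j" using that by auto
            then have "fst (V i) \<noteq> fst (V j)" using inj(1) ij by (auto dest: inj_onD)
            moreover have "\<not> fst (V j) < fst (V i)" using lt(1)[OF ij(2,1)] that by auto
            ultimately show ?thesis by linarith
          qed
          show "snd (V i) < snd (V j)" if "snd (w i) < snd (w j)"
          proof -
            have "i \<noteq> j" using that by auto
            then have "snd (V i) \<noteq> snd (V j)" using inj(2) ij by (auto dest: inj_onD)
            moreover have "\<not> snd (V j) < snd (V i)" using lt(2)[OF ij(2,1)] that by auto
            ultimately show ?thesis by linarith
          qed
        qed
      next
        assume "forms_diagram k \<pi> V"
        then show "forms_diagram k \<pi> w" by (rule forms_diagram_mono) (rule lt; assumption)+
      qed
      moreover have "forms_diagram k \<pi> (?f zq) \<longleftrightarrow> forms_diagram k \<pi> V"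
        by (rule forms_diagram_cong) (simp only: V_def z_def q_def restrict_apply if_True singleton_iff)
      ultimately have "forms_diagram k \<pi> (?f zq) \<longleftrightarrow> inflated_forms k \<pi> \<epsilon> b {k} (fst zq) (snd zq)"
        unfolding inflated_forms_def w_def z_def q_def by (simp only:)
      then show ?case
        using elim(3) measurable_space[OF f(2) elim(3)] by (simp only: vimage_eq Int_iff mem_Collect_eq simp_thms)
    qed
  qed
  finally show ?thesis by (simp only: inflated_prob_integral)
qed

lemma sorts_diagram_sets:
  assumes "s permutes {1..n}"
  shows "{V \<in> space (\<Pi>\<^sub>M i\<in>{1..n}. meas \<mu>). sorts_diagram n \<tau> s V} \<in> sets (\<Pi>\<^sub>M i\<in>{1..n}. meas \<mu>)"
proof -
  let ?P = "\<Pi>\<^sub>M i\<in>{1..n}. meas \<mu>"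
  have c: "(\<lambda>V. fst (V (s i))) \<in> borel_measurable ?P" "(\<lambda>V. snd (V (s i))) \<in> borel_measurable ?P" if "i \<in> {1..n}" for i
  proof -
    have "s i \<in> {1..n}" using assms that by (simp only: permutes_in_image)
    then show "(\<lambda>V. fst (V (s i))) \<in> borel_measurable ?P" "(\<lambda>V. snd (V (s i))) \<in> borel_measurable ?P"
      by (rule measurable_compose[OF measurable_component_meas measurable_fst_borel],
          rule measurable_compose[OF measurable_component_meas measurable_snd_borel])
  qed
  have "Measurable.pred ?P (sorts_diagram n \<tau> s)"
    unfolding sorts_diagram_def[abs_def]
  proof (intro pred_intros_finite finite_atLeastAtMost)
    fix i j assume ij: "i \<in> {1..n}" "j \<in> {1..n}"
    have 1: "Measurable.pred ?P (\<lambda>V. fst (V (s i)) < fst (V (s j)))"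
      by (rule borel_measurable_pred_less[OF c(1)[OF ij(1)] c(1)[OF ij(2)]])
    have 2: "Measurable.pred ?P (\<lambda>V. snd (V (s i)) < snd (V (s j)))"
      by (rule borel_measurable_pred_less[OF c(2)[OF ij(1)] c(2)[OF ij(2)]])
    show "Measurable.pred ?P (\<lambda>V. (i < j \<longrightarrow> fst (V (s i)) < fst (V (s j))) \<and> (\<tau> i < \<tau> j \<longrightarrow> snd (V (s i)) < snd (V (s j))))"
      by (cases "i < j"; cases "\<tau> i < \<tau> j")
        (simp_all only: simp_thms 1 2 pred_intros_logic measurable_const space_count_space UNIV_I)
  qed
  then show ?thesis by (simp only: pred_def)
qed

text \<open>Decomposition according to the labelling that sorts the sample; the events are disjoint
  because the labelling is unique. The labelling tells which sample point occupies which place, and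
  this will locate the root.\<close>

lemma perm_density_sum_sorts:
  assumes \<tau>: "\<tau> permutes {1..n}"
  shows "perm_density n \<tau> \<mu> = (\<Sum>s | s permutes {1..n}. measure (\<Pi>\<^sub>M i\<in>{1..n}. meas \<mu>)
     {V \<in> space (\<Pi>\<^sub>M i\<in>{1..n}. meas \<mu>). sorts_diagram n \<tau> s V})"
proof -
  let ?P = "\<Pi>\<^sub>M i\<in>{1..n}. meas \<mu>" and ?S = "{s. s permutes {1..n}}"
  interpret P: prob_space ?P by (intro prob_space_PiM) simp
  have "{V \<in> space ?P. forms_diagram n \<tau> V} = (\<Union>s\<in>?S. {V \<in> space ?P. sorts_diagram n \<tau> s V})"
    by (auto simp: forms_diagram_iff)
  then have "perm_density n \<tau> \<mu> = P.prob (\<Union>s\<in>?S. {V \<in> space ?P. sorts_diagram n \<tau> s V})"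
    unfolding perm_density_def by (rule arg_cong)
  also have "\<dots> = (\<Sum>s\<in>?S. P.prob {V \<in> space ?P. sorts_diagram n \<tau> s V})"
  proof (rule P.finite_measure_finite_Union)
    show "finite ?S" by (rule finite_permutations) simp
    show "(\<lambda>s. {V \<in> space ?P. sorts_diagram n \<tau> s V}) ` ?S \<subseteq> P.events"
      by (rule image_subsetI) (simp only: sorts_diagram_sets mem_Collect_eq)
    have "{V \<in> space ?P. sorts_diagram n \<tau> s V} \<inter> {V \<in> space ?P. sorts_diagram n \<tau> t V} = {}"
      if "s permutes {1..n}" "t permutes {1..n}" "s \<noteq> t" for s t
    proof (rule ccontr)
      assume "\<not> ?thesis"
      then obtain V where "sorts_diagram n \<tau> s V" "sorts_diagram n \<tau> t V" by blast
      then have "s = t" by (rule sorts_diagram_unique(1)[OF that(1,2) \<tau> \<tau>])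
      then show False using that(3) by blast
    qed
    then show "disjoint_family_on (\<lambda>s. {V \<in> space ?P. sorts_diagram n \<tau> s V}) ?S"
      unfolding disjoint_family_on_def mem_Collect_eq by (intro ballI impI) simp
  qed
  finally show ?thesis .
qed

text \<open>Of the two points on the diagonal, \<open>a\<close> is replaced by the root and
  \<open>Suc n\<close> becomes its twin. If the first \<open>n\<close> points, with the root in
  place of \<open>a\<close>, form \<open>\<tau>\<close> through the labelling \<open>s\<close>, then
  the root occupies the place \<open>inv s a\<close>, and adding the twin duplicates this place in
  the direction \<open>b\<close>.\<close>

lemma integral_inflated_prob_pair:
  assumes e: "0 < \<epsilon>" "\<epsilon> < 1" and a: "a \<in> {1..n}" and \<pi>: "\<pi> permutes {1..Suc n}"
  shows "(\<integral>z. inflated_prob (Suc n) \<pi> \<epsilon> b \<mu> {a, Suc n} z \<partial>(meas \<mu>)) =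
    (\<Sum>\<tau> | \<tau> permutes {1..n}. \<Sum>s | s permutes {1..n}. of_bool (duplicate (inv s a) b \<tau> = \<pi>) *
      measure (\<Pi>\<^sub>M i\<in>{1..n}. meas \<mu>) {V \<in> space (\<Pi>\<^sub>M i\<in>{1..n}. meas \<mu>). sorts_diagram n \<tau> s V})"
proof -
  let ?I = "{1..Suc n}" and ?J = "{1..n}" and ?K = "{a, Suc n}"
  let ?QI = "\<Pi>\<^sub>M i\<in>?I. marked_point \<mu>" and ?P = "\<Pi>\<^sub>M i\<in>?J. meas \<mu>"
  let ?\<Omega> = "meas \<mu> \<Otimes>\<^sub>M ?QI"
  let ?f = "\<lambda>zq. \<lambda>i\<in>?J. if i = a then fst zq else fst (snd zq i)"
  let ?S = "{s. s permutes ?J}"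
  \<comment> \<open>The pairs of a permutation and a labelling for which duplication at the place of
    the root gives \<open>\<pi>\<close>.\<close>
  define W where "W = {ts \<in> ?S \<times> ?S. duplicate (inv (snd ts) a) b (fst ts) = \<pi>}"
  define D where "D ts = {V \<in> space ?P. sorts_diagram n (fst ts) (snd ts) V}" for ts
  have finS: "finite ?S" by (rule finite_permutations) simp
  have finW: "finite W" unfolding W_def using finS by simp
  have WS: "fst ts permutes ?J" "snd ts permutes ?J" if "ts \<in> W" for ts using that by (auto simp: W_def)
  have sub: "?J \<subseteq> ?I" by auto
  interpret M: prob_space "meas \<mu>" by simp
  interpret P: prob_space ?P by (intro prob_space_PiM) simp
  interpret QI: prob_space ?QI by (rule prob_space_marked_points)
  interpret MQ: pair_prob_space "meas \<mu>" ?QI ..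
  note f = distr_resample[OF sub a finite_atLeastAtMost, of \<mu>]
  have Dm: "D ts \<in> sets ?P" if "ts \<in> W" for ts
    unfolding D_def using WS(2)[OF that] by (rule sorts_diagram_sets)
  have UD: "(\<Union>ts\<in>W. D ts) \<in> sets ?P" by (rule sets.finite_UN[OF finW Dm])
  have "(\<Sum>\<tau>\<in>?S. \<Sum>s\<in>?S. of_bool (duplicate (inv s a) b \<tau> = \<pi>) * P.prob {V \<in> space ?P. sorts_diagram n \<tau> s V})
     = (\<Sum>ts\<in>?S \<times> ?S. of_bool (duplicate (inv (snd ts) a) b (fst ts) = \<pi>) * P.prob (D ts))"
    unfolding D_def sum.cartesian_product by (simp add: case_prod_beta')
  also have "\<dots> = (\<Sum>ts\<in>W. P.prob (D ts))"
    unfolding W_def using finS by (intro sum.mono_neutral_cong_right) auto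
  also have "\<dots> = P.prob (\<Union>ts\<in>W. D ts)"
  proof (rule P.finite_measure_finite_Union[symmetric, OF finW])
    show "D ` W \<subseteq> P.events" using Dm by blast
    show "disjoint_family_on D W"
      unfolding disjoint_family_on_def
    proof (intro ballI impI)
      fix t t' assume t: "t \<in> W" "t' \<in> W" "t \<noteq> t'"
      show "D t \<inter> D t' = {}"
      proof (rule ccontr)
        assume "D t \<inter> D t' \<noteq> {}"
        then obtain V where V: "sorts_diagram n (fst t) (snd t) V" "sorts_diagram n (fst t') (snd t') V"
          unfolding D_def by blast
        have "snd t = snd t'" "fst t = fst t'"
          using sorts_diagram_unique[OF WS(2)[OF t(1)] WS(2)[OF t(2)] WS(1)[OF t(1)] WS(1)[OF t(2)] V] by simp_all
        then show False using t(3) by (simp add: prod_eq_iff)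
      qed
    qed
  qed
  also have "\<dots> = measure (distr ?\<Omega> ?P ?f) (\<Union>ts\<in>W. D ts)" unfolding f(1) ..
  also have "\<dots> = measure ?\<Omega> (?f -` (\<Union>ts\<in>W. D ts) \<inter> space ?\<Omega>)"
    by (rule measure_distr[OF f(2) UD])
  also have "\<dots> = measure ?\<Omega> {zq \<in> space ?\<Omega>. inflated_forms (Suc n) \<pi> \<epsilon> b ?K (fst zq) (snd zq)}"
  proof (rule MQ.finite_measure_eq_AE)
    show "?f -` (\<Union>ts\<in>W. D ts) \<inter> space ?\<Omega> \<in> sets ?\<Omega>"
      by (rule measurable_sets[OF f(2) UD])
    show "{zq \<in> space ?\<Omega>. inflated_forms (Suc n) \<pi> \<epsilon> b ?K (fst zq) (snd zq)} \<in> sets ?\<Omega>"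
      by (rule inflated_forms_pair_sets)
    have nk: "n \<le> Suc n" by simp
    show "AE zq in ?\<Omega>. zq \<in> ?f -` (\<Union>ts\<in>W. D ts) \<inter> space ?\<Omega> \<longleftrightarrow>
       zq \<in> {zq \<in> space ?\<Omega>. inflated_forms (Suc n) \<pi> \<epsilon> b ?K (fst zq) (snd zq)}"
      using AE_marks_generic_pair[of "Suc n" \<mu>] AE_resampled_generic[OF nk a, of \<mu>] AE_space
    proof eventually_elim
      case (elim zq)
      define z q where "z = fst zq" and "q = snd zq"
      define V where "V = ?f zq"
      define w where "w i = inflated_point \<epsilon> b z (i \<in> ?K) (q i)" for i
      have V: "V i = (if i = a then z else fst (q i))" if "i \<in> ?J" for i
        using that unfolding V_def z_def q_def by (simp only: restrict_apply if_True)
      have VP: "V \<in> space ?P" unfolding V_def by (rule measurable_space[OF f(2) elim(3)])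
      have inj: "inj_on (\<lambda>i. fst (V i)) ?J" "inj_on (\<lambda>i. snd (V i)) ?J"
      proof -
        have i1: "inj_on (\<lambda>i. fst (if i = a then z else fst (q i))) ?J" and i2: "inj_on (\<lambda>i. snd (if i = a then z else fst (q i))) ?J"
          using elim(2) unfolding z_def q_def by blast+
        show "inj_on (\<lambda>i. fst (V i)) ?J" using i1 by (rule inj_on_cong[THEN iffD1, rotated]) (simp only: V)
        show "inj_on (\<lambda>i. snd (V i)) ?J" using i2 by (rule inj_on_cong[THEN iffD1, rotated]) (simp only: V)
      qed
      then obtain \<tau> s where \<tau>: "\<tau> permutes ?J" and s: "s permutes ?J" and sV: "sorts_diagram n \<tau> s V"
        using ex_sorts_diagram[of V n] by blast
      define i where "i = inv s a"
      have i: "i \<in> ?J" unfolding i_def using permutes_in_image[OF permutes_inv[OF s]] a by blast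
      have si: "s i = a" unfolding i_def by (rule permutes_inverses(1)[OF s])
      have u: "0 \<le> snd (q j)" "snd (q j) \<le> 1" if "j \<in> ?I" for j using elim(1) that unfolding q_def by blast+
      define c where "c j = (if j = Suc n then s i else j)" for j
      have Vc: "V (c j) = (if j \<in> ?K then z else fst (q j))" if "j \<in> ?I" for j
        using that a V[of j] V[OF a] unfolding c_def si by auto
      have "forms_diagram (Suc n) \<pi> w \<longleftrightarrow> duplicate i b \<tau> = \<pi>"
      proof (rule forms_diagram_duplicate_iff[OF \<tau> s sV i \<pi>])
        fix j l assume jl: "j \<in> ?I" "l \<in> ?I"
        show "fst (w j) < fst (w l)" if "fst (V (if j = Suc n then s i else j)) < fst (V (if l = Suc n then s i else l))"
        proof -
          have lt: "fst (V (c j)) < fst (V (c l))" using that unfolding c_def .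
          then have "\<not> (j \<in> ?K \<and> l \<in> ?K)" using Vc[OF jl(1)] Vc[OF jl(2)] by auto
          then show ?thesis
            using lt unfolding w_def Vc[OF jl(1)] Vc[OF jl(2)] by (intro inflated_point_less(1)[OF e] u jl)
        qed
        show "snd (w j) < snd (w l)" if "snd (V (if j = Suc n then s i else j)) < snd (V (if l = Suc n then s i else l))"
        proof -
          have lt: "snd (V (c j)) < snd (V (c l))" using that unfolding c_def .
          then have "\<not> (j \<in> ?K \<and> l \<in> ?K)" using Vc[OF jl(1)] Vc[OF jl(2)] by auto
          then show ?thesis
            using lt unfolding w_def Vc[OF jl(1)] Vc[OF jl(2)] by (intro inflated_point_less(2)[OF e] u jl)
        qed
      next
        \<comment> \<open>The relative positions on the diagonal differ almost surely. Their order
          fixes the left twin, and \<open>b\<close> decides whether the ordinates are ordered in the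
          same way.\<close>
        have "a \<noteq> Suc n" using a by auto
        moreover have "inj_on (\<lambda>i. snd (q i)) ?I" using elim(1) unfolding q_def by blast
        ultimately have "snd (q a) \<noteq> snd (q (Suc n))" using a by (auto dest!: inj_onD)
        then have "\<epsilon> * snd (q a) < \<epsilon> * snd (q (Suc n)) \<or> \<epsilon> * snd (q (Suc n)) < \<epsilon> * snd (q a)"
          using e(1) by (simp add: linorder_neq_iff)
        then show "fst (w (s i)) < fst (w (Suc n)) \<and> (if b then snd (w (s i)) < snd (w (Suc n)) else snd (w (Suc n)) < snd (w (s i)))
          \<or> fst (w (Suc n)) < fst (w (s i)) \<and> (if b then snd (w (Suc n)) < snd (w (s i)) else snd (w (s i)) < snd (w (Suc n)))"
        proof -
          have w: "w j = ((1 - \<epsilon>) * fst z + \<epsilon> * snd (q j), (1 - \<epsilon>) * snd z + (if b then \<epsilon> * snd (q j) else \<epsilon> - \<epsilon> * snd (q j)))"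
            if "j \<in> ?K" for j
            using that by (simp add: w_def inflated_point_def right_diff_distrib)
          assume "\<epsilon> * snd (q a) < \<epsilon> * snd (q (Suc n)) \<or> \<epsilon> * snd (q (Suc n)) < \<epsilon> * snd (q a)"
          then show ?thesis
            unfolding si w[OF insertI1] w[OF insertI2[OF singletonI]] fst_conv snd_conv by (cases b) (simp_all only: if_True if_False, linarith+)
        qed
      qed
      moreover have "V \<in> (\<Union>ts\<in>W. D ts) \<longleftrightarrow> duplicate i b \<tau> = \<pi>"
      proof
        assume "V \<in> (\<Union>ts\<in>W. D ts)"
        then obtain t where t: "t \<in> W" "sorts_diagram n (fst t) (snd t) V" unfolding D_def by blast
        have "snd t = s" "fst t = \<tau>"
          using sorts_diagram_unique[OF WS(2)[OF t(1)] s WS(1)[OF t(1)] \<tau> t(2) sV] by simp_all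
        then show "duplicate i b \<tau> = \<pi>" using t(1) unfolding W_def i_def by simp
      next
        assume "duplicate i b \<tau> = \<pi>"
        then have "(\<tau>, s) \<in> W" using \<tau> s unfolding W_def i_def by simp
        moreover have "V \<in> D (\<tau>, s)" using sV VP unfolding D_def by simp
        ultimately show "V \<in> (\<Union>ts\<in>W. D ts)" by blast
      qed
      ultimately have "V \<in> (\<Union>ts\<in>W. D ts) \<longleftrightarrow> inflated_forms (Suc n) \<pi> \<epsilon> b ?K (fst zq) (snd zq)"
        unfolding inflated_forms_def w_def z_def q_def by (simp only:)
      then show ?case
        using elim(3) unfolding V_def by (simp only: vimage_eq Int_iff mem_Collect_eq simp_thms)
    qed
  qed
  finally show ?thesis by (simp only: inflated_prob_integral)
qed

section \<open>From averages over the root to the up-step, and the expansion in powers of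
  \<epsilon>\<close>

lemma pmf_up_step:
  assumes n: "1 \<le> n" and p: "0 \<le> p" "p \<le> 1"
  shows "pmf (up_step p n \<tau>) \<pi> =
    (p * (\<Sum>i\<in>{1..n}. of_bool (duplicate i True \<tau> = \<pi>)) + (1 - p) * (\<Sum>i\<in>{1..n}. of_bool (duplicate i False \<tau> = \<pi>))) / n"
proof -
  let ?P = "pair_pmf (pmf_of_set {1..n}) (bernoulli_pmf p)"
  let ?f = "\<lambda>(i, b). duplicate i b \<tau>"
  have ne: "{1..n} \<noteq> {}" using n by simp
  have "pmf (up_step p n \<tau>) \<pi> = measure ?P (?f -` {\<pi>})"
    unfolding up_step_def by (rule pmf_map)
  also have "\<dots> = (\<integral>x. indicator (?f -` {\<pi>}) x \<partial>measure_pmf ?P)"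
    by simp
  also have "\<dots> = (\<Sum>x\<in>{1..n} \<times> UNIV. pmf ?P x *\<^sub>R indicator (?f -` {\<pi>}) x)"
    by (rule integral_measure_pmf) (use ne in auto)
  also have "\<dots> = (\<Sum>i\<in>{1..n}. \<Sum>b\<in>UNIV. pmf ?P (i, b) * of_bool (duplicate i b \<tau> = \<pi>))"
    by (simp add: sum.cartesian_product indicator_def of_bool_def case_prod_beta')
  also have "\<dots> = (\<Sum>i\<in>{1..n}. (p * of_bool (duplicate i True \<tau> = \<pi>) + (1 - p) * of_bool (duplicate i False \<tau> = \<pi>)) / n)"
    by (rule sum.cong) (use p ne in \<open>auto simp: UNIV_bool pmf_pair add_divide_distrib\<close>)
  also have "\<dots> = (p * (\<Sum>i\<in>{1..n}. of_bool (duplicate i True \<tau> = \<pi>)) + (1 - p) * (\<Sum>i\<in>{1..n}. of_bool (duplicate i False \<tau> = \<pi>))) / n"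
    by (simp only: sum_divide_distrib[symmetric] sum.distrib sum_distrib_left)
  finally show ?thesis .
qed

text \<open>For a fixed labelling \<open>s\<close> the place \<open>inv s a\<close> of the root runs
  through all of \<open>{1..n}\<close> when \<open>a\<close> does. Summing over \<open>a\<close>
  thus produces the uniform choice of the duplicated point in \<open>up_step\<close>, and the sum
  over \<open>s\<close> recovers the pattern density.\<close>

lemma sum_integral_inflated_prob_pair:
  assumes e: "0 < \<epsilon>" "\<epsilon> < 1" and \<pi>: "\<pi> permutes {1..Suc n}"
  shows "(\<Sum>a\<in>{1..n}. \<integral>z. inflated_prob (Suc n) \<pi> \<epsilon> b \<mu> {a, Suc n} z \<partial>(meas \<mu>)) =
    (\<Sum>\<tau> | \<tau> permutes {1..n}. (\<Sum>i\<in>{1..n}. of_bool (duplicate i b \<tau> = \<pi>)) * perm_density n \<tau> \<mu>)"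
proof -
  define m where "m \<tau> s = measure (\<Pi>\<^sub>M i\<in>{1..n}. meas \<mu>) {V \<in> space (\<Pi>\<^sub>M i\<in>{1..n}. meas \<mu>). sorts_diagram n \<tau> s V}" for \<tau> s
  let ?S = "{s. s permutes {1..n}}"
  have "(\<Sum>a\<in>{1..n}. \<integral>z. inflated_prob (Suc n) \<pi> \<epsilon> b \<mu> {a, Suc n} z \<partial>(meas \<mu>)) =
     (\<Sum>a\<in>{1..n}. \<Sum>\<tau>\<in>?S. \<Sum>s\<in>?S. of_bool (duplicate (inv s a) b \<tau> = \<pi>) * m \<tau> s)"
    unfolding m_def by (rule sum.cong[OF refl]) (rule integral_inflated_prob_pair[OF e _ \<pi>])
  also have "\<dots> = (\<Sum>\<tau>\<in>?S. \<Sum>s\<in>?S. \<Sum>a\<in>{1..n}. of_bool (duplicate (inv s a) b \<tau> = \<pi>) * m \<tau> s)"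
    by (subst sum.swap) (rule sum.cong[OF refl], rule sum.swap)
  also have "\<dots> = (\<Sum>\<tau>\<in>?S. \<Sum>s\<in>?S. (\<Sum>i\<in>{1..n}. of_bool (duplicate i b \<tau> = \<pi>)) * m \<tau> s)"
  proof (rule sum.cong[OF refl], rule sum.cong[OF refl])
    fix \<tau> s assume "s \<in> ?S"
    then have "inv s permutes {1..n}" by (simp add: permutes_inv)
    from sum.permute[OF this, of "\<lambda>i. of_bool (duplicate i b \<tau> = \<pi>) * m \<tau> s"]
    show "(\<Sum>a\<in>{1..n}. of_bool (duplicate (inv s a) b \<tau> = \<pi>) * m \<tau> s) = (\<Sum>i\<in>{1..n}. of_bool (duplicate i b \<tau> = \<pi>)) * m \<tau> s"
      by (simp only: comp_def sum_distrib_right)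
  qed
  also have "\<dots> = (\<Sum>\<tau>\<in>?S. (\<Sum>i\<in>{1..n}. of_bool (duplicate i b \<tau> = \<pi>)) * perm_density n \<tau> \<mu>)"
    by (rule sum.cong[OF refl]) (simp only: mem_Collect_eq perm_density_sum_sorts m_def sum_distrib_left)
  finally show ?thesis .
qed

lemma expect_Inf_perm_density:
  assumes e: "0 < \<epsilon>" "\<epsilon> < 1" and p: "0 \<le> p" "p \<le> 1"
  shows "expect_Inf p \<epsilon> (perm_density k \<pi>) \<mu> = (\<Sum>S\<in>Pow {1..k}. \<epsilon> ^ card S * (1 - \<epsilon>) ^ card ({1..k} - S) *
     (p * (\<integral>z. inflated_prob k \<pi> \<epsilon> True \<mu> S z \<partial>(meas \<mu>)) + (1 - p) * (\<integral>z. inflated_prob k \<pi> \<epsilon> False \<mu> S z \<partial>(meas \<mu>))))"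
proof -
  interpret M: prob_space "meas \<mu>" by simp
  interpret B: prob_space "measure_pmf (bernoulli_pmf p)" by (rule prob_space_measure_pmf)
  interpret MB: pair_prob_space "meas \<mu>" "measure_pmf (bernoulli_pmf p)" ..
  let ?w = "\<lambda>S. \<epsilon> ^ card S * (1 - \<epsilon>) ^ card ({1..k} - S)"
  define g where "g b z = (\<Sum>S\<in>Pow {1..k}. ?w S * inflated_prob k \<pi> \<epsilon> b \<mu> S z)" for b z
  \<comment> \<open>Outside the unit square \<open>inflate\<close> leaves the permuton unchanged;
    this null set is carried along until the inner integral has been computed.\<close>
  define h where "h b z = (if z \<in> {0..1} \<times> {0..1} then g b z else perm_density k \<pi> \<mu>)" for b and z :: "real \<times> real"
  have hp: "perm_density k \<pi> (inflate \<epsilon> b z \<mu>) = h b z" for b z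
    using perm_density_inflate[OF e, of z k \<pi> b \<mu>] by (simp add: h_def g_def inflate_def)
  have h1: "\<bar>h b z\<bar> \<le> 1" for b z
    unfolding hp[symmetric] by (simp add: perm_density_nonneg perm_density_le_1)
  have ipm: "inflated_prob k \<pi> \<epsilon> b \<mu> S \<in> borel_measurable (meas \<mu>)" for b S
    using inflated_prob_integral(1) by (simp only: measurable_cong_sets[OF sets_meas refl])
  have gm: "g b \<in> borel_measurable (meas \<mu>)" for b
    unfolding g_def[abs_def] by (intro borel_measurable_sum borel_measurable_times borel_measurable_const ipm)
  have sq: "{0..1} \<times> {0..1} \<in> sets (meas \<mu>)" unfolding sets_meas by (intro borel_Times) auto
  have hm: "h b \<in> borel_measurable (meas \<mu>)" for b
    unfolding h_def[abs_def] by (rule measurable_If_set[OF gm]) (use sq in simp_all)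
  let ?F = "\<lambda>zb. if snd zb then h True (fst zb) else h False (fst zb)"
  have Fm: "?F \<in> borel_measurable (meas \<mu> \<Otimes>\<^sub>M measure_pmf (bernoulli_pmf p))"
  proof (rule measurable_If)
    show "(\<lambda>zb. h True (fst zb)) \<in> borel_measurable (meas \<mu> \<Otimes>\<^sub>M measure_pmf (bernoulli_pmf p))"
      "(\<lambda>zb. h False (fst zb)) \<in> borel_measurable (meas \<mu> \<Otimes>\<^sub>M measure_pmf (bernoulli_pmf p))"
      by (rule measurable_compose[OF measurable_fst hm])+
    show "{zb \<in> space (meas \<mu> \<Otimes>\<^sub>M measure_pmf (bernoulli_pmf p)). snd zb} \<in> sets (meas \<mu> \<Otimes>\<^sub>M measure_pmf (bernoulli_pmf p))"
      using measurable_sets[OF measurable_snd, of "{True}" "measure_pmf (bernoulli_pmf p)" "meas \<mu>"]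
      by (simp add: vimage_def Int_def conj_commute)
  qed
  have "expect_Inf p \<epsilon> (perm_density k \<pi>) \<mu> = (\<integral>zb. ?F zb \<partial>(meas \<mu> \<Otimes>\<^sub>M measure_pmf (bernoulli_pmf p)))"
    unfolding expect_Inf_def hp by (intro Bochner_Integration.integral_cong) auto
  also have "\<dots> = (\<integral>z. (\<integral>b. ?F (z, b) \<partial>measure_pmf (bernoulli_pmf p)) \<partial>(meas \<mu>))"
  proof (rule MB.integral_fst'[symmetric])
    show "integrable (meas \<mu> \<Otimes>\<^sub>M measure_pmf (bernoulli_pmf p)) ?F"
      by (rule MB.integrable_const_bound[of _ 1]) (use h1 Fm in auto)
  qed
  also have "\<dots> = (\<integral>z. p * g True z + (1 - p) * g False z \<partial>(meas \<mu>))"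
  proof (rule Bochner_Integration.integral_cong_AE)
    have "AE z in meas \<mu>. z \<in> {0..1} \<times> {0..1}"
      using AE_meas_square[of \<mu>] by eventually_elim (auto simp: mem_Times_iff)
    then show "AE z in meas \<mu>. (\<integral>b. ?F (z, b) \<partial>measure_pmf (bernoulli_pmf p)) = p * g True z + (1 - p) * g False z"
      by eventually_elim (use p in \<open>simp add: h_def\<close>)
    have "(\<lambda>z. \<integral>b. ?F (z, b) \<partial>measure_pmf (bernoulli_pmf p)) = (\<lambda>z. h True z * p + h False z * (1 - p))"
      using p by (simp add: fun_eq_iff)
    then show "(\<lambda>z. \<integral>b. ?F (z, b) \<partial>measure_pmf (bernoulli_pmf p)) \<in> borel_measurable (meas \<mu>)"
      using hm by simp
  qed (use gm in simp)
  also have "\<dots> = p * (\<integral>z. g True z \<partial>(meas \<mu>)) + (1 - p) * (\<integral>z. g False z \<partial>(meas \<mu>))"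
  proof -
    have ib: "integrable (meas \<mu>) (inflated_prob k \<pi> \<epsilon> b \<mu> S)" for b S
      by (rule M.integrable_const_bound[of _ 1]) (use ipm in \<open>auto simp: inflated_prob_le_1 inflated_prob_nonneg\<close>)
    then have "integrable (meas \<mu>) (g b)" for b
      unfolding g_def[abs_def] by (intro Bochner_Integration.integrable_sum integrable_mult_right)
    then show ?thesis by simp
  qed
  also have "\<dots> = (\<Sum>S\<in>Pow {1..k}. ?w S * (p * (\<integral>z. inflated_prob k \<pi> \<epsilon> True \<mu> S z \<partial>(meas \<mu>)) + (1 - p) * (\<integral>z. inflated_prob k \<pi> \<epsilon> False \<mu> S z \<partial>(meas \<mu>))))"
  proof -
    have ib: "integrable (meas \<mu>) (inflated_prob k \<pi> \<epsilon> b \<mu> S)" for b S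
      by (rule M.integrable_const_bound[of _ 1]) (use ipm in \<open>auto simp: inflated_prob_le_1 inflated_prob_nonneg\<close>)
    have "(\<integral>z. g b z \<partial>(meas \<mu>)) = (\<Sum>S\<in>Pow {1..k}. ?w S * (\<integral>z. inflated_prob k \<pi> \<epsilon> b \<mu> S z \<partial>(meas \<mu>)))" for b
      unfolding g_def by (subst Bochner_Integration.integral_sum) (auto intro!: integrable_mult_right ib)
    then show ?thesis
      by (simp add: sum_distrib_left sum.distrib[symmetric] distrib_left ac_simps)
  qed
  finally show ?thesis .
qed

lemma sum_Pow_binomial:
  fixes x y :: real
  assumes "finite I"
  shows "(\<Sum>S\<in>Pow I. x ^ card S * y ^ card (I - S)) = (x + y) ^ card I"
  using prod_add[OF assms, of "\<lambda>_. x" "\<lambda>_. y"] by simp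

text \<open>In the expansion over subsets, sets of size 0 and 1 contribute the density itself and
  cancel. The \<open>k choose 2\<close> pairs contribute
  \<open>\<epsilon>\<^sup>2 * (1 - \<epsilon>) ^ (k - 2) * (U - ?d)\<close> each, where
  \<open>?d\<close> is the density of \<open>\<pi>\<close>; replacing the power of
  \<open>1 - \<epsilon>\<close> by 1 costs at most \<open>k ^ 3 * \<epsilon>\<close> by Bernoulli's
  inequality. At most \<open>2 ^ k\<close> larger sets, of weight at most
  \<open>\<epsilon> ^ 3\<close>, give the other constant.\<close>

lemma generator_perm_density:
  fixes \<mu> :: permuton
  assumes e: "0 < \<epsilon>" "\<epsilon> < 1" and p: "0 \<le> p" "p \<le> 1" and k: "1 \<le> k" and \<pi>: "\<pi> permutes {1..k}"
  defines "U \<equiv> (\<Sum>\<tau> | \<tau> permutes {1..k - 1}. pmf (up_step p (k - 1) \<tau>) \<pi> * perm_density (k - 1) \<tau> \<mu>)"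
  shows "\<bar>2 / \<epsilon>\<^sup>2 * (expect_Inf p \<epsilon> (perm_density k \<pi>) \<mu> - perm_density k \<pi> \<mu>)
     - (- real (k * (k - 1)) * (perm_density k \<pi> \<mu> - U))\<bar> \<le> (real k ^ 3 + 2 * 2 ^ k) * \<epsilon>"
proof -
  let ?I = "{1..k}" and ?d = "perm_density k \<pi> \<mu>"
  let ?w = "\<lambda>S. \<epsilon> ^ card S * (1 - \<epsilon>) ^ card (?I - S)"
  define J where "J b S = (\<integral>z. inflated_prob k \<pi> \<epsilon> b \<mu> S z \<partial>(meas \<mu>))" for b S
  \<comment> \<open>Probability of the pattern given that exactly the points in \<open>S\<close> are
    on the diagonal, averaged over root and direction.\<close>
  define a where "a S = p * J True S + (1 - p) * J False S" for S
  interpret M: prob_space "meas \<mu>" by simp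
  have J01: "0 \<le> J b S" "J b S \<le> 1" for b S
  proof -
    show "0 \<le> J b S" unfolding J_def by (rule Bochner_Integration.integral_nonneg) (rule inflated_prob_nonneg)
    have "inflated_prob k \<pi> \<epsilon> b \<mu> S \<in> borel_measurable (meas \<mu>)"
      using inflated_prob_integral(1) by (simp only: measurable_cong_sets[OF sets_meas refl])
    then show "J b S \<le> 1" unfolding J_def
      by (intro M.integral_le_const M.integrable_const_bound[of _ 1]) (auto simp: inflated_prob_nonneg inflated_prob_le_1)
  qed
  have Jcong: "J b S = J b T" if "S \<subseteq> ?I" "T \<subseteq> ?I" "card S = card T" for b S T
    unfolding J_def inflated_prob_cong_card[OF that] ..
  have a01: "0 \<le> a S" "a S \<le> 1" for S
    unfolding a_def using p J01 by (auto intro!: add_nonneg_nonneg mult_nonneg_nonneg convex_bound_le)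
  have d01: "0 \<le> ?d" "?d \<le> 1" by (rule perm_density_nonneg perm_density_le_1)+
  have a0: "a {} = ?d"
    unfolding a_def J_def inflated_prob_empty[OF e] by (simp add: M.prob_space[simplified] algebra_simps)
  have a1: "a S = ?d" if "S \<subseteq> ?I" "card S = 1" for S
  proof -
    have "J b S = ?d" for b
      using Jcong[of S "{k}" b] that k integral_inflated_prob_singleton[OF e k] by (simp add: J_def)
    then show ?thesis by (simp add: a_def algebra_simps)
  qed
  have a2: "a S = U" if S: "S \<subseteq> ?I" "card S = 2" for S
  proof -
    obtain n where kn: "k = Suc n" using k by (cases k) auto
    have "card S \<le> card ?I" using S by (intro card_mono) auto
    then have n: "1 \<le> n" using S kn by simp
    have S2: "J b S = J b {c, Suc n}" if "c \<in> {1..n}" for b c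
      using that S kn by (intro Jcong) auto
    define m where "m b \<tau> = (\<Sum>i\<in>{1..n}. of_bool (duplicate i b \<tau> = \<pi>) :: real)" for b \<tau>
    \<comment> \<open>By exchangeability every pair has the same probability, so \<open>n\<close>
      copies of it are the sum over the pairs \<open>{c, Suc n}\<close>.\<close>
    have nJ: "n * J b S = (\<Sum>\<tau> | \<tau> permutes {1..n}. m b \<tau> * perm_density n \<tau> \<mu>)" for b
    proof -
      have "n * J b S = (\<Sum>c\<in>{1..n}. J b S)" by simp
      also have "\<dots> = (\<Sum>c\<in>{1..n}. J b {c, Suc n})" by (rule sum.cong[OF refl]) (rule S2)
      also have "\<dots> = (\<Sum>\<tau> | \<tau> permutes {1..n}. m b \<tau> * perm_density n \<tau> \<mu>)"
        using sum_integral_inflated_prob_pair[OF e \<pi>[unfolded kn]] unfolding J_def kn m_def .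
      finally show ?thesis .
    qed
    have "n * a S = p * (n * J True S) + (1 - p) * (n * J False S)" by (simp add: a_def algebra_simps)
    also have "\<dots> = (\<Sum>\<tau> | \<tau> permutes {1..n}. (p * m True \<tau> + (1 - p) * m False \<tau>) * perm_density n \<tau> \<mu>)"
      unfolding nJ sum_distrib_left sum.distrib[symmetric] by (rule sum.cong[OF refl]) (simp only: distrib_right mult.assoc)
    also have "\<dots> = n * U"
      unfolding U_def kn diff_Suc_1 pmf_up_step[OF n p] m_def[symmetric] sum_distrib_left using n
      by (intro sum.cong) auto
    finally show ?thesis using n by simp
  qed
  have sumw: "(\<Sum>S\<in>Pow ?I. ?w S) = 1" using sum_Pow_binomial[of ?I \<epsilon> "1 - \<epsilon>"] by simp
  have w0: "0 \<le> ?w S" for S using e by simp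
  define P2 where "P2 = {S \<in> Pow ?I. card S = 2}"
  define P3 where "P3 = {S \<in> Pow ?I. 3 \<le> card S}"
  have "expect_Inf p \<epsilon> (perm_density k \<pi>) \<mu> - ?d = (\<Sum>S\<in>Pow ?I. ?w S * a S) - (\<Sum>S\<in>Pow ?I. ?w S) * ?d"
    unfolding expect_Inf_perm_density[OF e p] a_def J_def sumw by simp
  also have "\<dots> = (\<Sum>S\<in>Pow ?I. ?w S * (a S - ?d))"
    by (simp only: sum_distrib_right sum_subtractf[symmetric] right_diff_distrib)
  also have "\<dots> = (\<Sum>S\<in>P2 \<union> P3. ?w S * (a S - ?d))"
  proof (rule sum.mono_neutral_right)
    show "\<forall>S\<in>Pow ?I - (P2 \<union> P3). ?w S * (a S - ?d) = 0"
    proof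
      fix S assume S: "S \<in> Pow ?I - (P2 \<union> P3)"
      then have "card S = 0 \<or> card S = 1" "finite S" by (auto simp: P2_def P3_def intro: finite_subset)
      then have "S = {} \<or> card S = 1" by auto
      then show "?w S * (a S - ?d) = 0" using a0 a1[of S] S by auto
    qed
  qed (auto simp: P2_def P3_def)
  also have "\<dots> = (\<Sum>S\<in>P2. ?w S * (a S - ?d)) + (\<Sum>S\<in>P3. ?w S * (a S - ?d))"
    by (rule sum.union_disjoint) (auto simp: P2_def P3_def)
  also have "(\<Sum>S\<in>P2. ?w S * (a S - ?d)) = (\<Sum>S\<in>P2. \<epsilon>\<^sup>2 * (1 - \<epsilon>) ^ (k - 2) * (U - ?d))"
  proof (rule sum.cong[OF refl])
    fix S assume S: "S \<in> P2"
    then have "S \<subseteq> ?I" "card S = 2" by (auto simp: P2_def)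
    moreover from this have "card (?I - S) = k - 2" by (simp add: card_Diff_subset finite_subset)
    ultimately show "?w S * (a S - ?d) = \<epsilon>\<^sup>2 * (1 - \<epsilon>) ^ (k - 2) * (U - ?d)" using a2 by simp
  qed
  also have "\<dots> = real (k choose 2) * (\<epsilon>\<^sup>2 * (1 - \<epsilon>) ^ (k - 2) * (U - ?d))"
    using n_subsets[of ?I 2] by (simp add: P2_def Pow_def)
  finally have E: "expect_Inf p \<epsilon> (perm_density k \<pi>) \<mu> - ?d =
     real (k choose 2) * (\<epsilon>\<^sup>2 * (1 - \<epsilon>) ^ (k - 2) * (U - ?d)) + (\<Sum>S\<in>P3. ?w S * (a S - ?d))" .
  have R: "\<bar>\<Sum>S\<in>P3. ?w S * (a S - ?d)\<bar> \<le> 2 ^ k * \<epsilon> ^ 3"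
  proof -
    have "\<bar>\<Sum>S\<in>P3. ?w S * (a S - ?d)\<bar> \<le> (\<Sum>S\<in>P3. \<bar>?w S * (a S - ?d)\<bar>)" by (rule sum_abs)
    also have "\<dots> \<le> (\<Sum>S\<in>P3. \<epsilon> ^ 3)"
    proof (rule sum_mono)
      fix S assume "S \<in> P3"
      then have c: "3 \<le> card S" by (simp add: P3_def)
      have "\<bar>?w S * (a S - ?d)\<bar> = \<epsilon> ^ card S * ((1 - \<epsilon>) ^ card (?I - S) * \<bar>a S - ?d\<bar>)"
        using e by (simp add: abs_mult)
      also have "\<dots> \<le> \<epsilon> ^ card S * 1"
        using e a01[of S] d01 by (intro mult_left_mono mult_le_one power_le_one) auto
      also have "\<dots> \<le> \<epsilon> ^ 3" using e c by (simp add: power_decreasing)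
      finally show "\<bar>?w S * (a S - ?d)\<bar> \<le> \<epsilon> ^ 3" .
    qed
    also have "\<dots> = card P3 * \<epsilon> ^ 3" by simp
    also have "\<dots> \<le> 2 ^ k * \<epsilon> ^ 3"
    proof (rule mult_right_mono)
      have "card P3 \<le> card (Pow ?I)" by (intro card_mono) (auto simp: P3_def)
      then show "real (card P3) \<le> 2 ^ k" by (simp add: card_Pow flip: of_nat_le_iff)
    qed (use e in simp)
    finally show ?thesis .
  qed
  have ch: "2 * real (k choose 2) = real (k * (k - 1))"
  proof -
    have "2 * (k choose 2) = k * (k - 1)" unfolding choose_two by (rule dvd_mult_div_cancel) (cases "even k"; simp)
    then show ?thesis by (metis of_nat_mult of_nat_numeral)
  qed
  have e2: "\<epsilon>\<^sup>2 \<noteq> 0" using e by simp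
  have "2 / \<epsilon>\<^sup>2 * (expect_Inf p \<epsilon> (perm_density k \<pi>) \<mu> - ?d) - (- real (k * (k - 1)) * (?d - U))
     = real (k * (k - 1)) * ((1 - \<epsilon>) ^ (k - 2) - 1) * (U - ?d) + 2 / \<epsilon>\<^sup>2 * (\<Sum>S\<in>P3. ?w S * (a S - ?d))"
    unfolding E ch[symmetric] using e2 by (simp add: field_simps)
  also have "\<bar>\<dots>\<bar> \<le> real k ^ 3 * \<epsilon> + 2 * 2 ^ k * \<epsilon>"
  proof (rule order_trans[OF abs_triangle_ineq add_mono])
    show "\<bar>2 / \<epsilon>\<^sup>2 * (\<Sum>S\<in>P3. ?w S * (a S - ?d))\<bar> \<le> 2 * 2 ^ k * \<epsilon>"
    proof -
      have "\<bar>2 / \<epsilon>\<^sup>2 * (\<Sum>S\<in>P3. ?w S * (a S - ?d))\<bar> \<le> 2 / \<epsilon>\<^sup>2 * (2 ^ k * \<epsilon> ^ 3)"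
        unfolding abs_mult using R by (intro mult_mono) auto
      also have "\<dots> = 2 * 2 ^ k * \<epsilon>" using e by (simp add: power2_eq_square power3_eq_cube)
      finally show ?thesis .
    qed
    show "\<bar>real (k * (k - 1)) * ((1 - \<epsilon>) ^ (k - 2) - 1) * (U - ?d)\<bar> \<le> real k ^ 3 * \<epsilon>"
    \<comment> \<open>Bounds for \<open>U\<close> come from a subset of size 2; for
      \<open>k = 1\<close> the prefactor is 0.\<close>
    proof (cases "2 \<le> k")
      case True
      have "\<exists>S. S \<subseteq> ?I \<and> card S = 2" using obtain_subset_with_card_n[of 2 ?I] True by auto
      then have U: "0 \<le> U" "U \<le> 1" using a2 a01 by metis+
      have "1 + real (k - 2) * (- \<epsilon>) \<le> (1 + - \<epsilon>) ^ (k - 2)" using e by (intro Bernoulli_inequality) simp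
      moreover have "(1 - \<epsilon>) ^ (k - 2) \<le> 1" using e by (intro power_le_one) auto
      moreover have "real (k - 2) * \<epsilon> \<le> real k * \<epsilon>" using e by (intro mult_right_mono) auto
      ultimately have "\<bar>(1 - \<epsilon>) ^ (k - 2) - 1\<bar> \<le> real k * \<epsilon>" by (simp add: abs_le_iff)
      moreover have "\<bar>U - ?d\<bar> \<le> 1" using U d01 by (simp add: abs_le_iff)
      moreover have "\<bar>real (k * (k - 1))\<bar> \<le> real k * real k" by (simp add: mult_left_mono)
      ultimately have "\<bar>real (k * (k - 1)) * ((1 - \<epsilon>) ^ (k - 2) - 1) * (U - ?d)\<bar> \<le> (real k * real k) * (real k * \<epsilon>) * 1"
        unfolding abs_mult using e by (intro mult_mono) auto
      then show ?thesis by (simp add: power3_eq_cube ac_simps)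
    next
      case False
      then have "k = 1" using k by simp
      then show ?thesis using e by simp
    qed
  qed
  finally show ?thesis by (simp only: distrib_right)
qed

subsection \<open>Feller semigroups\<close>

lemma feller_semigroupD:
  assumes "feller_semigroup T"
  shows feller_linear: "0 \<le> t \<Longrightarrow> linear (T t)"
    and feller_one: "0 \<le> t \<Longrightarrow> T t (const_bcontfun 1) = const_bcontfun 1"
    and feller_pos: "0 \<le> t \<Longrightarrow> (\<And>x. 0 \<le> apply_bcontfun f x) \<Longrightarrow> 0 \<le> apply_bcontfun (T t f) y"
    and feller_0: "T 0 f = f"
    and feller_add: "0 \<le> s \<Longrightarrow> 0 \<le> t \<Longrightarrow> T (s + t) f = T s (T t f)"
    and feller_lim: "((\<lambda>t. T t f) \<longlongrightarrow> f) (at_right 0)"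
  using assms unfolding feller_semigroup_def by (auto simp: fun_eq_iff)

text \<open>Positivity and preservation of constants, applied to
  \<open>const_bcontfun (norm f)\<close> minus and plus \<open>f\<close>.\<close>

lemma feller_contraction:
  assumes T: "feller_semigroup T" and t: "0 \<le> t"
  shows "norm (T t f) \<le> norm f"
proof (rule norm_bound)
  fix x
  interpret L: linear "T t" using feller_linear[OF T t] .
  have c: "T t (const_bcontfun (norm f)) = const_bcontfun (norm f)"
  proof -
    have "const_bcontfun (norm f) = norm f *\<^sub>R (const_bcontfun 1 :: 'a \<Rightarrow>\<^sub>C real)"
      by (rule bcontfun_eqI) simp
    then show ?thesis using feller_one[OF T t] by (simp add: L.scale)
  qed
  have b: "\<bar>apply_bcontfun f y\<bar> \<le> norm f" for y using norm_bounded[of f y] by simp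
  have "0 \<le> apply_bcontfun (T t (const_bcontfun (norm f) - f)) x"
  proof (rule feller_pos[OF T t])
    show "0 \<le> apply_bcontfun (const_bcontfun (norm f) - f) y" for y using b[of y] by (simp add: minus_bcontfun.rep_eq)
  qed
  moreover have "0 \<le> apply_bcontfun (T t (const_bcontfun (norm f) + f)) x"
  proof (rule feller_pos[OF T t])
    show "0 \<le> apply_bcontfun (const_bcontfun (norm f) + f) y" for y using b[of y] by (simp add: plus_bcontfun.rep_eq)
  qed
  ultimately show "norm (apply_bcontfun (T t f) x) \<le> norm f"
    by (simp add: L.diff L.add c minus_bcontfun.rep_eq plus_bcontfun.rep_eq)
qed

lemma feller_bounded_linear:
  assumes T: "feller_semigroup T" and t: "0 \<le> t"
  shows "bounded_linear (T t)"
proof -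
  interpret L: linear "T t" using feller_linear[OF T t] .
  show ?thesis
    by (rule bounded_linear_intro[of _ 1]) (auto simp: L.add L.scale feller_contraction[OF T t])
qed

lemma feller_diff_contraction:
  assumes T: "feller_semigroup T" and t: "0 \<le> t"
  shows "norm (T t f - T t g) \<le> norm (f - g)"
proof -
  interpret L: linear "T t" using feller_linear[OF T t] .
  show ?thesis using feller_contraction[OF T t, of "f - g"] by (simp add: L.diff)
qed

text \<open>The semigroup at the earlier of the two times is a contraction and can be taken out of
  the difference.\<close>

lemma feller_increment:
  assumes T: "feller_semigroup T" and st: "0 \<le> s" "0 \<le> t"
  shows "norm (T s f - T t f) \<le> norm (T \<bar>s - t\<bar> f - f)"
proof (cases "s \<le> t")
  case True
  have "T t f = T s (T (t - s) f)" using feller_add[OF T, of s "t - s"] st True by simp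
  then show ?thesis
    using feller_diff_contraction[OF T st(1), of f "T (t - s) f"] True by (simp add: norm_minus_commute)
next
  case False
  then have "T s f = T t (T (s - t) f)" using feller_add[OF T, of t "s - t"] st by simp
  then show ?thesis
    using feller_diff_contraction[OF T st(2), of "T (s - t) f" f] False by simp
qed

lemma feller_continuous:
  assumes T: "feller_semigroup T"
  shows "continuous_on {0..} (\<lambda>t. T t f)"
  unfolding continuous_on_iff
proof (intro ballI allI impI)
  fix t e :: real assume t: "t \<in> {0..}" and e: "0 < e"
  have "\<forall>\<^sub>F h in at_right 0. dist (T h f) f < e" using feller_lim[OF T] e by (rule tendstoD)
  then obtain d where d: "0 < d" "\<And>h. 0 < h \<Longrightarrow> h < d \<Longrightarrow> dist (T h f) f < e"
    unfolding eventually_at_right_field by auto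
  show "\<exists>d>0. \<forall>s\<in>{0..}. dist s t < d \<longrightarrow> dist (T s f) (T t f) < e"
  proof (intro exI[of _ d] conjI ballI impI)
    fix s assume s: "s \<in> {0..}" "dist s t < d"
    have "norm (T \<bar>s - t\<bar> f - f) < e"
      using d(2)[of "\<bar>s - t\<bar>"] s(2) e feller_0[OF T] by (cases "s = t") (auto simp: dist_norm)
    then show "dist (T s f) (T t f) < e"
      using feller_increment[OF T, of s t f] s t by (simp add: dist_norm)
  qed (rule d)
qed

text \<open>From the right, the difference quotient at \<open>t\<close> is the image under
  \<open>T t\<close> of the quotient at 0. From the left only \<open>T s\<close> with
  \<open>s < t\<close> can be factored out; strong continuity of the semigroup at \<open>g\<close>
  then accounts for the replacement of \<open>T s g\<close> by \<open>T t g\<close>.\<close>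

lemma feller_has_derivative:
  assumes T: "feller_semigroup T" and fg: "(f, g) \<in> generator T" and t: "0 \<le> t"
  shows "((\<lambda>s. apply_bcontfun (T s f) x) has_real_derivative apply_bcontfun (T t g) x) (at t within {0..})"
  unfolding has_field_derivative_iff
proof (rule tendstoI)
  fix e :: real assume e: "0 < e"
  have "((\<lambda>h. (T h f - f) /\<^sub>R h) \<longlongrightarrow> g) (at_right 0)" using fg by (simp add: generator_def)
  then have 1: "\<forall>\<^sub>F h in at_right 0. dist ((T h f - f) /\<^sub>R h) g < e / 2" using e by (intro tendstoD) auto
  have 2: "\<forall>\<^sub>F h in at_right 0. dist (T h g) g < e / 2" using feller_lim[OF T] e by (intro tendstoD) auto
  from eventually_conj[OF 1 2] obtain d where d: "0 < d"
    "\<And>h. 0 < h \<Longrightarrow> h < d \<Longrightarrow> norm ((T h f - f) /\<^sub>R h - g) < e / 2 \<and> norm (T h g - g) < e / 2"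
    unfolding eventually_at_right_field by (auto simp: dist_norm)
  have main: "norm ((T s f - T t f) /\<^sub>R (s - t) - T t g) < e" if s: "0 \<le> s" "s \<noteq> t" "\<bar>s - t\<bar> < d" for s
  proof (cases "t < s")
    case True
    define h where "h = s - t"
    have h: "0 < h" "h < d" using True s by (auto simp: h_def)
    interpret L: linear "T t" using feller_linear[OF T t] .
    have "T s f = T t (T h f)" using feller_add[OF T t, of h f] h by (simp add: h_def)
    then have "(T s f - T t f) /\<^sub>R (s - t) - T t g = T t ((T h f - f) /\<^sub>R h - g)"
      by (simp add: L.diff L.scale h_def)
    then have "norm ((T s f - T t f) /\<^sub>R (s - t) - T t g) \<le> norm ((T h f - f) /\<^sub>R h - g)"
      using feller_contraction[OF T t] by simp
    then show ?thesis using d(2)[OF h] e by simp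
  next
    case False
    define h where "h = t - s"
    have h: "0 < h" "h < d" using False s by (auto simp: h_def)
    interpret L: linear "T s" using feller_linear[OF T s(1)] .
    have f: "T t f = T s (T h f)" and g: "T t g = T s (T h g)"
      using feller_add[OF T s(1), of h] h by (simp_all add: h_def)
    have "(T s f - T t f) /\<^sub>R (s - t) = (T t f - T s f) /\<^sub>R h"
    proof -
      have "inverse (s - t) = - inverse h" by (simp add: h_def flip: inverse_minus_eq)
      then show ?thesis by (simp add: scaleR_diff_right)
    qed
    then have "(T s f - T t f) /\<^sub>R (s - t) - T t g = T s ((T h f - f) /\<^sub>R h - g) + T s (g - T h g)"
      unfolding f g by (simp add: L.diff L.scale)
    then have "norm ((T s f - T t f) /\<^sub>R (s - t) - T t g) \<le> norm ((T h f - f) /\<^sub>R h - g) + norm (g - T h g)"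
      using norm_triangle_ineq[of "T s ((T h f - f) /\<^sub>R h - g)" "T s (g - T h g)"]
        feller_contraction[OF T s(1), of "(T h f - f) /\<^sub>R h - g"] feller_contraction[OF T s(1), of "g - T h g"] by simp
    then show ?thesis using d(2)[OF h] by (simp add: norm_minus_commute[of g])
  qed
  have "\<forall>\<^sub>F s in at t within {0..}. s \<in> {0..} \<and> s \<noteq> t \<and> \<bar>s - t\<bar> < d"
    unfolding eventually_at using d(1) by (intro exI[of _ d]) (auto simp: dist_real_def)
  then show "\<forall>\<^sub>F s in at t within {0..}.
     dist ((apply_bcontfun (T s f) x - apply_bcontfun (T t f) x) / (s - t)) (apply_bcontfun (T t g) x) < e"
  proof eventually_elim
    case (elim s)
    have "\<bar>apply_bcontfun ((T s f - T t f) /\<^sub>R (s - t) - T t g) x\<bar> < e"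
      using norm_bounded[of "(T s f - T t f) /\<^sub>R (s - t) - T t g" x] main[of s] elim by simp
    then show ?case
      by (simp add: dist_real_def minus_bcontfun.rep_eq scaleR_bcontfun.rep_eq divide_inverse_commute)
  qed
qed

section \<open>Integrals of curves in function space and density of the domain\<close>

lemma riemann_sum_step:
  fixes c :: "real \<Rightarrow> real"
  assumes c: "continuous_on {a..b} c" and \<delta>: "0 \<le> \<delta>" and e: "\<And>s t. s \<in> {a..b} \<Longrightarrow> t \<in> {a..b} \<Longrightarrow> \<bar>s - t\<bar> \<le> \<delta> \<Longrightarrow> \<bar>c s - c t\<bar> \<le> e"
  shows "a + real k * \<delta> \<le> b \<Longrightarrow> \<bar>(\<Sum>i<k. \<delta> * c (a + real i * \<delta>)) - integral {a..a + real k * \<delta>} c\<bar> \<le> e * (real k * \<delta>)"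
proof (induction k)
  case (Suc k)
  define u v where "u = a + real k * \<delta>" and "v = a + real (Suc k) * \<delta>"
  have uv: "a \<le> u" "u \<le> v" "v \<le> b" "v - u = \<delta>"
    using \<delta> Suc.prems by (auto simp: u_def v_def algebra_simps)
  have ci: "c integrable_on {x..y}" if "a \<le> x" "y \<le> b" for x y
    using continuous_on_subset[OF c, of "{x..y}"] that by (intro integrable_continuous_real) auto
  have IH: "\<bar>(\<Sum>i<k. \<delta> * c (a + real i * \<delta>)) - integral {a..u} c\<bar> \<le> e * (real k * \<delta>)"
    unfolding u_def using Suc.IH uv by (simp add: u_def)
  have "integral {a..v} c = integral {a..u} c + integral {u..v} c"
    using uv ci[of a v] by (intro Henstock_Kurzweil_Integration.integral_combine[symmetric]) auto
  moreover have "\<bar>\<delta> * c u - integral {u..v} c\<bar> \<le> e * \<delta>"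
  proof -
    have "integral {u..v} (\<lambda>s. c u - c s) = \<delta> * c u - integral {u..v} c"
      using uv ci[of u v] by (subst integral_diff) (auto simp: content_real)
    moreover have "norm (integral {u..v} (\<lambda>s. c u - c s)) \<le> e * (v - u)"
    proof (rule integral_bound)
      show "continuous_on {u..v} (\<lambda>s. c u - c s)"
        using continuous_on_subset[OF c, of "{u..v}"] uv by (intro continuous_intros) auto
      show "norm (c u - c s) \<le> e" if "s \<in> {u..v}" for s using e[of u s] that uv by auto
    qed (use uv in auto)
    ultimately show ?thesis using uv by simp
  qed
  ultimately have "\<bar>(\<Sum>i<Suc k. \<delta> * c (a + real i * \<delta>)) - integral {a..v} c\<bar> \<le> e * (real k * \<delta>) + e * \<delta>"
    using IH unfolding sum.lessThan_Suc u_def[symmetric] by linarith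
  then show ?case unfolding v_def by (simp add: algebra_simps)
qed simp

text \<open>The integral is defined pointwise, and uniform continuity of the curve makes Riemann
  sums converge to it in norm. The sums are part of the statement because they allow a bounded
  operator to be moved inside the integral.\<close>

lemma curve_integral:
  fixes c :: "real \<Rightarrow> ('a::topological_space \<Rightarrow>\<^sub>C real)"
  assumes c: "continuous_on {a..b} c" and ab: "a \<le> b"
  shows "\<exists>F. (\<forall>x. apply_bcontfun F x = integral {a..b} (\<lambda>s. apply_bcontfun (c s) x)) \<and>
    (\<lambda>n. \<Sum>i<Suc n. ((b - a) / real (Suc n)) *\<^sub>R c (a + real i * ((b - a) / real (Suc n)))) \<longlonglongrightarrow> F"
proof -
  define I where "I x = integral {a..b} (\<lambda>s. apply_bcontfun (c s) x)" for x
  define R where "R n = (\<Sum>i<Suc n. ((b - a) / real (Suc n)) *\<^sub>R c (a + real i * ((b - a) / real (Suc n))))" for n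
  have cx: "continuous_on {a..b} (\<lambda>s. apply_bcontfun (c s) x)" for x
    unfolding continuous_on_iff
  proof (intro ballI allI impI)
    fix s e :: real assume "s \<in> {a..b}" "0 < e"
    then obtain d where "0 < d" "\<And>t. t \<in> {a..b} \<Longrightarrow> dist t s < d \<Longrightarrow> dist (c t) (c s) < e"
      using c unfolding continuous_on_iff by metis
    then show "\<exists>d>0. \<forall>t\<in>{a..b}. dist t s < d \<longrightarrow> dist (apply_bcontfun (c t) x) (apply_bcontfun (c s) x) < e"
      using dist_bounded order_le_less_trans by blast
  qed
  have ap: "apply_bcontfun (R n) x = (\<Sum>i<Suc n. ((b - a) / real (Suc n)) * apply_bcontfun (c (a + real i * ((b - a) / real (Suc n)))) x)" for n x
  proof -
    have "apply_bcontfun (\<Sum>i\<in>J. g i) x = (\<Sum>i\<in>J. apply_bcontfun (g i) x)" if "finite J" for J :: "nat set" and g :: "nat \<Rightarrow> 'a \<Rightarrow>\<^sub>C real"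
      using that by (induction J) auto
    then show ?thesis by (simp add: R_def)
  qed
  have lim: "\<exists>M. \<forall>n\<ge>M. \<forall>x. \<bar>apply_bcontfun (R n) x - I x\<bar> \<le> e * (b - a)" if e: "0 < e" for e
  proof -
    have "uniformly_continuous_on {a..b} c" using c by (rule compact_uniformly_continuous) simp
    then obtain d where d: "0 < d" "\<And>s t. s \<in> {a..b} \<Longrightarrow> t \<in> {a..b} \<Longrightarrow> dist s t < d \<Longrightarrow> dist (c s) (c t) < e"
      unfolding uniformly_continuous_on_def using e by metis
    obtain M :: nat where M: "(b - a) / d < real M" using reals_Archimedean2 by blast
    have "\<bar>apply_bcontfun (R n) x - I x\<bar> \<le> e * (b - a)" if n: "M \<le> n" for n x
    proof -
      define \<delta> where "\<delta> = (b - a) / real (Suc n)"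
      have "(b - a) / d < real (Suc n)" using M n by linarith
      then have \<delta>: "0 \<le> \<delta>" "\<delta> < d" using ab d(1) by (auto simp: \<delta>_def field_simps)
      have k: "real (Suc n) * \<delta> = b - a" by (simp add: \<delta>_def)
      have "\<bar>(\<Sum>i<Suc n. \<delta> * apply_bcontfun (c (a + real i * \<delta>)) x) - integral {a..a + real (Suc n) * \<delta>} (\<lambda>s. apply_bcontfun (c s) x)\<bar> \<le> e * (real (Suc n) * \<delta>)"
      proof (rule riemann_sum_step[OF cx \<delta>(1)])
        fix s t assume st: "s \<in> {a..b}" "t \<in> {a..b}" "\<bar>s - t\<bar> \<le> \<delta>"
        then have "dist (c s) (c t) < e" using \<delta> by (intro d(2)) (auto simp: dist_real_def)
        then show "\<bar>apply_bcontfun (c s) x - apply_bcontfun (c t) x\<bar> \<le> e"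
          using dist_bounded[of "c s" x "c t"] by (simp add: dist_real_def)
      qed (use k in linarith)
      then show ?thesis unfolding ap \<delta>_def[symmetric] k I_def by simp
    qed
    then show ?thesis by blast
  qed
  have "continuous_on UNIV I"
  proof (rule continuous_on_uniformly_approximable)
    fix e :: real assume e: "0 < e"
    \<comment> \<open>The summand 1 in the denominator covers the case \<open>a = b\<close>.\<close>
    obtain M where "\<forall>n\<ge>M. \<forall>x. \<bar>apply_bcontfun (R n) x - I x\<bar> \<le> e / (b - a + 1) * (b - a)" using lim[of "e / (b - a + 1)"] e ab by auto
    moreover have "e / (b - a + 1) * (b - a) \<le> e" using e ab by (simp add: field_simps)
    ultimately show "\<exists>g. continuous_on UNIV g \<and> (\<forall>x\<in>UNIV. dist (g x) (I x) \<le> e)"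
      by (intro exI[of _ "apply_bcontfun (R M)"]) (auto simp: dist_real_def intro: order_trans)
  qed
  moreover have "bounded (range I)"
  proof -
    obtain M where M: "\<forall>n\<ge>M. \<forall>x. \<bar>apply_bcontfun (R n) x - I x\<bar> \<le> 1 * (b - a)" using lim[of 1] by auto
    have "\<bar>I x\<bar> \<le> norm (R M) + (b - a)" for x
    proof -
      have "\<bar>apply_bcontfun (R M) x - I x\<bar> \<le> b - a" using M by auto
      moreover have "\<bar>apply_bcontfun (R M) x\<bar> \<le> norm (R M)" using norm_bounded[of "R M" x] by simp
      ultimately show ?thesis by linarith
    qed
    then show ?thesis by (auto intro!: boundedI[of _ "norm (R M) + (b - a)"])
  qed
  ultimately have "I \<in> bcontfun" by (simp add: bcontfun_def)
  then obtain F where F: "I = apply_bcontfun F" by (rule bcontfunE)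
  have "R \<longlonglongrightarrow> F"
  proof (rule LIMSEQ_I)
    fix e :: real assume e: "0 < e"
    obtain M where M: "\<forall>n\<ge>M. \<forall>x. \<bar>apply_bcontfun (R n) x - I x\<bar> \<le> e / (b - a + 1) * (b - a)" using lim[of "e / (b - a + 1)"] e ab by auto
    have lt: "e / (b - a + 1) * (b - a) < e" using e ab by (simp add: field_simps)
    have "norm (R n - F) < e" if "M \<le> n" for n
    proof -
      have "norm (R n - F) \<le> e / (b - a + 1) * (b - a)"
        using M that by (intro norm_bound) (auto simp: F[symmetric])
      then show ?thesis using lt by linarith
    qed
    then show "\<exists>M. \<forall>n\<ge>M. norm (R n - F) < e" by blast
  qed
  moreover have "apply_bcontfun F x = integral {a..b} (\<lambda>s. apply_bcontfun (c s) x)" for x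
    by (simp only: F[symmetric] I_def)
  ultimately show ?thesis unfolding R_def by blast
qed

text \<open>The classical argument: with \<open>F h\<close> the integral of \<open>T s f\<close>
  over \<open>{0..h}\<close>, the averages \<open>F h /\<^sub>R h\<close> lie in the domain and tend
  to \<open>f\<close> as \<open>h\<close> decreases to 0.\<close>

lemma feller_generator_dense:
  fixes T :: "real \<Rightarrow> ('a::topological_space \<Rightarrow>\<^sub>C real) \<Rightarrow> ('a \<Rightarrow>\<^sub>C real)"
  assumes T: "feller_semigroup T"
  shows "closure (Domain (generator T)) = UNIV"
proof -
  have "f \<in> closure (Domain (generator T))" for f
  proof -
    have cont: "continuous_on {a..b} (\<lambda>s. T s f)" if "0 \<le> a" for a b
      using feller_continuous[OF T] by (rule continuous_on_subset) (use that in auto)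
    have contx: "continuous_on {a..b} (\<lambda>s. apply_bcontfun (T s f) x)" if "0 \<le> a" for a b x
      unfolding continuous_on_iff
    proof (intro ballI allI impI)
      fix s e :: real assume "s \<in> {a..b}" "0 < e"
      then obtain d where "0 < d" "\<And>t. t \<in> {a..b} \<Longrightarrow> dist t s < d \<Longrightarrow> dist (T t f) (T s f) < e"
        using cont[OF \<open>0 \<le> a\<close>, of b] unfolding continuous_on_iff by metis
      then show "\<exists>d>0. \<forall>t\<in>{a..b}. dist t s < d \<longrightarrow> dist (apply_bcontfun (T t f) x) (apply_bcontfun (T s f) x) < e"
        using dist_bounded order_le_less_trans by blast
    qed
    have "\<exists>F. \<forall>t\<ge>0. (\<forall>x. apply_bcontfun (F t) x = integral {0..t} (\<lambda>s. apply_bcontfun (T s f) x)) \<and>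
      (\<lambda>n. \<Sum>i<Suc n. (t / real (Suc n)) *\<^sub>R T (real i * (t / real (Suc n))) f) \<longlonglongrightarrow> F t"
      using curve_integral[OF cont, of 0] by (intro choice_iff[THEN iffD1]) auto
    then obtain F where F: "\<And>t x. 0 \<le> t \<Longrightarrow> apply_bcontfun (F t) x = integral {0..t} (\<lambda>s. apply_bcontfun (T s f) x)"
      and FR: "\<And>t. 0 \<le> t \<Longrightarrow> (\<lambda>n. \<Sum>i<Suc n. (t / real (Suc n)) *\<^sub>R T (real i * (t / real (Suc n))) f) \<longlonglongrightarrow> F t" by blast
    have Fdiff: "apply_bcontfun (F v) x - apply_bcontfun (F u) x = integral {u..v} (\<lambda>s. apply_bcontfun (T s f) x)"
      if "0 \<le> u" "u \<le> v" for u v x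
      using Henstock_Kurzweil_Integration.integral_combine[of 0 u v "\<lambda>s. apply_bcontfun (T s f) x"]
        integrable_continuous_real[OF contx[of 0 v x]] that by (simp add: F)
    have der: "((\<lambda>h. (F (t + h) - F t) /\<^sub>R h) \<longlongrightarrow> T t f) (at_right 0)" if t: "0 \<le> t" for t
    proof (rule tendstoI)
      fix e :: real assume e: "0 < e"
      obtain d where d: "0 < d" "\<And>s. s \<in> {0..} \<Longrightarrow> dist s t < d \<Longrightarrow> dist (T s f) (T t f) < e / 2"
        using feller_continuous[OF T, of f] e t unfolding continuous_on_iff by (metis atLeast_iff half_gt_zero)
      have "\<forall>\<^sub>F h in at_right 0. h \<in> {0<..<d}" using d(1) by (rule eventually_at_right_real)
      then show "\<forall>\<^sub>F h in at_right 0. dist ((F (t + h) - F t) /\<^sub>R h) (T t f) < e"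
      proof eventually_elim
        case (elim h)
        have "norm ((F (t + h) - F t) /\<^sub>R h - T t f) \<le> e / 2"
        proof (rule norm_bound)
          fix x
          have int: "(\<lambda>s. apply_bcontfun (T s f) x) integrable_on {t..t + h}"
            using integrable_continuous_real[OF contx] t by auto
          have "norm (integral {t..t + h} (\<lambda>s. apply_bcontfun (T s f) x - apply_bcontfun (T t f) x)) \<le> e / 2 * (t + h - t)"
          proof (rule integral_bound)
            show "continuous_on {t..t + h} (\<lambda>s. apply_bcontfun (T s f) x - apply_bcontfun (T t f) x)"
              using contx t by (intro continuous_intros) auto
            show "norm (apply_bcontfun (T s f) x - apply_bcontfun (T t f) x) \<le> e / 2" if "s \<in> {t..t + h}" for s
            proof -
              have "dist (T s f) (T t f) < e / 2" using that elim t by (intro d(2)) (auto simp: dist_real_def)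
              then show ?thesis using dist_bounded[of "T s f" x "T t f"] by (simp add: dist_real_def)
            qed
          qed (use elim in auto)
          moreover have "integral {t..t + h} (\<lambda>s. apply_bcontfun (T s f) x - apply_bcontfun (T t f) x) =
             apply_bcontfun (F (t + h)) x - apply_bcontfun (F t) x - h * apply_bcontfun (T t f) x"
            using int Fdiff[of t "t + h" x] t elim by (subst integral_diff) (auto simp: content_real)
          ultimately have "\<bar>apply_bcontfun (F (t + h)) x - apply_bcontfun (F t) x - h * apply_bcontfun (T t f) x\<bar> / h \<le> e / 2"
            using elim by (simp add: divide_le_eq)
          moreover have "\<bar>apply_bcontfun (F (t + h)) x - apply_bcontfun (F t) x - h * apply_bcontfun (T t f) x\<bar> / h
             = \<bar>(apply_bcontfun (F (t + h)) x - apply_bcontfun (F t) x) / h - apply_bcontfun (T t f) x\<bar>"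
          proof -
            have "\<bar>A - h * y\<bar> / h = \<bar>A / h - y\<bar>" for A y
            proof -
              have "A / h - y = (A - h * y) / h" using elim by (simp add: diff_divide_distrib)
              then show ?thesis using elim by (simp add: abs_divide)
            qed
            then show ?thesis .
          qed
          moreover have "apply_bcontfun ((F (t + h) - F t) /\<^sub>R h - T t f) x =
             (apply_bcontfun (F (t + h)) x - apply_bcontfun (F t) x) / h - apply_bcontfun (T t f) x"
            by (simp add: divide_inverse mult.commute)
          ultimately show "norm (apply_bcontfun ((F (t + h) - F t) /\<^sub>R h - T t f) x) \<le> e / 2"
            by (simp only: real_norm_def)
        qed
        then show ?case using e by (simp add: dist_norm)
      qed
    qed
    have dom: "F t \<in> Domain (generator T)" if t: "0 < t" for t
    proof -
      \<comment> \<open>\<open>T h\<close> shifts the domain of integration by \<open>h\<close>. It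
        is applied to the Riemann sums, whose shifted limit is identified by the same construction
        on \<open>{h..t + h}\<close>.\<close>
      have shift: "T h (F t) = F (t + h) - F h" if h: "0 < h" for h
      proof -
        interpret L: bounded_linear "T h" using feller_bounded_linear[OF T, of h] h by simp
        let ?\<delta> = "\<lambda>n. t / real (Suc n)"
        have "(\<lambda>n. T h (\<Sum>i<Suc n. ?\<delta> n *\<^sub>R T (real i * ?\<delta> n) f)) \<longlonglongrightarrow> T h (F t)"
          using FR[of t] t by (intro L.tendsto) auto
        moreover have "T h (\<Sum>i<Suc n. ?\<delta> n *\<^sub>R T (real i * ?\<delta> n) f) = (\<Sum>i<Suc n. ?\<delta> n *\<^sub>R T (h + real i * ?\<delta> n) f)" for n
          unfolding L.sum L.scale
        proof (rule sum.cong[OF refl])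
          fix i
          have "T (h + real i * ?\<delta> n) f = T h (T (real i * ?\<delta> n) f)" using h t by (intro feller_add[OF T]) auto
          then show "?\<delta> n *\<^sub>R T h (T (real i * ?\<delta> n) f) = ?\<delta> n *\<^sub>R T (h + real i * ?\<delta> n) f" by (simp only:)
        qed
        ultimately have 1: "(\<lambda>n. \<Sum>i<Suc n. ?\<delta> n *\<^sub>R T (h + real i * ?\<delta> n) f) \<longlonglongrightarrow> T h (F t)" by (simp only:)
        obtain G where G: "\<And>x. apply_bcontfun G x = integral {h..t + h} (\<lambda>s. apply_bcontfun (T s f) x)"
          "(\<lambda>n. \<Sum>i<Suc n. ((t + h - h) / real (Suc n)) *\<^sub>R T (h + real i * ((t + h - h) / real (Suc n))) f) \<longlonglongrightarrow> G"
        proof -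
          have "0 \<le> h" "h \<le> t + h" using h t by simp_all
          then show thesis using curve_integral[OF cont, of h "t + h"] that by blast
        qed
        have "(\<lambda>n. \<Sum>i<Suc n. ?\<delta> n *\<^sub>R T (h + real i * ?\<delta> n) f) \<longlonglongrightarrow> G"
          using G(2) by (simp only: add_diff_cancel_right')
        with 1 have "T h (F t) = G" by (rule LIMSEQ_unique)
        also have "G = F (t + h) - F h"
          by (rule bcontfun_eqI) (use G(1) Fdiff[of h "t + h"] h t in simp)
        finally show ?thesis .
      qed
      have "((\<lambda>h. (F (t + h) - F t) /\<^sub>R h - (F (0 + h) - F 0) /\<^sub>R h) \<longlongrightarrow> T t f - T 0 f) (at_right 0)"
        using t by (intro tendsto_diff der) auto
      moreover have F0: "F 0 = 0" by (rule bcontfun_eqI) (simp add: F)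
      have "\<forall>\<^sub>F h in at_right 0. (F (t + h) - F t) /\<^sub>R h - (F (0 + h) - F 0) /\<^sub>R h = (T h (F t) - F t) /\<^sub>R h"
        using eventually_at_right_less[of 0]
      proof eventually_elim
        case (elim h)
        then show ?case using shift[OF elim] by (simp add: F0 scaleR_diff_right[symmetric])
      qed
      ultimately have "((\<lambda>h. (T h (F t) - F t) /\<^sub>R h) \<longlongrightarrow> T t f - T 0 f) (at_right 0)"
        by (rule Lim_transform_eventually)
      then have "(F t, T t f - T 0 f) \<in> generator T" unfolding generator_def mem_Collect_eq prod.case .
      then show ?thesis by (rule DomainI)
    qed
    have F0: "F 0 = 0" by (rule bcontfun_eqI) (simp add: F)
    have lim: "((\<lambda>h. F h /\<^sub>R h) \<longlongrightarrow> f) (at_right 0)"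
      using der[of 0] feller_0[OF T] by (simp add: F0)
    have "\<forall>\<^sub>F h in at_right 0. F h /\<^sub>R h \<in> closure (Domain (generator T))"
      using eventually_at_right_less[of 0]
    proof eventually_elim
      case (elim h)
      then obtain g where "(F h, g) \<in> generator T" using dom by blast
      then have "((\<lambda>s. inverse h *\<^sub>R ((T s (F h) - F h) /\<^sub>R s)) \<longlongrightarrow> inverse h *\<^sub>R g) (at_right 0)"
        unfolding generator_def mem_Collect_eq prod.case by (rule tendsto_scaleR[OF tendsto_const])
      moreover have "\<forall>\<^sub>F s in at_right 0. inverse h *\<^sub>R ((T s (F h) - F h) /\<^sub>R s) = (T s (F h /\<^sub>R h) - F h /\<^sub>R h) /\<^sub>R s"
        using eventually_at_right_less[of 0]
      proof eventually_elim
        case (elim s)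
        interpret L: linear "T s" using feller_linear[OF T, of s] elim by simp
        show ?case
          by (simp only: L.scale scaleR_diff_right scaleR_scaleR mult.commute[of "inverse h"])
      qed
      ultimately have "((\<lambda>s. (T s (F h /\<^sub>R h) - F h /\<^sub>R h) /\<^sub>R s) \<longlongrightarrow> inverse h *\<^sub>R g) (at_right 0)"
        by (rule Lim_transform_eventually)
      then have "(F h /\<^sub>R h, inverse h *\<^sub>R g) \<in> generator T" unfolding generator_def mem_Collect_eq prod.case .
      then have "F h /\<^sub>R h \<in> Domain (generator T)" by (rule DomainI)
      then show ?case by (rule closure_subset[THEN subsetD])
    qed
    then show ?thesis
      by (rule Lim_in_closed_set[OF closed_closure _ trivial_limit_at_right_real lim])
  qed
  then show ?thesis by blast
qed

text \<open>The graph over \<open>D\<close> is dense in the graph of the generator; projecting to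
  the first component puts the domain, which is dense, into the closure of \<open>D\<close>.\<close>

lemma core_dense:
  assumes T: "feller_semigroup T" and D: "is_core (generator T) D"
  shows "closure D = UNIV"
proof -
  let ?G = "{(f, g) \<in> generator T. f \<in> D}"
  have "closure ?G = generator T"
    using D unfolding is_core_def by (elim conjE)
  then have "Domain (generator T) = fst ` closure ?G"
    by (simp only: Domain_fst)
  also have "\<dots> \<subseteq> closure (fst ` ?G)"
    by (rule image_closure_subset[OF _ closed_closure closure_subset]) (intro continuous_intros)
  also have "\<dots> \<subseteq> closure D" by (intro closure_mono) auto
  finally have "closure (Domain (generator T)) \<subseteq> closure D"
    by (intro closure_minimal) auto
  then show ?thesis using feller_generator_dense[OF T] by blast
qed

text \<open>Integrating factor \<open>exp (a * s)\<close>. As \<open>a\<close> is nonnegative, the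
  factor at time \<open>s\<close> is at most the one at time \<open>t\<close>, which cancels in the
  end; the bound is therefore linear in \<open>t\<close>.\<close>

lemma linear_ode_bound:
  fixes w \<rho> :: "real \<Rightarrow> real"
  assumes a: "0 \<le> a" and t: "0 \<le> t" and w0: "w 0 = 0"
    and der: "\<And>s. 0 \<le> s \<Longrightarrow> s \<le> t \<Longrightarrow> (w has_real_derivative - a * w s + \<rho> s) (at s within {0..})"
    and b: "\<And>s. 0 \<le> s \<Longrightarrow> s \<le> t \<Longrightarrow> \<bar>\<rho> s\<bar> \<le> b"
  shows "\<bar>w t\<bar> \<le> b * t"
proof -
  define \<phi> where "\<phi> s = exp (a * s) * w s" for s
  have "norm (\<phi> t - \<phi> 0) \<le> (exp (a * t) * b) * norm (t - 0)"
  proof (rule field_differentiable_bound[where S = "{0..t}" and f' = "\<lambda>s. exp (a * s) * \<rho> s"])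
    fix s assume s: "s \<in> {0..t}"
    have "(w has_real_derivative - a * w s + \<rho> s) (at s within {0..t})"
      using der[of s] s by (rule_tac DERIV_subset) auto
    then have "(\<phi> has_real_derivative a * exp (a * s) * w s + exp (a * s) * (- a * w s + \<rho> s)) (at s within {0..t})"
      unfolding \<phi>_def[abs_def] by (auto intro!: derivative_eq_intros)
    then show "(\<phi> has_real_derivative exp (a * s) * \<rho> s) (at s within {0..t})"
      by (simp add: algebra_simps)
    have "a * s \<le> a * t" using s a by (intro mult_left_mono) auto
    then show "norm (exp (a * s) * \<rho> s) \<le> exp (a * t) * b"
      using b[of s] s by (auto simp: abs_mult intro!: mult_mono)
  qed (use t in auto)
  then have "exp (a * t) * \<bar>w t\<bar> \<le> exp (a * t) * (b * t)"
    using w0 t by (simp add: \<phi>_def abs_mult ac_simps)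
  then show ?thesis by simp
qed

subsection \<open>Convergence of the semigroups\<close>

definition pattern_density :: "nat \<Rightarrow> (nat \<Rightarrow> nat) \<Rightarrow> permuton \<Rightarrow>\<^sub>C real" where
  "pattern_density k \<pi> = Bcontfun (perm_density k \<pi>)"

lemma apply_pattern_density [simp]: "apply_bcontfun (pattern_density k \<pi>) = perm_density k \<pi>"
proof -
  have "perm_density k \<pi> \<in> bcontfun"
    by (rule bcontfun_normI[OF continuous_perm_density, of _ _ 1]) (simp add: perm_density_nonneg perm_density_le_1)
  then show ?thesis unfolding pattern_density_def by (rule Bcontfun_inverse)
qed

lemma pattern_density_in_density_functions:
  "1 \<le> k \<Longrightarrow> \<pi> permutes {1..k} \<Longrightarrow> pattern_density k \<pi> \<in> density_functions"
  unfolding density_functions_def using apply_pattern_density by blast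

lemma apply_bcontfun_sum: "apply_bcontfun (\<Sum>i\<in>J. g i) x = (\<Sum>i\<in>J. apply_bcontfun (g i) x)"
  by (induction J rule: infinite_finite_induct) simp_all

text \<open>The part of \<open>inflation_process\<close> that concerns the semigroup only, with the
  semigroup as a parameter, so that a family indexed by \<epsilon> can be chosen.\<close>

definition inflation_semigroup :: "real \<Rightarrow> real \<Rightarrow> (real \<Rightarrow> (permuton \<Rightarrow>\<^sub>C real) \<Rightarrow> (permuton \<Rightarrow>\<^sub>C real)) \<Rightarrow> bool" where
  "inflation_semigroup p \<epsilon> T \<longleftrightarrow> feller_semigroup T \<and> Domain (generator T) = UNIV \<and>
     (\<forall>(f, g)\<in>generator T. \<forall>\<mu>.
        apply_bcontfun g \<mu> = 2 / \<epsilon>\<^sup>2 * (expect_Inf p \<epsilon> (apply_bcontfun f) \<mu> - apply_bcontfun f \<mu>))"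

text \<open>The difference \<open>w\<close> of the two semigroups, applied to a pattern density,
  solves w' = - a w + \<rho> with \<open>a = k * (k - 1)\<close>. The forcing \<rho> consists of the
  error of the generators, of order \<epsilon>, and of the differences for patterns of size
  \<open>k - 1\<close>, again of order \<epsilon> by induction. The constant may depend on the
  pattern and on the time horizon.\<close>

lemma pattern_density_convergence:
  assumes p: "0 < p" "p < 1" and T: "feller_semigroup T" and A: "diffusion_generator p (generator T)"
    and S: "\<And>\<epsilon>. 0 < \<epsilon> \<Longrightarrow> \<epsilon> < 1 \<Longrightarrow> inflation_semigroup p \<epsilon> (S \<epsilon>)"
    and R: "0 \<le> R"
  shows "1 \<le> k \<Longrightarrow> \<pi> permutes {1..k} \<Longrightarrow>
    \<exists>C. \<forall>\<epsilon>\<in>{0<..<1}. \<forall>t\<in>{0..R}. norm (S \<epsilon> t (pattern_density k \<pi>) - T t (pattern_density k \<pi>)) \<le> C * \<epsilon>"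
proof (induction k arbitrary: \<pi>)
  case 0
  then show ?case by simp
next
  case (Suc n)
  define k where "k = Suc n"
  have k: "1 \<le> k" "\<pi> permutes {1..k}" "k - 1 = n" using Suc.prems by (simp_all add: k_def)
  define a where "a = real (k * (k - 1))"
  define P where "P = {\<tau>. \<tau> permutes {1..n}}"
  define c where "c \<tau> = pmf (up_step p n \<tau>) \<pi>" for \<tau>
  let ?d = "pattern_density k \<pi>"
  have a0: "0 \<le> a" by (simp add: a_def)
  have fin: "finite P" unfolding P_def by (rule finite_permutations) simp
  \<comment> \<open>The factor \<open>a\<close> is kept in the statement so that it covers
    \<open>n = 0\<close>, where no induction hypothesis is available and
    \<open>a = 0\<close>.\<close>
  have "\<exists>C. \<forall>\<epsilon>\<in>{0<..<1}. \<forall>t\<in>{0..R}. a * norm (S \<epsilon> t (pattern_density n \<tau>) - T t (pattern_density n \<tau>)) \<le> C * \<epsilon>"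
    if "\<tau> \<in> P" for \<tau>
  proof (cases "n = 0")
    case True
    then have "a = 0" by (simp add: a_def k_def)
    then show ?thesis by (intro exI[of _ 0]) simp
  next
    case False
    then obtain C where C: "\<forall>\<epsilon>\<in>{0<..<1}. \<forall>t\<in>{0..R}. norm (S \<epsilon> t (pattern_density n \<tau>) - T t (pattern_density n \<tau>)) \<le> C * \<epsilon>"
      using Suc.IH[of \<tau>] \<open>\<tau> \<in> P\<close> unfolding P_def by auto
    show ?thesis
    proof (intro exI[of _ "a * C"] ballI)
      fix \<epsilon> t :: real assume "\<epsilon> \<in> {0<..<1}" "t \<in> {0..R}"
      then have "norm (S \<epsilon> t (pattern_density n \<tau>) - T t (pattern_density n \<tau>)) \<le> C * \<epsilon>" using C by blast
      then have "a * norm (S \<epsilon> t (pattern_density n \<tau>) - T t (pattern_density n \<tau>)) \<le> a * (C * \<epsilon>)" using a0 by (rule mult_left_mono)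
      then show "a * norm (S \<epsilon> t (pattern_density n \<tau>) - T t (pattern_density n \<tau>)) \<le> a * C * \<epsilon>" by (simp only: mult.assoc)
    qed
  qed
  then obtain C where C: "\<And>\<tau> \<epsilon> t. \<tau> \<in> P \<Longrightarrow> \<epsilon> \<in> {0<..<1} \<Longrightarrow> t \<in> {0..R} \<Longrightarrow>
     a * norm (S \<epsilon> t (pattern_density n \<tau>) - T t (pattern_density n \<tau>)) \<le> C \<tau> * \<epsilon>"
    by metis
  \<comment> \<open>The limiting generator at \<open>?d\<close>. It is again a combination of
    pattern densities, so that both semigroups can be compared on it.\<close>
  define G where "G = (- a) *\<^sub>R ?d + a *\<^sub>R (\<Sum>\<tau>\<in>P. c \<tau> *\<^sub>R pattern_density n \<tau>)"
  have "apply_bcontfun G \<mu> = - a * (perm_density k \<pi> \<mu> - (\<Sum>\<tau>\<in>P. c \<tau> * perm_density n \<tau> \<mu>))" for \<mu>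
    unfolding G_def by (simp add: apply_bcontfun_sum algebra_simps)
  then have Gx: "apply_bcontfun G \<mu> = - real (k * (k - 1)) * (perm_density k \<pi> \<mu>
           - (\<Sum>\<tau> | \<tau> permutes {1..k - 1}. pmf (up_step p (k - 1) \<tau>) \<pi> * perm_density (k - 1) \<tau> \<mu>))" for \<mu>
    unfolding a_def P_def c_def k(3)[symmetric] .
  have G: "(?d, G) \<in> generator T"
  proof -
    have "?d \<in> Domain (generator T)"
      using A span_base[OF pattern_density_in_density_functions[OF k(1,2)]]
      unfolding diffusion_generator_def is_core_def by blast
    then obtain g where g: "(?d, g) \<in> generator T" by blast
    have "\<forall>\<mu>. apply_bcontfun g \<mu> = - real (k * (k - 1)) * (perm_density k \<pi> \<mu>
           - (\<Sum>\<tau> | \<tau> permutes {1..k - 1}. pmf (up_step p (k - 1) \<tau>) \<pi> * perm_density (k - 1) \<tau> \<mu>))"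
      using A k(1,2) g apply_pattern_density unfolding diffusion_generator_def by blast
    then have "g = G"
      by (intro bcontfun_eqI) (simp only: Gx)
    then show ?thesis using g by simp
  qed
  define K where "K = real k ^ 3 + 2 * 2 ^ k"
  define B where "B = K + (\<Sum>\<tau>\<in>P. C \<tau>)"
  have c1: "0 \<le> c \<tau>" "c \<tau> \<le> 1" for \<tau> by (simp_all add: c_def pmf_le_1)
  have "norm (S \<epsilon> t ?d - T t ?d) \<le> (\<bar>B\<bar> * R) * \<epsilon>" if \<epsilon>: "\<epsilon> \<in> {0<..<1}" and t: "t \<in> {0..R}" for \<epsilon> t
  proof (rule norm_bound)
    fix x
    have e: "0 < \<epsilon>" "\<epsilon> < 1" using \<epsilon> by auto
    have Se: "feller_semigroup (S \<epsilon>)" using S[OF e] by (simp add: inflation_semigroup_def)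
    obtain g where g: "(?d, g) \<in> generator (S \<epsilon>)"
      using S[OF e] unfolding inflation_semigroup_def by blast
    then have gx: "apply_bcontfun g \<mu> = 2 / \<epsilon>\<^sup>2 * (expect_Inf p \<epsilon> (perm_density k \<pi>) \<mu> - perm_density k \<pi> \<mu>)" for \<mu>
      using S[OF e] unfolding inflation_semigroup_def by fastforce
    have gG: "norm (g - G) \<le> K * \<epsilon>"
    proof (rule norm_bound)
      fix \<mu>
      show "norm (apply_bcontfun (g - G) \<mu>) \<le> K * \<epsilon>"
        using generator_perm_density[OF e _ _ k(1,2), of p \<mu>] p unfolding K_def minus_bcontfun.rep_eq gx Gx by simp
    qed
    define w where "w s = apply_bcontfun (S \<epsilon> s ?d) x - apply_bcontfun (T s ?d) x" for s
    define \<rho> where "\<rho> s = apply_bcontfun (S \<epsilon> s (g - G)) x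
       + a * (\<Sum>\<tau>\<in>P. c \<tau> * (apply_bcontfun (S \<epsilon> s (pattern_density n \<tau>)) x - apply_bcontfun (T s (pattern_density n \<tau>)) x))" for s
    have "\<bar>w t\<bar> \<le> (\<bar>B\<bar> * \<epsilon>) * t"
    proof (rule linear_ode_bound[OF a0])
      show "w 0 = 0" by (simp add: w_def feller_0[OF Se] feller_0[OF T])
      fix s assume s: "0 \<le> s" "s \<le> t"
      then have sR: "s \<in> {0..R}" using t by simp
      interpret LS: linear "S \<epsilon> s" using feller_linear[OF Se s(1)] .
      interpret LT: linear "T s" using feller_linear[OF T s(1)] .
      have "(w has_real_derivative apply_bcontfun (S \<epsilon> s g) x - apply_bcontfun (T s G) x) (at s within {0..})"
        unfolding w_def[abs_def] by (intro DERIV_diff feller_has_derivative[OF Se g s(1)] feller_has_derivative[OF T G s(1)])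
      moreover have "apply_bcontfun (S \<epsilon> s g) x - apply_bcontfun (T s G) x = - a * w s + \<rho> s"
      proof -
        have "S \<epsilon> s g = S \<epsilon> s (g - G) + S \<epsilon> s G" by (simp add: LS.diff)
        moreover have "S \<epsilon> s G = (- a) *\<^sub>R S \<epsilon> s ?d + a *\<^sub>R (\<Sum>\<tau>\<in>P. c \<tau> *\<^sub>R S \<epsilon> s (pattern_density n \<tau>))"
          unfolding G_def by (simp only: LS.add LS.scale LS.sum)
        moreover have "T s G = (- a) *\<^sub>R T s ?d + a *\<^sub>R (\<Sum>\<tau>\<in>P. c \<tau> *\<^sub>R T s (pattern_density n \<tau>))"
          unfolding G_def by (simp only: LT.add LT.scale LT.sum)
        ultimately show ?thesis
          by (simp only: w_def \<rho>_def plus_bcontfun.rep_eq scaleR_bcontfun.rep_eq apply_bcontfun_sum real_scaleR_def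
              right_diff_distrib sum_subtractf)
      qed
      ultimately show "(w has_real_derivative - a * w s + \<rho> s) (at s within {0..})" by (simp only:)
      have 1: "\<bar>apply_bcontfun (S \<epsilon> s (g - G)) x\<bar> \<le> K * \<epsilon>"
        using norm_bounded[of "S \<epsilon> s (g - G)" x] feller_contraction[OF Se s(1), of "g - G"] gG by simp
      have "\<bar>a * (\<Sum>\<tau>\<in>P. c \<tau> * (apply_bcontfun (S \<epsilon> s (pattern_density n \<tau>)) x - apply_bcontfun (T s (pattern_density n \<tau>)) x))\<bar>
        \<le> (\<Sum>\<tau>\<in>P. C \<tau> * \<epsilon>)"
        unfolding sum_distrib_left
      proof (rule order_trans[OF sum_abs sum_mono])
        fix \<tau> assume \<tau>: "\<tau> \<in> P"
        let ?D = "S \<epsilon> s (pattern_density n \<tau>) - T s (pattern_density n \<tau>)"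
        have "\<bar>apply_bcontfun ?D x\<bar> \<le> norm ?D" using norm_bounded[of ?D x] by simp
        then have "c \<tau> * \<bar>apply_bcontfun ?D x\<bar> \<le> 1 * norm ?D" using c1 by (intro mult_mono) auto
        then have "a * (c \<tau> * \<bar>apply_bcontfun ?D x\<bar>) \<le> a * norm ?D" using a0 by (simp add: mult_left_mono)
        also have "\<dots> \<le> C \<tau> * \<epsilon>" by (rule C[OF \<tau> \<epsilon> sR])
        finally show "\<bar>a * (c \<tau> * (apply_bcontfun (S \<epsilon> s (pattern_density n \<tau>)) x - apply_bcontfun (T s (pattern_density n \<tau>)) x))\<bar> \<le> C \<tau> * \<epsilon>"
          using a0 c1 by (simp add: abs_mult)
      qed
      with 1 have "\<bar>\<rho> s\<bar> \<le> K * \<epsilon> + (\<Sum>\<tau>\<in>P. C \<tau> * \<epsilon>)" unfolding \<rho>_def by linarith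
      also have "\<dots> = B * \<epsilon>" unfolding B_def by (simp only: distrib_right sum_distrib_right)
      also have "\<dots> \<le> \<bar>B\<bar> * \<epsilon>" using e by (intro mult_right_mono) auto
      finally show "\<bar>\<rho> s\<bar> \<le> \<bar>B\<bar> * \<epsilon>" .
    qed (use t in auto)
    also have "\<dots> \<le> (\<bar>B\<bar> * \<epsilon>) * R" using t e by (intro mult_left_mono) auto
    finally show "norm (apply_bcontfun (S \<epsilon> t ?d - T t ?d) x) \<le> (\<bar>B\<bar> * R) * \<epsilon>"
      by (simp add: w_def ac_simps)
  qed
  then show ?case unfolding k_def by blast
qed

text \<open>The set \<open>V\<close> of functions for which the claim holds is a subspace containing
  the pattern densities, hence their span. The core property makes the span dense, and contractivity
  of both semigroups extends the convergence to the closure, at a cost of \<delta>/3 three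
  times.\<close>

lemma semigroup_convergence:
  assumes p: "0 < p" "p < 1" and T: "feller_semigroup T" and A: "diffusion_generator p (generator T)"
    and S: "\<And>\<epsilon>. 0 < \<epsilon> \<Longrightarrow> \<epsilon> < 1 \<Longrightarrow> inflation_semigroup p \<epsilon> (S \<epsilon>)"
    and R: "0 \<le> R" and \<delta>: "0 < \<delta>"
  shows "\<forall>\<^sub>F \<epsilon> in at_right 0. \<forall>t\<in>{0..R}. norm (S \<epsilon> t f - T t f) \<le> \<delta>"
proof -
  define V where "V = {f. \<forall>\<delta>>0. \<forall>\<^sub>F \<epsilon> in at_right 0. \<forall>t\<in>{0..R}. norm (S \<epsilon> t f - T t f) \<le> \<delta>}"
  have small: "\<forall>\<^sub>F \<epsilon> in at_right (0::real). 0 < \<epsilon> \<and> \<epsilon> < 1"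
    using eventually_at_right_real[of 0 1] by simp
  have Se: "feller_semigroup (S \<epsilon>)" if "0 < \<epsilon> \<and> \<epsilon> < 1" for \<epsilon>
    using S[of \<epsilon>] that by (simp add: inflation_semigroup_def)
  have "subspace V"
  proof (rule subspaceI)
    show "0 \<in> V"
      unfolding V_def
    proof (intro CollectI allI impI)
      fix \<delta> :: real assume "0 < \<delta>"
      show "\<forall>\<^sub>F \<epsilon> in at_right 0. \<forall>t\<in>{0..R}. norm (S \<epsilon> t 0 - T t 0) \<le> \<delta>"
        using small
      proof eventually_elim
        case (elim \<epsilon>)
        have "S \<epsilon> t 0 = 0" "T t 0 = 0" if "t \<in> {0..R}" for t
          using linear_0[OF feller_linear[OF Se[OF elim]]] linear_0[OF feller_linear[OF T]] that by auto
        then show ?case using \<open>0 < \<delta>\<close> by simp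
      qed
    qed
    fix f g assume fg: "f \<in> V" "g \<in> V"
    show "f + g \<in> V"
      unfolding V_def
    proof (intro CollectI allI impI)
      fix \<delta> :: real assume "0 < \<delta>"
      then have "0 < \<delta> / 2" by simp
      then have "\<forall>\<^sub>F \<epsilon> in at_right 0. \<forall>t\<in>{0..R}. norm (S \<epsilon> t f - T t f) \<le> \<delta> / 2"
        "\<forall>\<^sub>F \<epsilon> in at_right 0. \<forall>t\<in>{0..R}. norm (S \<epsilon> t g - T t g) \<le> \<delta> / 2"
        using fg unfolding V_def by blast+
      then show "\<forall>\<^sub>F \<epsilon> in at_right 0. \<forall>t\<in>{0..R}. norm (S \<epsilon> t (f + g) - T t (f + g)) \<le> \<delta>"
        using small
      proof eventually_elim
        case (elim \<epsilon>)
        show ?case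
        proof
          fix t assume t: "t \<in> {0..R}"
          have "S \<epsilon> t (f + g) - T t (f + g) = (S \<epsilon> t f - T t f) + (S \<epsilon> t g - T t g)"
            using linear_add[OF feller_linear[OF Se[OF elim(3)]], of t f g] linear_add[OF feller_linear[OF T], of t f g] t by simp
          then show "norm (S \<epsilon> t (f + g) - T t (f + g)) \<le> \<delta>"
            using norm_triangle_ineq[of "S \<epsilon> t f - T t f" "S \<epsilon> t g - T t g"] elim(1,2) t by fastforce
        qed
      qed
    qed
  next
    fix c :: real and f assume f: "f \<in> V"
    show "c *\<^sub>R f \<in> V"
      unfolding V_def
    proof (intro CollectI allI impI)
      fix \<delta> :: real assume "0 < \<delta>"
      then have "0 < \<delta> / (\<bar>c\<bar> + 1)" by simp
      then have "\<forall>\<^sub>F \<epsilon> in at_right 0. \<forall>t\<in>{0..R}. norm (S \<epsilon> t f - T t f) \<le> \<delta> / (\<bar>c\<bar> + 1)"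
        using f unfolding V_def by blast
      then show "\<forall>\<^sub>F \<epsilon> in at_right 0. \<forall>t\<in>{0..R}. norm (S \<epsilon> t (c *\<^sub>R f) - T t (c *\<^sub>R f)) \<le> \<delta>"
        using small
      proof eventually_elim
        case (elim \<epsilon>)
        show ?case
        proof
          fix t assume t: "t \<in> {0..R}"
          have "S \<epsilon> t (c *\<^sub>R f) - T t (c *\<^sub>R f) = c *\<^sub>R (S \<epsilon> t f - T t f)"
            using linear_scale[OF feller_linear[OF Se[OF elim(2)]], of t c f] linear_scale[OF feller_linear[OF T], of t c f] t
            by (simp add: scaleR_diff_right)
          then have "norm (S \<epsilon> t (c *\<^sub>R f) - T t (c *\<^sub>R f)) = \<bar>c\<bar> * norm (S \<epsilon> t f - T t f)" by simp
          also have "\<dots> \<le> (\<bar>c\<bar> + 1) * (\<delta> / (\<bar>c\<bar> + 1))" using elim(1) t by (intro mult_mono) auto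
          also have "\<dots> = \<delta>" by simp
          finally show "norm (S \<epsilon> t (c *\<^sub>R f) - T t (c *\<^sub>R f)) \<le> \<delta>" .
        qed
      qed
    qed
  qed
  moreover have "density_functions \<subseteq> V"
  proof
    fix f assume "f \<in> density_functions"
    then obtain k \<pi> where k: "1 \<le> k" "\<pi> permutes {1..k}" and f: "apply_bcontfun f = perm_density k \<pi>"
      unfolding density_functions_def by blast
    have f': "f = pattern_density k \<pi>" by (rule bcontfun_eqI) (simp add: f)
    obtain C where C: "\<forall>\<epsilon>\<in>{0<..<1}. \<forall>t\<in>{0..R}. norm (S \<epsilon> t f - T t f) \<le> C * \<epsilon>"
      using pattern_density_convergence[OF p T A S R k] unfolding f' by blast
    show "f \<in> V"
      unfolding V_def
    proof (intro CollectI allI impI)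
      fix \<delta> :: real assume \<delta>: "0 < \<delta>"
      have "\<forall>\<^sub>F \<epsilon> in at_right 0. \<epsilon> \<in> {0<..<\<delta> / (\<bar>C\<bar> + 1)}" using \<delta> by (intro eventually_at_right_real) auto
      then show "\<forall>\<^sub>F \<epsilon> in at_right 0. \<forall>t\<in>{0..R}. norm (S \<epsilon> t f - T t f) \<le> \<delta>"
        using small
      proof eventually_elim
        case (elim \<epsilon>)
        have "C * \<epsilon> \<le> (\<bar>C\<bar> + 1) * \<epsilon>" using elim by (intro mult_right_mono) auto
        also have "\<dots> \<le> \<delta>" using elim by (auto simp: field_simps)
        finally show ?case using C elim(2) by (meson greaterThanLessThan_iff order_trans)
      qed
    qed
  qed
  ultimately have "span density_functions \<subseteq> V" by (intro span_minimal)
  moreover have "closure (span density_functions) = UNIV"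
    using core_dense[OF T] A unfolding diffusion_generator_def by blast
  ultimately have dense: "\<exists>g\<in>V. dist g f < e" if "0 < e" for e
    using that closure_approachable[of f "span density_functions"] by blast
  obtain g where g: "g \<in> V" "dist g f < \<delta> / 3" using dense[of "\<delta> / 3"] \<delta> by auto
  have "0 < \<delta> / 3" using \<delta> by simp
  then have "\<forall>\<^sub>F \<epsilon> in at_right 0. \<forall>t\<in>{0..R}. norm (S \<epsilon> t g - T t g) \<le> \<delta> / 3"
    using g(1) unfolding V_def by blast
  then show ?thesis
    using small
  proof eventually_elim
    case (elim \<epsilon>)
    show ?case
    proof
      fix t assume t: "t \<in> {0..R}"
      have "norm (S \<epsilon> t f - S \<epsilon> t g) \<le> \<delta> / 3" "norm (T t f - T t g) \<le> \<delta> / 3"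
        using feller_diff_contraction[OF Se[OF elim(2)], of t f g] feller_diff_contraction[OF T, of t f g] g(2) t
        by (auto simp: dist_norm norm_minus_commute)
      moreover have "norm (S \<epsilon> t g - T t g) \<le> \<delta> / 3" using elim(1) t by blast
      moreover have "S \<epsilon> t f - T t f = (S \<epsilon> t f - S \<epsilon> t g) + (S \<epsilon> t g - T t g) - (T t f - T t g)" by simp
      ultimately show "norm (S \<epsilon> t f - T t f) \<le> \<delta>"
        using norm_triangle_ineq4[of "(S \<epsilon> t f - S \<epsilon> t g) + (S \<epsilon> t g - T t g)" "T t f - T t g"]
          norm_triangle_ineq[of "S \<epsilon> t f - S \<epsilon> t g" "S \<epsilon> t g - T t g"] by simp
    qed
  qed
qed

subsection \<open>Feller processes\<close>

text \<open>Squares of observables give the second moments of increments; products merge factors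
  that refer to the same time.\<close>

definition bcontfun_times :: "('a::topological_space \<Rightarrow>\<^sub>C real) \<Rightarrow> ('a \<Rightarrow>\<^sub>C real) \<Rightarrow> ('a \<Rightarrow>\<^sub>C real)" where
  "bcontfun_times f g = Bcontfun (\<lambda>x. apply_bcontfun f x * apply_bcontfun g x)"

lemma apply_bcontfun_times [simp]: "apply_bcontfun (bcontfun_times f g) x = apply_bcontfun f x * apply_bcontfun g x"
proof -
  have "(\<lambda>x. apply_bcontfun f x * apply_bcontfun g x) \<in> bcontfun"
    by (rule bcontfun_normI[of _ "norm f * norm g"])
      (auto intro!: continuous_intros mult_mono simp: abs_mult norm_bounded[of f, simplified] norm_bounded[of g, simplified])
  then show ?thesis unfolding bcontfun_times_def by (simp add: Bcontfun_inverse)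
qed

locale feller_path =
  fixes d :: "'s::topological_space \<Rightarrow> 's \<Rightarrow> real" and T :: "real \<Rightarrow> ('s \<Rightarrow>\<^sub>C real) \<Rightarrow> ('s \<Rightarrow>\<^sub>C real)"
    and init :: "'s measure" and M :: "'a measure" and Y :: "'a \<Rightarrow> real \<Rightarrow> 's"
  assumes process: "feller_process d T init M Y"
begin

lemma semigroup: "feller_semigroup T"
  using process by (simp add: feller_process_def)

sublocale prob_space M
  using process by (simp add: feller_process_def random_element_def)

lemma measurable_Y [measurable]: "0 \<le> t \<Longrightarrow> (\<lambda>\<omega>. Y \<omega> t) \<in> M \<rightarrow>\<^sub>M borel"
  using process by (simp add: feller_process_def)

lemma cadlag: "\<omega> \<in> space M \<Longrightarrow> Y \<omega> \<in> cadlag_paths"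
proof -
  assume \<omega>: "\<omega> \<in> space M"
  have "Y \<in> M \<rightarrow>\<^sub>M sigma (topspace (skorokhod d)) {U. openin (skorokhod d) U}"
    using process by (simp add: feller_process_def random_element_def)
  then have "Y \<omega> \<in> space (sigma (topspace (skorokhod d)) {U. openin (skorokhod d) U})"
    using \<omega> by (rule measurable_space)
  then show ?thesis
    by (simp add: topspace_skorokhod space_measure_of_conv)
qed

lemma measurable_bcontfun [measurable]: "apply_bcontfun (f :: 's \<Rightarrow>\<^sub>C real) \<in> borel_measurable borel"
  by (rule borel_measurable_continuous_onI) simp

lemma space_past: "space (past M Y s) = space M"
  by (simp add: past_def space_measure_of_conv)

lemma subalgebra_past: "subalgebra M (past M Y s)"
  unfolding subalgebra_def
proof
  show "space (past M Y s) = space M" by (rule space_past)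
  have *: "{(\<lambda>\<omega>. Y \<omega> u) -` A \<inter> space M | u A. 0 \<le> u \<and> u \<le> s \<and> A \<in> sets borel} \<subseteq> sets M"
    using measurable_sets[OF measurable_Y] by blast
  show "sets (past M Y s) \<subseteq> sets M"
    unfolding past_def using * sets.space_closed by (subst sets_measure_of) (blast, rule sets.sigma_sets_subset)
qed

lemma measurable_past: "0 \<le> u \<Longrightarrow> u \<le> s \<Longrightarrow> (\<lambda>\<omega>. Y \<omega> u) \<in> past M Y s \<rightarrow>\<^sub>M borel"
proof (rule measurableI)
  fix A :: "'s set" assume u: "0 \<le> u" "u \<le> s" and A: "A \<in> sets borel"
  have "{(\<lambda>\<omega>. Y \<omega> u) -` A \<inter> space M | u A. 0 \<le> u \<and> u \<le> s \<and> A \<in> sets borel} \<subseteq> Pow (space M)" by blast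
  then show "(\<lambda>\<omega>. Y \<omega> u) -` A \<inter> space (past M Y s) \<in> sets (past M Y s)"
    unfolding space_past unfolding past_def using u A by (subst sets_measure_of) (assumption, blast)
qed simp

lemma measurable_past_bcontfun:
  fixes f :: "'s \<Rightarrow>\<^sub>C real"
  shows "0 \<le> u \<Longrightarrow> u \<le> s \<Longrightarrow> (\<lambda>\<omega>. apply_bcontfun f (Y \<omega> u)) \<in> borel_measurable (past M Y s)"
  by (rule measurable_compose[OF measurable_past measurable_bcontfun])

lemma integrable_bcontfun:
  fixes f :: "'s \<Rightarrow>\<^sub>C real"
  assumes "0 \<le> t" "H \<in> borel_measurable M" "\<And>\<omega>. \<omega> \<in> space M \<Longrightarrow> \<bar>H \<omega>\<bar> \<le> B"
  shows "integrable M (\<lambda>\<omega>. H \<omega> * apply_bcontfun f (Y \<omega> t))"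
proof (rule finite_measure.integrable_const_bound[OF finite_measure_axioms, where B = "B * norm f"])
  show "AE \<omega> in M. norm (H \<omega> * apply_bcontfun f (Y \<omega> t)) \<le> B * norm f"
    using AE_space
  proof eventually_elim
    case (elim \<omega>)
    have "0 \<le> B" using assms(3)[OF elim] by linarith
    then show ?case
      using assms(3)[OF elim] norm_bounded[of f "Y \<omega> t"] by (auto simp: abs_mult intro!: mult_mono)
  qed
  show "(\<lambda>\<omega>. H \<omega> * apply_bcontfun f (Y \<omega> t)) \<in> borel_measurable M"
    by (rule borel_measurable_times[OF assms(2) measurable_compose[OF measurable_Y[OF assms(1)] measurable_bcontfun]])
qed

text \<open>The conditional expectation tested against a bounded variable of the past. This
  integrated form takes the place of conditional expectations in all later estimates.\<close>

lemma markov: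
  fixes f :: "'s \<Rightarrow>\<^sub>C real"
  assumes s: "0 \<le> s" and t: "0 \<le> t" and H: "H \<in> borel_measurable (past M Y s)" "\<And>\<omega>. \<omega> \<in> space M \<Longrightarrow> \<bar>H \<omega>\<bar> \<le> B"
  shows "(\<integral>\<omega>. H \<omega> * apply_bcontfun f (Y \<omega> (s + t)) \<partial>M) = (\<integral>\<omega>. H \<omega> * apply_bcontfun (T t f) (Y \<omega> s) \<partial>M)"
proof -
  interpret P: finite_measure_subalgebra M "past M Y s"
    by unfold_locales (rule subalgebra_past)
  have HM: "H \<in> borel_measurable M" by (rule measurable_from_subalg[OF subalgebra_past H(1)])
  have int: "integrable M (\<lambda>\<omega>. H \<omega> * apply_bcontfun f (Y \<omega> (s + t)))"
    using s t by (intro integrable_bcontfun[OF _ HM H(2)]) auto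
  have fm: "(\<lambda>\<omega>. apply_bcontfun f (Y \<omega> (s + t))) \<in> borel_measurable M"
    using s t by (intro measurable_compose[OF measurable_Y measurable_bcontfun]) auto
  have "(\<integral>\<omega>. H \<omega> * apply_bcontfun f (Y \<omega> (s + t)) \<partial>M)
    = (\<integral>\<omega>. H \<omega> * real_cond_exp M (past M Y s) (\<lambda>\<omega>. apply_bcontfun f (Y \<omega> (s + t))) \<omega> \<partial>M)"
    by (rule P.real_cond_exp_intg(2)[OF int H(1) fm, symmetric])
  also have "\<dots> = (\<integral>\<omega>. H \<omega> * apply_bcontfun (T t f) (Y \<omega> s) \<partial>M)"
  proof (rule Bochner_Integration.integral_cong_AE)
    have "AE \<omega> in M. real_cond_exp M (past M Y s) (\<lambda>\<omega>. apply_bcontfun f (Y \<omega> (s + t))) \<omega> = apply_bcontfun (T t f) (Y \<omega> s)"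
      using process s t unfolding feller_process_def by blast
    then show "AE \<omega> in M. H \<omega> * real_cond_exp M (past M Y s) (\<lambda>\<omega>. apply_bcontfun f (Y \<omega> (s + t))) \<omega>
       = H \<omega> * apply_bcontfun (T t f) (Y \<omega> s)"
      by eventually_elim simp
    show "(\<lambda>\<omega>. H \<omega> * real_cond_exp M (past M Y s) (\<lambda>\<omega>. apply_bcontfun f (Y \<omega> (s + t))) \<omega>) \<in> borel_measurable M"
      by (rule borel_measurable_times[OF HM borel_measurable_cond_exp2])
    show "(\<lambda>\<omega>. H \<omega> * apply_bcontfun (T t f) (Y \<omega> s)) \<in> borel_measurable M"
      by (rule borel_measurable_times[OF HM measurable_compose[OF measurable_Y[OF s] measurable_bcontfun]])
  qed
  finally show ?thesis .
qed

lemma initial: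
  fixes f :: "'s \<Rightarrow>\<^sub>C real"
  shows "(\<integral>\<omega>. apply_bcontfun f (Y \<omega> 0) \<partial>M) = (\<integral>x. apply_bcontfun f x \<partial>init)"
proof -
  have "distr M borel (\<lambda>\<omega>. Y \<omega> 0) = init" using process by (simp add: feller_process_def)
  then show ?thesis
    using integral_distr[OF measurable_Y[OF order_refl] measurable_bcontfun[of f]] by simp
qed

text \<open>A conditional Chebyshev inequality. Given the past at \<open>s\<close>, the mean square
  increment is the value at \<open>Y \<omega> s\<close> of T_h(g^2) - 2 g T_h g + g^2, that is, of
  (T_h(g^2) - g^2) - 2 g (T_h g - g), which the hypothesis bounds by
  \<open>\<eta>\<^sup>2 / 2\<close> in every state. Being uniform in the state, the estimate holds
  on each event of the past.\<close>

lemma increment_probability: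
  assumes g: "\<And>x. \<bar>apply_bcontfun g x\<bar> \<le> 1" and s: "0 \<le> s" and h: "0 \<le> h" and \<eta>: "0 < \<eta>"
    and \<beta>: "norm (T h (bcontfun_times g g) - bcontfun_times g g) + 2 * norm (T h g - g) \<le> \<eta>\<^sup>2 / 2"
    and A: "A \<in> sets (past M Y s)"
  shows "prob (A \<inter> {\<omega> \<in> space M. \<bar>apply_bcontfun g (Y \<omega> (s + h)) - apply_bcontfun g (Y \<omega> s)\<bar> > \<eta>}) \<le> prob A / 2"
proof -
  let ?g2 = "bcontfun_times g g"
  let ?Z = "\<lambda>u \<omega>. apply_bcontfun g (Y \<omega> u)"
  let ?I = "indicat_real A"
  have AM: "A \<in> events" using A subalgebra_past[of s] unfolding subalgebra_def by blast
  have sh: "0 \<le> s + h" using s h by simp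
  have Im: "?I \<in> borel_measurable (past M Y s)" using A by (rule borel_measurable_indicator)
  have ImM: "?I \<in> borel_measurable M" using AM by (rule borel_measurable_indicator)
  have Ib: "\<bar>?I \<omega>\<bar> \<le> 1" for \<omega> by (simp add: indicator_def)
  have Zm: "?Z u \<in> borel_measurable M" if "0 \<le> u" for u
    by (rule measurable_compose[OF measurable_Y[OF that] measurable_bcontfun])
  have IZm: "(\<lambda>\<omega>. ?I \<omega> * ?Z s \<omega>) \<in> borel_measurable (past M Y s)"
    by (rule borel_measurable_times[OF Im measurable_past_bcontfun[OF s order_refl]])
  have IZmM: "(\<lambda>\<omega>. ?I \<omega> * ?Z s \<omega>) \<in> borel_measurable M"
    by (rule borel_measurable_times[OF ImM Zm[OF s]])
  have IZb: "\<bar>?I \<omega> * ?Z s \<omega>\<bar> \<le> 1" for \<omega> using g[of "Y \<omega> s"] by (simp add: indicator_def)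
  have i1: "integrable M (\<lambda>\<omega>. ?I \<omega> * apply_bcontfun ?g2 (Y \<omega> (s + h)))" by (rule integrable_bcontfun[OF sh ImM Ib])
  have i2: "integrable M (\<lambda>\<omega>. (?I \<omega> * ?Z s \<omega>) * apply_bcontfun g (Y \<omega> (s + h)))" by (rule integrable_bcontfun[OF sh IZmM IZb])
  have i3: "integrable M (\<lambda>\<omega>. ?I \<omega> * apply_bcontfun ?g2 (Y \<omega> s))" by (rule integrable_bcontfun[OF s ImM Ib])
  have i4: "integrable M (\<lambda>\<omega>. ?I \<omega> * apply_bcontfun (T h ?g2) (Y \<omega> s))" by (rule integrable_bcontfun[OF s ImM Ib])
  have i5: "integrable M (\<lambda>\<omega>. (?I \<omega> * ?Z s \<omega>) * apply_bcontfun (T h g) (Y \<omega> s))" by (rule integrable_bcontfun[OF s IZmM IZb])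
  \<comment> \<open>After expansion every term is a past variable times a function of a single
    state, to which the Markov property applies.\<close>
  have sq: "?I \<omega> * (?Z (s + h) \<omega> - ?Z s \<omega>)\<^sup>2 = ?I \<omega> * apply_bcontfun ?g2 (Y \<omega> (s + h))
     - 2 * ((?I \<omega> * ?Z s \<omega>) * apply_bcontfun g (Y \<omega> (s + h))) + ?I \<omega> * apply_bcontfun ?g2 (Y \<omega> s)" for \<omega>
    by (simp add: apply_bcontfun_times power2_eq_square algebra_simps)
  have intsq: "integrable M (\<lambda>\<omega>. ?I \<omega> * (?Z (s + h) \<omega> - ?Z s \<omega>)\<^sup>2)"
    unfolding sq by (intro Bochner_Integration.integrable_add Bochner_Integration.integrable_diff integrable_mult_right i1 i2 i3)
  have "(\<integral>\<omega>. ?I \<omega> * (?Z (s + h) \<omega> - ?Z s \<omega>)\<^sup>2 \<partial>M) =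
     (\<integral>\<omega>. ?I \<omega> * apply_bcontfun ?g2 (Y \<omega> (s + h)) \<partial>M) - 2 * (\<integral>\<omega>. (?I \<omega> * ?Z s \<omega>) * apply_bcontfun g (Y \<omega> (s + h)) \<partial>M)
     + (\<integral>\<omega>. ?I \<omega> * apply_bcontfun ?g2 (Y \<omega> s) \<partial>M)"
    unfolding sq using i1 i2 i3 by simp
  also have "\<dots> = (\<integral>\<omega>. ?I \<omega> * apply_bcontfun (T h ?g2) (Y \<omega> s) \<partial>M) - 2 * (\<integral>\<omega>. (?I \<omega> * ?Z s \<omega>) * apply_bcontfun (T h g) (Y \<omega> s) \<partial>M)
     + (\<integral>\<omega>. ?I \<omega> * apply_bcontfun ?g2 (Y \<omega> s) \<partial>M)"
    by (simp only: markov[OF s h Im Ib] markov[OF s h IZm IZb])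
  also have "\<dots> = (\<integral>\<omega>. ?I \<omega> * apply_bcontfun (T h ?g2) (Y \<omega> s) - 2 * ((?I \<omega> * ?Z s \<omega>) * apply_bcontfun (T h g) (Y \<omega> s))
     + ?I \<omega> * apply_bcontfun ?g2 (Y \<omega> s) \<partial>M)"
    using i3 i4 i5 by simp
  also have "\<dots> \<le> (\<integral>\<omega>. ?I \<omega> * (\<eta>\<^sup>2 / 2) \<partial>M)"
  proof (rule integral_mono)
    show "integrable M (\<lambda>\<omega>. ?I \<omega> * apply_bcontfun (T h ?g2) (Y \<omega> s) - 2 * ((?I \<omega> * ?Z s \<omega>) * apply_bcontfun (T h g) (Y \<omega> s))
     + ?I \<omega> * apply_bcontfun ?g2 (Y \<omega> s))"
      by (intro Bochner_Integration.integrable_add Bochner_Integration.integrable_diff integrable_mult_right i4 i5 i3)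
    show "integrable M (\<lambda>\<omega>. ?I \<omega> * (\<eta>\<^sup>2 / 2))"
      using AM by (intro integrable_mult_left integrable_real_indicator) (auto simp: emeasure_eq_measure)
    fix \<omega>
    define y where "y = Y \<omega> s"
    have 1: "\<bar>apply_bcontfun (T h ?g2) y - apply_bcontfun ?g2 y\<bar> \<le> norm (T h ?g2 - ?g2)"
      using norm_bounded[of "T h ?g2 - ?g2" y] by simp
    have 2: "\<bar>apply_bcontfun g y * (apply_bcontfun (T h g) y - apply_bcontfun g y)\<bar> \<le> 1 * norm (T h g - g)"
      unfolding abs_mult using norm_bounded[of "T h g - g" y] g[of y] by (intro mult_mono) auto
    have "apply_bcontfun (T h ?g2) y - 2 * (apply_bcontfun g y * apply_bcontfun (T h g) y) + apply_bcontfun ?g2 y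
       = (apply_bcontfun (T h ?g2) y - apply_bcontfun ?g2 y) - 2 * (apply_bcontfun g y * (apply_bcontfun (T h g) y - apply_bcontfun g y))"
      by (simp add: apply_bcontfun_times algebra_simps)
    also have "\<dots> \<le> \<eta>\<^sup>2 / 2" using 1 2 \<beta> by linarith
    finally have "apply_bcontfun (T h ?g2) y - 2 * (apply_bcontfun g y * apply_bcontfun (T h g) y) + apply_bcontfun ?g2 y \<le> \<eta>\<^sup>2 / 2" .
    then show "?I \<omega> * apply_bcontfun (T h ?g2) (Y \<omega> s) - 2 * ((?I \<omega> * ?Z s \<omega>) * apply_bcontfun (T h g) (Y \<omega> s))
     + ?I \<omega> * apply_bcontfun ?g2 (Y \<omega> s) \<le> ?I \<omega> * (\<eta>\<^sup>2 / 2)"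
      unfolding y_def[symmetric] by (cases "\<omega> \<in> A") simp_all
  qed
  also have "\<dots> = prob A * (\<eta>\<^sup>2 / 2)" using AM by simp
  finally have E: "(\<integral>\<omega>. ?I \<omega> * (?Z (s + h) \<omega> - ?Z s \<omega>)\<^sup>2 \<partial>M) \<le> prob A * (\<eta>\<^sup>2 / 2)" .
  let ?B = "A \<inter> {\<omega> \<in> space M. \<bar>?Z (s + h) \<omega> - ?Z s \<omega>\<bar> > \<eta>}"
  have Bm: "?B \<in> events"
    by (intro sets.Int AM borel_measurable_less borel_measurable_const borel_measurable_abs borel_measurable_diff Zm s sh)
  have "\<eta>\<^sup>2 * prob ?B = (\<integral>\<omega>. \<eta>\<^sup>2 * indicat_real ?B \<omega> \<partial>M)" using Bm by simp
  also have "\<dots> \<le> (\<integral>\<omega>. ?I \<omega> * (?Z (s + h) \<omega> - ?Z s \<omega>)\<^sup>2 \<partial>M)"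
  proof (rule integral_mono[OF _ intsq])
    show "integrable M (\<lambda>\<omega>. \<eta>\<^sup>2 * indicat_real ?B \<omega>)"
      using Bm by (intro integrable_mult_right integrable_real_indicator) (auto simp: emeasure_eq_measure)
    fix \<omega>
    show "\<eta>\<^sup>2 * indicat_real ?B \<omega> \<le> ?I \<omega> * (?Z (s + h) \<omega> - ?Z s \<omega>)\<^sup>2"
    proof (cases "\<omega> \<in> ?B")
      case True
      then have "\<eta>\<^sup>2 \<le> \<bar>?Z (s + h) \<omega> - ?Z s \<omega>\<bar>\<^sup>2" using \<eta> by (intro power_mono) auto
      then show ?thesis using True by simp
    next
      case False
      then have "indicat_real ?B \<omega> = 0" by (rule indicator_simps(2))
      moreover have "0 \<le> ?I \<omega> * (?Z (s + h) \<omega> - ?Z s \<omega>)\<^sup>2" by simp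
      ultimately show ?thesis by (simp only: mult_zero_right)
    qed
  qed
  also note E
  finally have "\<eta>\<^sup>2 * prob ?B \<le> \<eta>\<^sup>2 * (prob A / 2)" by (simp add: mult.commute)
  then show ?thesis using \<eta> by simp
qed

end

section \<open>Oscillation between the points of a time grid\<close>

primrec max_increment :: "(nat \<Rightarrow> real) \<Rightarrow> nat \<Rightarrow> real" where
  "max_increment v 0 = 0"
| "max_increment v (Suc n) = max (max_increment v n) \<bar>v (Suc n) - v n\<bar>"

lemma max_increment_nonneg: "0 \<le> max_increment v n"
  by (induction n) auto

lemma max_increment_ge: "i < n \<Longrightarrow> \<bar>v (Suc i) - v i\<bar> \<le> max_increment v n"
  by (induction n) (auto simp: less_Suc_eq max_def)

lemma max_increment_le: "0 \<le> c \<Longrightarrow> (\<And>i. i < n \<Longrightarrow> \<bar>v (Suc i) - v i\<bar> \<le> c) \<Longrightarrow> max_increment v n \<le> c"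
  by (induction n) auto

lemma measurable_max_increment [measurable]:
  "(\<And>i. (\<lambda>\<omega>. v \<omega> i) \<in> borel_measurable M) \<Longrightarrow> (\<lambda>\<omega>. max_increment (v \<omega>) n) \<in> borel_measurable M"
  by (induction n) simp_all

lemma floor_grid:
  fixes t :: real
  assumes "0 < m" "0 \<le> t" "t * real m < real k"
  shows "real (nat \<lfloor>t * m\<rfloor>) / m \<le> t" "t \<le> real (Suc (nat \<lfloor>t * m\<rfloor>)) / m" "nat \<lfloor>t * m\<rfloor> < k"
proof -
  have 0: "0 \<le> t * m" using assms by simp
  have 1: "real (nat \<lfloor>t * m\<rfloor>) \<le> t * m" "t * m \<le> real (Suc (nat \<lfloor>t * m\<rfloor>))"
    using 0 by linarith+
  show "real (nat \<lfloor>t * m\<rfloor>) / m \<le> t" "t \<le> real (Suc (nat \<lfloor>t * m\<rfloor>)) / m"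
    using 1 assms by (simp_all add: field_simps)
  show "nat \<lfloor>t * m\<rfloor> < k" using 1(1) assms(3) by linarith
qed

context feller_path
begin

text \<open>Decomposition by the first exceedance: from there to the next grid point the observable moves by more
  than \<open>\<eta>\<close> with conditional probability at most one half.\<close>

lemma oscillation_on_finite_set:
  assumes g: "\<And>x. \<bar>apply_bcontfun g x\<bar> \<le> 1" and \<eta>: "0 < \<eta>" and m: "0 < m"
    and \<beta>: "\<And>h. 0 \<le> h \<Longrightarrow> h \<le> 1 / real m \<Longrightarrow>
      norm (T h (bcontfun_times g g) - bcontfun_times g g) + 2 * norm (T h g - g) \<le> \<eta>\<^sup>2 / 2"
    and Q: "finite Q" "\<And>q. q \<in> Q \<Longrightarrow> 0 \<le> q \<and> q * real m < real k"
  shows "prob {\<omega> \<in> space M. \<exists>q\<in>Q. \<bar>apply_bcontfun g (Y \<omega> q) - apply_bcontfun g (Y \<omega> (real (nat \<lfloor>q * m\<rfloor>) / m))\<bar> > 3 * \<eta>}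
    \<le> 2 * prob {\<omega> \<in> space M. max_increment (\<lambda>i. apply_bcontfun g (Y \<omega> (real i / m))) k > 2 * \<eta>}"
proof -
  let ?Z = "\<lambda>u \<omega>. apply_bcontfun g (Y \<omega> u)"
  define e where "e q \<omega> = \<bar>?Z q \<omega> - ?Z (real (nat \<lfloor>q * m\<rfloor>) / m) \<omega>\<bar>" for q \<omega>
  define D where "D = {\<omega> \<in> space M. max_increment (\<lambda>i. ?Z (real i / m) \<omega>) k > 2 * \<eta>}"
  define A where "A q = {\<omega> \<in> space M. e q \<omega> > 3 * \<eta> \<and> (\<forall>r\<in>{r\<in>Q. r < q}. e r \<omega> \<le> 3 * \<eta>)}" for q
  have Zm: "?Z u \<in> borel_measurable M" if "0 \<le> u" for u
    by (rule measurable_compose[OF measurable_Y[OF that] measurable_bcontfun])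
  have D[measurable]: "D \<in> events"
    unfolding D_def by (intro borel_measurable_less borel_measurable_const measurable_max_increment Zm) simp
  \<comment> \<open>The grid point to the left of \<open>r\<close> does not exceed \<open>r\<close>,
    so the excess at \<open>r\<close> is known at every time \<open>q\<close> from \<open>r\<close>
    on; hence a first exceedance at \<open>q\<close> is an event of the past at
    \<open>q\<close>.\<close>
  have em: "e r \<in> borel_measurable (past M Y q)" if "r \<in> Q" "r \<le> q" for r q
  proof -
    have "?Z u \<in> borel_measurable (past M Y q)" if "0 \<le> u" "u \<le> r" for u
      using that \<open>r \<le> q\<close> by (intro measurable_past_bcontfun) auto
    then show ?thesis unfolding e_def[abs_def] using Q(2)[OF \<open>r \<in> Q\<close>] floor_grid(1)[OF m, of r k]
      by (intro borel_measurable_abs borel_measurable_diff) auto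
  qed
  have A_past: "A q \<in> sets (past M Y q)" if q: "q \<in> Q" for q
  proof -
    have [measurable]: "e q \<in> borel_measurable (past M Y q)" "\<And>r. r \<in> {r\<in>Q. r < q} \<Longrightarrow> e r \<in> borel_measurable (past M Y q)"
      using em q by auto
    have "finite {r\<in>Q. r < q}" using Q(1) by simp
    then have "{\<omega> \<in> space (past M Y q). e q \<omega> > 3 * \<eta> \<and> (\<forall>r\<in>{r\<in>Q. r < q}. e r \<omega> \<le> 3 * \<eta>)} \<in> sets (past M Y q)"
      by (intro sets.sets_Collect_conj sets.sets_Collect_finite_All borel_measurable_less borel_measurable_le borel_measurable_const) auto
    then show ?thesis by (simp only: A_def space_past)
  qed
  have A_ev: "A q \<in> events" if "q \<in> Q" for q
    using A_past[OF that] subalgebra_past[of q] unfolding subalgebra_def by blast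
  have disj: "disjoint_family_on A Q"
    unfolding disjoint_family_on_def
  proof (intro ballI impI equals0I)
    fix a b \<omega> assume "a \<in> Q" "b \<in> Q" "a \<noteq> b" "\<omega> \<in> A a \<inter> A b"
    then show False unfolding A_def by (cases "a < b") (force, force)
  qed
  have sub: "{\<omega> \<in> space M. \<exists>q\<in>Q. e q \<omega> > 3 * \<eta>} \<subseteq> (\<Union>q\<in>Q. A q)"
  proof
    fix \<omega> assume \<omega>: "\<omega> \<in> {\<omega> \<in> space M. \<exists>q\<in>Q. e q \<omega> > 3 * \<eta>}"
    let ?q = "Min {q\<in>Q. e q \<omega> > 3 * \<eta>}"
    have fin: "finite {q\<in>Q. e q \<omega> > 3 * \<eta>}" "{q\<in>Q. e q \<omega> > 3 * \<eta>} \<noteq> {}" using Q(1) \<omega> by auto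
    have "?q \<in> {q\<in>Q. e q \<omega> > 3 * \<eta>}" by (rule Min_in[OF fin])
    moreover have "e r \<omega> \<le> 3 * \<eta>" if "r \<in> Q" "r < ?q" for r
    proof (rule ccontr)
      assume "\<not> e r \<omega> \<le> 3 * \<eta>"
      then have "?q \<le> r" using that fin by (intro Min_le) auto
      then show False using that by simp
    qed
    ultimately have "\<omega> \<in> A ?q" using \<omega> unfolding A_def by blast
    then show "\<omega> \<in> (\<Union>q\<in>Q. A q)" using \<open>?q \<in> {q\<in>Q. e q \<omega> > 3 * \<eta>}\<close> by blast
  qed
  have step: "prob (A q) \<le> 2 * prob (A q \<inter> D)" if q: "q \<in> Q" for q
  proof -
    \<comment> \<open>Time from \<open>q\<close> to the next grid point, at most one mesh
      width.\<close>
    define h where "h = real (Suc (nat \<lfloor>q * m\<rfloor>)) / m - q"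
    note fl = floor_grid[OF m, of q k, OF conjunct1[OF Q(2)[OF q]] conjunct2[OF Q(2)[OF q]]]
    have h: "0 \<le> h" "h \<le> 1 / real m" using fl m by (simp_all add: h_def field_simps)
    let ?B = "A q \<inter> {\<omega> \<in> space M. \<bar>?Z (q + h) \<omega> - ?Z q \<omega>\<bar> > \<eta>}"
    have q0: "0 \<le> q" using Q(2)[OF q] by simp
    have B: "prob ?B \<le> prob (A q) / 2"
      by (rule increment_probability[OF g q0 h(1) \<eta> \<beta>[OF h] A_past[OF q]])
    have Bev: "?B \<in> events"
      using q0 h by (intro sets.Int A_ev q borel_measurable_less borel_measurable_const borel_measurable_abs borel_measurable_diff Zm) auto
    have "A q \<subseteq> ?B \<union> (A q \<inter> D)"
    proof
      fix \<omega> assume \<omega>: "\<omega> \<in> A q"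
      show "\<omega> \<in> ?B \<union> (A q \<inter> D)"
      proof (cases "\<bar>?Z (q + h) \<omega> - ?Z q \<omega>\<bar> > \<eta>")
        case True
        then show ?thesis using \<omega> unfolding A_def by blast
      next
        case False
        have qh: "q + h = real (Suc (nat \<lfloor>q * m\<rfloor>)) / m" by (simp add: h_def)
        have "e q \<omega> > 3 * \<eta>" using \<omega> unfolding A_def by blast
        \<comment> \<open>At \<open>q\<close> the observable is more than \<open>3 * \<eta>\<close>
          away from its value at the left grid point and at most \<eta> from the one at the right
          grid point, so this grid step exceeds \<open>2 * \<eta>\<close>.\<close>
        then have "\<bar>?Z (real (Suc (nat \<lfloor>q * m\<rfloor>)) / m) \<omega> - ?Z (real (nat \<lfloor>q * m\<rfloor>) / m) \<omega>\<bar> > 2 * \<eta>"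
          using False unfolding e_def qh by linarith
        then have "max_increment (\<lambda>i. ?Z (real i / m) \<omega>) k > 2 * \<eta>"
          using max_increment_ge[OF fl(3), of "\<lambda>i. ?Z (real i / m) \<omega>"] by linarith
        then show ?thesis using \<omega> unfolding D_def A_def by blast
      qed
    qed
    then have "prob (A q) \<le> prob (?B \<union> (A q \<inter> D))"
      using Bev A_ev[OF q] D by (intro finite_measure_mono) auto
    also have "\<dots> \<le> prob ?B + prob (A q \<inter> D)"
      using Bev A_ev[OF q] D by (intro measure_Un_le) auto
    finally show ?thesis using B by linarith
  qed
  have "prob {\<omega> \<in> space M. \<exists>q\<in>Q. e q \<omega> > 3 * \<eta>} \<le> prob (\<Union>q\<in>Q. A q)"
    using A_ev Q(1) by (intro finite_measure_mono sub sets.finite_UN) auto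
  also have "\<dots> = (\<Sum>q\<in>Q. prob (A q))"
    using A_ev Q(1) disj by (intro finite_measure_finite_Union) auto
  also have "\<dots> \<le> (\<Sum>q\<in>Q. 2 * prob (A q \<inter> D))" by (intro sum_mono step)
  also have "\<dots> = 2 * prob (\<Union>q\<in>Q. A q \<inter> D)"
    unfolding sum_distrib_left[symmetric] using A_ev Q(1) D disj
    by (subst finite_measure_finite_Union) (auto simp: disjoint_family_on_def)
  also have "\<dots> \<le> 2 * prob D" using D by (intro mult_left_mono finite_measure_mono) auto
  finally show ?thesis unfolding e_def D_def .
qed


text \<open>Right continuity reduces all times to rational ones, which are exhausted by finite sets.
  Markov's inequality turns the exceedance of \<open>2 * \<eta>\<close> into an expectation, and the
  factor 2 cancels. An expectation is preferred to a probability because the maximal increment is a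
  continuous function of finitely many observations, whose means converge.\<close>

lemma oscillation_probability:
  fixes k m :: nat
  assumes g: "\<And>x. \<bar>apply_bcontfun g x\<bar> \<le> 1" and \<eta>: "0 < \<eta>" and m: "0 < m"
    and \<beta>: "\<And>h. 0 \<le> h \<Longrightarrow> h \<le> 1 / real m \<Longrightarrow>
      norm (T h (bcontfun_times g g) - bcontfun_times g g) + 2 * norm (T h g - g) \<le> \<eta>\<^sup>2 / 2"
  defines "E \<equiv> {\<omega> \<in> space M. \<exists>t\<ge>0. t * real m < real k \<and>
      \<bar>apply_bcontfun g (Y \<omega> t) - apply_bcontfun g (Y \<omega> (real (nat \<lfloor>t * m\<rfloor>) / m))\<bar> > 3 * \<eta>}"
  shows "E \<in> events"
    and "prob E \<le> (\<integral>\<omega>. max_increment (\<lambda>i. apply_bcontfun g (Y \<omega> (real i / m))) k \<partial>M) / \<eta>"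
proof -
  let ?Z = "\<lambda>u \<omega>. apply_bcontfun g (Y \<omega> u)"
  define e where "e q \<omega> = \<bar>?Z q \<omega> - ?Z (real (nat \<lfloor>q * m\<rfloor>) / m) \<omega>\<bar>" for q \<omega>
  define Q where "Q = {q \<in> \<rat>. 0 \<le> q \<and> q * real m < real k}"
  \<comment> \<open>The intersection with \<open>Q\<close> also covers an empty \<open>Q\<close>,
    where \<open>from_nat_into\<close> returns an arbitrary value.\<close>
  define Qn where "Qn n = {q \<in> Q. q \<in> from_nat_into Q ` {..n}}" for n :: nat
  define En where "En n = {\<omega> \<in> space M. \<exists>q\<in>Qn n. e q \<omega> > 3 * \<eta>}" for n
  have cQ: "countable Q" unfolding Q_def by (rule countable_subset[OF _ countable_rat]) auto
  have Zm: "?Z u \<in> borel_measurable M" if "0 \<le> u" for u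
    by (rule measurable_compose[OF measurable_Y[OF that] measurable_bcontfun])
  have em: "e r \<in> borel_measurable M" if "0 \<le> r" for r
    unfolding e_def[abs_def] using that by (intro borel_measurable_abs borel_measurable_diff Zm) auto
  have Qn: "finite (Qn n)" "\<And>q. q \<in> Qn n \<Longrightarrow> 0 \<le> q \<and> q * real m < real k" for n
    unfolding Qn_def Q_def by auto
  have En_ev: "En n \<in> events" for n
    unfolding En_def using Qn
    by (intro sets.sets_Collect_finite_Ex borel_measurable_less borel_measurable_const em) auto
  have E_eq: "E = (\<Union>n. En n)"
  proof (intro set_eqI iffI)
    fix \<omega> assume "\<omega> \<in> E"
    then obtain t where \<omega>: "\<omega> \<in> space M" and t: "0 \<le> t" "t * real m < real k" "e t \<omega> > 3 * \<eta>"
      unfolding E_def e_def by blast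
    have "(Y \<omega> \<longlongrightarrow> Y \<omega> t) (at_right t)"
      using cadlag[OF \<omega>] t(1) unfolding cadlag_paths_def by blast
    then have "((\<lambda>u. ?Z u \<omega>) \<longlongrightarrow> ?Z t \<omega>) (at_right t)"
      by (intro continuous_on_tendsto_compose[of UNIV "apply_bcontfun g"]) auto
    then have "((\<lambda>u. \<bar>?Z u \<omega> - ?Z (real (nat \<lfloor>t * m\<rfloor>) / m) \<omega>\<bar>) \<longlongrightarrow> e t \<omega>) (at_right t)"
      unfolding e_def by (intro tendsto_intros)
    then have 1: "\<forall>\<^sub>F u in at_right t. 3 * \<eta> < \<bar>?Z u \<omega> - ?Z (real (nat \<lfloor>t * m\<rfloor>) / m) \<omega>\<bar>"
      by (rule order_tendstoD(1)[OF _ t(3)])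
    \<comment> \<open>Up to this bound, times to the right of \<open>t\<close> stay below the
      horizon and have the same left grid point as \<open>t\<close>.\<close>
    let ?b = "min (real k / m) ((real_of_int \<lfloor>t * m\<rfloor> + 1) / m)"
    have "t * m < real_of_int \<lfloor>t * m\<rfloor> + 1" by linarith
    then have tb: "t < ?b" using t(2) m by (simp add: field_simps)
    obtain b1 where b1: "t < b1" "\<And>u. t < u \<Longrightarrow> u < b1 \<Longrightarrow> 3 * \<eta> < \<bar>?Z u \<omega> - ?Z (real (nat \<lfloor>t * m\<rfloor>) / m) \<omega>\<bar>"
      using 1 unfolding eventually_at_right_field by blast
    define b where "b = min b1 ?b"
    have b: "t < b" "\<And>u. t < u \<Longrightarrow> u < b \<Longrightarrow> 3 * \<eta> < \<bar>?Z u \<omega> - ?Z (real (nat \<lfloor>t * m\<rfloor>) / m) \<omega>\<bar> \<and> u < ?b"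
      using b1 tb unfolding b_def by auto
    obtain q where q: "q \<in> \<rat>" "t < q" "q < b" using Rats_dense_in_real[OF b(1)] by blast
    have qb: "q < ?b" using b(2)[OF q(2,3)] by simp
    have qk: "q * m < k" "q * m < real_of_int \<lfloor>t * m\<rfloor> + 1" using qb m by (simp_all add: field_simps)
    have "t * m \<le> q * m" using q(2) by (intro mult_right_mono) auto
    then have "\<lfloor>q * m\<rfloor> = \<lfloor>t * m\<rfloor>" using qk by (intro floor_unique) linarith+
    then have "e q \<omega> > 3 * \<eta>" using b(2)[OF q(2,3)] unfolding e_def by simp
    moreover have "q \<in> Q" unfolding Q_def using q qk t(1) by auto
    moreover then obtain n where "from_nat_into Q n = q" using from_nat_into_surj[OF cQ] by blast
    ultimately show "\<omega> \<in> (\<Union>n. En n)" using \<omega> unfolding En_def Qn_def by blast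
  next
    fix \<omega> assume "\<omega> \<in> (\<Union>n. En n)"
    then show "\<omega> \<in> E" unfolding E_def En_def Qn_def Q_def e_def by blast
  qed
  show "E \<in> events" unfolding E_eq using En_ev by blast
  let ?X = "\<lambda>\<omega>. max_increment (\<lambda>i. ?Z (real i / m) \<omega>) k"
  have Xm: "?X \<in> borel_measurable M" by (intro measurable_max_increment Zm) simp
  have X2: "?X \<omega> \<le> 2" for \<omega>
  proof (rule max_increment_le)
    fix i
    show "\<bar>?Z (real (Suc i) / m) \<omega> - ?Z (real i / m) \<omega>\<bar> \<le> 2"
      using g[of "Y \<omega> (real (Suc i) / m)"] g[of "Y \<omega> (real i / m)"] by linarith
  qed simp
  have Xi: "integrable M ?X"
    using X2 max_increment_nonneg by (intro integrable_const_bound[OF _ Xm, of 2] AE_I2) auto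
  have "prob {\<omega> \<in> space M. ?X \<omega> > 2 * \<eta>} \<le> prob {\<omega> \<in> space M. ?X \<omega> \<ge> 2 * \<eta>}"
    using Xm by (intro finite_measure_mono) auto
  also have "\<dots> \<le> (\<integral>\<omega>. ?X \<omega> \<partial>M) / (2 * \<eta>)"
    using \<eta> Xi max_increment_nonneg by (intro integral_Markov_inequality_measure[where A = "{}"]) auto
  finally have D: "2 * prob {\<omega> \<in> space M. ?X \<omega> > 2 * \<eta>} \<le> (\<integral>\<omega>. ?X \<omega> \<partial>M) / \<eta>" by (simp add: field_simps)
  have "prob (En n) \<le> (\<integral>\<omega>. ?X \<omega> \<partial>M) / \<eta>" for n
    using oscillation_on_finite_set[OF g \<eta> m \<beta> Qn] D unfolding En_def e_def by (rule order_trans)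
  moreover have "(\<lambda>n. prob (En n)) \<longlonglongrightarrow> prob (\<Union>n. En n)"
  proof (rule finite_Lim_measure_incseq)
    show "range En \<subseteq> events" using En_ev by blast
    show "incseq En" unfolding En_def Qn_def incseq_def by force
  qed
  ultimately show "prob E \<le> (\<integral>\<omega>. ?X \<omega> \<partial>M) / \<eta>" unfolding E_eq by (intro LIMSEQ_le_const2) auto
qed

end

subsection \<open>Finite-dimensional distributions\<close>

text \<open>The coordinates after time index \<open>k\<close> are frozen at \<open>0\<close>, so that functions of the first ones separate points.\<close>

definition observation_cube :: "nat \<Rightarrow> (nat \<times> 'j \<Rightarrow> real) set" where
  "observation_cube k = {v. \<forall>i j. v (i, j) \<in> (if i \<le> k then {0..1} else {0})}"

lemma compact_observation_cube: "compact (observation_cube k :: (nat \<times> 'j \<Rightarrow> real) set)"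
proof -
  have eq: "observation_cube k = (PiE UNIV (\<lambda>p. if fst p \<le> k then {0..1} else {0}) :: (nat \<times> 'j \<Rightarrow> real) set)"
    unfolding observation_cube_def PiE_UNIV_domain Pi_def by (simp only: split_paired_All fst_conv UNIV_I True_implies_equals simp_thms)
  have "compactin (product_topology (\<lambda>_ :: nat \<times> 'j. euclidean :: real topology) UNIV)
      (PiE UNIV (\<lambda>p. if fst p \<le> k then {0..1} else {0}))"
    by (subst compactin_PiE) (auto simp: compactin_euclidean_iff)
  then show ?thesis unfolding eq euclidean_product_topology compactin_euclidean_iff .
qed

definition observations :: "('j \<Rightarrow> 's::topological_space \<Rightarrow>\<^sub>C real) \<Rightarrow> nat \<Rightarrow> nat \<Rightarrow> (real \<Rightarrow> 's) \<Rightarrow> nat \<times> 'j \<Rightarrow> real" where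
  "observations g m k y = (\<lambda>(i, j). if i \<le> k then apply_bcontfun (g j) (y (real i / m)) else 0)"

locale observables =
  fixes g :: "'j::countable \<Rightarrow> 's::topological_space \<Rightarrow>\<^sub>C real" and k :: nat
  assumes g01: "\<And>j x. apply_bcontfun (g j) x \<in> {0..1}"
begin

text \<open>Admissible functions of the observations made at one time: continuous in the
  observations, and bounded continuous as functions on the state space, where the semigroup acts on
  them.\<close>

definition factors :: "(('j \<Rightarrow> real) \<Rightarrow> real) set" where
  "factors = {q. continuous_on UNIV q \<and> (\<lambda>x. q (\<lambda>j. apply_bcontfun (g j) x)) \<in> bcontfun}"

lemma factors_const: "(\<lambda>_. c) \<in> factors"
  by (simp add: factors_def const_bcontfun)

lemma factors_coordinate: "(\<lambda>w. w j) \<in> factors"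
  by (simp add: factors_def apply_bcontfun)

lemma factors_mult:
  assumes "q \<in> factors" "r \<in> factors"
  shows "(\<lambda>w. q w * r w) \<in> factors"
proof -
  let ?q = "\<lambda>x. q (\<lambda>j. apply_bcontfun (g j) x)" and ?r = "\<lambda>x. r (\<lambda>j. apply_bcontfun (g j) x)"
  have "(\<lambda>x. ?q x * ?r x) = apply_bcontfun (bcontfun_times (Bcontfun ?q) (Bcontfun ?r))"
    using assms unfolding factors_def by (simp add: Bcontfun_inverse fun_eq_iff)
  then have "(\<lambda>x. ?q x * ?r x) \<in> bcontfun" by (simp add: apply_bcontfun)
  then show ?thesis using assms unfolding factors_def by (auto intro!: continuous_on_mult)
qed

text \<open>Sums of products with one factor per time. They form an algebra, as Stone-Weierstrass
  demands, and the Markov property evaluates the mean of each product.\<close>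

inductive_set test_functions :: "((nat \<times> 'j \<Rightarrow> real) \<Rightarrow> real) set" where
  prod: "(\<And>i. q i \<in> factors) \<Longrightarrow> (\<lambda>v. \<Prod>i\<le>k. q i (\<lambda>j. v (i, j))) \<in> test_functions"
| add: "f \<in> test_functions \<Longrightarrow> h \<in> test_functions \<Longrightarrow> (\<lambda>v. f v + h v) \<in> test_functions"

lemma test_functions_mult:
  assumes "f \<in> test_functions" "h \<in> test_functions"
  shows "(\<lambda>v. f v * h v) \<in> test_functions"
  using assms
proof (induction arbitrary: h)
  case (prod q)
  from prod.prems show ?case
  proof induction
    case (prod r)
    then show ?case
      using test_functions.prod[of "\<lambda>i w. q i w * r i w"] factors_mult[OF \<open>\<And>i. q i \<in> factors\<close>]
      by (simp add: prod.distrib)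
  next
    case (add h1 h2)
    then show ?case by (simp add: distrib_left test_functions.add)
  qed
next
  case (add f1 f2)
  then show ?case by (simp add: distrib_right test_functions.add)
qed

lemma test_functions_product_coordinate:
  assumes "q \<in> factors" "i0 \<le> k"
  shows "(\<lambda>v. q (\<lambda>j. v (i0, j))) \<in> test_functions"
proof -
  have "(\<Prod>i\<le>k. (if i = i0 then q else (\<lambda>_. 1)) (\<lambda>j. v (i, j))) = q (\<lambda>j. v (i0, j))" for v :: "nat \<times> 'j \<Rightarrow> real"
    using assms(2) by (subst prod.remove[of _ i0]) (auto intro!: prod.neutral)
  then show ?thesis
    using test_functions.prod[of "\<lambda>i. if i = i0 then q else (\<lambda>_. 1)"] assms(1) factors_const by simp
qed

lemma test_functions_continuous: "f \<in> test_functions \<Longrightarrow> continuous_on UNIV f"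
proof (induction rule: test_functions.induct)
  case (prod q)
  have "continuous_on UNIV (\<lambda>v. q i (\<lambda>j. v (i, j)))" for i
  proof (rule continuous_on_compose2[of UNIV "q i"])
    show "continuous_on UNIV (q i)" using prod[of i] by (simp add: factors_def)
    show "continuous_on UNIV (\<lambda>v :: nat \<times> 'j \<Rightarrow> real. \<lambda>j. v (i, j))"
      by (intro continuous_on_coordinatewise_then_product) simp
  qed simp
  then show ?case by (intro continuous_on_prod) auto
qed (rule continuous_on_add)

lemma test_functions_ring: "function_ring_on test_functions (observation_cube k)"
proof
  show "compact (observation_cube k :: (nat \<times> 'j \<Rightarrow> real) set)" by (rule compact_observation_cube)
  show "continuous_on (observation_cube k) f" if "f \<in> test_functions" for f
    using test_functions_continuous[OF that] by (rule continuous_on_subset) simp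
  show "(\<lambda>_. c) \<in> test_functions" for c
    by (rule test_functions_product_coordinate[OF factors_const le0])
  fix v w :: "nat \<times> 'j \<Rightarrow> real"
  assume vw: "v \<in> observation_cube k" "w \<in> observation_cube k" "v \<noteq> w"
  have "\<exists>i j. v (i, j) \<noteq> w (i, j)"
    using vw(3) by (simp only: fun_eq_iff split_paired_All not_all simp_thms)
  then obtain i j where ij: "v (i, j) \<noteq> w (i, j)" by (elim exE)
  have "i \<le> k"
  proof (rule ccontr)
    assume "\<not> i \<le> k"
    moreover have "u (i, j) \<in> (if i \<le> k then {0..1} else {0})" if "u \<in> observation_cube k" for u :: "nat \<times> 'j \<Rightarrow> real"
      using that unfolding observation_cube_def by blast
    ultimately have 0: "u (i, j) = 0" if "u \<in> observation_cube k" for u :: "nat \<times> 'j \<Rightarrow> real"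
      using that by (simp only: if_False singleton_iff)
    show False using ij 0[OF vw(1)] 0[OF vw(2)] by (simp only: not_True_eq_False simp_thms)
  qed
  show "\<exists>f\<in>test_functions. f v \<noteq> f w"
    by (rule bexI[of _ "\<lambda>v. v (i, j)"]) (rule ij, rule test_functions_product_coordinate[OF factors_coordinate \<open>i \<le> k\<close>])
next
  show "(\<lambda>v. f v + h v) \<in> test_functions" if "f \<in> test_functions" "h \<in> test_functions" for f h
    using that by (rule test_functions.add)
next
  show "(\<lambda>v. f v * h v) \<in> test_functions" if "f \<in> test_functions" "h \<in> test_functions" for f h
    using that by (rule test_functions_mult)
qed

lemma observations_in_cube: "observations g m k y \<in> observation_cube k"
  using g01 by (auto simp: observations_def observation_cube_def)

lemma test_function_observations:
  assumes "f \<in> test_functions"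
  shows "\<exists>(N :: nat) (F :: nat \<Rightarrow> nat \<Rightarrow> 's \<Rightarrow>\<^sub>C real). \<forall>y. f (observations g m k y) = (\<Sum>a<N. \<Prod>i\<le>k. apply_bcontfun (F a i) (y (real i / m)))"
  using assms
proof induction
  case (prod q)
  let ?F = "\<lambda>i. Bcontfun (\<lambda>x. q i (\<lambda>j. apply_bcontfun (g j) x))"
  have "q i (\<lambda>j. observations g m k y (i, j)) = apply_bcontfun (?F i) (y (real i / m))" if "i \<le> k" for i y
    using prod[of i] that unfolding factors_def by (simp add: observations_def Bcontfun_inverse)
  then have "(\<Prod>i\<le>k. q i (\<lambda>j. observations g m k y (i, j))) = (\<Prod>i\<le>k. apply_bcontfun (?F i) (y (real i / m)))" for y
    by (intro prod.cong) auto
  then have "\<forall>y. (\<Prod>i\<le>k. q i (\<lambda>j. observations g m k y (i, j))) = (\<Sum>a<Suc 0. \<Prod>i\<le>k. apply_bcontfun (?F i) (y (real i / m)))"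
    by simp
  then show ?case by (intro exI[of _ "Suc 0"] exI[of _ "\<lambda>_. ?F"])
next
  case (add f h)
  obtain N1 and F1 :: "nat \<Rightarrow> nat \<Rightarrow> 's \<Rightarrow>\<^sub>C real" where 1: "\<And>y. f (observations g m k y) = (\<Sum>a<N1. \<Prod>i\<le>k. apply_bcontfun (F1 a i) (y (real i / m)))"
    using add.IH(1) by blast
  obtain N2 and F2 :: "nat \<Rightarrow> nat \<Rightarrow> 's \<Rightarrow>\<^sub>C real" where 2: "\<And>y. h (observations g m k y) = (\<Sum>a<N2. \<Prod>i\<le>k. apply_bcontfun (F2 a i) (y (real i / m)))"
    using add.IH(2) by blast
  define F where "F a = (if a < N1 then F1 a else F2 (a - N1))" for a
  have split: "(\<Sum>a<N1 + n. u a) = (\<Sum>a<N1. u a) + (\<Sum>a<n. u (N1 + a))" for u :: "nat \<Rightarrow> real" and n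
    by (induction n) (simp_all add: add.assoc)
  have "(\<Sum>a<N1 + N2. \<Prod>i\<le>k. apply_bcontfun (F a i) (y (real i / m)))
     = f (observations g m k y) + h (observations g m k y)" for y
    unfolding 1 2 split by (simp add: F_def)
  then show ?case by (intro exI[of _ "N1 + N2"] exI[of _ F]) simp
qed

end

section \<open>Means of products over several times\<close>

context feller_path
begin

lemma measurable_past_prod:
  fixes f :: "nat \<Rightarrow> 's \<Rightarrow>\<^sub>C real"
  assumes "\<And>i. i \<le> n \<Longrightarrow> 0 \<le> t i \<and> t i \<le> s"
  shows "(\<lambda>\<omega>. \<Prod>i\<le>n. apply_bcontfun (f i) (Y \<omega> (t i))) \<in> borel_measurable (past M Y s)"
  using assms by (intro borel_measurable_prod measurable_past_bcontfun) auto

lemma abs_prod_bcontfun_le: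
  fixes f :: "nat \<Rightarrow> 's \<Rightarrow>\<^sub>C real"
  shows "\<bar>\<Prod>i\<le>n. apply_bcontfun (f i) (x i)\<bar> \<le> (\<Prod>i\<le>n. norm (f i))"
proof -
  have "\<bar>\<Prod>i\<le>n. apply_bcontfun (f i) (x i)\<bar> = (\<Prod>i\<le>n. \<bar>apply_bcontfun (f i) (x i)\<bar>)"
    by (rule abs_prod)
  also have "\<dots> \<le> (\<Prod>i\<le>n. norm (f i))"
  proof (rule prod_mono)
    fix i show "0 \<le> \<bar>apply_bcontfun (f i) (x i)\<bar> \<and> \<bar>apply_bcontfun (f i) (x i)\<bar> \<le> norm (f i)"
      using norm_bounded[of "f i" "x i"] by simp
  qed
  finally show ?thesis .
qed

text \<open>The Markov property at the last time but one: the last factor is replaced by its image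
  under the semigroup and can then be merged into the preceding factor.\<close>

lemma integral_prod_Suc:
  fixes f :: "nat \<Rightarrow> 's \<Rightarrow>\<^sub>C real"
  assumes t: "0 \<le> t 0" "\<And>i. t i \<le> t (Suc i)"
  shows "(\<integral>\<omega>. (\<Prod>i\<le>Suc n. apply_bcontfun (f i) (Y \<omega> (t i))) \<partial>M)
     = (\<integral>\<omega>. (\<Prod>i\<le>n. apply_bcontfun (f i) (Y \<omega> (t i))) * apply_bcontfun (T (t (Suc n) - t n) (f (Suc n))) (Y \<omega> (t n)) \<partial>M)"
proof -
  have mono: "t i \<le> t j" if "i \<le> j" for i j using lift_Suc_mono_le[of t, OF t(2) that] .
  have t0: "0 \<le> t i" for i using mono[of 0 i] t(1) by simp
  have "(\<integral>\<omega>. (\<Prod>i\<le>n. apply_bcontfun (f i) (Y \<omega> (t i))) * apply_bcontfun (f (Suc n)) (Y \<omega> (t n + (t (Suc n) - t n))) \<partial>M)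
     = (\<integral>\<omega>. (\<Prod>i\<le>n. apply_bcontfun (f i) (Y \<omega> (t i))) * apply_bcontfun (T (t (Suc n) - t n) (f (Suc n))) (Y \<omega> (t n)) \<partial>M)"
  proof (rule markov)
    show "0 \<le> t n" by (rule t0)
    show "0 \<le> t (Suc n) - t n" using t(2)[of n] by simp
    show "(\<lambda>\<omega>. \<Prod>i\<le>n. apply_bcontfun (f i) (Y \<omega> (t i))) \<in> borel_measurable (past M Y (t n))"
      by (rule measurable_past_prod) (simp add: t0 mono)
  qed (rule abs_prod_bcontfun_le)
  then show ?thesis by simp
qed

lemma prod_bcontfun_times_last:
  fixes f :: "nat \<Rightarrow> 's \<Rightarrow>\<^sub>C real"
  shows "(\<Prod>i\<le>n. apply_bcontfun ((f(n := bcontfun_times (f n) h)) i) (x i))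
     = (\<Prod>i\<le>n. apply_bcontfun (f i) (x i)) * apply_bcontfun h (x n)"
proof -
  have "(\<Prod>i<n. apply_bcontfun ((f(n := bcontfun_times (f n) h)) i) (x i)) = (\<Prod>i<n. apply_bcontfun (f i) (x i))"
    by (rule prod.cong) auto
  then show ?thesis by (simp add: lessThan_Suc_atMost[symmetric] mult.assoc)
qed

lemma integral_prod_diff_le:
  fixes f :: "nat \<Rightarrow> 's \<Rightarrow>\<^sub>C real"
  assumes t: "\<And>i. i \<le> n \<Longrightarrow> 0 \<le> t i" and u: "0 \<le> u"
  shows "\<bar>(\<integral>\<omega>. (\<Prod>i\<le>n. apply_bcontfun (f i) (Y \<omega> (t i))) * apply_bcontfun h (Y \<omega> u) \<partial>M)
     - (\<integral>\<omega>. (\<Prod>i\<le>n. apply_bcontfun (f i) (Y \<omega> (t i))) * apply_bcontfun h' (Y \<omega> u) \<partial>M)\<bar>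
     \<le> (\<Prod>i\<le>n. norm (f i)) * norm (h - h')"
proof -
  let ?H = "\<lambda>\<omega>. \<Prod>i\<le>n. apply_bcontfun (f i) (Y \<omega> (t i))"
  have Hm: "?H \<in> borel_measurable M"
    using t by (intro borel_measurable_prod measurable_compose[OF measurable_Y measurable_bcontfun]) auto
  have int: "integrable M (\<lambda>\<omega>. ?H \<omega> * apply_bcontfun q (Y \<omega> u))" for q :: "'s \<Rightarrow>\<^sub>C real"
    by (rule integrable_bcontfun[OF u Hm abs_prod_bcontfun_le])
  have "(\<integral>\<omega>. ?H \<omega> * apply_bcontfun h (Y \<omega> u) \<partial>M) - (\<integral>\<omega>. ?H \<omega> * apply_bcontfun h' (Y \<omega> u) \<partial>M)
     = (\<integral>\<omega>. ?H \<omega> * apply_bcontfun (h - h') (Y \<omega> u) \<partial>M)"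
    using Bochner_Integration.integral_diff[OF int[of h] int[of h']] by (simp add: right_diff_distrib)
  also have "\<bar>\<dots>\<bar> \<le> (\<integral>\<omega>. \<bar>?H \<omega> * apply_bcontfun (h - h') (Y \<omega> u)\<bar> \<partial>M)"
    by (rule integral_abs_bound)
  also have "\<dots> \<le> (\<integral>\<omega>. (\<Prod>i\<le>n. norm (f i)) * norm (h - h') \<partial>M)"
  proof (rule integral_mono)
    show "integrable M (\<lambda>\<omega>. \<bar>?H \<omega> * apply_bcontfun (h - h') (Y \<omega> u)\<bar>)" using int by (rule integrable_abs)
    fix \<omega>
    show "\<bar>?H \<omega> * apply_bcontfun (h - h') (Y \<omega> u)\<bar> \<le> (\<Prod>i\<le>n. norm (f i)) * norm (h - h')"
      unfolding abs_mult using norm_bounded[of "h - h'" "Y \<omega> u"]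
      by (intro mult_mono abs_prod_bcontfun_le prod_nonneg) auto
  qed simp
  finally show ?thesis by (simp add: prob_space)
qed

end

text \<open>Stated for an arbitrary state space and filter, with a common initial law. Uniformity
  over bounded time intervals serves the increment estimates, which concern all steps
  \<open>h\<close> up to the mesh width at once.\<close>

locale feller_convergence = feller_path d T init M Y
  for d :: "'s::topological_space \<Rightarrow> 's \<Rightarrow> real" and T init and M :: "'a measure" and Y +
  fixes G :: "'i filter" and S :: "'i \<Rightarrow> real \<Rightarrow> ('s \<Rightarrow>\<^sub>C real) \<Rightarrow> ('s \<Rightarrow>\<^sub>C real)"
    and N :: "'i \<Rightarrow> 'b measure" and Z :: "'i \<Rightarrow> 'b \<Rightarrow> real \<Rightarrow> 's"
  assumes processes: "\<forall>\<^sub>F i in G. feller_process d (S i) init (N i) (Z i)"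
    and semigroups: "\<And>R \<delta> f. 0 \<le> R \<Longrightarrow> 0 < \<delta> \<Longrightarrow> \<forall>\<^sub>F i in G. \<forall>t\<in>{0..R}. norm (S i t f - T t f) \<le> \<delta>"
begin

text \<open>Induction on the number of times. In the last factor the semigroup \<open>S i\<close> is
  replaced by \<open>T\<close> at a uniform cost; the image \<open>h\<close> is then a fixed
  function, which is merged into the factor at time \<open>t n\<close>, and the induction hypothesis
  applies to one time less. At time 0 the laws agree.\<close>

lemma tendsto_integral_prod:
  fixes f :: "nat \<Rightarrow> 's \<Rightarrow>\<^sub>C real"
  assumes t: "t 0 = 0" "\<And>i. t i \<le> t (Suc i)"
  shows "((\<lambda>i. \<integral>\<omega>. (\<Prod>j\<le>n. apply_bcontfun (f j) (Z i \<omega> (t j))) \<partial>N i)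
     \<longlongrightarrow> (\<integral>\<omega>. (\<Prod>j\<le>n. apply_bcontfun (f j) (Y \<omega> (t j))) \<partial>M)) G"
proof (induction n arbitrary: f)
  case 0
  have "\<forall>\<^sub>F i in G. (\<integral>\<omega>. apply_bcontfun (f 0) (Y \<omega> 0) \<partial>M) = (\<integral>\<omega>. apply_bcontfun (f 0) (Z i \<omega> 0) \<partial>N i)"
    using processes
  proof eventually_elim
    case (elim i)
    interpret Z: feller_path d "S i" init "N i" "Z i" by (unfold_locales) (rule elim)
    show ?case by (simp only: initial Z.initial)
  qed
  then show ?case by (simp add: t) (rule Lim_transform_eventually[OF tendsto_const])
next
  case (Suc n)
  define \<tau> where "\<tau> = t (Suc n) - t n"
  have mono: "t i \<le> t j" if "i \<le> j" for i j using lift_Suc_mono_le[of t, OF t(2) that] .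
  have t0: "0 \<le> t i" for i using mono[of 0 i] t(1) by simp
  have \<tau>: "0 \<le> \<tau>" using t(2)[of n] by (simp add: \<tau>_def)
  define h where "h = T \<tau> (f (Suc n))"
  let ?f = "f(n := bcontfun_times (f n) h)"
  define C where "C = (\<Prod>j\<le>n. norm (f j))"
  have C: "0 \<le> C" unfolding C_def by (intro prod_nonneg) auto
  have lim: "((\<lambda>i. \<integral>\<omega>. (\<Prod>j\<le>n. apply_bcontfun (?f j) (Z i \<omega> (t j))) \<partial>N i)
     \<longlongrightarrow> (\<integral>\<omega>. (\<Prod>j\<le>n. apply_bcontfun (?f j) (Y \<omega> (t j))) \<partial>M)) G"
    by (rule Suc.IH)
  have eqY: "(\<integral>\<omega>. (\<Prod>j\<le>n. apply_bcontfun (?f j) (Y \<omega> (t j))) \<partial>M) = (\<integral>\<omega>. (\<Prod>j\<le>Suc n. apply_bcontfun (f j) (Y \<omega> (t j))) \<partial>M)"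
    unfolding integral_prod_Suc[of t, OF t0[of 0] t(2)] \<tau>_def[symmetric] h_def[symmetric]
    by (intro Bochner_Integration.integral_cong prod_bcontfun_times_last refl)
  have "((\<lambda>i. (\<integral>\<omega>. (\<Prod>j\<le>Suc n. apply_bcontfun (f j) (Z i \<omega> (t j))) \<partial>N i)
      - (\<integral>\<omega>. (\<Prod>j\<le>n. apply_bcontfun (?f j) (Z i \<omega> (t j))) \<partial>N i)) \<longlongrightarrow> 0) G"
    unfolding tendsto_iff
  proof (intro allI impI)
    fix e :: real assume e: "0 < e"
    define \<delta> where "\<delta> = e / 2 / (C + 1)"
    have \<delta>: "0 < \<delta>" using e C by (simp add: \<delta>_def)
    have "C * \<delta> \<le> (C + 1) * \<delta>" using \<delta> by (intro mult_right_mono) auto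
    also have "\<dots> = e / 2" unfolding \<delta>_def using C by (intro nonzero_mult_div_cancel_left[of "C + 1", folded times_divide_eq_right]) simp
    finally have C\<delta>: "C * \<delta> < e" using e by linarith
    have "\<forall>\<^sub>F i in G. \<forall>t\<in>{0..\<tau>}. norm (S i t (f (Suc n)) - T t (f (Suc n))) \<le> \<delta>"
      by (rule semigroups[OF \<tau> \<delta>])
    with processes show "\<forall>\<^sub>F i in G. dist ((\<integral>\<omega>. (\<Prod>j\<le>Suc n. apply_bcontfun (f j) (Z i \<omega> (t j))) \<partial>N i)
      - (\<integral>\<omega>. (\<Prod>j\<le>n. apply_bcontfun (?f j) (Z i \<omega> (t j))) \<partial>N i)) 0 < e"
    proof eventually_elim
      case (elim i)
      interpret Z: feller_path d "S i" init "N i" "Z i" by (unfold_locales) (rule elim)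
      have eqZ: "(\<integral>\<omega>. (\<Prod>j\<le>n. apply_bcontfun (?f j) (Z i \<omega> (t j))) \<partial>N i)
        = (\<integral>\<omega>. (\<Prod>j\<le>n. apply_bcontfun (f j) (Z i \<omega> (t j))) * apply_bcontfun h (Z i \<omega> (t n)) \<partial>N i)"
        by (intro Bochner_Integration.integral_cong prod_bcontfun_times_last refl)
      have "\<bar>(\<integral>\<omega>. (\<Prod>j\<le>Suc n. apply_bcontfun (f j) (Z i \<omega> (t j))) \<partial>N i)
        - (\<integral>\<omega>. (\<Prod>j\<le>n. apply_bcontfun (?f j) (Z i \<omega> (t j))) \<partial>N i)\<bar> \<le> C * norm (S i \<tau> (f (Suc n)) - h)"
        unfolding Z.integral_prod_Suc[of t, OF t0[of 0] t(2)] eqZ \<tau>_def[symmetric] C_def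
        by (rule Z.integral_prod_diff_le) (rule t0)+
      also have "\<dots> \<le> C * \<delta>" using elim(2) \<tau> C unfolding h_def by (intro mult_left_mono) auto
      finally show ?case using C\<delta> by (simp add: dist_real_def)
    qed
  qed
  from tendsto_add[OF this lim] show ?case unfolding eqY by simp
qed

end

context observables
begin

lemma measurable_test_function_observations:
  assumes "feller_path d T init M Y" "f \<in> test_functions"
  shows "(\<lambda>\<omega>. f (observations g m k (Y \<omega>))) \<in> borel_measurable M"
proof -
  interpret feller_path d T init M Y by fact
  obtain n and F :: "nat \<Rightarrow> nat \<Rightarrow> 's \<Rightarrow>\<^sub>C real" where F: "\<And>y. f (observations g m k y) = (\<Sum>a<n. \<Prod>i\<le>k. apply_bcontfun (F a i) (y (real i / m)))"
    using test_function_observations[OF assms(2), of m] by blast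
  show ?thesis unfolding F
    by (intro borel_measurable_sum borel_measurable_prod measurable_compose[OF measurable_Y measurable_bcontfun]) simp
qed

text \<open>By Stone-Weierstrass a uniform limit of test functions, each of which is a finite
  expression in values of single observables.\<close>

lemma measurable_continuous_observations:
  fixes \<Phi> :: "(nat \<times> 'j \<Rightarrow> real) \<Rightarrow> real"
  assumes "feller_path d T init M Y" and \<Phi>: "continuous_on (observation_cube k) \<Phi>"
  shows "(\<lambda>\<omega>. \<Phi> (observations g m k (Y \<omega>))) \<in> borel_measurable M"
proof -
  interpret R: function_ring_on test_functions "observation_cube k" by (rule test_functions_ring)
  obtain q where q: "q \<in> UNIV \<rightarrow> test_functions" "uniform_limit (observation_cube k) q \<Phi> sequentially"
    using R.Stone_Weierstrass[OF \<Phi>] by blast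
  show ?thesis
  proof (rule borel_measurable_LIMSEQ_real)
    show "(\<lambda>n. q n (observations g m k (Y \<omega>))) \<longlonglongrightarrow> \<Phi> (observations g m k (Y \<omega>))" for \<omega>
      using q(2) observations_in_cube by (rule tendsto_uniform_limitI)
    show "(\<lambda>\<omega>. q n (observations g m k (Y \<omega>))) \<in> borel_measurable M" for n
      using q(1) by (intro measurable_test_function_observations[OF assms(1)]) blast
  qed
qed


lemma bounded_continuous_observations:
  fixes \<Phi> :: "(nat \<times> 'j \<Rightarrow> real) \<Rightarrow> real"
  assumes "continuous_on (observation_cube k) \<Phi>"
  obtains B where "\<And>y. \<bar>\<Phi> (observations g m k y)\<bar> \<le> B"
proof -
  have "bounded (\<Phi> ` observation_cube k)"
    by (rule compact_imp_bounded[OF compact_continuous_image[OF assms compact_observation_cube]])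
  then obtain B where "\<And>x. x \<in> \<Phi> ` observation_cube k \<Longrightarrow> norm x \<le> B" unfolding bounded_iff by blast
  then have "\<bar>\<Phi> (observations g m k y)\<bar> \<le> B" for y
    using observations_in_cube[of m y] unfolding real_norm_def by blast
  then show ?thesis by (rule that)
qed

lemma integrable_continuous_observations:
  fixes \<Phi> :: "(nat \<times> 'j \<Rightarrow> real) \<Rightarrow> real"
  assumes "feller_path d T init M Y" and \<Phi>: "continuous_on (observation_cube k) \<Phi>"
  shows "integrable M (\<lambda>\<omega>. \<Phi> (observations g m k (Y \<omega>)))"
proof -
  interpret feller_path d T init M Y by fact
  obtain B where "\<And>y. \<bar>\<Phi> (observations g m k y)\<bar> \<le> B"
    by (rule bounded_continuous_observations[OF \<Phi>, of m]) (rule that)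
  then show ?thesis
    by (intro integrable_const_bound[where B = B] AE_I2 measurable_continuous_observations[OF assms]) simp
qed

lemma integral_observations_close:
  fixes \<Phi> q :: "(nat \<times> 'j \<Rightarrow> real) \<Rightarrow> real"
  assumes path: "feller_path d T init M Y"
    and \<Phi>: "continuous_on (observation_cube k) \<Phi>" and q: "continuous_on (observation_cube k) q"
    and e: "\<And>v. v \<in> observation_cube k \<Longrightarrow> \<bar>\<Phi> v - q v\<bar> \<le> e"
  shows "\<bar>(\<integral>\<omega>. \<Phi> (observations g m k (Y \<omega>)) \<partial>M) - (\<integral>\<omega>. q (observations g m k (Y \<omega>)) \<partial>M)\<bar> \<le> e"
proof -
  interpret feller_path d T init M Y by fact
  note i = integrable_continuous_observations[OF path \<Phi>, of m] integrable_continuous_observations[OF path q, of m]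
  have "\<bar>(\<integral>\<omega>. \<Phi> (observations g m k (Y \<omega>)) \<partial>M) - (\<integral>\<omega>. q (observations g m k (Y \<omega>)) \<partial>M)\<bar>
    = \<bar>\<integral>\<omega>. \<Phi> (observations g m k (Y \<omega>)) - q (observations g m k (Y \<omega>)) \<partial>M\<bar>"
    by (simp only: Bochner_Integration.integral_diff[OF i])
  also have "\<dots> \<le> (\<integral>\<omega>. \<bar>\<Phi> (observations g m k (Y \<omega>)) - q (observations g m k (Y \<omega>))\<bar> \<partial>M)"
    by (rule integral_abs_bound)
  also have "\<dots> \<le> (\<integral>\<omega>. e \<partial>M)"
    by (rule integral_mono) (auto intro!: integrable_abs Bochner_Integration.integrable_diff i e observations_in_cube)
  finally show ?thesis by (simp add: prob_space)
qed

end

context feller_convergence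
begin

lemma tendsto_test_function_observations:
  assumes "observables g" and q: "q \<in> observables.test_functions g k"
  shows "((\<lambda>i. \<integral>\<omega>. q (observations g m k (Z i \<omega>)) \<partial>N i)
     \<longlongrightarrow> (\<integral>\<omega>. q (observations g m k (Y \<omega>)) \<partial>M)) G"
proof -
  interpret observables g k by fact
  obtain n and F :: "nat \<Rightarrow> nat \<Rightarrow> 's \<Rightarrow>\<^sub>C real" where F: "\<And>y. q (observations g m k y) = (\<Sum>a<n. \<Prod>i\<le>k. apply_bcontfun (F a i) (y (real i / m)))"
    using test_function_observations[OF q, of m] by blast
  have split: "(\<integral>\<omega>. q (observations g m k (Y \<omega>)) \<partial>M) = (\<Sum>a<n. \<integral>\<omega>. (\<Prod>i\<le>k. apply_bcontfun (F a i) (Y \<omega> (real i / m))) \<partial>M)"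
    if "feller_path d T init M Y" for d T init and M :: "'z measure" and Y
  proof -
    interpret P: feller_path d T init M Y by fact
    have "integrable M (\<lambda>\<omega>. \<Prod>i\<le>k. apply_bcontfun (F a i) (Y \<omega> (real i / m)))" for a
    proof (rule P.integrable_const_bound)
      show "AE \<omega> in M. norm (\<Prod>i\<le>k. apply_bcontfun (F a i) (Y \<omega> (real i / m))) \<le> (\<Prod>i\<le>k. norm (F a i))"
        using P.abs_prod_bcontfun_le by (intro AE_I2) simp
      show "(\<lambda>\<omega>. \<Prod>i\<le>k. apply_bcontfun (F a i) (Y \<omega> (real i / m))) \<in> borel_measurable M"
        by (intro borel_measurable_prod measurable_compose[OF P.measurable_Y measurable_bcontfun]) simp
    qed
    then show ?thesis unfolding F by (intro Bochner_Integration.integral_sum)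
  qed
  have "((\<lambda>i. \<Sum>a<n. \<integral>\<omega>. (\<Prod>j\<le>k. apply_bcontfun (F a j) (Z i \<omega> (real j / m))) \<partial>N i)
     \<longlongrightarrow> (\<Sum>a<n. \<integral>\<omega>. (\<Prod>j\<le>k. apply_bcontfun (F a j) (Y \<omega> (real j / m))) \<partial>M)) G"
    by (intro tendsto_sum tendsto_integral_prod) (auto intro: divide_right_mono)
  moreover have "\<forall>\<^sub>F i in G. (\<Sum>a<n. \<integral>\<omega>. (\<Prod>j\<le>k. apply_bcontfun (F a j) (Z i \<omega> (real j / m))) \<partial>N i)
     = (\<integral>\<omega>. q (observations g m k (Z i \<omega>)) \<partial>N i)"
    using processes by eventually_elim (rule split[symmetric], rule feller_path.intro)
  ultimately show ?thesis
    unfolding split[OF feller_path_axioms] by (rule Lim_transform_eventually)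
qed

text \<open>By Stone-Weierstrass some test function is within \<open>e / 4\<close> of \<Phi> on the
  whole cube, which contains all observations; the error is therefore the same for all
  processes.\<close>

lemma tendsto_continuous_observations:
  fixes \<Phi> :: "(nat \<times> 'j::countable \<Rightarrow> real) \<Rightarrow> real"
  assumes obs: "observables g" and \<Phi>: "continuous_on (observation_cube k) \<Phi>"
  shows "((\<lambda>i. \<integral>\<omega>. \<Phi> (observations g m k (Z i \<omega>)) \<partial>N i)
     \<longlongrightarrow> (\<integral>\<omega>. \<Phi> (observations g m k (Y \<omega>)) \<partial>M)) G"
  unfolding tendsto_iff
proof (intro allI impI)
  fix e :: real assume e: "0 < e"
  interpret observables g k by fact
  interpret R: function_ring_on test_functions "observation_cube k" by (rule test_functions_ring)
  have e4: "0 < e / 4" using e by simp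
  obtain q where q: "q \<in> test_functions" "\<And>v. v \<in> observation_cube k \<Longrightarrow> \<bar>\<Phi> v - q v\<bar> < e / 4"
    using R.Stone_Weierstrass_basic[OF \<Phi> e4] by blast
  have q_close: "\<bar>\<Phi> v - q v\<bar> \<le> e / 4" if "v \<in> observation_cube k" for v using q(2)[OF that] by simp
  have "\<forall>\<^sub>F i in G. dist (\<integral>\<omega>. q (observations g m k (Z i \<omega>)) \<partial>N i) (\<integral>\<omega>. q (observations g m k (Y \<omega>)) \<partial>M) < e / 4"
    using tendsto_test_function_observations[OF obs q(1)] e4 by (rule tendstoD)
  with processes show "\<forall>\<^sub>F i in G. dist (\<integral>\<omega>. \<Phi> (observations g m k (Z i \<omega>)) \<partial>N i) (\<integral>\<omega>. \<Phi> (observations g m k (Y \<omega>)) \<partial>M) < e"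
  proof eventually_elim
    case (elim i)
    have "\<bar>(\<integral>\<omega>. \<Phi> (observations g m k (Z i \<omega>)) \<partial>N i) - (\<integral>\<omega>. q (observations g m k (Z i \<omega>)) \<partial>N i)\<bar> \<le> e / 4"
      by (rule integral_observations_close[OF feller_path.intro[OF elim(1)] \<Phi> R.continuous[OF q(1)] q_close])
    moreover have "\<bar>(\<integral>\<omega>. \<Phi> (observations g m k (Y \<omega>)) \<partial>M) - (\<integral>\<omega>. q (observations g m k (Y \<omega>)) \<partial>M)\<bar> \<le> e / 4"
      by (rule integral_observations_close[OF feller_path_axioms \<Phi> R.continuous[OF q(1)] q_close])
    ultimately show ?case using elim(2) e unfolding dist_real_def by linarith
  qed
qed

end

text \<open>Uniform continuity of the path on \<open>{0..R}\<close> and dominated convergence. This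
  is where continuity of the limiting paths enters.\<close>

lemma (in feller_path) max_increment_tendsto_0:
  assumes cont: "AE \<omega> in M. continuous_on {0..} (Y \<omega>)"
  shows "(\<lambda>m. \<integral>\<omega>. max_increment (\<lambda>i. apply_bcontfun g (Y \<omega> (real i / real m))) (R * m) \<partial>M) \<longlonglongrightarrow> 0"
proof -
  let ?X = "\<lambda>m \<omega>. max_increment (\<lambda>i. apply_bcontfun g (Y \<omega> (real i / real m))) (R * m)"
  have Xm: "?X m \<in> borel_measurable M" for m
    by (intro measurable_max_increment measurable_compose[OF measurable_Y measurable_bcontfun]) simp
  have "(\<lambda>m. \<integral>\<omega>. ?X m \<omega> \<partial>M) \<longlonglongrightarrow> (\<integral>\<omega>. 0 \<partial>M)"
  proof (rule integral_dominated_convergence[where w = "\<lambda>_. 2 * norm g"])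
    show "AE \<omega> in M. norm (?X m \<omega>) \<le> 2 * norm g" for m
    proof (rule AE_I2)
      fix \<omega>
      have "?X m \<omega> \<le> 2 * norm g"
      proof (rule max_increment_le)
        fix i
        show "\<bar>apply_bcontfun g (Y \<omega> (real (Suc i) / real m)) - apply_bcontfun g (Y \<omega> (real i / real m))\<bar> \<le> 2 * norm g"
          using norm_bounded[of g "Y \<omega> (real (Suc i) / real m)"] norm_bounded[of g "Y \<omega> (real i / real m)"]
          unfolding real_norm_def by linarith
      qed simp
      then show "norm (?X m \<omega>) \<le> 2 * norm g" using max_increment_nonneg by simp
    qed
    show "AE \<omega> in M. (\<lambda>m. ?X m \<omega>) \<longlonglongrightarrow> 0"
      using cont
    proof eventually_elim
      case (elim \<omega>)
      have "continuous_on {0..real R} (\<lambda>t. apply_bcontfun g (Y \<omega> t))"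
        by (rule continuous_on_compose2[of UNIV "apply_bcontfun g" _ "Y \<omega>"])
          (auto intro: continuous_on_subset[OF elim])
      then have uc: "uniformly_continuous_on {0..real R} (\<lambda>t. apply_bcontfun g (Y \<omega> t))"
        by (rule compact_uniformly_continuous) simp
      show ?case
        unfolding tendsto_iff
      proof (intro allI impI)
        fix e :: real assume e: "0 < e"
        then have "0 < e / 2" by simp
        with uc obtain \<delta> where \<delta>: "0 < \<delta>"
          "\<And>s t. s \<in> {0..real R} \<Longrightarrow> t \<in> {0..real R} \<Longrightarrow> dist s t < \<delta> \<Longrightarrow> dist (apply_bcontfun g (Y \<omega> s)) (apply_bcontfun g (Y \<omega> t)) < e / 2"
          unfolding uniformly_continuous_on_def by metis
        show "\<forall>\<^sub>F m in sequentially. dist (?X m \<omega>) 0 < e"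
          using eventually_gt_at_top[of "nat \<lceil>1 / \<delta>\<rceil>"]
        proof eventually_elim
          case (elim m)
          have "1 / \<delta> < real m" using elim by linarith
          then have m: "1 / real m < \<delta>" "0 < m" using \<delta>(1) elim by (auto simp: field_simps)
          have "?X m \<omega> \<le> e / 2"
          proof (rule max_increment_le)
            fix i assume i: "i < R * m"
            have R: "real R = real (R * m) / real m" using m by simp
            have "real (Suc i) \<le> real (R * m)" "real i \<le> real (R * m)" using i unfolding of_nat_le_iff by linarith+
            then have "real (Suc i) / real m \<le> real R" "real i / real m \<le> real R"
              unfolding R by (simp_all only: divide_right_mono of_nat_0_le_iff)
            moreover have "dist (real (Suc i) / real m) (real i / real m) < \<delta>"
              using m by (simp add: dist_real_def diff_divide_distrib[symmetric])
            ultimately have "dist (apply_bcontfun g (Y \<omega> (real (Suc i) / real m))) (apply_bcontfun g (Y \<omega> (real i / real m))) < e / 2"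
              by (intro \<delta>(2)) auto
            then show "\<bar>apply_bcontfun g (Y \<omega> (real (Suc i) / real m)) - apply_bcontfun g (Y \<omega> (real i / real m))\<bar> \<le> e / 2"
              by (simp add: dist_real_def)
          qed (use e in simp)
          then show ?case using e max_increment_nonneg[of "\<lambda>i. apply_bcontfun g (Y \<omega> (real i / real m))" "R * m"]
            by (simp add: dist_real_def)
        qed
      qed
    qed
  qed (use Xm in auto)
  then show ?thesis by simp
qed

lemma measurable_continuous_map_sigma:
  assumes h: "continuous_map X euclideanreal h"
  shows "h \<in> borel_measurable (sigma (topspace X) {U. openin X U})"
proof (rule borel_measurableI)
  fix V :: "real set" assume "open V"
  then have "openin X {x \<in> topspace X. h x \<in> V}"
    using h unfolding continuous_map_def by simp
  moreover have "h -` V \<inter> space (sigma (topspace X) {U. openin X U}) = {x \<in> topspace X. h x \<in> V}"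
    by (auto simp: space_measure_of_conv)
  moreover have "{U. openin X U} \<subseteq> Pow (topspace X)" using openin_subset by blast
  ultimately show "h -` V \<inter> space (sigma (topspace X) {U. openin X U}) \<in> sets (sigma (topspace X) {U. openin X U})"
    by (simp add: sets_measure_of sigma_sets.Basic)
qed

lemma (in feller_path) measurable_continuous_functional:
  assumes "continuous_map (skorokhod d) euclideanreal h"
  shows "(\<lambda>\<omega>. h (Y \<omega>)) \<in> borel_measurable M"
proof -
  have "Y \<in> M \<rightarrow>\<^sub>M sigma (topspace (skorokhod d)) {U. openin (skorokhod d) U}"
    using process by (simp add: feller_process_def random_element_def)
  then show ?thesis by (rule measurable_compose) (rule measurable_continuous_map_sigma[OF assms])
qed

subsection \<open>Convergence in the Skorokhod space\<close>

lemma log_slopes_nonempty: "log_slopes \<theta> \<noteq> {}"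
proof -
  have "\<bar>ln ((\<theta> 1 - \<theta> 0) / (1 - 0))\<bar> \<in> log_slopes \<theta>"
    unfolding log_slopes_def by (intro CollectI exI[of _ 0] exI[of _ 1]) simp
  then show ?thesis by blast
qed

lemma log_slope_nonneg: "\<theta> \<in> time_changes \<Longrightarrow> 0 \<le> log_slope \<theta>"
proof -
  assume \<theta>: "\<theta> \<in> time_changes"
  obtain l where l: "l \<in> log_slopes \<theta>" using log_slopes_nonempty by blast
  have "0 \<le> l" using l unfolding log_slopes_def by auto
  also have "l \<le> log_slope \<theta>" unfolding log_slope_def using \<theta> l by (intro cSup_upper) (auto simp: time_changes_def)
  finally show ?thesis .
qed

lemma log_slopes_id: "log_slopes (\<lambda>t. t) = {0}"
proof -
  have "\<bar>ln ((t - s) / (t - s))\<bar> = 0" if "s < t" for s t :: real using that by simp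
  then show ?thesis using log_slopes_nonempty[of "\<lambda>t. t"] unfolding log_slopes_def by fastforce
qed

lemma has_bochner_integral_exp_tail:
  "has_bochner_integral lborel (\<lambda>u. indicator {R..} u * exp (- u)) (exp (- R :: real))"
proof (rule has_bochner_integral_nn_integral)
  have "(\<integral>\<^sup>+ u. ennreal (exp (- u)) * indicator {R..} u \<partial>lborel) = ennreal (0 - - exp (- R))"
  proof (rule nn_integral_FTC_atLeast)
    show "((\<lambda>u. - exp (- u)) has_real_derivative exp (- x)) (at x)" for x :: real
      by (auto intro!: derivative_eq_intros)
    have "((\<lambda>u :: real. exp (- u)) \<longlongrightarrow> 0) at_top"
      by (rule filterlim_compose[OF exp_at_bot filterlim_uminus_at_bot_at_top])
    then show "((\<lambda>u :: real. - exp (- u)) \<longlongrightarrow> 0) at_top"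
      using tendsto_minus by fastforce
  qed auto
  moreover have "(\<integral>\<^sup>+ u. ennreal (indicator {R..} u * exp (- u)) \<partial>lborel) = (\<integral>\<^sup>+ u. ennreal (exp (- u)) * indicator {R..} u \<partial>lborel)"
    by (intro nn_integral_cong) (auto split: split_indicator)
  ultimately show "(\<integral>\<^sup>+ u. ennreal (indicator {R..} u * exp (- u)) \<partial>lborel) = ennreal (exp (- R))" by simp
qed auto

text \<open>The identity serves as time change. For \<open>u < R\<close> the truncated distance is
  at most \<delta>, beyond that at most 1, and the weight \<open>exp (- u)\<close> leaves
  \<open>exp (- R)\<close> for the tail.\<close>

lemma skorokhod_dist_le:
  assumes \<delta>: "0 \<le> \<delta>" and R: "0 \<le> R" and d: "\<And>t. 0 \<le> t \<Longrightarrow> t < R \<Longrightarrow> d (x t) (y t) \<le> \<delta>"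
  shows "skorokhod_dist d x y \<le> \<delta> + exp (- R)"
proof -
  let ?f = "\<lambda>u. (SUP t\<in>{0..}. min 1 (d (x (min t u)) (y (min t u))))"
  let ?I = "LBINT u:{0..}. exp (- u) * ?f u"
  have id: "(\<lambda>t. t) \<in> time_changes"
    unfolding time_changes_def by (auto simp: log_slopes_id strict_mono_on_def)
  have "skorokhod_dist d x y \<le> max (log_slope (\<lambda>t. t)) ?I"
    unfolding skorokhod_dist_def
  proof (rule cINF_lower[OF _ id])
    show "bdd_below ((\<lambda>\<theta>. max (log_slope \<theta>) (LBINT u:{0..}. exp (- u) * (SUP t\<in>{0..}. min 1 (d (x (min t u)) (y (min (\<theta> t) u)))))) ` time_changes)"
      by (rule bdd_belowI2[of _ 0]) (meson log_slope_nonneg max.coboundedI1)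
  qed
  also have "\<dots> = max 0 ?I" by (simp add: log_slope_def log_slopes_id)
  also have "?I \<le> \<delta> + exp (- R)"
  proof (cases "set_integrable lborel {0..} (\<lambda>u. exp (- u) * ?f u)")
    \<comment> \<open>The integral of a function that is not integrable is 0 by convention.\<close>
    case False
    then have "?I = 0" unfolding set_lebesgue_integral_def set_integrable_def by (rule not_integrable_integral_eq)
    then show ?thesis using \<delta> by simp
  next
    case True
    have f1: "?f u \<le> 1" for u by (intro cSUP_least) auto
    have f\<delta>: "?f u \<le> \<delta>" if "0 \<le> u" "u < R" for u
      using that by (intro cSUP_least) (auto intro!: min.coboundedI2 d)
    note tail = has_bochner_integral_exp_tail
    have "?I = (\<integral>u. indicator {0..} u * (exp (- u) * ?f u) \<partial>lborel)"
      by (simp add: set_lebesgue_integral_def)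
    also have "\<dots> \<le> (\<integral>u. \<delta> * (indicator {0..} u * exp (- u)) + indicator {R..} u * exp (- u) \<partial>lborel)"
    proof (rule integral_mono)
      show "integrable lborel (\<lambda>u. indicator {0..} u * (exp (- u) * ?f u))"
        using True by (simp add: set_integrable_def)
      show "integrable lborel (\<lambda>u. \<delta> * (indicator {0..} u * exp (- u)) + indicator {R..} u * exp (- u) :: real)"
        using tail[of 0] tail[of R] by (intro Bochner_Integration.integrable_add integrable_mult_right) (auto simp: has_bochner_integral_iff)
      fix u :: real
      show "indicator {0..} u * (exp (- u) * ?f u) \<le> \<delta> * (indicator {0..} u * exp (- u)) + indicator {R..} u * exp (- u)"
      proof (cases "0 \<le> u")
        case u: True
        show ?thesis
        proof (cases "u < R")
          case True
          have "exp (- u) * ?f u \<le> exp (- u) * \<delta>" by (rule mult_left_mono[OF f\<delta>[OF u True]]) simp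
          then show ?thesis using u True by (simp add: mult.commute)
        next
          case False
          have "exp (- u) * ?f u \<le> exp (- u) * 1" by (rule mult_left_mono[OF f1]) simp
          moreover have "0 \<le> \<delta> * exp (- u)" using \<delta> by simp
          ultimately have "exp (- u) * ?f u \<le> \<delta> * exp (- u) + exp (- u)" by linarith
          then show ?thesis using u False by simp
        qed
      next
        case False
        then show ?thesis by (simp add: indicator_def)
      qed
    qed
    also have "\<dots> = \<delta> * exp (- 0) + exp (- R)"
      using tail[of 0] tail[of R] by (intro has_bochner_integral_integral_eq has_bochner_integral_add has_bochner_integral_mult_right) auto
    finally show ?thesis by simp
  qed
  finally show ?thesis using \<delta> by simp
qed

text \<open>The largest function of the observations with Lipschitz constant \<open>c\<close> that lies below \<open>h\<close> on \<open>K\<close>, cut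
  off at \<open>B\<close>.\<close>

definition lower_envelope ::
    "('y \<Rightarrow> real) \<Rightarrow> 'y set \<Rightarrow> real \<Rightarrow> real \<Rightarrow> 'p set \<Rightarrow> ('y \<Rightarrow> 'p \<Rightarrow> real) \<Rightarrow> ('p \<Rightarrow> real) \<Rightarrow> real" where
  "lower_envelope h K B c J ob v = min B (INF y\<in>K. h y + c * (\<Sum>j\<in>J. \<bar>v j - ob y j\<bar>))"

context
  fixes h :: "'y \<Rightarrow> real" and K :: "'y set" and B c :: real and J :: "'p set" and ob :: "'y \<Rightarrow> 'p \<Rightarrow> real"
  assumes K: "K \<noteq> {}" and h: "\<And>y. y \<in> K \<Longrightarrow> \<bar>h y\<bar> \<le> B" and c: "0 \<le> c"
begin

lemma lower_envelope_terms_ge: "y \<in> K \<Longrightarrow> - B \<le> h y + c * (\<Sum>j\<in>J. \<bar>v j - ob y j\<bar>)"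
  using h[of y] mult_nonneg_nonneg[OF c, of "\<Sum>j\<in>J. \<bar>v j - ob y j\<bar>"] sum_nonneg[of J "\<lambda>j. \<bar>v j - ob y j\<bar>"] by fastforce

lemma bdd_below_lower_envelope: "bdd_below ((\<lambda>y. h y + c * (\<Sum>j\<in>J. \<bar>v j - ob y j\<bar>)) ` K)"
  using lower_envelope_terms_ge by (intro bdd_belowI2[of _ "- B"])

lemma lower_envelope_le: "y \<in> K \<Longrightarrow> lower_envelope h K B c J ob (ob y) \<le> h y"
  unfolding lower_envelope_def
  using cINF_lower[OF bdd_below_lower_envelope[of "ob y"], of y] by (simp add: min.coboundedI2)

lemma abs_lower_envelope_le: "\<bar>lower_envelope h K B c J ob v\<bar> \<le> B"
proof -
  obtain y where y: "y \<in> K" using K by blast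
  have "0 \<le> B" using h[OF y] by linarith
  moreover have "- B \<le> (INF y\<in>K. h y + c * (\<Sum>j\<in>J. \<bar>v j - ob y j\<bar>))"
    by (rule cINF_greatest[OF K lower_envelope_terms_ge])
  ultimately show ?thesis unfolding lower_envelope_def by (simp add: abs_le_iff min_def)
qed

text \<open>A competitor \<open>y\<close> whose penalty exceeds \<open>2 * B\<close> keeps the term
  above \<open>a\<close>, since \<open>h\<close> is at least \<open>- B\<close> and \<open>a\<close>
  is at most \<open>B\<close>. Only competitors with observations near \<open>v\<close> have to be
  examined.\<close>

lemma lower_envelope_ge:
  assumes "a \<le> B" "\<And>y. y \<in> K \<Longrightarrow> c * (\<Sum>j\<in>J. \<bar>v j - ob y j\<bar>) \<le> 2 * B \<Longrightarrow> a \<le> h y"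
  shows "a \<le> lower_envelope h K B c J ob v"
proof -
  have "a \<le> h y + c * (\<Sum>j\<in>J. \<bar>v j - ob y j\<bar>)" if y: "y \<in> K" for y
  proof (cases "c * (\<Sum>j\<in>J. \<bar>v j - ob y j\<bar>) \<le> 2 * B")
    case True
    have "0 \<le> c * (\<Sum>j\<in>J. \<bar>v j - ob y j\<bar>)" using c by (intro mult_nonneg_nonneg sum_nonneg) auto
    then show ?thesis using assms(2)[OF y True] by linarith
  next
    case False
    then show ?thesis using h[OF y] assms(1) by linarith
  qed
  then show ?thesis unfolding lower_envelope_def using assms(1) by (auto intro: cINF_greatest[OF K])
qed

text \<open>An infimum of functions with Lipschitz constant \<open>c\<close> has the same constant,
  and cutting off at \<open>B\<close> preserves it.\<close>

lemma lower_envelope_increment: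
  "lower_envelope h K B c J ob v \<le> lower_envelope h K B c J ob w + c * (\<Sum>j\<in>J. \<bar>v j - w j\<bar>)"
proof -
  have nn: "0 \<le> c * (\<Sum>j\<in>J. \<bar>v j - w j\<bar>)" using c by (intro mult_nonneg_nonneg sum_nonneg) auto
  have "(INF y\<in>K. h y + c * (\<Sum>j\<in>J. \<bar>v j - ob y j\<bar>)) - c * (\<Sum>j\<in>J. \<bar>v j - w j\<bar>) \<le> (INF y\<in>K. h y + c * (\<Sum>j\<in>J. \<bar>w j - ob y j\<bar>))"
  proof (rule cINF_greatest[OF K])
    fix y assume y: "y \<in> K"
    have "(\<Sum>j\<in>J. \<bar>v j - ob y j\<bar>) \<le> (\<Sum>j\<in>J. \<bar>v j - w j\<bar> + \<bar>w j - ob y j\<bar>)"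
      by (intro sum_mono) linarith
    then have "c * (\<Sum>j\<in>J. \<bar>v j - ob y j\<bar>) \<le> c * (\<Sum>j\<in>J. \<bar>v j - w j\<bar>) + c * (\<Sum>j\<in>J. \<bar>w j - ob y j\<bar>)"
      using mult_left_mono[OF _ c] by (fastforce simp: sum.distrib distrib_left[symmetric])
    then show "(INF y\<in>K. h y + c * (\<Sum>j\<in>J. \<bar>v j - ob y j\<bar>)) - c * (\<Sum>j\<in>J. \<bar>v j - w j\<bar>) \<le> h y + c * (\<Sum>j\<in>J. \<bar>w j - ob y j\<bar>)"
      using cINF_lower[OF bdd_below_lower_envelope[of v] y] by linarith
  qed
  then show ?thesis using nn unfolding lower_envelope_def by linarith
qed

end

lemma continuous_lower_envelope:
  fixes h :: "'y \<Rightarrow> real" and ob :: "'y \<Rightarrow> 'p \<Rightarrow> real"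
  assumes "K \<noteq> {}" "\<And>y. y \<in> K \<Longrightarrow> \<bar>h y\<bar> \<le> B" "0 \<le> c"
  shows "continuous_on UNIV (lower_envelope h K B c J ob)"
  unfolding continuous_on_def
proof
  fix v :: "'p \<Rightarrow> real"
  let ?f = "lower_envelope h K B c J ob" and ?g = "\<lambda>w. c * (\<Sum>j\<in>J. \<bar>w j - v j\<bar>)"
  have "continuous_on UNIV ?g"
    by (intro continuous_on_mult continuous_on_sum continuous_on_rabs continuous_on_diff continuous_on_const continuous_on_product_coordinates)
  then have "(?g \<longlongrightarrow> ?g v) (at v)" unfolding continuous_on_def by blast
  then have g: "(?g \<longlongrightarrow> 0) (at v)" by (simp only: diff_self abs_zero sum.neutral_const mult_zero_right)
  have "((\<lambda>w. ?f w - ?f v) \<longlongrightarrow> 0) (at v)"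
  proof (rule Lim_null_comparison[OF always_eventually g], intro allI)
    fix w
    have s: "(\<Sum>j\<in>J. \<bar>v j - w j\<bar>) = (\<Sum>j\<in>J. \<bar>w j - v j\<bar>)" by (simp add: abs_minus_commute)
    show "norm (?f w - ?f v) \<le> ?g w"
      using lower_envelope_increment[where h = h, OF assms, where J = J and ob = ob and v = v and w = w] lower_envelope_increment[where h = h, OF assms, where J = J and ob = ob and v = w and w = v] unfolding s real_norm_def by linarith
  qed
  then show "(?f \<longlongrightarrow> ?f v) (at v within UNIV)" by (simp add: LIM_zero_iff)
qed

lemma max_increment_cong: "(\<And>i. i \<le> n \<Longrightarrow> v i = w i) \<Longrightarrow> max_increment v n = max_increment w n"
  by (induction n) auto

lemma continuous_on_max_increment:
  "(\<And>i. continuous_on A (\<lambda>x. v x i)) \<Longrightarrow> continuous_on A (\<lambda>x. max_increment (v x) n)"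
  by (induction n) (auto intro!: continuous_intros)

section \<open>Paths that are approximately determined by copula values on a grid\<close>

definition grid_copula :: "nat \<Rightarrow> nat \<times> nat \<Rightarrow> permuton \<Rightarrow>\<^sub>C real" where
  "grid_copula n ab = Bcontfun (\<lambda>\<mu>. copula \<mu> (real (fst ab) / n) (real (snd ab) / n))"

lemma apply_grid_copula: "apply_bcontfun (grid_copula n ab) \<mu> = copula \<mu> (real (fst ab) / n) (real (snd ab) / n)"
proof -
  have "(\<lambda>\<mu>. copula \<mu> (real (fst ab) / n) (real (snd ab) / n)) \<in> bcontfun"
    by (rule bcontfun_normI[OF continuous_copula, of _ _ 1]) (simp add: copula_nonneg copula_le_1)
  then show ?thesis unfolding grid_copula_def by (simp add: Bcontfun_inverse)
qed

lemma grid_copula_01: "apply_bcontfun (grid_copula n ab) \<mu> \<in> {0..1}"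
  by (simp add: apply_grid_copula copula_nonneg copula_le_1)

lemma observables_grid_copula: "observables (grid_copula n)"
  by unfold_locales (rule grid_copula_01)

text \<open>Paths whose grid copulas stay within \<open>3 * \<eta>\<close> of their value at the
  preceding point of the time grid. The number \<open>n\<close> is at once the resolution in the
  square and the time horizon, so that a single index governs both errors; the time grid has mesh
  \<open>1 / m\<close>.\<close>

definition slow_paths :: "nat \<Rightarrow> nat \<Rightarrow> real \<Rightarrow> (real \<Rightarrow> permuton) set" where
  "slow_paths n m \<eta> = {y \<in> cadlag_paths. \<forall>ab\<in>{..n} \<times> {..n}. \<forall>t\<ge>0. t * real m < real (n * m) \<longrightarrow>
     \<bar>apply_bcontfun (grid_copula n ab) (y t) - apply_bcontfun (grid_copula n ab) (y (real (nat \<lfloor>t * m\<rfloor>) / m))\<bar> \<le> 3 * \<eta>}"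

text \<open>Constant paths belong to the set, so that the infimum in \<open>lower_envelope\<close>
  is taken over a nonempty set.\<close>

lemma slow_paths_nonempty: "0 \<le> \<eta> \<Longrightarrow> slow_paths n m \<eta> \<noteq> {}"
proof -
  assume \<eta>: "0 \<le> \<eta>"
  fix \<mu> :: permuton
  let ?y = "restrict (\<lambda>_. \<mu>) {0..}"
  have "?y \<in> cadlag_paths"
    unfolding cadlag_paths_def
  proof (intro CollectI conjI allI impI)
    show "?y \<in> extensional {0..}" by simp
    fix t :: real
    { assume t: "0 \<le> t"
      show "(?y \<longlongrightarrow> ?y t) (at_right t)"
      proof (rule tendsto_eventually)
        show "\<forall>\<^sub>F u in at_right t. ?y u = ?y t"
          using eventually_at_right_less[of t] by eventually_elim (use t in simp)
      qed }
    assume t: "0 < t"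
    have "(?y \<longlongrightarrow> \<mu>) (at_left t)"
    proof (rule tendsto_eventually)
      show "\<forall>\<^sub>F u in at_left t. ?y u = \<mu>"
        using eventually_at_left_real[OF t] by eventually_elim auto
    qed
    then show "\<exists>l. (?y \<longlongrightarrow> l) (at_left t)" by blast
  qed
  then have "?y \<in> slow_paths n m \<eta>" using \<eta> by (auto simp: slow_paths_def)
  then show ?thesis by blast
qed

text \<open>At any time before \<open>n\<close>, two such paths differ in a grid copula by at most
  \<open>3 * \<eta>\<close> for each path plus \<rho> at the preceding grid point. The Wasserstein
  bound applies with this error, and times beyond \<open>n\<close> cost
  \<open>exp (- real n)\<close>.\<close>

lemma skorokhod_dist_slow_paths:
  assumes n: "0 < n" and m: "0 < m" and x: "x \<in> slow_paths n m \<eta>" and y: "y \<in> slow_paths n m \<eta>" and \<rho>: "0 \<le> \<rho>" and \<eta>: "0 \<le> \<eta>"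
    and close: "\<And>i ab. i \<le> n * m \<Longrightarrow> ab \<in> {..n} \<times> {..n} \<Longrightarrow>
      \<bar>apply_bcontfun (grid_copula n ab) (x (real i / m)) - apply_bcontfun (grid_copula n ab) (y (real i / m))\<bar> \<le> \<rho>"
  shows "skorokhod_dist wasserstein x y \<le> 2 / n + 8 * (real n)\<^sup>2 * (6 * \<eta> + \<rho>) + exp (- real n)"
proof (rule skorokhod_dist_le)
  show "0 \<le> 2 / n + 8 * (real n)\<^sup>2 * (6 * \<eta> + \<rho>)" using \<rho> \<eta> by simp
  fix t :: real assume t: "0 \<le> t" "t < real n"
  then have tm: "t * real m < real (n * m)" using m by simp
  show "wasserstein (x t) (y t) \<le> 2 / n + 8 * (real n)\<^sup>2 * (6 * \<eta> + \<rho>)"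
  proof (rule wasserstein_le_grid[OF n])
    fix a b assume "a \<le> n" "b \<le> n"
    then have ab: "(a, b) \<in> {..n} \<times> {..n}" by simp
    let ?g = "apply_bcontfun (grid_copula n (a, b))"
    have "\<bar>?g (x t) - ?g (x (real (nat \<lfloor>t * m\<rfloor>) / m))\<bar> \<le> 3 * \<eta>" "\<bar>?g (y t) - ?g (y (real (nat \<lfloor>t * m\<rfloor>) / m))\<bar> \<le> 3 * \<eta>"
      using x y ab t(1) tm unfolding slow_paths_def by blast+
    moreover have "\<bar>?g (x (real (nat \<lfloor>t * m\<rfloor>) / m)) - ?g (y (real (nat \<lfloor>t * m\<rfloor>) / m))\<bar> \<le> \<rho>"
      using floor_grid(3)[OF m t(1) tm] by (intro close ab) simp
    ultimately show "\<bar>copula (x t) (real a / real n) (real b / real n) - copula (y t) (real a / real n) (real b / real n)\<bar> \<le> 6 * \<eta> + \<rho>"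
      unfolding apply_grid_copula fst_conv snd_conv by linarith
  qed
qed simp

text \<open>A union bound over the grid copulas. Measurability is part of the claim, since
  \<open>slow_paths\<close> refers to uncountably many times.\<close>

lemma not_slow_probability:
  assumes path: "feller_path wasserstein T init M Y" and \<eta>: "0 < \<eta>" and m: "0 < m"
    and \<beta>: "\<And>ab h. ab \<in> {..n} \<times> {..n} \<Longrightarrow> 0 \<le> h \<Longrightarrow> h \<le> 1 / real m \<Longrightarrow>
      norm (T h (bcontfun_times (grid_copula n ab) (grid_copula n ab)) - bcontfun_times (grid_copula n ab) (grid_copula n ab))
        + 2 * norm (T h (grid_copula n ab) - grid_copula n ab) \<le> \<eta>\<^sup>2 / 2"
  shows "{\<omega> \<in> space M. Y \<omega> \<notin> slow_paths n m \<eta>} \<in> sets M"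
    and "measure M {\<omega> \<in> space M. Y \<omega> \<notin> slow_paths n m \<eta>} \<le>
      (\<Sum>ab\<in>{..n} \<times> {..n}. (\<integral>\<omega>. max_increment (\<lambda>i. apply_bcontfun (grid_copula n ab) (Y \<omega> (real i / m))) (n * m) \<partial>M) / \<eta>)"
proof -
  interpret feller_path wasserstein T init M Y by fact
  define E where "E ab = {\<omega> \<in> space M. \<exists>t\<ge>0. t * real m < real (n * m) \<and>
      \<bar>apply_bcontfun (grid_copula n ab) (Y \<omega> t) - apply_bcontfun (grid_copula n ab) (Y \<omega> (real (nat \<lfloor>t * m\<rfloor>) / m))\<bar> > 3 * \<eta>}" for ab
  have eq: "{\<omega> \<in> space M. Y \<omega> \<notin> slow_paths n m \<eta>} = (\<Union>ab\<in>{..n} \<times> {..n}. E ab)"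
  proof (intro set_eqI iffI)
    fix \<omega> assume "\<omega> \<in> {\<omega> \<in> space M. Y \<omega> \<notin> slow_paths n m \<eta>}"
    then show "\<omega> \<in> (\<Union>ab\<in>{..n} \<times> {..n}. E ab)" unfolding slow_paths_def E_def not_le[symmetric] using cadlag[of \<omega>] by blast
  next
    fix \<omega> assume "\<omega> \<in> (\<Union>ab\<in>{..n} \<times> {..n}. E ab)"
    then show "\<omega> \<in> {\<omega> \<in> space M. Y \<omega> \<notin> slow_paths n m \<eta>}" unfolding slow_paths_def E_def not_le[symmetric] by blast
  qed
  have g1: "\<bar>apply_bcontfun (grid_copula n ab) x\<bar> \<le> 1" for ab x using grid_copula_01[of n ab x] by simp
  note E = oscillation_probability[OF g1 \<eta> m \<beta>, of _ "n * m", folded E_def]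
  show "{\<omega> \<in> space M. Y \<omega> \<notin> slow_paths n m \<eta>} \<in> sets M"
    unfolding eq by (intro sets.finite_UN E) auto
  have "prob (\<Union>ab\<in>{..n} \<times> {..n}. E ab) \<le> (\<Sum>ab\<in>{..n} \<times> {..n}. prob (E ab))"
    using E(1) by (intro finite_measure_subadditive_finite) auto
  also have "\<dots> \<le> (\<Sum>ab\<in>{..n} \<times> {..n}. (\<integral>\<omega>. max_increment (\<lambda>i. apply_bcontfun (grid_copula n ab) (Y \<omega> (real i / m))) (n * m) \<partial>M) / \<eta>)"
    by (intro sum_mono E(2))
  finally show "prob {\<omega> \<in> space M. Y \<omega> \<notin> slow_paths n m \<eta>} \<le>
      (\<Sum>ab\<in>{..n} \<times> {..n}. (\<integral>\<omega>. max_increment (\<lambda>i. apply_bcontfun (grid_copula n ab) (Y \<omega> (real i / m))) (n * m) \<partial>M) / \<eta>)"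
    unfolding eq .
qed

text \<open>A bound, uniform over the states, for the conditional mean square increment of
  \<open>g\<close> over a time \<open>h\<close> when \<open>g\<close> is bounded by 1 in absolute
  value.\<close>

definition step_defect ::
    "(real \<Rightarrow> ('s::topological_space \<Rightarrow>\<^sub>C real) \<Rightarrow> ('s \<Rightarrow>\<^sub>C real)) \<Rightarrow> ('s \<Rightarrow>\<^sub>C real) \<Rightarrow> real \<Rightarrow> real" where
  "step_defect T g h = norm (T h (bcontfun_times g g) - bcontfun_times g g) + 2 * norm (T h g - g)"

lemma step_defect_tendsto_0:
  assumes "feller_semigroup T"
  shows "(step_defect T g \<longlongrightarrow> 0) (at_right 0)"
proof -
  have "((\<lambda>t. T t f) \<longlongrightarrow> f) (at_right 0)" for f
    using assms by (simp add: feller_semigroup_def)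
  then have "((\<lambda>t. T t f - f) \<longlongrightarrow> 0) (at_right 0)" for f
    by (simp add: LIM_zero_iff)
  then have "((\<lambda>h. norm (T h (bcontfun_times g g) - bcontfun_times g g) + 2 * norm (T h g - g)) \<longlongrightarrow> 0 + 2 * 0) (at_right 0)"
    by (intro tendsto_add tendsto_mult tendsto_const tendsto_norm_zero)
  then show ?thesis unfolding step_defect_def[abs_def] by simp
qed

locale permuton_convergence = feller_convergence wasserstein T init M Y G S N Z
  for T :: "real \<Rightarrow> (permuton \<Rightarrow>\<^sub>C real) \<Rightarrow> (permuton \<Rightarrow>\<^sub>C real)" and init and M :: "'a measure" and Y
    and G :: "'i filter" and S and N :: "'i \<Rightarrow> 'b measure" and Z +
  assumes continuous_paths: "AE \<omega> in M. continuous_on {0..} (Y \<omega>)"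
begin

text \<open>The denominator 4, where the increment estimate allows 2, leaves room for replacing the
  limiting semigroup by its approximations. A mesh exists because the defect tends to 0 with the
  step, and the mean maximal increments tend to 0 with the mesh width.\<close>

lemma exists_mesh:
  assumes \<eta>: "0 < \<eta>" and \<gamma>: "0 < \<gamma>"
  obtains m :: nat where "0 < m"
    "\<And>ab h. ab \<in> {..n} \<times> {..n} \<Longrightarrow> 0 \<le> h \<Longrightarrow> h \<le> 1 / real m \<Longrightarrow> step_defect T (grid_copula n ab) h \<le> \<eta>\<^sup>2 / 4"
    "(\<Sum>ab\<in>{..n} \<times> {..n}. (\<integral>\<omega>. max_increment (\<lambda>i. apply_bcontfun (grid_copula n ab) (Y \<omega> (real i / m))) (n * m) \<partial>M) / \<eta>) < \<gamma>"
proof -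
  let ?sum = "\<lambda>m. \<Sum>ab\<in>{..n} \<times> {..n}. (\<integral>\<omega>. max_increment (\<lambda>i. apply_bcontfun (grid_copula n ab) (Y \<omega> (real i / real m))) (n * m) \<partial>M) / \<eta>"
  have "\<forall>\<^sub>F h in at_right 0. step_defect T (grid_copula n ab) h < \<eta>\<^sup>2 / 4" for ab
    using \<eta> by (intro order_tendstoD(2)[OF step_defect_tendsto_0[OF semigroup]]) simp
  then have "\<forall>\<^sub>F h in at_right 0. \<forall>ab\<in>{..n} \<times> {..n}. step_defect T (grid_copula n ab) h < \<eta>\<^sup>2 / 4"
    by (intro eventually_ball_finite) auto
  then obtain b where b: "0 < b" "\<And>h ab. 0 < h \<Longrightarrow> h < b \<Longrightarrow> ab \<in> {..n} \<times> {..n} \<Longrightarrow> step_defect T (grid_copula n ab) h < \<eta>\<^sup>2 / 4"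
    unfolding eventually_at_right_field by blast
  have "T 0 = id" using semigroup by (simp add: feller_semigroup_def)
  then have zero: "step_defect T g 0 = 0" for g by (simp add: step_defect_def)
  have "?sum \<longlonglongrightarrow> (\<Sum>ab\<in>{..n} \<times> {..n}. 0 / \<eta>)"
    using \<eta> by (intro tendsto_sum tendsto_divide tendsto_const max_increment_tendsto_0[OF continuous_paths]) auto
  then have "\<forall>\<^sub>F m in sequentially. ?sum m < \<gamma>"
    using \<gamma> by (intro order_tendstoD(2)) auto
  then have "\<forall>\<^sub>F m in sequentially. ?sum m < \<gamma> \<and> nat \<lceil>1 / b\<rceil> < m"
    by (rule eventually_conj[OF _ eventually_gt_at_top])
  then obtain m where m: "?sum m < \<gamma>" "nat \<lceil>1 / b\<rceil> < m"
    by (rule eventually_happens'[OF sequentially_bot, THEN exE]) blast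
  have "1 / b < real m" using m(2) by linarith
  moreover have m0: "0 < m" using m(2) by simp
  ultimately have mb: "1 / real m < b" using b(1) by (simp add: field_simps)
  show ?thesis
  proof (rule that[OF m0 _ m(1)])
    fix ab h assume *: "ab \<in> {..n} \<times> {..n}" "0 \<le> h" "h \<le> 1 / real m"
    show "step_defect T (grid_copula n ab) h \<le> \<eta>\<^sup>2 / 4"
    \<comment> \<open>The one-sided limit does not cover \<open>h = 0\<close>, where the defect
      vanishes since \<open>T 0\<close> is the identity.\<close>
    proof (cases "h = 0")
      case True
      then show ?thesis by (simp add: zero)
    next
      case False
      then show ?thesis using b(2)[OF _ _ *(1), of h] * mb by simp
    qed
  qed
qed

text \<open>Both ingredients of the bound pass to the approximations: the defect by uniform
  convergence of the semigroups on \<open>{0..1 / real m}\<close>, the mean maximal increments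
  because they are expectations of continuous functions of the observations. One mesh thus serves
  all indices far enough along the filter.\<close>

lemma eventually_not_slow_probability:
  assumes \<eta>: "0 < \<eta>" and m: "0 < m"
    and \<beta>: "\<And>ab h. ab \<in> {..n} \<times> {..n} \<Longrightarrow> 0 \<le> h \<Longrightarrow> h \<le> 1 / real m \<Longrightarrow> step_defect T (grid_copula n ab) h \<le> \<eta>\<^sup>2 / 4"
    and \<gamma>: "(\<Sum>ab\<in>{..n} \<times> {..n}. (\<integral>\<omega>. max_increment (\<lambda>i. apply_bcontfun (grid_copula n ab) (Y \<omega> (real i / m))) (n * m) \<partial>M) / \<eta>) < \<gamma>"
  shows "\<forall>\<^sub>F i in G. {\<omega> \<in> space (N i). Z i \<omega> \<notin> slow_paths n m \<eta>} \<in> sets (N i) \<and>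
    measure (N i) {\<omega> \<in> space (N i). Z i \<omega> \<notin> slow_paths n m \<eta>} \<le> \<gamma>"
proof -
  let ?J = "{..n} \<times> {..n}"
  \<comment> \<open>The defect contains one norm with coefficient 1 and one with coefficient 2, so
    its change is at most \<open>3 * \<delta>\<close>, which is
    \<open>\<eta>\<^sup>2 / 4\<close>.\<close>
  define \<delta> where "\<delta> = \<eta>\<^sup>2 / 12"
  have \<delta>: "0 < \<delta>" using \<eta> by (simp add: \<delta>_def)
  have "\<forall>\<^sub>F i in G. \<forall>ab\<in>?J. \<forall>t\<in>{0..1 / real m}. norm (S i t (f ab) - T t (f ab)) \<le> \<delta>" for f :: "nat \<times> nat \<Rightarrow> permuton \<Rightarrow>\<^sub>C real"
    by (intro eventually_ball_finite ballI semigroups \<delta>) auto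
  from eventually_conj[OF this[of "\<lambda>ab. bcontfun_times (grid_copula n ab) (grid_copula n ab)"] this[of "grid_copula n"]]
  have sg: "\<forall>\<^sub>F i in G. (\<forall>ab\<in>?J. \<forall>t\<in>{0..1 / real m}.
      norm (S i t (bcontfun_times (grid_copula n ab) (grid_copula n ab)) - T t (bcontfun_times (grid_copula n ab) (grid_copula n ab))) \<le> \<delta>) \<and>
      (\<forall>ab\<in>?J. \<forall>t\<in>{0..1 / real m}. norm (S i t (grid_copula n ab) - T t (grid_copula n ab)) \<le> \<delta>)" .
  have obs: "max_increment (\<lambda>i. observations (grid_copula n) m (n * m) y (i, ab)) (n * m)
      = max_increment (\<lambda>i. apply_bcontfun (grid_copula n ab) (y (real i / m))) (n * m)" for y ab
    by (rule max_increment_cong) (simp add: observations_def)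
  have "((\<lambda>i. \<integral>\<omega>. max_increment (\<lambda>j. observations (grid_copula n) m (n * m) (Z i \<omega>) (j, ab)) (n * m) \<partial>N i)
      \<longlongrightarrow> (\<integral>\<omega>. max_increment (\<lambda>j. observations (grid_copula n) m (n * m) (Y \<omega>) (j, ab)) (n * m) \<partial>M)) G" for ab
    by (rule tendsto_continuous_observations[OF observables_grid_copula])
      (intro continuous_on_max_increment continuous_on_subset[OF continuous_on_product_coordinates subset_UNIV])
  then have "((\<lambda>i. \<Sum>ab\<in>?J. (\<integral>\<omega>. max_increment (\<lambda>j. apply_bcontfun (grid_copula n ab) (Z i \<omega> (real j / m))) (n * m) \<partial>N i) / \<eta>)
     \<longlongrightarrow> (\<Sum>ab\<in>?J. (\<integral>\<omega>. max_increment (\<lambda>j. apply_bcontfun (grid_copula n ab) (Y \<omega> (real j / m))) (n * m) \<partial>M) / \<eta>)) G"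
    unfolding obs using \<eta> by (intro tendsto_sum tendsto_divide tendsto_const) auto
  then have "\<forall>\<^sub>F i in G. (\<Sum>ab\<in>?J. (\<integral>\<omega>. max_increment (\<lambda>j. apply_bcontfun (grid_copula n ab) (Z i \<omega> (real j / m))) (n * m) \<partial>N i) / \<eta>) < \<gamma>"
    using \<gamma> by (rule order_tendstoD(2))
  with processes sg show ?thesis
  proof eventually_elim
    case (elim i)
    have defect: "norm (S i h (bcontfun_times (grid_copula n ab) (grid_copula n ab)) - bcontfun_times (grid_copula n ab) (grid_copula n ab))
        + 2 * norm (S i h (grid_copula n ab) - grid_copula n ab) \<le> \<eta>\<^sup>2 / 2"
      if ab: "ab \<in> ?J" and h: "0 \<le> h" "h \<le> 1 / real m" for ab h
    proof -
      have tri: "norm (S i h f - f) \<le> norm (S i h f - T h f) + norm (T h f - f)" for f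
        using norm_triangle_ineq[of "S i h f - T h f" "T h f - f"] by simp
      have hm: "h \<in> {0..1 / real m}" using h by simp
      have "norm (S i h (bcontfun_times (grid_copula n ab) (grid_copula n ab)) - T h (bcontfun_times (grid_copula n ab) (grid_copula n ab))) \<le> \<delta>"
        "norm (S i h (grid_copula n ab) - T h (grid_copula n ab)) \<le> \<delta>"
        using elim(2) ab hm by blast+
      then show ?thesis
        using tri[of "bcontfun_times (grid_copula n ab) (grid_copula n ab)"] tri[of "grid_copula n ab"] \<beta>[OF ab h]
        unfolding step_defect_def \<delta>_def by linarith
    qed
    note path = feller_path.intro[OF elim(1)]
    show ?case
      using not_slow_probability(1)[OF path \<eta> m defect] order_trans[OF not_slow_probability(2)[OF path \<eta> m defect] less_imp_le[OF elim(3)]] by blast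
  qed
qed

end

text \<open>With slope \<open>2 * B * real n ^ 3\<close>, only competitors whose observations are
  within 1/n^3 of those of \<open>x\<close> count. For them \<eta> = \<rho> = 1/n^3 gives a distance
  of at most 2/n + 56/n + 1/n = 59/n, the middle term being 8 n^2 times 7/n^3. The exponent 3 is
  chosen to beat the factor n^2 of the Wasserstein bound.\<close>

lemma lower_envelope_near_path:
  fixes n m :: nat and B r e :: real and h :: "(real \<Rightarrow> permuton) \<Rightarrow> real"
  assumes n: "0 < n" and m: "0 < m" and B: "0 < B" and hB: "\<And>y. y \<in> cadlag_paths \<Longrightarrow> \<bar>h y\<bar> \<le> B"
    and x: "x \<in> slow_paths n m (1 / real n ^ 3)" and e: "0 \<le> e"
    and r: "\<And>y. y \<in> cadlag_paths \<Longrightarrow> skorokhod_dist wasserstein x y < r \<Longrightarrow> \<bar>h y - h x\<bar> \<le> e"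
    and nr: "59 / real n < r"
  shows "h x - e \<le> lower_envelope h (slow_paths n m (1 / real n ^ 3)) B (2 * B * real n ^ 3) ({..n * m} \<times> {..n} \<times> {..n})
    (observations (grid_copula n) m (n * m)) (observations (grid_copula n) m (n * m) x)"
proof -
  let ?\<eta> = "1 / real n ^ 3"
  let ?J = "{..n * m} \<times> {..n} \<times> {..n}"
  let ?ob = "observations (grid_copula n) m (n * m)"
  let ?c = "2 * B * real n ^ 3"
  have c: "0 < ?c" using B n by simp
  have \<eta>: "0 \<le> ?\<eta>" by simp
  have sub: "y \<in> cadlag_paths" if "y \<in> slow_paths n m ?\<eta>" for y using that by (simp add: slow_paths_def)
  have hK: "\<bar>h y\<bar> \<le> B" if "y \<in> slow_paths n m ?\<eta>" for y by (rule hB[OF sub[OF that]])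
  show ?thesis
  proof (rule lower_envelope_ge[OF slow_paths_nonempty[OF \<eta>] hK less_imp_le[OF c]])
    show "h x - e \<le> B" using hK[OF x] e by linarith
    fix y assume y: "y \<in> slow_paths n m ?\<eta>" and le: "?c * (\<Sum>j\<in>?J. \<bar>?ob x j - ?ob y j\<bar>) \<le> 2 * B"
    have "(2 * B) * (real n ^ 3 * (\<Sum>j\<in>?J. \<bar>?ob x j - ?ob y j\<bar>)) \<le> (2 * B) * 1" using le by (simp only: mult.assoc mult_1_right)
    then have "real n ^ 3 * (\<Sum>j\<in>?J. \<bar>?ob x j - ?ob y j\<bar>) \<le> 1" using B by (subst (asm) mult_le_cancel_left_pos) simp_all
    then have s: "(\<Sum>j\<in>?J. \<bar>?ob x j - ?ob y j\<bar>) \<le> ?\<eta>" using n by (simp add: field_simps)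
    have "skorokhod_dist wasserstein x y \<le> 2 / n + 8 * (real n)\<^sup>2 * (6 * ?\<eta> + ?\<eta>) + exp (- real n)"
    proof (rule skorokhod_dist_slow_paths[OF n m x y \<eta> \<eta>])
      fix i ab assume i: "i \<le> n * m" and ab: "ab \<in> {..n} \<times> {..n}"
      then have "\<bar>?ob x (i, ab) - ?ob y (i, ab)\<bar> \<le> (\<Sum>j\<in>?J. \<bar>?ob x j - ?ob y j\<bar>)"
        by (intro member_le_sum) auto
      also note s
      finally show "\<bar>apply_bcontfun (grid_copula n ab) (x (real i / m)) - apply_bcontfun (grid_copula n ab) (y (real i / m))\<bar> \<le> ?\<eta>"
        using i by (simp add: observations_def)
    qed
    also have "8 * (real n)\<^sup>2 * (6 * ?\<eta> + ?\<eta>) = 56 / n"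
      using n by (simp add: field_simps power2_eq_square power3_eq_cube)
    also have "exp (- real n) \<le> 1 / n"
    proof -
      have "real n \<le> exp (real n)" using exp_ge_add_one_self[of "real n"] by linarith
      then show ?thesis using n by (simp add: exp_minus field_simps)
    qed
    also have "2 / real n + 56 / n + 1 / n = 59 / n" by (simp add: add_divide_distrib[symmetric])
    also note nr
    finally have "\<bar>h y - h x\<bar> \<le> e" by (intro r sub y) simp
    then show "h x - e \<le> h y" by linarith
  qed
qed

context permuton_convergence
begin

text \<open>For fixed \<open>q\<close> the envelope \<open>\<Phi> q\<close> lies below
  \<open>h\<close> on the slow paths \<open>K q\<close>; off \<open>K q\<close>, an event whose
  probability is eventually at most \<open>(1 / 2) ^ q\<close>, it exceeds \<open>h\<close> by at
  most \<open>2 * B\<close>. So its mean, which converges, bounds the mean of \<open>h\<close> from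
  below. It remains to see that the envelope loses little at the limit process when \<open>q\<close>
  is large; \<open>q\<close> is fixed before the limit along the filter is taken.\<close>

lemma eventually_integral_ge:
  assumes h: "continuous_map skorokhod_permuton euclideanreal h" and bdd: "bounded (h ` cadlag_paths)" and e: "0 < e"
  shows "\<forall>\<^sub>F i in G. (\<integral>\<omega>. h (Y \<omega>) \<partial>M) - e \<le> (\<integral>\<omega>. h (Z i \<omega>) \<partial>N i)"
proof -
  obtain B where B: "0 < B" "\<And>y. y \<in> cadlag_paths \<Longrightarrow> \<bar>h y\<bar> \<le> B"
    using bdd unfolding bounded_pos real_norm_def by blast
  \<comment> \<open>Used at \<open>Suc q\<close>, which keeps resolution and horizon
    positive.\<close>
  define \<eta> where "\<eta> n = 1 / real n ^ 3" for n :: nat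
  have \<eta>: "0 < \<eta> (Suc q)" for q unfolding \<eta>_def by simp
  \<comment> \<open>The mesh for index \<open>q\<close> is so fine that the bad events of the limit
    process have summable probabilities.\<close>
  have "\<exists>m. 0 < m \<and>
    (\<forall>ab h. ab \<in> {..Suc q} \<times> {..Suc q} \<longrightarrow> 0 \<le> h \<longrightarrow> h \<le> 1 / real m \<longrightarrow> step_defect T (grid_copula (Suc q)  ab) h \<le> (\<eta> (Suc q))\<^sup>2 / 4) \<and>
    (\<Sum>ab\<in>{..Suc q} \<times> {..Suc q}. (\<integral>\<omega>. max_increment (\<lambda>i. apply_bcontfun (grid_copula (Suc q) ab) (Y \<omega> (real i / m))) (Suc q * m) \<partial>M) / \<eta> (Suc q)) < (1 / 2) ^ q" for q
    by (rule exists_mesh[OF \<eta>[of q], of "(1 / 2) ^ q" "Suc q"]) (simp, blast)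
  then obtain mesh where mesh: "\<And>q. 0 < mesh q"
    "\<And>q ab h. ab \<in> {..Suc q} \<times> {..Suc q} \<Longrightarrow> 0 \<le> h \<Longrightarrow> h \<le> 1 / real (mesh q) \<Longrightarrow> step_defect T (grid_copula (Suc q) ab) h \<le> (\<eta> (Suc q))\<^sup>2 / 4"
    "\<And>q. (\<Sum>ab\<in>{..Suc q} \<times> {..Suc q}. (\<integral>\<omega>. max_increment (\<lambda>i. apply_bcontfun (grid_copula (Suc q) ab) (Y \<omega> (real i / mesh q))) (Suc q * mesh q) \<partial>M) / \<eta> (Suc q)) < (1 / 2) ^ q"
    by metis
  define K where "K q = slow_paths (Suc q) (mesh q) (\<eta> (Suc q))" for q
  define ob where "ob q = observations (grid_copula (Suc q)) (mesh q) (Suc q * mesh q)" for q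
  define \<Phi> where "\<Phi> q = lower_envelope h (K q) B (2 * B * real (Suc q) ^ 3) ({..Suc q * mesh q} \<times> {..Suc q} \<times> {..Suc q}) (ob q)" for q
  have K_ne: "K q \<noteq> {}" for q unfolding K_def by (rule slow_paths_nonempty[OF less_imp_le[OF \<eta>]])
  have K_sub: "y \<in> cadlag_paths" if "y \<in> K q" for y q using that by (simp add: K_def slow_paths_def)
  have hK: "\<bar>h y\<bar> \<le> B" if "y \<in> K q" for y q by (rule B(2)[OF K_sub[OF that]])
  have c: "0 \<le> 2 * B * real (Suc q) ^ 3" for q using B by simp
  have \<Phi>_cont: "continuous_on A (\<Phi> q)" for A q
    unfolding \<Phi>_def by (rule continuous_on_subset[OF continuous_lower_envelope[OF K_ne hK c] subset_UNIV])
  have \<Phi>_B: "\<bar>\<Phi> q v\<bar> \<le> B" for q v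
    unfolding \<Phi>_def by (rule abs_lower_envelope_le[OF K_ne hK c])
  have \<Phi>_le: "\<Phi> q (ob q y) \<le> h y" if "y \<in> K q" for q y
    unfolding \<Phi>_def by (rule lower_envelope_le[OF K_ne hK c that])
  have bad: "\<forall>\<^sub>F i in G. {\<omega> \<in> space (N i). Z i \<omega> \<notin> K q} \<in> sets (N i) \<and> measure (N i) {\<omega> \<in> space (N i). Z i \<omega> \<notin> K q} \<le> (1 / 2) ^ q" for q
    unfolding K_def by (rule eventually_not_slow_probability[OF \<eta> mesh])

  have defect: "norm (T h (bcontfun_times (grid_copula (Suc q) ab) (grid_copula (Suc q) ab)) - bcontfun_times (grid_copula (Suc q) ab) (grid_copula (Suc q) ab))
        + 2 * norm (T h (grid_copula (Suc q) ab) - grid_copula (Suc q) ab) \<le> (\<eta> (Suc q))\<^sup>2 / 2"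
    if "ab \<in> {..Suc q} \<times> {..Suc q}" "0 \<le> h" "h \<le> 1 / real (mesh q)" for q ab h
  proof -
    have "(\<eta> (Suc q))\<^sup>2 / 4 \<le> (\<eta> (Suc q))\<^sup>2 / 2" by simp
    then show ?thesis using mesh(2)[OF that] unfolding step_defect_def by linarith
  qed
  have A_ev: "{\<omega> \<in> space M. Y \<omega> \<notin> K q} \<in> events" for q
    unfolding K_def by (rule not_slow_probability(1)[OF feller_path_axioms \<eta> mesh(1) defect])
  have A_le: "prob {\<omega> \<in> space M. Y \<omega> \<notin> K q} \<le> (1 / 2) ^ q" for q
    unfolding K_def
    by (rule order_trans[OF not_slow_probability(2)[OF feller_path_axioms \<eta> mesh(1) defect] less_imp_le[OF mesh(3)]])
  \<comment> \<open>Borel-Cantelli: almost every path of the limit process is slow for all large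
    \<open>q\<close>, although resolution and horizon grow with \<open>q\<close>.\<close>
  have "AE \<omega> in M. \<forall>\<^sub>F q in sequentially. \<omega> \<in> space M - {\<omega> \<in> space M. Y \<omega> \<notin> K q}"
  proof (rule borel_cantelli_AE1[OF A_ev])
    show "emeasure M {\<omega> \<in> space M. Y \<omega> \<notin> K q} < \<infinity>" for q by (simp add: emeasure_eq_measure)
    show "summable (\<lambda>q. prob {\<omega> \<in> space M. Y \<omega> \<notin> K q})"
      by (rule summable_comparison_test'[of "\<lambda>q. (1 / 2) ^ q" 0]) (use A_le in \<open>auto intro!: summable_geometric\<close>)
  qed
  then have slow: "AE \<omega> in M. \<forall>\<^sub>F q in sequentially. \<omega> \<in> space M \<and> Y \<omega> \<in> K q"
    by eventually_elim (auto elim: eventually_mono)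

  \<comment> \<open>The positive part of the loss, because off \<open>K q\<close> the envelope may
    exceed \<open>h\<close>.\<close>
  define D where "D q \<omega> = max 0 (h (Y \<omega>) - \<Phi> q (ob q (Y \<omega>)))" for q \<omega>
  have hm: "(\<lambda>\<omega>. h (Y \<omega>)) \<in> borel_measurable M" by (rule measurable_continuous_functional[OF h])
  have \<Phi>m: "(\<lambda>\<omega>. \<Phi> q (ob q (Y \<omega>))) \<in> borel_measurable M" for q
    unfolding ob_def by (rule observables.measurable_continuous_observations[OF observables_grid_copula feller_path_axioms \<Phi>_cont])
  have Dm: "D q \<in> borel_measurable M" for q
    unfolding D_def[abs_def] by (intro borel_measurable_max borel_measurable_const borel_measurable_diff hm \<Phi>m)
  have D_le: "\<bar>D q \<omega>\<bar> \<le> 2 * B" if "\<omega> \<in> space M" for q \<omega>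
    using B(2)[OF cadlag[OF that]] \<Phi>_B[of q "ob q (Y \<omega>)"] unfolding D_def by (simp add: abs_le_iff)
  have "(\<lambda>q. \<integral>\<omega>. D q \<omega> \<partial>M) \<longlonglongrightarrow> (\<integral>\<omega>. 0 \<partial>M)"
  proof (rule integral_dominated_convergence[where w = "\<lambda>_. 2 * B"])
    show "AE \<omega> in M. norm (D q \<omega>) \<le> 2 * B" for q using D_le by (intro AE_I2) simp
    show "AE \<omega> in M. (\<lambda>q. D q \<omega>) \<longlonglongrightarrow> 0"
      using slow
    proof eventually_elim
      case (elim \<omega>)
      then have "\<omega> \<in> space M" using eventually_happens'[OF sequentially_bot elim] by blast
      then have x: "Y \<omega> \<in> cadlag_paths" by (rule cadlag)
      show ?case
        unfolding tendsto_iff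
      proof (intro allI impI)
        fix a :: real assume a: "0 < a"
        \<comment> \<open>Continuity of \<open>h\<close> at the path gives a ball in the Skorokhod
          distance on which \<open>h\<close> varies by less than \<open>a / 2\<close>.\<close>
        have "openin skorokhod_permuton {y \<in> topspace skorokhod_permuton. h y \<in> ball (h (Y \<omega>)) (a / 2)}"
          by (rule openin_continuous_map_preimage[OF h]) (simp only: open_openin[symmetric] open_ball)
        then obtain r where r: "0 < r" "\<And>y. y \<in> cadlag_paths \<Longrightarrow> skorokhod_dist wasserstein (Y \<omega>) y < r \<Longrightarrow> h y \<in> ball (h (Y \<omega>)) (a / 2)"
          unfolding openin_skorokhod topspace_skorokhod using x a by fastforce
        show "\<forall>\<^sub>F q in sequentially. dist (D q \<omega>) 0 < a"
          using elim eventually_gt_at_top[of "nat \<lceil>59 / r\<rceil>"]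
        proof eventually_elim
          case (elim q)
          have "59 / r < real (Suc q)" using elim(2) by linarith
          then have q: "59 / real (Suc q) < r" using r(1) by (simp add: field_simps)
          have "h (Y \<omega>) - a / 2 \<le> \<Phi> q (ob q (Y \<omega>))"
            unfolding \<Phi>_def ob_def K_def \<eta>_def
          proof (rule lower_envelope_near_path[OF zero_less_Suc mesh(1) B])
            show "Y \<omega> \<in> slow_paths (Suc q) (mesh q) (1 / real (Suc q) ^ 3)" using elim(1) by (simp add: K_def \<eta>_def)
            show "\<bar>h y - h (Y \<omega>)\<bar> \<le> a / 2" if "y \<in> cadlag_paths" "skorokhod_dist wasserstein (Y \<omega>) y < r" for y
              using r(2)[OF that] by (simp add: dist_real_def abs_minus_commute)
          qed (use a q in auto)
          then show ?case using a unfolding D_def dist_real_def by simp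
        qed
      qed
    qed
  qed (use Dm in auto)
  then have "\<forall>\<^sub>F q in sequentially. (\<integral>\<omega>. D q \<omega> \<partial>M) < e / 3"
    using e by (intro order_tendstoD(2)) auto
  moreover have "(\<lambda>q. 2 * B * (1 / 2) ^ q) \<longlonglongrightarrow> 2 * B * 0"
    by (intro tendsto_mult tendsto_const LIMSEQ_power_zero) simp
  then have "\<forall>\<^sub>F q in sequentially. 2 * B * (1 / 2) ^ q < e / 3"
    using e by (intro order_tendstoD(2)) auto
  ultimately have "\<forall>\<^sub>F q in sequentially. (\<integral>\<omega>. D q \<omega> \<partial>M) < e / 3 \<and> 2 * B * (1 / 2) ^ q < e / 3"
    by (rule eventually_conj)
  then obtain q where q: "(\<integral>\<omega>. D q \<omega> \<partial>M) < e / 3" "2 * B * (1 / 2) ^ q < e / 3"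
    using eventually_happens'[OF sequentially_bot] by blast

  have hi: "integrable M (\<lambda>\<omega>. h (Y \<omega>))"
    using B(2) cadlag by (intro integrable_const_bound[where B = B, OF _ hm] AE_I2) simp
  have \<Phi>i: "integrable M (\<lambda>\<omega>. \<Phi> q (ob q (Y \<omega>)))"
    using \<Phi>_B by (intro integrable_const_bound[where B = B, OF _ \<Phi>m] AE_I2) simp
  have Di: "integrable M (D q)"
    using D_le by (intro integrable_const_bound[where B = "2 * B", OF _ Dm] AE_I2) simp
  have "(\<integral>\<omega>. h (Y \<omega>) \<partial>M) \<le> (\<integral>\<omega>. \<Phi> q (ob q (Y \<omega>)) + D q \<omega> \<partial>M)"
    by (intro integral_mono hi Bochner_Integration.integrable_add \<Phi>i Di) (simp add: D_def max_def)
  then have limit: "(\<integral>\<omega>. h (Y \<omega>) \<partial>M) - e / 3 \<le> (\<integral>\<omega>. \<Phi> q (ob q (Y \<omega>)) \<partial>M)"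
    using q(1) \<Phi>i Di by simp
  have "((\<lambda>i. \<integral>\<omega>. \<Phi> q (ob q (Z i \<omega>)) \<partial>N i) \<longlongrightarrow> (\<integral>\<omega>. \<Phi> q (ob q (Y \<omega>)) \<partial>M)) G"
    unfolding ob_def by (rule tendsto_continuous_observations[OF observables_grid_copula \<Phi>_cont])
  then have "\<forall>\<^sub>F i in G. (\<integral>\<omega>. \<Phi> q (ob q (Y \<omega>)) \<partial>M) - e / 3 < (\<integral>\<omega>. \<Phi> q (ob q (Z i \<omega>)) \<partial>N i)"
    using e by (intro order_tendstoD(1)) auto
  with processes bad[of q] show ?thesis
  proof eventually_elim
    case (elim i)
    interpret Z: feller_path wasserstein "S i" init "N i" "Z i" by unfold_locales (rule elim(1))
    let ?A = "{\<omega> \<in> space (N i). Z i \<omega> \<notin> K q}"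
    have A: "?A \<in> Z.events" "Z.prob ?A \<le> (1 / 2) ^ q" using elim(2) by blast+
    have Zh: "integrable (N i) (\<lambda>\<omega>. h (Z i \<omega>))"
      using B(2) Z.cadlag by (intro Z.integrable_const_bound[where B = B, OF _ Z.measurable_continuous_functional[OF h]] AE_I2) simp
    have Z\<Phi>: "integrable (N i) (\<lambda>\<omega>. \<Phi> q (ob q (Z i \<omega>)))"
      unfolding ob_def by (rule observables.integrable_continuous_observations[OF observables_grid_copula Z.feller_path_axioms \<Phi>_cont])
    have ZA: "integrable (N i) (\<lambda>\<omega>. 2 * B * indicat_real ?A \<omega>)"
      using A(1) by (intro integrable_mult_right integrable_real_indicator) (auto simp: Z.emeasure_eq_measure)
    have "(\<integral>\<omega>. \<Phi> q (ob q (Z i \<omega>)) - 2 * B * indicat_real ?A \<omega> \<partial>N i) \<le> (\<integral>\<omega>. h (Z i \<omega>) \<partial>N i)"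
    proof (rule integral_mono[OF Bochner_Integration.integrable_diff[OF Z\<Phi> ZA] Zh])
      fix \<omega> assume \<omega>: "\<omega> \<in> space (N i)"
      show "\<Phi> q (ob q (Z i \<omega>)) - 2 * B * indicat_real ?A \<omega> \<le> h (Z i \<omega>)"
      proof (cases "Z i \<omega> \<in> K q")
        case True
        then show ?thesis using \<Phi>_le by simp
      next
        case False
        then have "indicat_real ?A \<omega> = 1" using \<omega> by simp
        then show ?thesis using \<Phi>_B[of q "ob q (Z i \<omega>)"] B(2)[OF Z.cadlag[OF \<omega>]] by (simp add: abs_le_iff)
      qed
    qed
    also have "(\<integral>\<omega>. \<Phi> q (ob q (Z i \<omega>)) - 2 * B * indicat_real ?A \<omega> \<partial>N i) = (\<integral>\<omega>. \<Phi> q (ob q (Z i \<omega>)) \<partial>N i) - 2 * B * Z.prob ?A"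
      using Bochner_Integration.integral_diff[OF Z\<Phi> ZA] A(1) by simp
    finally have "(\<integral>\<omega>. \<Phi> q (ob q (Z i \<omega>)) \<partial>N i) - 2 * B * Z.prob ?A \<le> (\<integral>\<omega>. h (Z i \<omega>) \<partial>N i)" .
    moreover have "2 * B * Z.prob ?A \<le> 2 * B * (1 / 2) ^ q" using A(2) B(1) by (intro mult_left_mono) auto
    ultimately show ?case using elim(3) limit q(2) by linarith
  qed
qed

lemma converges: "converges_in_distribution skorokhod_permuton N Z M Y G"
  unfolding converges_in_distribution_def
proof (intro conjI allI impI)
  show "\<forall>\<^sub>F i in G. random_element skorokhod_permuton (N i) (Z i)"
    using processes by eventually_elim (simp add: feller_process_def)
  show "random_element skorokhod_permuton M Y" using process by (simp add: feller_process_def)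
  fix h :: "(real \<Rightarrow> permuton) \<Rightarrow> real"
  assume "continuous_map skorokhod_permuton euclideanreal h \<and> bounded (h ` topspace skorokhod_permuton)"
  then have h: "continuous_map skorokhod_permuton euclideanreal h" "bounded (h ` cadlag_paths)"
    unfolding topspace_skorokhod by blast+
  have h': "continuous_map skorokhod_permuton euclideanreal (\<lambda>y. - h y)"
    using h(1) by (rule continuous_map_minus)
  have b': "bounded ((\<lambda>y. - h y) ` cadlag_paths)"
    using h(2) unfolding bounded_iff by simp
  show "((\<lambda>i. \<integral>\<omega>. h (Z i \<omega>) \<partial>N i) \<longlongrightarrow> (\<integral>\<omega>. h (Y \<omega>) \<partial>M)) G"
    unfolding tendsto_iff
  proof (intro allI impI)
    fix e :: real assume "0 < e"
    then have e: "0 < e / 2" by simp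
    show "\<forall>\<^sub>F i in G. dist (\<integral>\<omega>. h (Z i \<omega>) \<partial>N i) (\<integral>\<omega>. h (Y \<omega>) \<partial>M) < e"
      using eventually_integral_ge[OF h e] eventually_integral_ge[OF h' b' e]
    proof eventually_elim
      case (elim i)
      then show ?case using e unfolding dist_real_def Bochner_Integration.integral_minus by linarith
    qed
  qed
qed

end

theorem proposition6p10:
  fixes p :: real
    and \<mu>0 :: "permuton measure"
    and L :: "nat \<Rightarrow> 'c measure" and X :: "nat \<Rightarrow> nat \<Rightarrow> 'c \<Rightarrow> nat \<Rightarrow> nat"
    and M :: "'a measure" and F :: "'a \<Rightarrow> real \<Rightarrow> permuton"
    and N :: "real \<Rightarrow> 'b measure" and F_eps :: "real \<Rightarrow> 'b \<Rightarrow> real \<Rightarrow> permuton"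
  assumes "0 < p" and "p < 1"
    and "prob_space \<mu>0" and "sets \<mu>0 = sets borel"
    and "permuton_diffusion p \<mu>0 L X M F"
    and "\<And>\<epsilon>. 0 < \<epsilon> \<Longrightarrow> \<epsilon> < 1 \<Longrightarrow> inflation_process p \<epsilon> \<mu>0 (N \<epsilon>) (F_eps \<epsilon>)"
  shows "converges_in_distribution skorokhod_permuton N F_eps M F (at_right 0)"
proof -
  from assms(5) have cont: "AE \<omega> in M. continuous_on {0..} (F \<omega>)"
    unfolding permuton_diffusion_def by (elim conjE)
  from assms(5) obtain T where T: "feller_process wasserstein T \<mu>0 M F" "diffusion_generator p (generator T)"
    unfolding permuton_diffusion_def by (elim conjE exE)
  \<comment> \<open>Each process comes with some semigroup; a family indexed by \<epsilon> is
    chosen, with arbitrary values outside the open unit interval.\<close>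
  have "\<exists>S. \<forall>\<epsilon>. 0 < \<epsilon> \<longrightarrow> \<epsilon> < 1 \<longrightarrow> feller_process wasserstein (S \<epsilon>) \<mu>0 (N \<epsilon>) (F_eps \<epsilon>) \<and> inflation_semigroup p \<epsilon> (S \<epsilon>)"
  proof (intro choice allI)
    fix \<epsilon>
    show "\<exists>S. 0 < \<epsilon> \<longrightarrow> \<epsilon> < 1 \<longrightarrow> feller_process wasserstein S \<mu>0 (N \<epsilon>) (F_eps \<epsilon>) \<and> inflation_semigroup p \<epsilon> S"
    proof (cases "0 < \<epsilon> \<and> \<epsilon> < 1")
      case True
      then obtain S where S: "feller_process wasserstein S \<mu>0 (N \<epsilon>) (F_eps \<epsilon>)" "Domain (generator S) = UNIV"
        "\<forall>(f, g)\<in>generator S. \<forall>\<mu>. apply_bcontfun g \<mu> = 2 / \<epsilon>\<^sup>2 * (expect_Inf p \<epsilon> (apply_bcontfun f) \<mu> - apply_bcontfun f \<mu>)"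
        using assms(6) unfolding inflation_process_def by blast
      have "feller_semigroup S" using S(1) unfolding feller_process_def by (elim conjE)
      then have "inflation_semigroup p \<epsilon> S" unfolding inflation_semigroup_def using S(2,3) by (intro conjI)
      then show ?thesis using S(1) by blast
    qed blast
  qed
  then obtain S where S: "\<And>\<epsilon>. 0 < \<epsilon> \<Longrightarrow> \<epsilon> < 1 \<Longrightarrow> feller_process wasserstein (S \<epsilon>) \<mu>0 (N \<epsilon>) (F_eps \<epsilon>)"
    "\<And>\<epsilon>. 0 < \<epsilon> \<Longrightarrow> \<epsilon> < 1 \<Longrightarrow> inflation_semigroup p \<epsilon> (S \<epsilon>)"
    by blast
  have sg: "feller_semigroup T" using T(1) unfolding feller_process_def by (elim conjE)
  interpret permuton_convergence T \<mu>0 M F "at_right 0" S N F_eps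
  proof unfold_locales
    show "feller_process wasserstein T \<mu>0 M F" by (rule T(1))
    show "\<forall>\<^sub>F \<epsilon> in at_right 0. feller_process wasserstein (S \<epsilon>) \<mu>0 (N \<epsilon>) (F_eps \<epsilon>)"
      using eventually_at_right_real[of 0 "1 :: real"] by (rule eventually_mono) (auto intro: S(1))
    show "\<forall>\<^sub>F \<epsilon> in at_right 0. \<forall>t\<in>{0..R}. norm (S \<epsilon> t f - T t f) \<le> \<delta>" if "0 \<le> R" "0 < \<delta>" for R \<delta> f
      by (rule semigroup_convergence[OF assms(1,2) sg T(2) S(2) that])
    show "AE \<omega> in M. continuous_on {0..} (F \<omega>)" by (rule cont)
  qed
  show ?thesis by (rule converges)
qed

end
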